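(* Let $k$ be a field and $\{i_1,\ldots,i_m,i_{m+1},\ldots,i_n\}=\{1,\ldots,n\}$. Let $A=k[X_1,\ldots,X_n]/J$ with $J=(h_1,\ldots,h_r,h_{r+1},\ldots,h_s)$ a homogeneous ideal generated in degree $\geq 2$, where the $h_j$ are homogeneous, $h_1,\ldots,h_r\in k[X_{i_1},\ldots,X_{i_m}]$ and $h_{r+1},\ldots,h_s\in k[X_{i_{m+1}},\ldots,X_{i_n}]$. Let $x_i$ be the image of $X_i$ in the relevant quotient ring, and set $A_1=k[X_{i_1},\ldots,X_{i_m}]/(h_1,\ldots,h_r)$, $\mathfrak m_1=(x_{i_1},\ldots,x_{i_m})\subset A_1$, $A_2=k[X_{i_{m+1}},\ldots,X_{i_n}]/(h_{r+1},\ldots,h_s)$, $\mathfrak m_2=(x_{i_{m+1}},\ldots,x_{i_n})\subset A_2$. Let $R=A[It]$ be the Rees algebra with respect to $I=(x_{i_1},\ldots,x_{i_m})\subset A$, and let $\mathcal M=\mathfrak m\oplus R_+$, where $\mathfrak m=(x_1,\ldots,x_n)\subset A$ and $R_+=\bigoplus_{\ell\geq1}I^\ell t^\ell$. Then for all $\ell$ and all $a\in\mathbb Z$, $$H^\ell_{\mathcal M}(R)_a=\bigoplus_{\substack{\alpha+\beta=a\\ \alpha\geq 0}}\ \bigoplus_{p+q=\ell}H^p_{\mathfrak m_1}(A_1)_\alpha^{\oplus(\alpha+1)}\otimes_k H^q_{\mathfrak m_2}(A_2)_\beta\ \oplus\ \bigoplus_{\substack{\alpha+\beta=a\\ \alpha\leq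 -2}}\ \bigoplus_{p+q=\ell}H^{p-1}_{\mathfrak m_1}(A_1)_\alpha^{\oplus(-\alpha-1)}\otimes_k H^q_{\mathfrak m_2}(A_2)_\beta .$$
   Context: $H^q_{\mathcal M}(-)$ denotes graded local cohomology and a subscript denotes the graded component. $A,A_1,A_2$ have the standard grading ($\deg X_i=1$). The Rees algebra $R=A[It]=\bigoplus_{\ell\geq0}I^\ell t^\ell\subset A[t]$ is graded by $A$-degree with $\deg t=0$ (so that each $x_i$ and each $x_{i_j}t$ has degree $1$). Equality means isomorphism of $k$-vector spaces. *)

theory Defs
  imports
    "HOL-Algebra.UnivPoly"
    "HOL-Algebra.QuotRing"
    "HOL-Algebra.Ideal_Product"
    "HOL-Library.Poly_Mapping"
begin

section \<open>Vector spaces\<close>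

text \<open>
  The ground field is a type \<open>'k\<close> of class \<^class>\<open>field\<close>. A vector space over it is a record of type
  \<open>('k, 'v) module\<close>; as usual for HOL-Algebra modules, the multiplicative part of the record is
  irrelevant, and \<open>vec\<close> leaves it unspecified.
\<close>

definition vec ::
    "'v set \<Rightarrow> 'v \<Rightarrow> ('v \<Rightarrow> 'v \<Rightarrow> 'v) \<Rightarrow> ('k \<Rightarrow> 'v \<Rightarrow> 'v) \<Rightarrow> ('k, 'v) module" where
  "vec C z pl sc =
     \<lparr>carrier = C, monoid.mult = undefined, one = undefined, ring.zero = z, add = pl, smult = sc\<rparr>"

definition vec_iso :: "('k, 'v) module \<Rightarrow> ('k, 'w) module \<Rightarrow> bool"  (infix \<open>\<cong>\<^sub>k\<close> 50) where
  "V \<cong>\<^sub>k W \<longleftrightarrow>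
     (\<exists>\<phi>. bij_betw \<phi> (carrier V) (carrier W) \<and>
          (\<forall>x\<in>carrier V. \<forall>y\<in>carrier V. \<phi> (x \<oplus>\<^bsub>V\<^esub> y) = \<phi> x \<oplus>\<^bsub>W\<^esub> \<phi> y) \<and>
          (\<forall>c. \<forall>x\<in>carrier V. \<phi> (c \<odot>\<^bsub>V\<^esub> x) = c \<odot>\<^bsub>W\<^esub> \<phi> x))"

definition coset_smult :: "('k, 'v, 'm) module_scheme \<Rightarrow> 'v set \<Rightarrow> 'k \<Rightarrow> 'v set \<Rightarrow> 'v set" where
  "coset_smult V W c X = (\<Union>x\<in>X. W +>\<^bsub>V\<^esub> (c \<odot>\<^bsub>V\<^esub> x))"

definition quotient_space :: "('k, 'v) module \<Rightarrow> 'v set \<Rightarrow> ('k, 'v set) module" where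
  "quotient_space V W = vec (a_rcosets\<^bsub>V\<^esub> W) W (set_add V) (coset_smult V W)"

definition direct_sum :: "'i set \<Rightarrow> ('i \<Rightarrow> ('k, 'v) module) \<Rightarrow> ('k, 'i \<Rightarrow> 'v) module" where
  "direct_sum I V = vec
     {f \<in> (\<Pi>\<^sub>E i\<in>I. carrier (V i)). finite {i \<in> I. f i \<noteq> \<zero>\<^bsub>V i\<^esub>}}
     (\<lambda>i\<in>I. \<zero>\<^bsub>V i\<^esub>)
     (\<lambda>f g. \<lambda>i\<in>I. f i \<oplus>\<^bsub>V i\<^esub> g i)
     (\<lambda>c f. \<lambda>i\<in>I. c \<odot>\<^bsub>V i\<^esub> f i)"

definition direct_sum2 ::
    "('k, 'v) module \<Rightarrow> ('k, 'w) module \<Rightarrow> ('k, 'v \<times> 'w) module"  (infixr \<open>\<oplus>\<^sub>k\<close> 65) where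
  "V \<oplus>\<^sub>k W = vec
     (carrier V \<times> carrier W)
     (\<zero>\<^bsub>V\<^esub>, \<zero>\<^bsub>W\<^esub>)
     (\<lambda>(v, w) (v', w'). (v \<oplus>\<^bsub>V\<^esub> v', w \<oplus>\<^bsub>W\<^esub> w'))
     (\<lambda>c (v, w). (c \<odot>\<^bsub>V\<^esub> v, c \<odot>\<^bsub>W\<^esub> w))"

definition copies :: "nat \<Rightarrow> ('k, 'v) module \<Rightarrow> ('k, nat \<Rightarrow> 'v) module" where
  "copies N V = direct_sum {..<N} (\<lambda>_. V)"

definition free_space :: "'s set \<Rightarrow> ('k::field, 's \<Rightarrow>\<^sub>0 'k) module" where
  "free_space S = vec {f. Poly_Mapping.keys f \<subseteq> S} 0 (+) (\<lambda>c. Poly_Mapping.map ((*) c))"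

definition bilinear_relations ::
    "('k::field, 'v) module \<Rightarrow> ('k, 'w) module \<Rightarrow> ('v \<times> 'w \<Rightarrow>\<^sub>0 'k) set" where
  "bilinear_relations V W =
     {Poly_Mapping.single (v \<oplus>\<^bsub>V\<^esub> v', w) 1 - Poly_Mapping.single (v, w) 1
        - Poly_Mapping.single (v', w) 1
      | v v' w. v \<in> carrier V \<and> v' \<in> carrier V \<and> w \<in> carrier W} \<union>
     {Poly_Mapping.single (v, w \<oplus>\<^bsub>W\<^esub> w') 1 - Poly_Mapping.single (v, w) 1
        - Poly_Mapping.single (v, w') 1
      | v w w'. v \<in> carrier V \<and> w \<in> carrier W \<and> w' \<in> carrier W} \<union>
     {Poly_Mapping.single (c \<odot>\<^bsub>V\<^esub> v, w) 1 - Poly_Mapping.single (v, w) c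
      | c v w. v \<in> carrier V \<and> w \<in> carrier W} \<union>
     {Poly_Mapping.single (v, c \<odot>\<^bsub>W\<^esub> w) 1 - Poly_Mapping.single (v, w) c
      | c v w. v \<in> carrier V \<and> w \<in> carrier W}"

definition scalars :: "'k::field ring" where
  "scalars = \<lparr>carrier = UNIV, monoid.mult = (*), one = 1, ring.zero = 0, add = (+)\<rparr>"

definition tensor ::
    "('k::field, 'v) module \<Rightarrow> ('k, 'w) module \<Rightarrow> ('k, ('v \<times> 'w \<Rightarrow>\<^sub>0 'k) set) module"
    (infixr \<open>\<otimes>\<^sub>k\<close> 70) where
  "V \<otimes>\<^sub>k W =
     (let F = free_space (carrier V \<times> carrier W)
      in quotient_space F
           (\<Inter>{N. submodule N scalars F \<and> bilinear_relations V W \<subseteq> N}))"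


section \<open>Graded algebras\<close>

record ('k, 'r) graded_algebra = "('k, 'r) module" +
  gcomp :: "int \<Rightarrow> 'r set"

definition graded_piece :: "('k, 'r) graded_algebra \<Rightarrow> int \<Rightarrow> ('k, 'r) module" where
  "graded_piece R a = vec (gcomp R a) \<zero>\<^bsub>R\<^esub> (add R) (smult R)"

text \<open>
  Polynomials in the variables \<open>X\<^sub>i\<close> with \<open>i \<in> V\<close>, for a set \<open>V\<close> of natural numbers, with the standard
  grading. A monomial is its exponent vector. Polynomial rings in different sets of variables live
  in the same type, so the inclusion of one in another is the identity.
\<close>

type_synonym 'k mpoly = "(nat \<Rightarrow>\<^sub>0 nat) \<Rightarrow>\<^sub>0 'k"

definition mono_degree :: "(nat \<Rightarrow>\<^sub>0 nat) \<Rightarrow> nat" where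
  "mono_degree e = (\<Sum>i\<in>Poly_Mapping.keys e. Poly_Mapping.lookup e i)"

definition poly_algebra :: "nat set \<Rightarrow> ('k::field, 'k mpoly) graded_algebra" where
  "poly_algebra V =
     (let C = {p. \<forall>e\<in>Poly_Mapping.keys p. Poly_Mapping.keys e \<subseteq> V}
      in \<lparr>carrier = C, monoid.mult = (*), one = 1, ring.zero = 0, add = (+),
          smult = (\<lambda>c. Poly_Mapping.map ((*) c)),
          gcomp = (\<lambda>d. {p \<in> C. \<forall>e\<in>Poly_Mapping.keys p. int (mono_degree e) = d})\<rparr>)"

definition Var :: "nat \<Rightarrow> 'k::field mpoly" where
  "Var i = Poly_Mapping.single (Poly_Mapping.single i 1) 1"

definition quotient_algebra ::
    "('k, 'r) graded_algebra \<Rightarrow> 'r set \<Rightarrow> ('k, 'r set) graded_algebra" where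
  "quotient_algebra P J =
     \<lparr>carrier = carrier (P Quot J), monoid.mult = mult (P Quot J), one = one (P Quot J),
      ring.zero = zero (P Quot J), add = add (P Quot J), smult = coset_smult P J,
      gcomp = (\<lambda>d. (\<lambda>p. J +>\<^bsub>P\<^esub> p) ` gcomp P d)\<rparr>"

text \<open>
  The Rees algebra \<open>A[It]\<close> as a subring of \<open>A[t] = UP A\<close>, with \<open>deg t = 0\<close>; the powers of \<open>I\<close> are
  taken in the monoid of ideals of \<open>A\<close>, so that \<open>I\<^sup>0 = A\<close>.
\<close>

definition rees_algebra :: "('k, 'r) graded_algebra \<Rightarrow> 'r set \<Rightarrow> ('k, nat \<Rightarrow> 'r) graded_algebra" where
  "rees_algebra A I =
     (let C = {f \<in> carrier (UP A). \<forall>l::nat. f l \<in> I [^]\<^bsub>ideals_set A\<^esub> l}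
      in \<lparr>carrier = C, monoid.mult = mult (UP A), one = one (UP A),
          ring.zero = zero (UP A), add = add (UP A), smult = (\<lambda>c f l. c \<odot>\<^bsub>A\<^esub> f l),
          gcomp = (\<lambda>a. {f \<in> C. \<forall>l. f l \<in> gcomp A a})\<rparr>)"


section \<open>Localization\<close>

text \<open>
  The fraction \<open>r/s\<close> is the class of \<open>(r, s)\<close>, where \<open>r/s = r'/s'\<close> iff \<open>u r s' = u r' s\<close> for some
  \<open>u \<in> S\<close>. The degree of \<open>r/s\<close> is \<open>deg r - deg s\<close> for homogeneous \<open>r\<close> and \<open>s\<close>.
\<close>

definition frac :: "('k, 'r) graded_algebra \<Rightarrow> 'r set \<Rightarrow> 'r \<Rightarrow> 'r \<Rightarrow> ('r \<times> 'r) set" where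
  "frac R S r s =
     {(r', s') \<in> carrier R \<times> S. \<exists>u\<in>S. u \<otimes>\<^bsub>R\<^esub> (r \<otimes>\<^bsub>R\<^esub> s') = u \<otimes>\<^bsub>R\<^esub> (r' \<otimes>\<^bsub>R\<^esub> s)}"

definition localization ::
    "('k, 'r) graded_algebra \<Rightarrow> 'r set \<Rightarrow> ('k, ('r \<times> 'r) set) graded_algebra" where
  "localization R S =
     \<lparr>carrier = {frac R S r s | r s. r \<in> carrier R \<and> s \<in> S},
      monoid.mult = (\<lambda>X Y. \<Union>(r, s)\<in>X. \<Union>(r', s')\<in>Y. frac R S (r \<otimes>\<^bsub>R\<^esub> r') (s \<otimes>\<^bsub>R\<^esub> s')),
      one = frac R S \<one>\<^bsub>R\<^esub> \<one>\<^bsub>R\<^esub>,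
      ring.zero = frac R S \<zero>\<^bsub>R\<^esub> \<one>\<^bsub>R\<^esub>,
      add = (\<lambda>X Y. \<Union>(r, s)\<in>X. \<Union>(r', s')\<in>Y.
               frac R S ((r \<otimes>\<^bsub>R\<^esub> s') \<oplus>\<^bsub>R\<^esub> (r' \<otimes>\<^bsub>R\<^esub> s)) (s \<otimes>\<^bsub>R\<^esub> s')),
      smult = (\<lambda>c X. \<Union>(r, s)\<in>X. frac R S (c \<odot>\<^bsub>R\<^esub> r) s),
      gcomp = (\<lambda>a. {frac R S r s | r s d. s \<in> S \<and> s \<in> gcomp R d \<and> r \<in> gcomp R (a + d)})\<rparr>"

text \<open>The canonical map \<open>r/s \<mapsto> r/s\<close> to the localization at a larger multiplicative set \<open>T\<close>.\<close>

definition localization_map ::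
    "('k, 'r) graded_algebra \<Rightarrow> 'r set \<Rightarrow> ('r \<times> 'r) set \<Rightarrow> ('r \<times> 'r) set" where
  "localization_map R T X = (\<Union>(r, s)\<in>X. frac R T r s)"


section \<open>Local cohomology\<close>

text \<open>
  For a list \<open>f\<^sub>0, \<dots>, f\<^bsub>N-1\<^esub>\<close> of homogeneous elements of \<open>R\<close>, the graded Cech complex is
  \<open>C\<^sup>p = \<Oplus>\<^bsub>|S| = p\<^esub> R\<^sub>S\<close>, where \<open>S\<close> ranges over the subsets of \<open>{0, \<dots>, N-1}\<close> and \<open>R\<^sub>S\<close> is \<open>R\<close> with
  all \<open>f\<^sub>i\<close>, \<open>i \<in> S\<close>, inverted. This is the localization at the product of these \<open>f\<^sub>i\<close>; the
  multiplicative set consists of all monomials in them rather than of the powers of the product, so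
  that it grows with \<open>S\<close>. The cohomological degree is an integer, and \<open>C\<^sup>p = 0\<close> for negative \<open>p\<close>.
\<close>

definition monomials :: "('k, 'r) graded_algebra \<Rightarrow> 'r list \<Rightarrow> nat set \<Rightarrow> 'r set" where
  "monomials R fs S = {\<Otimes>\<^bsub>R\<^esub>i\<in>S. (fs ! i) [^]\<^bsub>R\<^esub> e i | e :: nat \<Rightarrow> nat. True}"

definition cech_localization ::
    "('k, 'r) graded_algebra \<Rightarrow> 'r list \<Rightarrow> nat set \<Rightarrow> ('k, ('r \<times> 'r) set) graded_algebra" where
  "cech_localization R fs S = localization R (monomials R fs S)"

definition cech_index :: "'r list \<Rightarrow> int \<Rightarrow> nat set set" where
  "cech_index fs p = {S. S \<subseteq> {..<length fs} \<and> int (card S) = p}"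

definition cech_cochains ::
    "('k, 'r) graded_algebra \<Rightarrow> 'r list \<Rightarrow> int \<Rightarrow> int \<Rightarrow> ('k, nat set \<Rightarrow> ('r \<times> 'r) set) module" where
  "cech_cochains R fs p a =
     direct_sum (cech_index fs p) (\<lambda>S. graded_piece (cech_localization R fs S) a)"

definition cech_differential ::
    "('k::field, 'r) graded_algebra \<Rightarrow> 'r list \<Rightarrow> int \<Rightarrow>
     (nat set \<Rightarrow> ('r \<times> 'r) set) \<Rightarrow> (nat set \<Rightarrow> ('r \<times> 'r) set)" where
  "cech_differential R fs p c =
     (\<lambda>T\<in>cech_index fs (p + 1).
        \<Oplus>\<^bsub>cech_localization R fs T\<^esub>i\<in>T.
          (-1) ^ card {j \<in> T. j < i} \<odot>\<^bsub>cech_localization R fs T\<^esub>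
            localization_map R (monomials R fs T) (c (T - {i})))"

definition cech_cohomology ::
    "('k::field, 'r) graded_algebra \<Rightarrow> 'r list \<Rightarrow> int \<Rightarrow> int \<Rightarrow>
     ('k, (nat set \<Rightarrow> ('r \<times> 'r) set) set) module" where
  "cech_cohomology R fs p a =
     quotient_space
       (cech_cochains R fs p a
          \<lparr>carrier := {c \<in> carrier (cech_cochains R fs p a).
                        cech_differential R fs p c = \<zero>\<^bsub>cech_cochains R fs (p + 1) a\<^esub>}\<rparr>)
       (cech_differential R fs (p - 1) ` carrier (cech_cochains R fs (p - 1) a))"

text \<open>
  \<open>local_cohomology R M p a\<close> is the component of degree \<open>a\<close> of the graded local cohomology of \<open>R\<close> in
  cohomological degree \<open>p\<close> with support in the homogeneous ideal \<open>M\<close>, that is, of the cohomology of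
  the Cech complex on a finite system of homogeneous generators of \<open>M\<close>. Up to isomorphism it does
  not depend on the system; one is picked arbitrarily.
\<close>

definition homogeneous_generators :: "('k, 'r) graded_algebra \<Rightarrow> 'r set \<Rightarrow> 'r list \<Rightarrow> bool" where
  "homogeneous_generators R M fs \<longleftrightarrow> set fs \<subseteq> (\<Union>d. gcomp R d) \<and> Idl\<^bsub>R\<^esub> (set fs) = M"

definition local_cohomology ::
    "('k::field, 'r) graded_algebra \<Rightarrow> 'r set \<Rightarrow> int \<Rightarrow> int \<Rightarrow>
     ('k, (nat set \<Rightarrow> ('r \<times> 'r) set) set) module" where
  "local_cohomology R M p a = cech_cohomology R (SOME fs. homogeneous_generators R M fs) p a"

end

theory Submission
  imports Defs "HOL.Vector_Spaces" "HOL-Library.Product_Plus"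
begin

text \<open>
  The Cech complexes of \<open>A\<^sub>1\<close>, \<open>A\<^sub>2\<close> and \<open>R\<close> on the variables (and on the \<open>x\<^sub>i t\<close>) are spanned by Laurent
  monomials modulo the monomial multiples of the \<open>h\<^sub>j\<close>. Splitting each monomial, the complex of \<open>R\<close> is the
  tensor product of the complex of \<open>A\<^sub>2\<close> with the complex of \<open>A\<^sub>1[I t]\<close>, so the Kuenneth formula applies. In
  the second factor fix the degree \<open>\<alpha>\<close> and the exponent \<open>c\<close> of \<open>t\<close>. Since \<open>x\<^sub>i\<close> and \<open>x\<^sub>i t\<close> invert the same
  variable, the faces that meet one of the two sets of generators form an acyclic complex. What is left
  is \<open>H\<^sup>p(A\<^sub>1)\<^sub>\<alpha>\<close> for \<open>0 \<le> c \<le> \<alpha>\<close>, a copy shifted by one degree for \<open>\<alpha> < c < 0\<close>, and \<open>0\<close> otherwise; this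
  gives \<open>\<alpha> + 1\<close> and \<open>- \<alpha> - 1\<close> copies. All cohomology is compared through bases.
\<close>

text \<open>Only an isomorphism of possibly infinite-dimensional vector spaces is asserted; so each
  space receives a basis index set, and no map between the two sides is written down.
  \<open>local_cohomology\<close> uses a system of generators chosen by \<open>SOME\<close>, of
  which only homogeneity and the generated ideal are known. The monomial computation reaches it only
  after Cech cohomology is shown to agree for any two homogeneous systems of the same ideal. Both
  multiplicities have one origin. Besides the sign conditions on the x-exponents, a monomial of
  degree \<alpha> with t-exponent c occurs at a face S iff (c >= 0 or S contains some x_i t) and (c
  <= \<alpha> or S contains some x_i): t^c needs c factors from I, and inverting x_i t or x_i lifts
  one of the bounds. If exactly one bound fails, the faces present are acyclic. If none fails, the
  faces without any x_i t remain. If both fail, the connecting map passes from the faces meeting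
  both sets to the nonempty faces of the x_i t alone, one degree lower; there the empty face carries
  nothing because \<alpha> < 0.\<close>

type_synonym ('x, 'k) pm = "'x \<Rightarrow>\<^sub>0 'k"

abbreviation (input) eqv :: "bool => bool => bool" (infixr "<->" 25) where "A <-> B == A = B"

lemmas single_mult = Poly_Mapping.mult_single
lemmas pmI = poly_mapping_eqI
lemmas cld = cech_localization_def

section \<open>Linear algebra in spaces of finitely supported functions\<close>

abbreviation lookup :: "('x, 'k::zero) pm=>'x=>'k" where "lookup == Poly_Mapping.lookup"
abbreviation keys :: "('x, 'k::zero) pm=>'x set" where "keys == Poly_Mapping.keys"
abbreviation single :: "'x=>'k=>('x, 'k::zero) pm" where "single == Poly_Mapping.single"

definition sc :: "'k::field=>('x, 'k) pm=>('x, 'k) pm" where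
 "sc c f = Poly_Mapping.map ((*) c) f"

lemma lookup_sc [simp]: "lookup (sc c f) x = c * lookup f x"
 by (simp add: sc_def map.rep_eq when_def)

lemma sc_add: "sc c (f + g) = sc c f + sc c g"
 by (rule pmI) (simp add: lookup_add algebra_simps)

lemma sc_add_left: "sc (c + d) f = sc c f + sc d f"
 by (rule pmI) (simp add: lookup_add algebra_simps)

lemma sc_sc [simp]: "sc c (sc d f) = sc (c * d) f"
 by (rule pmI) (simp add: algebra_simps)

lemma sc_1 [simp]: "sc 1 f = f"
 by (rule pmI) simp

lemma sc_0 [simp]: "sc 0 f = 0"
 by (rule pmI) simp

lemma sc_zero [simp]: "sc c 0 = 0"
 by (rule pmI) simp

lemma sc_single [simp]: "sc c (single x a) = single x (c * a)"
 by (rule pmI) (simp add: lookup_single when_def)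

lemma sc_m1: "sc (- 1) f = - f"
 by (rule pmI) simp

lemma sc_uminus: "sc (- c) f = - sc c f"
 by (rule pmI) simp

lemma sc_diff: "sc c (f - g) = sc c f - sc c g"
 by (rule pmI) (simp add: lookup_minus algebra_simps)

lemma sc_sum: "sc c (sum f A) = (\<Sum>x\<in>A. sc c (f x))"
 by (rule pmI) (simp add: lookup_sum sum_distrib_left)

lemma keys_sc: "keys (sc c f) <= keys f"
 by (auto simp: in_keys_iff)

interpretation pm: vector_space "sc :: 'k::field=>('x, 'k) pm=>_"
 by unfold_locales (simp_all add: sc_add sc_add_left)

interpretation pmp: vector_space_pair "sc :: 'k::field=>('x, 'k) pm=>_" "sc :: 'k=>('y, 'k) pm=>_"
 by unfold_locales

section \<open>Coordinate subspaces, and linear maps given on basis vectors\<close>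

definition cs :: "'x set=>('x, 'k::field) pm set" where
 "cs P = {c. keys c <= P}"

text \<open>Linear maps are total on the ambient space and usually built by \<open>lext\<close>; a
  hypothesis about a subspace \<open>cs P\<close> then becomes a condition on the vectors
  \<open>single x 1\<close> with \<open>x\<close> in \<open>P\<close>.\<close>

definition lin :: "(('x, 'k::field) pm=>('y, 'k) pm)=>bool" where
 "lin f <-> (ALL a b. f (a + b) = f a + f b)&(ALL c a. f (sc c a) = sc c (f a))"

definition lsub :: "('x, 'k::field) pm set=>bool" where
 "lsub U <-> 0:U&(ALL u:U. ALL v:U. u + v:U)&(ALL c. ALL u:U. sc c u:U)"

definition lext :: "('x=>('y, 'k::field) pm)=>('x, 'k) pm=>('y, 'k) pm" where
 "lext v c = (\<Sum>x\<in>keys c. sc (lookup c x) (v x))"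

definition rst :: "'x set=>('x, 'k::field) pm=>('x, 'k) pm" where
 "rst Q = lext (%x. if x:Q then single x 1 else 0)"

lemma linI: "(!!a b. f (a + b) = f a + f b)==>(!!c a. f (sc c a) = sc c (f a))==>lin f"
 by (simp add: lin_def)

lemma lin_add: "lin f==>f (a + b) = f a + f b"
 and lin_sc: "lin f==>f (sc c a) = sc c (f a)"
 by (simp_all add: lin_def)

lemma lin_0: "lin f==>f 0 = 0"
 using lin_sc[of f 0 0] by simp

lemma lin_minus: "lin f==>f (- a) = - f a"
 using lin_sc[of f "- 1" a] by (simp add: sc_m1)

lemma lin_diff: "lin f==>f (a - b) = f a - f b"
 using lin_add[of f a "- b"] by (simp add: lin_minus)

lemma lin_sum: "lin f==>f (sum g A) = (\<Sum>x\<in>A. f (g x))"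
 by (induction A rule: infinite_finite_induct) (simp_all add: lin_0 lin_add)

lemmas lin_simps = lin_0 lin_add lin_sc lin_minus lin_diff

lemma lin_id: "lin (%x. x)"
 by (simp add: lin_def)

lemma lin_const0: "lin (%x. 0)"
 by (simp add: lin_def)

lemma lin_comp: "lin f==>lin g==>lin (%x. f (g x))"
 by (simp add: lin_def)

lemma lin_plus: "lin f==>lin g==>lin (%x. f x + g x)"
 and lin_sub: "lin f==>lin g==>lin (%x. f x - g x)"
 and lin_smult: "lin f==>lin (%x. sc c (f x))"
 by (auto simp: lin_def sc_add sc_diff mult.commute)

lemma lin_iff_linear: "lin f <-> Vector_Spaces.linear sc sc f"
 by (auto simp: lin_def Vector_Spaces.linear_iff pm.vector_space_axioms)

lemma lsub_iff_subspace: "lsub U <-> pm.subspace U"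
 by (auto simp: lsub_def pm.subspace_def)

lemma lsub_0: "lsub U==>0:U"
 and lsub_add: "lsub U==>u:U==>v:U==>u + v:U"
 and lsub_sc: "lsub U==>u:U==>sc c u:U"
 by (simp_all add: lsub_def)

lemma lsub_minus: "lsub U==>u:U==>- u:U"
 using lsub_sc[of U u "- 1"] by (simp add: sc_m1)

lemma lsub_diff: "lsub U==>u:U==>v:U==>u - v:U"
 using lsub_add[of U u "- v"] lsub_minus[of U v] by simp

lemma lsub_sum: "lsub U==>(!!x. x:A==>g x:U)==>sum g A:U"
 by (induction A rule: infinite_finite_induct) (simp_all add: lsub_0 lsub_add)

lemma lsubI:
 "0:U==>(!!u v. u:U==>v:U==>u + v:U)==>(!!c u. u:U==>sc c u:U)==>lsub U"
 by (simp add: lsub_def)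

lemma lsub_Int: "lsub U==>lsub V==>lsub (U Int V)"
 by (simp add: lsub_def)

lemma lsub_vimage: "lin f==>lsub U==>lsub {c. f c:U}"
 by (simp add: lsub_def lin_simps)

lemma lsub_ker: "lin f==>lsub {c. f c = 0}"
 by (simp add: lsub_def lin_simps)

lemma lsub_eq: "lin f==>lin g==>lsub {c. f c = g c}"
 by (simp add: lsub_def lin_simps)

lemma lsub_image: "lin f==>lsub U==>lsub (f ` U)"
 by (auto intro!: lsubI simp: image_iff)
 (metis lin_0 lsub_0, metis lin_add lsub_add, metis lin_sc lsub_sc)

lemma lsub_plus: "lsub U==>lsub V==>lsub {u + v | u v. u:U&v:V}"
proof (rule lsubI, goal_cases)
 case 1
 then show ?case using lsub_0 by force
next
 case (2 a b)
 then obtain u v u' v' where "a = u + v" "b = u' + v'" "u:U" "v:V" "u':U" "v':V" by blast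
 then have "a + b = (u + u') + (v + v')" "u + u':U" "v + v':V" 
 using 2 by (auto simp: lsub_add)
 then show ?case by blast
next
 case (3 c a)
 then obtain u v where "a = u + v" "u:U" "v:V" by blast
 then have "sc c a = sc c u + sc c v" "sc c u:U" "sc c v:V" 
 using 3 by (auto simp: lsub_sc sc_add)
 then show ?case by blast
qed

lemma lsub_span [simp]: "lsub (pm.span A)"
 by (simp add: lsub_iff_subspace)

lemma span_subset: "lsub U==>A <= U==>pm.span A <= U"
 by (simp add: lsub_iff_subspace pm.span_minimal)

lemma cs_iff_lookup: "c:cs P <-> (ALL x. x ~: P --> lookup c x = 0)"
 by (auto simp: cs_def in_keys_iff)

lemma lsub_cs [simp]: "lsub (cs P)"
 by (rule lsubI) (auto simp: cs_iff_lookup lookup_add)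

lemma single_cs: "x:P==>single x a:cs P"
 by (auto simp: cs_iff_lookup lookup_single when_def)

lemma cs_mono: "P <= Q==>c:cs P==>c:cs Q"
 by (auto simp: cs_def)

lemma cs_Int: "cs P Int cs Q = cs (P Int Q)"
 by (auto simp: cs_def)

lemma lext_superset:
 assumes "finite A" "keys c <= A"
 shows "lext v c = (\<Sum>x\<in>A. sc (lookup c x) (v x))"
 unfolding lext_def using assms by (intro sum.mono_neutral_left) (auto simp: in_keys_iff)

lemma lin_lext [simp]: "lin (lext v)"
proof (rule linI)
 fix a b :: "('a, 'b) pm"
 have "lext v (a + b) = (\<Sum>x\<in>keys a Un keys b. sc (lookup (a + b) x) (v x))"
 by (rule lext_superset) (use keys_add[of a b] in auto)
 then show "lext v (a + b) = lext v a + lext v b"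
 by (simp add: lext_superset[of "keys a Un keys b"] lookup_add sc_add_left sum.distrib)
next
 fix c and a :: "('a, 'b) pm"
 have "lext v (sc c a) = (\<Sum>x\<in>keys a. sc (lookup (sc c a) x) (v x))"
 by (rule lext_superset) (use keys_sc[of c a] in auto)
 then show "lext v (sc c a) = sc c (lext v a)"
 by (simp add: lext_def sc_sum)
qed

lemma lext_single [simp]: "lext v (single x a) = sc a (v x)"
 using lext_superset[of "{x}" "single x a" v] by (simp add: keys_single)

lemma lext_id: "lext (%x. single x 1) c = c"
proof (rule pmI)
 fix y
 have "lookup (lext (%x. single x 1) c) y = (\<Sum>x\<in>keys c. if x = y then lookup c y else 0)"
 unfolding lext_def lookup_sum by (intro sum.cong) (auto simp: lookup_single when_def)
 then show "lookup (lext (%x. single x 1) c) y = lookup c y"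
 by (simp add: in_keys_iff)
qed

text \<open>Finite support makes every element of \<open>cs P\<close> a combination of basis
  vectors. Nearly all later identities are reduced to single keys in this way.\<close>

lemma cs_induct [consumes 1]:
 assumes "c:cs P" "lsub U" "!!x. x:P==>single x 1:U"
 shows "c:U"
 by (subst lext_id[symmetric], unfold lext_def) (use assms in \<open>auto intro!: lsub_sum lsub_sc simp: cs_def simp del: sc_single\<close>)

lemma lin_cs_eqI:
 assumes "c:cs P" "lin f" "lin g" "!!x. x:P==>f (single x 1) = g (single x 1)"
 shows "f c = g c"
 using cs_induct[OF assms(1) lsub_eq[OF assms(2,3)]] assms(4) by simp

lemma lin_eqI:
 assumes "lin f" "lin g" "!!x. f (single x 1) = g (single x 1)"
 shows "f c = g c"
 using lin_cs_eqI[of c UNIV f g] assms by (simp add: cs_def)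

lemma lin_cs_mem:
 assumes "c:cs P" "lin f" "lsub U" "!!x. x:P==>f (single x 1):U"
 shows "f c:U"
 using cs_induct[OF assms(1) lsub_vimage[OF assms(2,3)]] assms(4) by simp

lemma lin_rst [simp]: "lin (rst Q)"
 by (simp add: rst_def)

lemma lookup_rst: "lookup (rst Q c) y = (if y:Q then lookup c y else 0)"
proof -
 have "lookup (rst Q c) y = (\<Sum>x\<in>keys c. if x = y then (if y:Q then lookup c y else 0) else 0)"
 unfolding rst_def lext_def lookup_sum by (intro sum.cong) (auto simp: lookup_single when_def)
 then show ?thesis by (simp add: in_keys_iff)
qed

lemma rst_cs: "rst Q c:cs Q"
 by (simp add: cs_iff_lookup lookup_rst)

lemma rst_cs_Int: "c:cs P==>rst Q c:cs (P Int Q)"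
 by (auto simp: cs_iff_lookup lookup_rst)

lemma rst_id: "c:cs P==>P <= Q==>rst Q c = c"
 by (rule pmI) (auto simp: cs_iff_lookup lookup_rst)

lemma rst_disjoint: "c:cs P==>P Int Q = {}==>rst Q c = 0"
 by (rule pmI) (auto simp: cs_iff_lookup lookup_rst)

lemma rst_rst: "rst P (rst Q c) = rst (P Int Q) c"
 by (rule pmI) (auto simp: lookup_rst)

lemma rst_split: "c:cs (P Un Q)==>P Int Q = {}==>rst P c + rst Q c = c"
 by (rule pmI) (auto simp: lookup_rst lookup_add cs_iff_lookup)

lemma rst_single: "rst Q (single x a) = (if x:Q then single x a else 0)"
 by (rule pmI) (auto simp: lookup_rst lookup_single when_def)

lemma lin_rst_0: "rst Q 0 = 0"
 by (simp add: lin_0)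

lemma rst_partition:
 assumes "finite G" "!!x. x:keys c==>h x:G"
 shows "c = (\<Sum>g\<in>G. rst {x. h x = g} c)"
proof (rule pmI)
 fix y
 have "lookup (\<Sum>g\<in>G. rst {x. h x = g} c) y = (\<Sum>g\<in>G. if g = h y then lookup c y else 0)"
 unfolding lookup_sum by (intro sum.cong) (auto simp: lookup_rst)
 then show "lookup c y = lookup (\<Sum>g\<in>G. rst {x. h x = g} c) y"
 using assms by (auto simp: in_keys_iff)
qed

text \<open>Only the finitely many values of \<open>h\<close> on \<open>keys c\<close> give nonzero
  parts, so \<open>h\<close> may be a grading by an infinite group.\<close>

lemma lsub_by_parts:
 assumes "lsub N" "!!g. rst {x. h x = g} c:N"
 shows "c:N"
 by (subst rst_partition[of "h ` keys c" c h]) (use assms in \<open>auto intro: lsub_sum\<close>)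

text \<open>A linear relation that is total on a subspace contains the graph of a linear map.\<close>

lemma linear_choice:
 fixes U U' :: "('x, 'k::field) pm set" and R :: "('x, 'k) pm=>('y, 'k) pm=>bool"
 assumes "lsub U" "lsub U'" "U' <= U"
 and add: "!!a b a' b'. R a b==>R a' b'==>R (a + a') (b + b')"
 and scl: "!!c a b. R a b==>R (sc c a) (sc c b)"
 and zero: "!!u. u:U'==>R u 0"
 and tot: "!!u. u:U==>EX v. R u v"
 shows "EX f. lin f&(ALL u:U'. f u = 0)&(ALL u:U. R u (f u))"
proof -
 obtain A where A: "A <= U'" "pm.independent A" "U' <= pm.span A"
 by (metis pm.maximal_independent_subset)
 obtain B where B: "A <= B" "B <= U" "pm.independent B" "U <= pm.span B"
 by (metis A(1,2) assms(3) pm.maximal_independent_subset_extend subset_trans)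
 \<comment> \<open>Basis vectors of \<open>U'\<close> go to 0, a related value by
   \<open>zero\<close>; a choice is made only on the complement. Additivity of \<open>R\<close> then
   extends the relation from the basis to all of \<open>U\<close>.\<close>
 define h where "h b = (if b:A then 0 else SOME v. R b v)" for b
 obtain f where f: "Vector_Spaces.linear sc sc f" "!!b. b:B==>f b = h b"
 using pmp.linear_independent_extend[OF B(3), of h] by blast
 have lf: "lin f" using f(1) by (simp add: lin_iff_linear)
 have "lsub {u. R u (f u)}"
 by (rule lsubI) (use lf add scl zero[OF lsub_0[OF assms(2)]] in \<open>auto simp: lin_simps\<close>)
 moreover have "B <= {u. R u (f u)}"
 proof
 fix b assume b: "b:B"
 show "b:{u. R u (f u)}"
 proof (cases "b:A")
 case True
 then show ?thesis using f(2)[OF b] zero A(1) by (auto simp: h_def)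
 next
 case False
 then have "R b (h b)" using someI_ex[OF tot[of b]] b B(2) by (auto simp: h_def)
 then show ?thesis using f(2)[OF b] by simp
 qed
 qed
 ultimately have 1: "ALL u:U. R u (f u)" using span_subset B(4) by blast
 have "A <= {u. f u = 0}" using f(2) B(1) by (auto simp: h_def)
 then have "ALL u:U'. f u = 0" using span_subset[OF lsub_ker[OF lf]] A(3) by blast
 then show ?thesis using lf 1 by blast
qed

text \<open>\<open>qb U U' B\<close>: the quotient of \<open>U\<close> by \<open>U'\<close> has a basis indexed by \<open>B\<close>.\<close>

definition qb :: "('x, 'k::field) pm set=>('x, 'k) pm set=>'b set=>bool" where
 "qb U U' B <-> (EX f. lin f&f ` U = cs B&(ALL u:U. f u = 0 <-> u:U'))"

text \<open>A basis of \<open>U'\<close> is extended to one of \<open>U\<close>, and the added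
  vectors themselves serve as indices; this explains the type of \<open>B\<close>.\<close>

lemma qb_exists:
 fixes U U' :: "('x, 'k::field) pm set"
 assumes "lsub U" "lsub U'" "U' <= U"
 shows "\<exists>B :: ('x, 'k) pm set. qb U U' B"
proof -
 obtain A where A: "A <= U'" "pm.independent A" "U' <= pm.span A"
 by (metis pm.maximal_independent_subset)
 obtain B where B: "A <= B" "B <= U" "pm.independent B" "U <= pm.span B"
 by (metis A(1,2) assms(3) pm.maximal_independent_subset_extend subset_trans)
 define h :: "('x, 'k) pm=>(('x, 'k) pm \<Rightarrow>\<^sub>0 'k)" where "h b = (if b:A then 0 else single b 1)" for b
 obtain f where f: "Vector_Spaces.linear sc sc f" "!!b. b:B==>f b = h b"
 using pmp.linear_independent_extend[OF B(3), of h] by blast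
 have lf: "lin f" using f(1) by (simp add: lin_iff_linear)
 have "B <= {u. f u:cs (B - A)}"
 using f(2) by (auto simp: h_def single_cs lsub_0)
 then have 1: "f ` U <= cs (B - A)"
 using span_subset[OF lsub_vimage[OF lf lsub_cs]] B(4) by blast
 have 2: "cs (B - A) <= f ` U"
 proof
 fix c :: "('x, 'k) pm \<Rightarrow>\<^sub>0 'k" assume "c:cs (B - A)"
 then show "c:f ` U"
 proof (rule cs_induct)
 show "lsub (f ` U)" using lsub_image lf assms(1) by blast
 fix x assume "x:B - A"
 then show "single x 1:f ` U" using f(2)[of x] B(2) by (auto simp: h_def image_iff intro!: bexI[of _ x])
 qed
 qed
 \<comment> \<open>\<open>g\<close> reads an index as the vector that it names. As
   \<open>g (f u) - u\<close> lies in \<open>U'\<close>, the kernel of \<open>f\<close> on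
   \<open>U\<close> is contained in \<open>U'\<close>.\<close>
 define g where "g = lext (%b :: ('x, 'k) pm. b)"
 have lg: "lin g" by (simp add: g_def)
 have "B <= {u. g (f u) - u:U'}"
 using f(2) A(1) lsub_minus[OF assms(2)] lsub_0[OF assms(2)] by (auto simp: h_def g_def lin_0)
 then have 3: "g (f u) - u:U'" if "u:U" for u
 using span_subset[OF lsub_vimage[OF lin_sub[OF lin_comp[OF lg lf] lin_id] assms(2)]] B(4) that by blast
 have "A <= {u. f u = 0}" using f(2) B(1) by (auto simp: h_def)
 then have 4: "ALL u:U'. f u = 0" using span_subset[OF lsub_ker[OF lf]] A(3) by blast
 have "u:U'" if "u:U" "f u = 0" for u
 using 3[OF that(1)] that(2) lsub_minus[OF assms(2), of "- u"] by (simp add: lin_0[OF lg])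
 with 4 have "ALL u:U. f u = 0 <-> u:U'" by blast
 moreover have "f ` U = cs (B - A)" using 1 2 by blast
 ultimately show ?thesis unfolding qb_def using lf by blast
qed

text \<open>Comparison maps in cohomology, such as the connecting homomorphism, are defined only up
  to boundaries; a linear relation that is total in both directions captures them. A linear
  selection from it is composed with the coordinates on \<open>V\<close>.\<close>

lemma qb_rel:
 fixes U U' :: "('x, 'k::field) pm set" and V V' :: "('y, 'k) pm set" and B :: "'b set"
 assumes "lsub U" "lsub V"
 and add: "!!a b a' b'. R a b==>R a' b'==>R (a + a') (b + b')"
 and scl: "!!c a b. R a b==>R (sc c a) (sc c b)"
 and zero: "R 0 0"
 and l: "!!u. u:U==>EX v:V. R u v" and r: "!!v. v:V==>EX u:U. R u v"
 and eq: "!!u v. u:U==>v:V==>R u v==>u:U' <-> v:V'"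
 and V: "qb V V' B"
 shows "qb U U' B"
proof -
 obtain f where f: "lin f" "f ` V = cs B" "!!v. v:V==>f v = 0 <-> v:V'"
 using V unfolding qb_def by blast
 have V0: "0:V" "0:U" "0:V'" using assms(1,2) f(1) f(3)[of 0] by (auto simp: lsub_0 lin_0)
 obtain h where h: "lin h" "!!u. u:U==>h u:V&R u (h u)"
 proof -
 have "EX h. lin h&(ALL u:{0}. h u = 0)&(ALL u:U. h u:V&R u (h u))"
 proof (rule linear_choice[OF assms(1)])
 show "lsub {0}" by (simp add: lsub_def)
 show "!!u. u:U==>EX v. v:V&R u v" using l by blast
 qed (use V0 zero assms(2) in \<open>simp_all add: add scl lsub_add lsub_sc\<close>)
 then show ?thesis using that by blast
 qed
 have mR: "R (- a) (- b)" if "R a b" for a b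
 using scl[OF that, of "-1"] by (simp add: sc_m1)
 \<comment> \<open>Two values related to the same \<open>u\<close> differ by something related to 0,
   hence by an element of \<open>V'\<close>, which \<open>f\<close> kills.\<close>
 have im: "f (h u) = f v" if "R u v" "u:U" "v:V" for u v
 proof -
 have "R 0 (v - h u)" using add[OF that(1) mR[OF conjunct2[OF h(2)[OF that(2)]]]] by simp
 then have "v - h u:V'" using eq[of 0 "v - h u"] eq[of 0 0] zero V0 that h(2)[OF that(2)] assms(2)
 by (simp add: lsub_diff)
 then show ?thesis using f(3)[of "v - h u"] that h(2)[OF that(2)] assms(2) f(1) by (simp add: lsub_diff lin_diff)
 qed
 have "(%u. f (h u)) ` U = cs B"
 proof
 show "(%u. f (h u)) ` U <= cs B" using h(2) f(2) by blast
 show "cs B <= (%u. f (h u)) ` U"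
 proof
 fix b :: "('b, 'k) pm" assume "b:cs B"
 then obtain v where v: "v:V" "b = f v" using f(2) by auto
 with r obtain u where "u:U" "R u v" by blast
 then have "b = f (h u)" using v im by simp
 then show "b:(%u. f (h u)) ` U" using \<open>u:U\<close> by blast
 qed
 qed
 moreover have "ALL u:U. f (h u) = 0 <-> u:U'" using h(2) f(3) eq by blast
 ultimately show ?thesis unfolding qb_def using lin_comp[OF f(1) h(1)] by blast
qed


section \<open>Vector spaces with a basis\<close>

text \<open>The record is not assumed to satisfy any module axioms, so compatibility with its zero
  is a separate clause; finite support in \<open>direct_sum\<close> is expressed through that
  zero.\<close>

definition is_free :: "('k::field, 'v) module=>'b set=>bool" where
 "is_free V B <-> (EX e. e ` cs B = carrier V&inj_on e (cs B) &
 (ALL u:cs B. ALL v:cs B. e (u + v) = e u \<oplus>\<^bsub>V\<^esub> e v) &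
 (ALL c. ALL u:cs B. e (sc c u) = c \<odot>\<^bsub>V\<^esub> e u)&e 0 = \<zero>\<^bsub>V\<^esub>)"

text \<open>\<open>V\<close> is covered by \<open>U\<close> through a map that may have a kernel:
  the situation of Cech cochains covered by formal combinations of fractions.\<close>

definition img :: "('k::field, 'v) module=>('x, 'k) pm set=>(('x, 'k) pm=>'v)=>bool" where
 "img V U e <-> lsub U&e ` U = carrier V &
 (ALL u:U. ALL v:U. e (u + v) = e u \<oplus>\<^bsub>V\<^esub> e v) &
 (ALL c. ALL u:U. e (sc c u) = c \<odot>\<^bsub>V\<^esub> e u)"

lemma vec_simps [simp]:
 "carrier (vec C z p s) = C" "ring.zero (vec C z p s) = z" "add (vec C z p s) = p" "smult (vec C z p s) = s"
 by (simp_all add: vec_def)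

text \<open>Coordinates with the same index set are composed. The isomorphism of the theorem arises
  here.\<close>

lemma is_free_iso:
 fixes V :: "('k::field, 'v) module" and W :: "('k, 'w) module"
 assumes "is_free V B" "is_free W B"
 shows "V \<cong>\<^sub>k W"
proof -
 obtain e where e: "e ` cs B = carrier V" "inj_on e (cs B)"
 "!!u v. u:cs B==>v:cs B==>e (u + v) = e u \<oplus>\<^bsub>V\<^esub> e v"
 "!!c u. u:cs B==>e (sc c u) = c \<odot>\<^bsub>V\<^esub> e u"
 using assms(1) unfolding is_free_def by blast
 obtain d where d: "d ` cs B = carrier W" "inj_on d (cs B)"
 "!!u v. u:cs B==>v:cs B==>d (u + v) = d u \<oplus>\<^bsub>W\<^esub> d v"
 "!!c u. u:cs B==>d (sc c u) = c \<odot>\<^bsub>W\<^esub> d u"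
 using assms(2) unfolding is_free_def by blast
 define g where "g = inv_into (cs B) e"
 have ge: "g (e u) = u" if "u:cs B" for u using that e(2) by (simp add: g_def)
 have b: "bij_betw e (cs B) (carrier V)" "bij_betw d (cs B) (carrier W)"
 using e(1,2) d(1,2) by (simp_all add: bij_betw_def)
 have "bij_betw (d \<circ> g) (carrier V) (carrier W)"
 using bij_betw_trans[OF bij_betw_inv_into[OF b(1)] b(2)] by (simp add: g_def)
 moreover have "(d \<circ> g) (x \<oplus>\<^bsub>V\<^esub> y) = (d \<circ> g) x \<oplus>\<^bsub>W\<^esub> (d \<circ> g) y"
 if xy: "x:carrier V" "y:carrier V" for x y
 proof -
 obtain u v where uv: "u:cs B" "v:cs B" "x = e u" "y = e v" using xy e(1) by blast
 then have "x \<oplus>\<^bsub>V\<^esub> y = e (u + v)" by (simp add: e(3))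
 then show ?thesis using uv by (simp add: ge d(3) lsub_add)
 qed
 moreover have "(d \<circ> g) (c \<odot>\<^bsub>V\<^esub> x) = c \<odot>\<^bsub>W\<^esub> (d \<circ> g) x" if x: "x:carrier V" for c x
 proof -
 obtain u where u: "u:cs B" "x = e u" using x e(1) by blast
 then have "c \<odot>\<^bsub>V\<^esub> x = e (sc c u)" by (simp add: e(4))
 then show ?thesis using u by (simp add: ge d(4) lsub_sc)
 qed
 ultimately show ?thesis unfolding vec_iso_def by blast
qed

text \<open>\<open>B\<close> will index a computed basis, while \<open>B'\<close> comes from the
  independence of generators and has another type; \<open>V\<close>, which is free on both, links
  them.\<close>

lemma is_free_transfer:
 fixes V :: "('k::field, 'v) module" and W :: "('k, 'w) module" and B :: "'b set" and B' :: "'c set"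
 assumes "is_free V B" "is_free V B'" "is_free W B'"
 shows "is_free W B"
proof -
 obtain e where e: "e ` cs B = carrier V" "inj_on e (cs B)"
 "!!u v. u:cs B==>v:cs B==>e (u + v) = e u \<oplus>\<^bsub>V\<^esub> e v"
 "!!c u. u:cs B==>e (sc c u) = c \<odot>\<^bsub>V\<^esub> e u" "e 0 = \<zero>\<^bsub>V\<^esub>"
 using assms(1) unfolding is_free_def by blast
 obtain e' where e': "e' ` cs B' = carrier V" "inj_on e' (cs B')"
 "!!u v. u:cs B'==>v:cs B'==>e' (u + v) = e' u \<oplus>\<^bsub>V\<^esub> e' v"
 "!!c u. u:cs B'==>e' (sc c u) = c \<odot>\<^bsub>V\<^esub> e' u" "e' 0 = \<zero>\<^bsub>V\<^esub>"
 using assms(2) unfolding is_free_def by blast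
 obtain d where d: "d ` cs B' = carrier W" "inj_on d (cs B')"
 "!!u v. u:cs B'==>v:cs B'==>d (u + v) = d u \<oplus>\<^bsub>W\<^esub> d v"
 "!!c u. u:cs B'==>d (sc c u) = c \<odot>\<^bsub>W\<^esub> d u" "d 0 = \<zero>\<^bsub>W\<^esub>"
 using assms(3) unfolding is_free_def by blast
 define g where "g = inv_into (cs B') e'"
 have ge: "g (e' u) = u" if "u:cs B'" for u using that e'(2) by (simp add: g_def)
 have b: "bij_betw e (cs B) (carrier V)" "bij_betw e' (cs B') (carrier V)" "bij_betw d (cs B') (carrier W)"
 using e(1,2) e'(1,2) d(1,2) by (simp_all add: bij_betw_def)
 have bij: "bij_betw (d \<circ> (g \<circ> e)) (cs B) (carrier W)"
 using bij_betw_trans[OF bij_betw_trans[OF b(1) bij_betw_inv_into[OF b(2)]] b(3)] by (simp add: g_def)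
 have ex: "\<exists>u'\<in>cs B'. e u = e' u'" if "u \<in> cs B" for u
 proof -
 have "e u:e' ` cs B'" using that e(1) e'(1) by auto
 then show ?thesis by auto
 qed
 moreover have "(d \<circ> (g \<circ> e)) (u + v) = (d \<circ> (g \<circ> e)) u \<oplus>\<^bsub>W\<^esub> (d \<circ> (g \<circ> e)) v"
 if uv: "u:cs B" "v:cs B" for u v
 proof -
 obtain u' v' where *: "u':cs B'" "v':cs B'" "e u = e' u'" "e v = e' v'" using uv ex by meson
 then have "e (u + v) = e' (u' + v')" using uv by (simp add: e e')
 then show ?thesis using * by (simp add: ge d(3) lsub_add)
 qed
 moreover have "(d \<circ> (g \<circ> e)) (sc c u) = c \<odot>\<^bsub>W\<^esub> (d \<circ> (g \<circ> e)) u" if u: "u:cs B" for c u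
 proof -
 obtain u' where *: "u':cs B'" "e u = e' u'" using u ex by meson
 then have "e (sc c u) = e' (sc c u')" using u by (simp add: e e')
 then show ?thesis using * by (simp add: ge d(4) lsub_sc)
 qed
 moreover have "(d \<circ> (g \<circ> e)) 0 = \<zero>\<^bsub>W\<^esub>" using ge[of 0] e(5) e'(5) d(5) by (simp add: lsub_0)
 ultimately show ?thesis unfolding is_free_def using bij
 by (intro exI[of _ "d \<circ> (g \<circ> e)"]) (auto simp only: bij_betw_def)
qed

lemma is_free_reindex:
 fixes V :: "('k::field, 'v) module" and B :: "'b set" and C :: "'c set"
 assumes "is_free V B" "bij_betw t B C"
 shows "is_free V C"
proof -
 obtain e where e: "e ` cs B = carrier V" "inj_on e (cs B)"
 "!!u v. u:cs B==>v:cs B==>e (u + v) = e u \<oplus>\<^bsub>V\<^esub> e v"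
 "!!c u. u:cs B==>e (sc c u) = c \<odot>\<^bsub>V\<^esub> e u" "e 0 = \<zero>\<^bsub>V\<^esub>"
 using assms(1) unfolding is_free_def by blast
 define g where "g = inv_into B t"
 have g: "g y:B" "t (g y) = y" if "y:C" for y
 using that assms(2) by (auto simp: g_def bij_betw_def inv_into_into f_inv_into_f)
 have gt: "t x:C" "g (t x) = x" if "x:B" for x
 using that assms(2) by (auto simp: g_def bij_betw_def)
 define T :: "('c, 'k) pm=>('b, 'k) pm" where "T = lext (%y. single (g y) 1)"
 define T' :: "('b, 'k) pm=>('c, 'k) pm" where "T' = lext (%x. single (t x) 1)"
 have T: "T u:cs B" "T' (T u) = u" if "u:cs C" for u
 proof -
 show "T u:cs B" using that lin_cs_mem[OF that, of T "cs B"] g by (simp add: T_def single_cs)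
 show "T' (T u) = u" using lin_cs_eqI[OF that lin_comp[of T' T] lin_id] g by (simp add: T_def T'_def)
 qed
 have T': "T' u:cs C" "T (T' u) = u" if "u:cs B" for u
 proof -
 show "T' u:cs C" using that lin_cs_mem[OF that, of T' "cs C"] gt by (simp add: T'_def single_cs)
 show "T (T' u) = u" using lin_cs_eqI[OF that lin_comp[of T T'] lin_id] gt by (simp add: T_def T'_def)
 qed
 have "T ` cs C = cs B"
 proof
 show "T ` cs C <= cs B" using T by blast
 show "cs B <= T ` cs C" using T' by (metis imageI subsetI)
 qed
 moreover have "inj_on T (cs C)" by (metis T(2) inj_onI)
 moreover have lT: "lin T" by (simp add: T_def)
 moreover have "inj_on (e \<circ> T) (cs C)" using calculation e(2) by (intro comp_inj_on) auto
 moreover have "(e \<circ> T) ` cs C = carrier V" using calculation(1) e(1) by (metis image_comp)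
 ultimately show ?thesis unfolding is_free_def 
 by (intro exI[of _ "e \<circ> T"] conjI) (simp_all add: e(3-5) lin_simps T)
qed

text \<open>Cosets of \<open>W\<close> correspond to cosets of \<open>U'\<close> in
  \<open>U\<close>, since by \<open>ker\<close> nothing else of \<open>U\<close> falls into
  \<open>W\<close>; the coordinates on \<open>U\<close> modulo \<open>U'\<close> therefore carry
  over.\<close>

lemma quot_free:
 fixes V :: "('k::field, 'v) module" and B :: "'b set" and U :: "('x, 'k) pm set"
 assumes img: "img V U e" and U': "lsub U'" "U' <= U" and W: "W = e ` U'"
 and ker: "!!u. u:U==>e u:W==>u:U'"
 and qb: "qb U U' B"
 shows "is_free (quotient_space V W) B"
proof -
 obtain f where f: "lin f" "f ` U = cs B" "!!v. v:U==>f v = 0 <-> v:U'"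
 using qb unfolding qb_def by blast
 have U: "lsub U" and e: "e ` U = carrier V"
 "!!u v. u:U==>v:U==>e (u + v) = e u \<oplus>\<^bsub>V\<^esub> e v"
 "!!c u. u:U==>e (sc c u) = c \<odot>\<^bsub>V\<^esub> e u"
 using img unfolding img_def by blast+
 define K where "K u = e ` {w + u | w. w:U'}" for u
 have coset: "W +>\<^bsub>V\<^esub> e u = K u" if "u:U" for u
 using that U'(2) unfolding W K_def a_r_coset_def' by (force simp: e(2) subset_iff)
 have K_eq: "K u = K v <-> u - v:U'" if uv: "u:U" "v:U" for u v
 proof
 assume "K u = K v"
 moreover have "e u:K u" unfolding K_def using lsub_0[OF U'(1)] by force
 ultimately obtain w where w: "w:U'" "e u = e (w + v)" unfolding K_def by blast
 have wv: "w + v:U" using uv w U U' by (simp add: lsub_add subset_iff)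
 \<comment> \<open>\<open>V\<close> has no subtraction of its own. It is simulated by the scalar -1,
   and the equality of \<open>e u\<close> and \<open>e (w + v)\<close> is used inside
   \<open>V\<close> before returning to \<open>U\<close>.\<close>
 have "e (u - (w + v)) = e (u + sc (- 1) (w + v))" by (simp only: sc_m1 diff_conv_add_uminus)
 also have "... = e u \<oplus>\<^bsub>V\<^esub> (- 1) \<odot>\<^bsub>V\<^esub> e (w + v)"
 by (simp only: e(2,3) uv(1) wv lsub_sc[OF U])
 also have "... = e (u + sc (- 1) u)" by (simp only: w(2)[symmetric] e(2,3) uv(1) lsub_sc[OF U])
 also have "... = e 0" by (simp add: sc_m1)
 also have "...:W" using U' by (simp add: W lsub_0)
 finally have "u - (w + v):U'"
 using ker[of "u - (w + v)"] uv w U U' by (simp add: lsub_add lsub_diff subset_iff)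
 from lsub_add[OF U'(1) this w(1)] show "u - v:U'" by (simp add: algebra_simps)
 next
 have *: "K u <= K v" if "u - v:U'" for u v
 unfolding K_def
 proof (rule image_mono, rule subsetI)
 fix x assume "x:{w + u |w. w:U'}"
 then obtain w where "w:U'" "x = w + u" by blast
 then have "x = (w + (u - v)) + v" "w + (u - v):U'" using that U'(1) by (auto simp: lsub_add)
 then show "x:{w + v |w. w:U'}" by blast
 qed
 assume a: "u - v:U'"
 then have "v - u:U'" using lsub_minus[OF U'(1) a] by simp
 with a * show "K u = K v" by blast
 qed
 obtain g where g: "!!b. b:cs B==>g b:U&f (g b) = b"
 proof -
 have "ALL b:cs B. EX u. u:U&f u = b"
 proof
 fix b :: "('b, 'k) pm" assume "b:cs B"
 then have "b:f ` U" using f(2) by simp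
 then show "EX u. u:U&f u = b" by blast
 qed
 then show ?thesis using that unfolding bchoice_iff by blast
 qed
 have Kg: "K (g b) = K u" if "b:cs B" "u:U" "f u = b" for b u
 using that g[of b] f(1) f(3)[of "g b - u"] U by (simp add: K_eq lin_diff lsub_diff)
 let ?Q = "quotient_space V W"
 have carr: "carrier ?Q = K ` U"
 unfolding quotient_space_def vec_simps A_RCOSETS_def' e(1)[symmetric] using coset by auto
 have Kadd: "K (u + v) = set_add V (K u) (K v)" if "u:U" "v:U" for u v
 proof -
 have "{w + (u + v) | w. w:U'} = {a + b | a b. a:{w + u | w. w:U'}&b:{w + v | w. w:U'}}"
 proof (intro equalityI subsetI)
 fix x assume "x:{w + (u + v) | w. w:U'}"
 then obtain w where "w:U'" "x = w + (u + v)" by blast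
 then have "x = (w + u) + (0 + v)" "0:U'" using U' by (auto simp: lsub_0)
 with \<open>w:U'\<close> show "x:{a + b | a b. a:{w + u | w. w:U'}&b:{w + v | w. w:U'}}" by blast
 next
 fix x assume "x:{a + b | a b. a:{w + u | w. w:U'}&b:{w + v | w. w:U'}}"
 then obtain w w' where "w:U'" "w':U'" "x = (w + u) + (w' + v)" by blast
 then have "x = (w + w') + (u + v)" "w + w':U'" using U' by (auto simp: lsub_add)
 then show "x:{w + (u + v) | w. w:U'}" by blast
 qed
 moreover have "set_add V (e ` X) (e ` Y) = e ` {a + b | a b. a:X&b:Y}" if "X <= U" "Y <= U" for X Y
 proof -
 have "e ` {a + b | a b. a:X&b:Y} = (\<Union>a\<in>X. \<Union>b\<in>Y. {e (a + b)})" by auto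
 also have "... = (\<Union>a\<in>X. \<Union>b\<in>Y. {e a \<oplus>\<^bsub>V\<^esub> e b})" using that e(2) by (intro SUP_cong refl) auto
 finally show ?thesis unfolding set_add_def' by simp
 qed
 moreover have "{w + u | w. w:U'} <= U" "{w + v | w. w:U'} <= U"
 using U' that U by (auto simp: lsub_add subset_iff)
 ultimately show ?thesis unfolding K_def by simp
 qed
 have Ksc: "K (sc c u) = coset_smult V W c (K u)" if "u:U" for u c
 proof -
 have "W +>\<^bsub>V\<^esub> (c \<odot>\<^bsub>V\<^esub> e (w + u)) = K (sc c u)" if "w:U'" for w
 proof -
 have wu: "w + u:U" "sc c (w + u):U" "sc c u:U" using that \<open>u:U\<close> U U' by (auto intro!: lsub_add lsub_sc)
 have "W +>\<^bsub>V\<^esub> (c \<odot>\<^bsub>V\<^esub> e (w + u)) = K (sc c (w + u))" using wu by (simp add: e(3)[symmetric] coset)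
 also have "... = K (sc c u)" using wu that U' by (simp add: K_eq sc_add lsub_sc)
 finally show ?thesis .
 qed
 then show ?thesis unfolding coset_smult_def K_def[of u] using U'(1) lsub_0 by fastforce
 qed
 show ?thesis unfolding is_free_def
 proof (intro exI[of _ "%b. K (g b)"] conjI ballI allI)
 show "(%b. K (g b)) ` cs B = carrier ?Q"
 proof -
 have "K (g (f u)) = K u" if "u:U" for u using Kg[of "f u" u] that f(2) by blast
 moreover have "K (g b):K ` U" if "b:cs B" for b using g[OF that] by blast
 moreover have "f u:cs B" if "u:U" for u using that f(2) by blast
 moreover have "K u:(%b. K (g b)) ` cs B" if "u:U" for u
 by (rule image_eqI[of _ _ "f u"]) (simp_all add: calculation that)
 ultimately show ?thesis unfolding carr by blast
 qed
 show "inj_on (%b. K (g b)) (cs B)"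
 proof (rule inj_onI)
 fix b b' assume b: "b:cs B" "b':cs B" "K (g b) = K (g b')"
 then have "f (g b - g b') = 0" using g U f(3) by (simp add: K_eq lsub_diff)
 then show "b = b'" using b g f(1) by (simp add: lin_diff)
 qed
 show "K (g 0) = \<zero>\<^bsub>?Q\<^esub>"
 using Kg[of 0 0] f(1) U by (simp add: lsub_0 lin_0 K_def W quotient_space_def)
 fix b :: "('b, 'k) pm" assume b: "b:cs B"
 show "K (g (b + b')) = K (g b) \<oplus>\<^bsub>?Q\<^esub> K (g b')" if b': "b':cs B" for b' :: "('b, 'k) pm"
 using Kg[of "b + b'" "g b + g b'"] b b' g U f(1)
 by (simp add: quotient_space_def Kadd lsub_add lin_add)
 show "K (g (sc c b)) = c \<odot>\<^bsub>?Q\<^esub> K (g b)" for c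
 using Kg[of "sc c b" "sc c (g b)"] b g U f(1)
 by (simp add: quotient_space_def Ksc lsub_sc lin_sc)
 qed
qed

section \<open>Bases of direct sums and tensor products\<close>

lemma lookup_lext: "lookup (lext v c) y = (\<Sum>x\<in>keys c. lookup c x * lookup (v x) y)"
 by (simp add: lext_def lookup_sum)

definition tens :: "('x, 'k::field) pm=>('y, 'k) pm=>('x \<times> 'y \<Rightarrow>\<^sub>0 'k)" where
 "tens u v = lext (%p. lext (%q. single (p, q) 1) v) u"

lemma lookup_tens: "lookup (tens u v) (p, q) = lookup u p * lookup v q"
proof -
 have "lookup (lext (%q. single (x, q) 1) v) (p, q) = (if x = p then lookup v q else 0)" for x
 proof -
 have "lookup (lext (%q. single (x, q) 1) v) (p, q) =
 (\<Sum>y\<in>keys v. if y = q then (if x = p then lookup v q else 0) else 0)"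
 unfolding lookup_lext by (intro sum.cong) (auto simp: lookup_single when_def)
 then show ?thesis by (simp add: in_keys_iff)
 qed
 then have "lookup (tens u v) (p, q) = (\<Sum>x\<in>keys u. if x = p then lookup u p * lookup v q else 0)"
 unfolding tens_def lookup_lext by (intro sum.cong) auto
 then show ?thesis by (simp add: in_keys_iff)
qed

lemma tens_single [simp]: "tens (single p a) (single q b) = single (p, q) (a * b)"
 by (simp add: tens_def mult.commute)

lemma tens_add1: "tens (u + u') v = tens u v + tens u' v"
 and tens_add2: "tens u (v + v') = tens u v + tens u v'"
 and tens_sc1: "tens (sc c u) v = sc c (tens u v)"
 and tens_sc2: "tens u (sc c v) = sc c (tens u v)"
 and tens_diff1: "tens (u - u') v = tens u v - tens u' v"
 and tens_diff2: "tens u (v - v') = tens u v - tens u v'"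
 and tens_minus1: "tens (- u) v = - tens u v"
 and tens_minus2: "tens u (- v) = - tens u v"
 and tens_01 [simp]: "tens 0 v = 0" and tens_02 [simp]: "tens u 0 = 0"
 by (rule pmI; clarsimp simp: lookup_tens lookup_add lookup_minus algebra_simps)+

lemma lin_tens1: "lin (%u. tens u v)"
 by (rule linI) (simp_all add: tens_add1 tens_sc1)

lemma lin_tens2: "lin (tens u)"
 by (rule linI) (simp_all add: tens_add2 tens_sc2)

lemma tens_cs: "u:cs P==>v:cs Q==>tens u v:cs (P \<times> Q)"
 by (auto simp: cs_iff_lookup lookup_tens)

text \<open>For keys in a disjoint union, \<open>slice i\<close> is the projection to the i-th
  summand and \<open>tag i\<close> the inclusion of that summand.\<close>

definition slice :: "'i=>('i \<times> 'b \<Rightarrow>\<^sub>0 'k::field)=>('b, 'k) pm" where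
 "slice i = lext (%(j, b). if j = i then single b 1 else 0)"

definition tag :: "'i=>('b, 'k::field) pm=>('i \<times> 'b \<Rightarrow>\<^sub>0 'k)" where
 "tag i = lext (%b. single (i, b) 1)"

lemma lin_slice [simp]: "lin (slice i)" and lin_tag [simp]: "lin (tag i)"
 by (simp_all add: slice_def tag_def)

lemma lookup_slice: "lookup (slice i u) b = lookup u (i, b)"
proof -
 have "lookup (slice i u) b = (\<Sum>x\<in>keys u. if x = (i, b) then lookup u (i, b) else 0)"
 unfolding slice_def lookup_lext by (intro sum.cong) (auto simp: lookup_single when_def split: if_splits)
 then show ?thesis by (simp add: in_keys_iff)
qed

lemma lookup_tag: "lookup (tag i w) (j, b) = (if i = j then lookup w b else 0)"
proof -
 have "lookup (tag i w) (j, b) = (\<Sum>x\<in>keys w. if x = b then (if i = j then lookup w b else 0) else 0)"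
 unfolding tag_def lookup_lext by (intro sum.cong) (auto simp: lookup_single when_def)
 then show ?thesis by (simp add: in_keys_iff)
qed

lemma slice_tag: "slice j (tag i w) = (if i = j then w else 0)"
 by (rule pmI) (simp add: lookup_slice lookup_tag)

lemma tag_cs: "i:I==>w:cs (B i)==>tag i w:cs (Sigma I B)"
 by (auto simp: cs_iff_lookup lookup_tag)

lemma slice_cs: "u:cs (Sigma I B)==>i:I==>slice i u:cs (B i)"
 by (auto simp: cs_iff_lookup lookup_slice)

lemma direct_sum_simps [simp]:
 "carrier (direct_sum I V) = {f \<in> (\<Pi>\<^sub>E i\<in>I. carrier (V i)). finite {i \<in> I. f i \<noteq> \<zero>\<^bsub>V i\<^esub>}}"
 "\<zero>\<^bsub>direct_sum I V\<^esub> = (\<lambda>i\<in>I. \<zero>\<^bsub>V i\<^esub>)"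
 "f \<oplus>\<^bsub>direct_sum I V\<^esub> g = (\<lambda>i\<in>I. f i \<oplus>\<^bsub>V i\<^esub> g i)"
 "c \<odot>\<^bsub>direct_sum I V\<^esub> f = (\<lambda>i\<in>I. c \<odot>\<^bsub>V i\<^esub> f i)"
 by (simp_all add: direct_sum_def)

lemma is_free_direct_sum:
 fixes V :: "'i=>('k::field, 'v) module" and B :: "'i=>'b set"
 assumes "!!i. i:I==>is_free (V i) (B i)"
 shows "is_free (direct_sum I V) (Sigma I B)"
proof -
 have "ALL i:I. EX e. e ` cs (B i) = carrier (V i)&inj_on e (cs (B i)) &
 (ALL u:cs (B i). ALL v:cs (B i). e (u + v) = e u \<oplus>\<^bsub>V i\<^esub> e v) &
 (ALL c. ALL u:cs (B i). e (sc c u) = c \<odot>\<^bsub>V i\<^esub> e u)&e 0 = \<zero>\<^bsub>V i\<^esub>"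
 using assms unfolding is_free_def by blast
 then obtain e where e: "ALL i:I. e i ` cs (B i) = carrier (V i)&inj_on (e i) (cs (B i)) &
 (ALL u:cs (B i). ALL v:cs (B i). e i (u + v) = e i u \<oplus>\<^bsub>V i\<^esub> e i v) &
 (ALL c. ALL u:cs (B i). e i (sc c u) = c \<odot>\<^bsub>V i\<^esub> e i u)&e i 0 = \<zero>\<^bsub>V i\<^esub>"
 unfolding bchoice_iff by blast
 let ?S = "Sigma I B" and ?D = "direct_sum I V"
 define E where "E u = (\<lambda>i\<in>I. e i (slice i u))" for u
 have "E ` cs ?S = carrier ?D"
 proof
 show "E ` cs ?S <= carrier ?D"
 proof
 fix f assume "f:E ` cs ?S"
 then obtain u where u: "u:cs ?S" "f = E u" by blast
 have "{i:I. E u i ~= \<zero>\<^bsub>V i\<^esub>} <= fst ` keys u"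
 proof
 fix i assume i: "i:{i:I. E u i ~= \<zero>\<^bsub>V i\<^esub>}"
 then have "slice i u ~= 0" using e by (auto simp: E_def)
 then obtain b where "lookup (slice i u) b ~= 0" by (metis lookup_zero pmI)
 then have "(i, b):keys u" by (simp add: lookup_slice in_keys_iff)
 then show "i:fst ` keys u" by force
 qed
 then have "finite {i:I. E u i ~= \<zero>\<^bsub>V i\<^esub>}" by (rule finite_subset) simp
 moreover have "e i (slice i u):carrier (V i)" if "i:I" for i
 using e slice_cs[OF u(1) that] that by blast
 then have "E u:(\<Pi>\<^sub>E i\<in>I. carrier (V i))" by (auto simp: E_def)
 ultimately show "f:carrier ?D" using u by simp
 qed
 show "carrier ?D <= E ` cs ?S"
 proof
 fix f assume f: "f:carrier ?D"
 define F where "F = {i:I. f i ~= \<zero>\<^bsub>V i\<^esub>}"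
 have F: "finite F" "F <= I" using f by (auto simp: F_def)
 have "ALL i:I. EX w. w:cs (B i)&f i = e i w"
 proof
 fix i assume i: "i:I"
 then have "f i:carrier (V i)" using f by auto
 then show "EX w. w:cs (B i)&f i = e i w" using e i by (metis imageE)
 qed
 then obtain w where w: "ALL i:I. w i:cs (B i)&f i = e i (w i)"
 unfolding bchoice_iff by blast
 \<comment> \<open>Summing over the support of \<open>f\<close> suffices: at the other indices both
   sides are zero, because each coordinate map sends 0 to the zero of its record.\<close>
 define u where "u = (\<Sum>i\<in>F. tag i (w i))"
 have "u:cs ?S" unfolding u_def using w F by (intro lsub_sum) (auto intro!: tag_cs)
 moreover have "f = E u"
 proof
 fix i
 show "f i = E u i"
 proof (cases "i:I")
 case False
 then show ?thesis using f by (auto simp: E_def PiE_def extensional_def)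
 next
 case True
 have "slice i u = (\<Sum>j\<in>F. if j = i then w i else 0)"
 unfolding u_def by (simp add: lin_sum slice_tag) (intro sum.cong, auto)
 also have "... = (if i:F then w i else 0)" using F by simp
 finally show ?thesis using True w e by (auto simp: E_def F_def)
 qed
 qed
 ultimately show "f:E ` cs ?S" by blast
 qed
 qed
 moreover have "inj_on E (cs ?S)"
 proof (rule inj_onI)
 fix u v assume uv: "u:cs ?S" "v:cs ?S" "E u = E v"
 have sl: "slice i u = slice i v" if "i:I" for i
 using fun_cong[OF uv(3), of i] that e slice_cs[OF uv(1) that] slice_cs[OF uv(2) that]
 by (auto simp: E_def inj_on_def)
 show "u = v"
 proof (rule pmI)
 fix x :: "'i \<times> 'b"
 obtain i b where x: "x = (i, b)" by (cases x)
 show "lookup u x = lookup v x"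
 using sl[of i] uv(1,2) unfolding x by (cases "i:I") (auto simp: cs_iff_lookup lookup_slice[symmetric])
 qed
 qed
 moreover have "E (u + v) = E u \<oplus>\<^bsub>?D\<^esub> E v" if "u:cs ?S" "v:cs ?S" for u v
 using e slice_cs[OF that(1)] slice_cs[OF that(2)]
 by (auto simp: E_def fun_eq_iff lin_add)
 moreover have "E (sc c u) = c \<odot>\<^bsub>?D\<^esub> E u" if "u:cs ?S" for u c
 using e slice_cs[OF that] by (auto simp: E_def fun_eq_iff lin_sc)
 moreover have "E 0 = \<zero>\<^bsub>?D\<^esub>" using e by (auto simp: E_def fun_eq_iff lin_0)
 ultimately show ?thesis unfolding is_free_def by blast
qed

lemma is_free_direct_sum2:
 fixes V :: "('k::field, 'v) module" and W :: "('k, 'w) module" and B :: "'b set" and C :: "'c set"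
 assumes "is_free V B" "is_free W C"
 shows "is_free (V \<oplus>\<^sub>k W) (B <+> C)"
proof -
 obtain e where e: "e ` cs B = carrier V" "inj_on e (cs B)"
 "!!u v. u:cs B==>v:cs B==>e (u + v) = e u \<oplus>\<^bsub>V\<^esub> e v"
 "!!c u. u:cs B==>e (sc c u) = c \<odot>\<^bsub>V\<^esub> e u" "e 0 = \<zero>\<^bsub>V\<^esub>"
 using assms(1) unfolding is_free_def by blast
 obtain d where d: "d ` cs C = carrier W" "inj_on d (cs C)"
 "!!u v. u:cs C==>v:cs C==>d (u + v) = d u \<oplus>\<^bsub>W\<^esub> d v"
 "!!c u. u:cs C==>d (sc c u) = c \<odot>\<^bsub>W\<^esub> d u" "d 0 = \<zero>\<^bsub>W\<^esub>"
 using assms(2) unfolding is_free_def by blast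
 define l :: "('b + 'c \<Rightarrow>\<^sub>0 'k) \<Rightarrow> ('b \<Rightarrow>\<^sub>0 'k)" where "l = lext (case_sum (\<lambda>b. single b 1) (\<lambda>c. 0))"
 define r :: "('b + 'c \<Rightarrow>\<^sub>0 'k) \<Rightarrow> ('c \<Rightarrow>\<^sub>0 'k)" where "r = lext (case_sum (\<lambda>b. 0) (\<lambda>c. single c 1))"
 define j :: "('b \<Rightarrow>\<^sub>0 'k) \<Rightarrow> ('b + 'c \<Rightarrow>\<^sub>0 'k)" where "j = lext (\<lambda>b. single (Inl b) 1)"
 define j' :: "('c \<Rightarrow>\<^sub>0 'k) \<Rightarrow> ('b + 'c \<Rightarrow>\<^sub>0 'k)" where "j' = lext (\<lambda>b. single (Inr b) 1)"
 have [simp]: "lin l" "lin r" "lin j" "lin j'" by (simp_all add: l_def r_def j_def j'_def)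
 have lj: "l (j u) = u" "r (j u) = 0" for u
 by (rule lin_eqI[OF lin_comp], simp_all add: l_def r_def j_def lin_id)
 (rule lin_eqI[OF lin_comp lin_const0], simp_all)
 have rj: "l (j' u) = 0" "r (j' u) = u" for u
 by (rule lin_eqI[OF lin_comp lin_const0], simp_all add: l_def r_def j'_def)
 (rule lin_eqI[OF lin_comp], simp_all add: lin_id)
 have jl: "j (l u) + j' (r u) = u" for u
 proof (rule lin_eqI[OF lin_plus[OF lin_comp[of j l] lin_comp[of j' r]] lin_id])
 show "j (l (single x 1)) + j' (r (single x 1)) = single x 1" for x
 by (cases x) (simp_all add: j_def j'_def l_def r_def lin_0)
 qed simp_all
 have lc: "l u:cs B" "r u:cs C" if "u:cs (B <+> C)" for u
 by (rule lin_cs_mem[OF that], auto simp: l_def r_def single_cs lsub_0)+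
 have jc: "u:cs B==>j u:cs (B <+> C)" "v:cs C==>j' v:cs (B <+> C)" for u v
 by (rule lin_cs_mem, assumption, auto simp: j_def j'_def intro!: single_cs)+
 define E where "E u = (e (l u), d (r u))" for u
 have "E ` cs (B <+> C) = carrier V \<times> carrier W"
 proof
 show "E ` cs (B <+> C) <= carrier V \<times> carrier W" using lc e(1) d(1) by (auto simp: E_def)
 show "carrier V \<times> carrier W <= E ` cs (B <+> C)"
 proof
 fix x assume "x:carrier V \<times> carrier W"
 then have "x:e ` cs B \<times> d ` cs C" using e(1) d(1) by simp
 then obtain u v where "u:cs B" "v:cs C" "x = (e u, d v)" by auto
 then have "x = E (j u + j' v)" "j u + j' v:cs (B <+> C)"
 by (auto simp: E_def lin_add lj rj lsub_add jc)
 then show "x:E ` cs (B <+> C)" by blast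
 qed
 qed
 moreover have "inj_on E (cs (B <+> C))"
 proof (rule inj_onI)
 fix u v assume "u:cs (B <+> C)" "v:cs (B <+> C)" "E u = E v"
 then have "l u = l v" "r u = r v" using e(2) d(2) lc by (auto simp: E_def inj_on_def)
 then show "u = v" by (metis jl)
 qed
 ultimately show ?thesis unfolding is_free_def direct_sum2_def vec_simps
 by (intro exI[of _ E]) (auto simp: E_def lin_simps e d lc)
qed

text \<open>The relations generate exactly the kernel of the map \<open>f\<close> that tensors
  coordinates. This kernel is one of the submodules intersected in \<open>tensor\<close>;
  conversely, modulo the relations a pair equals the bilinear expansion of its coordinates.\<close>

lemma is_free_tensor:
 fixes V :: "('k::field, 'v) module" and W :: "('k, 'w) module" and B :: "'b set" and C :: "'c set"
 assumes "is_free V B" "is_free W C"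
 shows "is_free (V \<otimes>\<^sub>k W) (B \<times> C)"
proof -
 obtain e where e: "e ` cs B = carrier V" "inj_on e (cs B)"
 "!!u v. u:cs B==>v:cs B==>e (u + v) = e u \<oplus>\<^bsub>V\<^esub> e v"
 "!!c u. u:cs B==>e (sc c u) = c \<odot>\<^bsub>V\<^esub> e u" "e 0 = \<zero>\<^bsub>V\<^esub>"
 using assms(1) unfolding is_free_def by blast
 obtain d where d: "d ` cs C = carrier W" "inj_on d (cs C)"
 "!!u v. u:cs C==>v:cs C==>d (u + v) = d u \<oplus>\<^bsub>W\<^esub> d v"
 "!!c u. u:cs C==>d (sc c u) = c \<odot>\<^bsub>W\<^esub> d u" "d 0 = \<zero>\<^bsub>W\<^esub>"
 using assms(2) unfolding is_free_def by blast
 define S where "S = carrier V \<times> carrier W"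
 have S: "S = e ` cs B \<times> d ` cs C" using e(1) d(1) by (simp add: S_def)
 define F :: "('k, 'v \<times> 'w \<Rightarrow>\<^sub>0 'k) module" where "F = free_space S"
 define N where "N = \<Inter>{N. submodule N scalars F&bilinear_relations V W <= N}"
 have F: "carrier F = cs S" "add F = (+)" "smult F = sc" "\<zero>\<^bsub>F\<^esub> = 0"
 by (auto simp: F_def free_space_def cs_def sc_def fun_eq_iff)
 \<comment> \<open>This turns the intersection in \<open>tensor\<close> into one over subspaces of
   \<open>cs S\<close>.\<close>
 have sub: "submodule M scalars F <-> lsub M&M <= cs S" for M
 proof
 assume a: "submodule M scalars F"
 have sg: "subgroup M (add_monoid F)" using submodule.axioms(1)[OF a] .
 have "0:M" using subgroup.one_closed[OF sg] by (simp add: F)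
 moreover have "M <= cs S" using subgroup.subset[OF sg] by (simp add: F)
 moreover have "u + v:M" if "u:M" "v:M" for u v
 using that subgroup.m_closed[OF sg, of u v] by (simp add: F)
 moreover have "sc c u:M" if "u:M" for c u
 using submodule.smult_closed[OF a, of c u] that by (auto simp: F scalars_def)
 ultimately show "lsub M&M <= cs S" by (auto intro: lsubI)
 next
 assume a: "lsub M&M <= cs S"
 have inv: "inv\<^bsub>add_monoid F\<^esub> u = - u" if "u:M" for u
 proof -
 have "- u:cs S" using a that lsub_minus[of M u] by auto
 then show ?thesis unfolding m_inv_def
 by (intro the_equality) (simp_all add: F eq_neg_iff_add_eq_0)
 qed
 show "submodule M scalars F"
 proof (intro submodule.intro subgroup.intro submodule_axioms.intro, goal_cases)
 case (3)
 then show ?case using a by (simp add: F lsub_0)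
 next
 case (4 x)
 then show ?case using a inv by (simp add: lsub_minus)
 qed (use a in \<open>simp_all add: F lsub_add lsub_sc subset_iff\<close>)
 qed
 define ph where "ph = inv_into (cs B) e"
 define \<psi> where "\<psi> = inv_into (cs C) d"
 have ph: "ph (e u) = u" if "u:cs B" for u using that e(2) by (simp add: ph_def)
 have \<psi>: "\<psi> (d u) = u" if "u:cs C" for u using that d(2) by (simp add: \<psi>_def)
 define f where "f = lext (%(v, w). tens (ph v) (\<psi> w))"
 define g :: "('b \<times> 'c \<Rightarrow>\<^sub>0 'k)=>('v \<times> 'w \<Rightarrow>\<^sub>0 'k)"
 where "g = lext (%(b, c). single (e (single b 1), d (single c 1)) 1)"
 have lf [simp]: "lin f" "lin g" by (simp_all add: f_def g_def)
 have fs: "f (single (e p, d q) 1) = tens p q" if "p:cs B" "q:cs C" for p q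
 using that by (simp add: f_def ph \<psi>)
 have rel_ker: "bilinear_relations V W <= {u:cs S. f u = 0}"
 proof -
 have V: "EX p:cs B. v = e p" if "v:carrier V" for v using that e(1) by auto
 have W: "EX p:cs C. v = d p" if "v:carrier W" for v using that d(1) by auto
 have ec: "p:cs B==>e p:carrier V" "q:cs C==>d q:carrier W" for p q
 using e(1) d(1) by blast+
 have fc: "f (single (e p, d q) c) = sc c (tens p q)" if "p:cs B" "q:cs C" for p q c
 using lin_sc[of f c "single (e p, d q) 1"] fs[OF that] by simp
 show ?thesis unfolding bilinear_relations_def
 by (safe; (drule V W)+; clarify;
 simp add: lin_simps e(3,4)[symmetric] d(3,4)[symmetric] fc lsub_add lsub_sc tens_add1 tens_add2
 tens_sc1 tens_sc2;
 intro lsub_diff single_cs; simp add: S_def ec lsub_add lsub_sc)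
 qed
 have N_ker: "N <= {u:cs S. f u = 0}"
 proof -
 have "lsub {u:cs S. f u = 0}" using lsub_Int[OF lsub_cs[of S] lsub_ker[OF lf(1)]] by (simp add: Int_def)
 then show ?thesis unfolding N_def using rel_ker by (intro Inter_lower) (auto simp: sub)
 qed
 have N: "lsub N" "bilinear_relations V W <= N"
 unfolding N_def by (auto simp: sub lsub_def)
 have NS: "N <= cs S" using N_ker by blast
 \<comment> \<open>Both terms are bilinear in \<open>p\<close> and \<open>q\<close> modulo
   \<open>N\<close>, so the claim reduces to basis vectors, first in \<open>p\<close> and then in
   \<open>q\<close>.\<close>
 have key: "single (e p, d q) 1 - g (tens p q):N" if pq: "p:cs B" "q:cs C" for p q
 proof -
 have r1: "single (e (p + p'), d q) 1 - single (e p, d q) 1 - single (e p', d q) 1:N"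
 if "p:cs B" "p':cs B" "q:cs C" for p p' q
 proof -
 have "e p:carrier V" "e p':carrier V" "d q:carrier W" using that e(1) d(1) by blast+
 then have "single (e p \<oplus>\<^bsub>V\<^esub> e p', d q) 1 - single (e p, d q) 1 - single (e p', d q) 1:N"
 by (intro subsetD[OF N(2)], unfold bilinear_relations_def) blast
 then show ?thesis using that by (simp add: e)
 qed
 have r2: "single (e p, d (q + q')) 1 - single (e p, d q) 1 - single (e p, d q') 1:N"
 if "p:cs B" "q':cs C" "q:cs C" for p q q'
 proof -
 have "e p:carrier V" "d q':carrier W" "d q:carrier W" using that e(1) d(1) by blast+
 then have "single (e p, d q \<oplus>\<^bsub>W\<^esub> d q') 1 - single (e p, d q) 1 - single (e p, d q') 1:N"
 by (intro subsetD[OF N(2)], unfold bilinear_relations_def) blast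
 then show ?thesis using that by (simp add: d)
 qed
 have r3: "single (e (sc c p), d q) 1 - sc c (single (e p, d q) 1):N"
 if "p:cs B" "q:cs C" for p q c
 proof -
 have "e p:carrier V" "d q:carrier W" using that e(1) d(1) by blast+
 then have "single (c \<odot>\<^bsub>V\<^esub> e p, d q) 1 - single (e p, d q) c:N"
 by (intro subsetD[OF N(2)], unfold bilinear_relations_def) blast
 then show ?thesis using that by (simp add: e)
 qed
 have r4: "single (e p, d (sc c q)) 1 - sc c (single (e p, d q) 1):N"
 if "p:cs B" "q:cs C" for p q c
 proof -
 have "e p:carrier V" "d q:carrier W" using that e(1) d(1) by blast+
 then have "single (e p, c \<odot>\<^bsub>W\<^esub> d q) 1 - single (e p, d q) c:N"
 by (intro subsetD[OF N(2)], unfold bilinear_relations_def) blast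
 then show ?thesis using that by (simp add: d)
 qed
 have step: "lsub {p:cs B. ALL q:Q. h p q - g (tens p q):N}"
 if "Q <= cs C" "!!p p' q. p:cs B==>p':cs B==>q:Q==>h (p + p') q - h p q - h p' q:N"
 "!!c p q. p:cs B==>q:Q==>h (sc c p) q - sc c (h p q):N" for Q h
 proof (rule lsubI, goal_cases)
 case 1
 have "h 0 q:N" if "q:Q" for q
 using \<open>!!c p q. p:cs B==>q:Q==>h (sc c p) q - sc c (h p q):N\<close>[of 0 q 0] that by (simp add: lsub_0)
 then show ?case by (simp add: lin_0 lsub_0)
 next
 case (2 u v)
 show ?case
 proof (simp add: lsub_add 2[simplified], intro ballI)
 fix q assume q: "q:Q"
 have "h (u + v) q - g (tens (u + v) q) =
 (h (u + v) q - h u q - h v q) + ((h u q - g (tens u q)) + (h v q - g (tens v q)))"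
 by (simp add: tens_add1 lin_simps)
 also have "...:N" using 2 q that(2) by (intro lsub_add N) auto
 finally show "h (u + v) q - g (tens (u + v) q):N" .
 qed
 next
 case (3 c u)
 show ?case
 proof (simp, intro conjI ballI)
 show "sc c u:cs B" using 3 by (simp add: lsub_sc)
 fix q assume q: "q:Q"
 have "h (sc c u) q - g (tens (sc c u) q) = (h (sc c u) q - sc c (h u q)) + sc c (h u q - g (tens u q))"
 by (simp add: tens_sc1 lin_simps sc_diff)
 also have "...:N" using 3 q that(3) by (intro lsub_add lsub_sc N) auto
 finally show "h (sc c u) q - g (tens (sc c u) q):N" .
 qed
 qed
 have base: "single (e (single b 1), d (single c 1)) 1 - g (tens (single b 1) (single c 1)):N" for b c
 using N(1) by (simp add: g_def lsub_0)
 have inner: "single (e (single b 1), d q) 1 - g (tens (single b 1) q):N" if "b:B" "q:cs C" for b q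
 proof -
 have b1: "single b 1:cs B" using that by (simp add: single_cs)
 have "lsub {q:cs C. single (e (single b 1), d q) 1 - g (tens (single b 1) q):N}"
 proof (rule lsubI, goal_cases)
 case 1
 have "single (e (single b 1), d 0) 1:N" using r4[OF b1, of 0 0] by (simp add: lsub_0)
 then show ?case by (simp add: lin_0 lsub_0)
 next
 case (2 u v)
 have "single (e (single b 1), d (u + v)) 1 - g (tens (single b 1) (u + v)) =
 (single (e (single b 1), d (u + v)) 1 - single (e (single b 1), d u) 1 - single (e (single b 1), d v) 1)
 + ((single (e (single b 1), d u) 1 - g (tens (single b 1) u)) + (single (e (single b 1), d v) 1 - g (tens (single b 1) v)))"
 by (simp add: tens_add2 lin_simps)
 also have "...:N" using 2 r2[OF b1, of v u] by (intro lsub_add N) auto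
 finally show ?case using 2 by (simp add: lsub_add)
 next
 case (3 c u)
 have "single (e (single b 1), d (sc c u)) 1 - g (tens (single b 1) (sc c u)) =
 (single (e (single b 1), d (sc c u)) 1 - sc c (single (e (single b 1), d u) 1))
 + sc c (single (e (single b 1), d u) 1 - g (tens (single b 1) u))"
 by (simp only: tens_sc2 lin_sc[OF lf(2)] sc_diff) simp
 also have "...:N" using 3 r4[OF b1, of u c] by (intro lsub_add lsub_sc N) auto
 finally show ?case using 3 by (simp add: lsub_sc)
 qed
 then have "q:{q:cs C. single (e (single b 1), d q) 1 - g (tens (single b 1) q):N}"
 by (rule cs_induct[OF that(2)]) (simp add: base single_cs del: tens_single)
 then show ?thesis by simp
 qed
 have "lsub {p:cs B. ALL q:cs C. single (e p, d q) 1 - g (tens p q):N}"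
 by (rule step) (use r1 r3 in auto)
 then have "p:{p:cs B. ALL q:cs C. single (e p, d q) 1 - g (tens p q):N}"
 by (rule cs_induct[OF pq(1)]) (simp add: inner single_cs)
 then show ?thesis using pq(2) by simp
 qed
 have ker_N: "u:N" if "u:cs S" "f u = 0" for u
 proof -
 have "u - g (f u):N"
 proof -
 have "lsub {u. u - g (f u):N}" by (rule lsub_vimage[OF lin_sub[OF lin_id lin_comp] N(1)]) simp_all
 moreover have "single x 1 - g (f (single x 1)):N" if "x:S" for x
 proof -
 obtain p q where "p:cs B" "q:cs C" "x = (e p, d q)" using \<open>x:S\<close> unfolding S by auto
 then show ?thesis using key[of p q] by (simp add: fs)
 qed
 ultimately have "u:{u. u - g (f u):N}" by (intro cs_induct[OF that(1)]) auto
 then show ?thesis by simp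
 qed
 then show ?thesis using that(2) by (simp add: lin_0)
 qed
 have "f ` cs S = cs (B \<times> C)"
 proof
 have "f u:cs (B \<times> C)" if "u:cs S" for u
 proof (rule lin_cs_mem[OF that])
 fix x assume "x:S"
 then obtain p q where "p:cs B" "q:cs C" "x = (e p, d q)" unfolding S by auto
 then show "f (single x 1):cs (B \<times> C)" by (simp add: fs tens_cs)
 qed simp_all
 then show "f ` cs S <= cs (B \<times> C)" by blast
 have "u:f ` cs S" if "u:cs (B \<times> C)" for u
 proof (rule cs_induct[OF that])
 fix x assume "x:B \<times> C"
 then obtain b c where x: "x = (b, c)" "b:B" "c:C" by auto
 then have bc: "single b (1::'k):cs B" "single c (1::'k):cs C" by (simp_all add: single_cs)
 then have "single x 1 = f (single (e (single b 1), d (single c 1)) 1)" using x by (simp only: fs tens_single) simp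
 moreover have "single (e (single b 1), d (single c 1)) 1:cs S" using bc by (auto intro!: single_cs simp: S)
 ultimately show "single x 1:f ` cs S" by blast
 qed (simp add: lsub_image)
 then show "cs (B \<times> C) <= f ` cs S" by blast
 qed
 then have "qb (cs S) N (B \<times> C)" unfolding qb_def using N_ker ker_N by (intro exI[of _ f]) auto
 moreover have "img F (cs S) (%u. u)" by (simp add: img_def F)
 ultimately have "is_free (quotient_space F N) (B \<times> C)"
 using quot_free[of F "cs S" "%u. u" N N "B \<times> C"] N(1) NS by auto
 then show ?thesis by (simp add: tensor_def Let_def F_def N_def S_def)
qed

section \<open>Cochain complexes\<close>

text \<open>A complex is the space \<open>cs P\<close> modulo a subspace \<open>N\<close>; \<open>gr\<close> grades the keys and the
 differential \<open>d\<close> has degree \<open>dl\<close>.\<close>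

definition cpx :: "'x set=>('x, 'k::field) pm set=>('x=>'g::ab_group_add)=>'g=>
 (('x, 'k) pm=>('x, 'k) pm)=>bool" where
 "cpx P N gr dl d <-> lin d&lsub N&N <= cs P &
 (ALL x:P. d (single x 1):cs {y:P. gr y = gr x + dl})&(ALL x:P. d (d (single x 1)) = 0) &
 (ALL n:N. d n:N)&(ALL n:N. ALL g. rst {x. gr x = g} n:N)"

definition Ch :: "'x set=>('x=>'g)=>'g=>('x, 'k::field) pm set" where
 "Ch P gr g = cs {x:P. gr x = g}"

text \<open>Cycles and boundaries of the quotient complex are lifted to subspaces of
  \<open>cs P\<close>: \<open>d c\<close> has only to lie in \<open>N\<close>, and \<open>BB\<close>
  absorbs the elements of \<open>N\<close>.\<close>

definition ZZ :: "'x set=>('x, 'k::field) pm set=>('x=>'g)=>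
 (('x, 'k) pm=>('x, 'k) pm)=>'g=>('x, 'k) pm set" where
 "ZZ P N gr d g = {c:Ch P gr g. d c:N}"

definition BB :: "'x set=>('x, 'k::field) pm set=>('x=>'g::ab_group_add)=>'g=>
 (('x, 'k) pm=>('x, 'k) pm)=>'g=>('x, 'k) pm set" where
 "BB P N gr dl d g = {d b + n | b n. b:Ch P gr (g - dl)&n:N Int Ch P gr g}"

definition coh where "coh P N gr dl d g B <-> qb (ZZ P N gr d g) (BB P N gr dl d g) B"

definition acyc where "acyc P N gr dl d <-> (ALL g. ZZ P N gr d g <= BB P N gr dl d g)"

lemma lsub_Ch [simp]: "lsub (Ch P gr g)"
 by (simp add: Ch_def)

lemma Ch_cs: "c:Ch P gr g==>c:cs P"
 by (auto simp: Ch_def cs_def)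

lemma single_Ch: "x:P==>single x a:Ch P gr (gr x)"
 by (simp add: Ch_def single_cs)

lemma rst_Ch: "c:cs P==>rst {x. gr x = g} c:Ch P gr g"
 by (auto simp: Ch_def cs_iff_lookup lookup_rst)

lemma Ch_mono: "P <= Q==>c:Ch P gr g==>c:Ch Q gr g"
 by (auto simp: Ch_def cs_def)

lemma rst_Ch_sub: "c:Ch P gr g==>V <= P==>rst V c:Ch V gr g"
 by (auto simp: Ch_def cs_iff_lookup lookup_rst)

section \<open>Cycles and boundaries of one complex\<close>

context
 fixes P :: "'x set" and N :: "('x, 'k::field) pm set" and gr :: "'x=>'g::ab_group_add" and dl d
 assumes C: "cpx P N gr dl d"
begin

lemma cpx_lin: "lin d" and cpx_N: "lsub N" and cpx_NP: "N <= cs P"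
 and cpx_dN: "n:N==>d n:N" and cpx_hom: "n:N==>rst {x. gr x = g} n:N"
 using C by (auto simp: cpx_def)

lemma cpx_d_Ch: "c:Ch P gr g==>d c:Ch P gr (g + dl)"
 unfolding Ch_def by (erule lin_cs_mem) (use C in \<open>auto simp: cpx_def\<close>)

lemma cpx_d_Ch': "c:Ch P gr (g - dl)==>d c:Ch P gr g"
 using cpx_d_Ch[of c "g - dl"] by simp

lemma cpx_d_cs: "c:cs P==>d c:cs P"
 by (erule lin_cs_mem) (use C in \<open>auto simp: cpx_def intro: cs_mono[rotated]\<close>)

lemma cpx_dd: "c:cs P==>d (d c) = 0"
 using lin_cs_eqI[of c P "%c. d (d c)" "%c. 0"] C by (auto simp: cpx_def lin_comp lin_const0)

lemma lsub_ZZ: "lsub (ZZ P N gr d g)"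
proof -
 have "ZZ P N gr d g = Ch P gr g Int {c. d c:N}" by (auto simp: ZZ_def)
 then show ?thesis by (simp add: lsub_Int lsub_vimage cpx_lin cpx_N)
qed

lemma lsub_BB: "lsub (BB P N gr dl d g)"
proof -
 have "BB P N gr dl d g = {u + v | u v. u:d ` Ch P gr (g - dl)&v:N Int Ch P gr g}" by (auto simp: BB_def)
 then show ?thesis by (simp only:) (intro lsub_plus lsub_image lsub_Int cpx_lin cpx_N lsub_Ch)
qed

lemma BBI: "b:Ch P gr (g - dl)==>c - d b:N==>c:Ch P gr g==>c:BB P N gr dl d g"
 unfolding BB_def using cpx_d_Ch'[of b g] lsub_diff[OF lsub_Ch, of c P gr g "d b"]
 by (intro CollectI exI[of _ b] exI[of _ "c - d b"]) simp

lemma BBE: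
 assumes "c:BB P N gr dl d g"
 obtains b where "b:Ch P gr (g - dl)" "c - d b:N" "c:Ch P gr g"
 using assms cpx_d_Ch' unfolding BB_def by (auto simp: lsub_add)

lemma BB_ZZ: "BB P N gr dl d g <= ZZ P N gr d g"
proof
 fix c assume "c:BB P N gr dl d g"
 then obtain b n where "b:Ch P gr (g - dl)" "n:N" "n:Ch P gr g" "c = d b + n" unfolding BB_def by blast
 then show "c:ZZ P N gr d g"
 using cpx_dd[of b] cpx_lin by (auto simp: ZZ_def lin_add lsub_add cpx_d_Ch' cpx_dN Ch_cs)
qed

lemma N_BB: "n:N==>n:Ch P gr g==>n:BB P N gr dl d g"
 by (rule BBI[of 0]) (simp_all add: lsub_0 lin_0 cpx_lin)

lemma d_BB: "b:Ch P gr g==>d b:BB P N gr dl d (g + dl)"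
 by (rule BBI[of b]) (simp_all add: lsub_0 cpx_N cpx_d_Ch)

lemma d_BB': "b:Ch P gr (g - dl)==>d b:BB P N gr dl d g"
 using d_BB[of b "g - dl"] by simp

lemma coh_exists: "\<exists>B :: ('x, 'k) pm set. coh P N gr dl d g B"
 unfolding coh_def by (rule qb_exists[OF lsub_ZZ lsub_BB BB_ZZ])

end

text \<open>In \<open>P = U \<union> V\<close> the part \<open>U\<close> is a subcomplex and \<open>V\<close> the quotient complex.\<close>

context
 fixes P :: "'x set" and N :: "('x, 'k::field) pm set" and gr :: "'x=>'g::ab_group_add" and dl d
 and U V :: "'x set"
 assumes C: "cpx P N gr dl d" and UV: "P = U Un V" "U Int V = {}" and dU: "!!x. x:U==>d (single x 1):cs U"
 and NU: "!!n. n:N==>rst U n:N"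
begin

lemma split_dU: "c:cs U==>d c:cs U"
 by (erule lin_cs_mem) (use dU in \<open>auto simp: cpx_lin[OF C]\<close>)

lemma split_rst: "c:cs P==>rst U c + rst V c = c"
 using UV by (simp add: rst_split)

lemma split_NV: "n:N==>rst V n:N"
proof -
 assume n: "n:N"
 then have "rst V n = n - rst U n" using split_rst[of n] cpx_NP[OF C] by (auto simp: algebra_simps)
 then show ?thesis using n NU by (simp add: lsub_diff cpx_N[OF C])
qed

lemma split_rstV_U: "c:cs U==>rst V c = 0"
 using UV by (simp add: rst_disjoint)

lemma split_rstV_V: "c:cs V==>rst V c = c"
 by (simp add: rst_id)

lemma split_dV: "c:cs P==>rst V (d c) = rst V (d (rst V c))"
proof -
 assume "c:cs P"
 then have "d c = d (rst U c) + d (rst V c)" using split_rst[of c] lin_add[OF cpx_lin[OF C]] by metis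
 then show ?thesis using split_rstV_U[OF split_dU[OF rst_cs[of U c]]] by (simp add: lin_add)
qed

lemma split_sub: "U <= P" "V <= P"
 using UV by auto

lemma split_cpx_U: "cpx U (N Int cs U) gr dl d"
 unfolding cpx_def
proof (intro conjI ballI allI)
 show "lin d" "lsub (N Int cs U)" "N Int cs U <= cs U" by (simp_all add: cpx_lin[OF C] cpx_N[OF C] lsub_Int)
 fix x assume x: "x:U"
 show "d (single x 1):cs {y:U. gr y = gr x + dl}"
 using dU[OF x] cpx_d_Ch[OF C single_Ch[of x P 1 gr]] x UV by (auto simp: Ch_def cs_def)
 show "d (d (single x 1)) = 0" using x UV by (intro cpx_dd[OF C]) (auto simp: single_cs)
next
 fix n assume n: "n:N Int cs U"
 then show "d n:N Int cs U" using cpx_dN[OF C] split_dU by blast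
 show "rst {x. gr x = g} n:N Int cs U" for g
 using n cpx_hom[OF C] by (auto simp: cs_iff_lookup lookup_rst)
qed

lemma split_cpx_V: "cpx V (N Int cs V) gr dl (%c. rst V (d c))"
 unfolding cpx_def
proof (intro conjI ballI allI)
 show "lin (%c. rst V (d c))" "lsub (N Int cs V)" "N Int cs V <= cs V"
 by (simp_all add: cpx_lin[OF C] cpx_N[OF C] lsub_Int lin_comp)
 fix x assume x: "x:V"
 then have xP: "x:P" using UV by auto
 show "rst V (d (single x 1)):cs {y:V. gr y = gr x + dl}"
 using rst_Ch_sub[OF cpx_d_Ch[OF C single_Ch[OF xP, of 1 gr]] split_sub(2)] by (simp add: Ch_def)
 have "rst V (d (rst V (d (single x 1)))) = rst V (d (d (single x 1)))"
 using split_dV[OF cpx_d_cs[OF C single_cs[OF xP]]] by simp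
 then show "rst V (d (rst V (d (single x 1)))) = 0" using cpx_dd[OF C single_cs[OF xP]] by (simp add: lin_0)
next
 fix n assume n: "n:N Int cs V"
 then show "rst V (d n):N Int cs V" using cpx_dN[OF C] split_NV by (auto simp: rst_cs)
 show "rst {x. gr x = g} n:N Int cs V" for g
 using n cpx_hom[OF C] by (auto simp: cs_iff_lookup lookup_rst)
qed

lemma split_ZU: "ZZ U (N Int cs U) gr d g = ZZ P N gr d g Int cs U"
 using split_sub(1) split_dU by (auto simp: ZZ_def Ch_def cs_def)

lemma split_ZV: "c:ZZ P N gr d g==>rst V c:ZZ V (N Int cs V) gr (%c. rst V (d c)) g"
 using split_dV[of c] split_NV[of "d c"] rst_Ch_sub[OF _ split_sub(2), of c gr g]
 by (auto simp: ZZ_def rst_cs Ch_cs)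

lemma split_BU:
 assumes "c:BB U (N Int cs U) gr dl d g"
 shows "c:BB P N gr dl d g"
proof -
 from assms obtain b n where bn: "b:Ch U gr (g - dl)" "n:N" "n:Ch U gr g" "c = d b + n" unfolding BB_def by blast
 moreover have "b:Ch P gr (g - dl)" "n:Ch P gr g" using bn by (auto intro: Ch_mono[OF split_sub(1)])
 ultimately show ?thesis unfolding BB_def by blast
qed

lemma split_BV: 
 assumes "c:BB P N gr dl d g"
 shows "rst V c:BB V (N Int cs V) gr dl (%c. rst V (d c)) g"
proof -
 from assms obtain b n where bn: "b:Ch P gr (g - dl)" "n:N" "n:Ch P gr g" "c = d b + n" unfolding BB_def by blast
 have "rst V c = rst V (d (rst V b)) + rst V n"
 using bn split_dV[OF Ch_cs[OF bn(1)]] by (simp add: lin_add)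
 moreover have "rst V b:Ch V gr (g - dl)" "rst V n:(N Int cs V) Int Ch V gr g"
 using bn split_NV rst_Ch_sub[OF _ split_sub(2)] by (simp_all add: rst_cs)
 ultimately show ?thesis unfolding BB_def by blast
qed

text \<open>For a cycle \<open>v\<close> of the quotient complex, the \<open>U\<close>-part of
  \<open>d v\<close> is a cycle of \<open>U\<close>, hence by acyclicity the boundary of some
  \<open>b\<close>; then \<open>v - b\<close> is a cycle of \<open>P\<close> over
  \<open>v\<close>.\<close>

lemma coh_quotient:
 assumes acU: "acyc U (N Int cs U) gr dl d"
 shows "coh P N gr dl d g B <-> coh V (N Int cs V) gr dl (%c. rst V (d c)) g B" (is "coh P N gr dl d g B <-> coh V ?N gr dl ?d g B")
proof -
 let ?R = "%u v. v = rst V u"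
 have lV: "lsub (ZZ V ?N gr ?d g)" using lsub_ZZ[OF split_cpx_V] by simp
 have l: "EX v:ZZ V ?N gr ?d g. ?R u v" if "u:ZZ P N gr d g" for u using split_ZV[OF that] by blast
 have r: "EX u:ZZ P N gr d g. ?R u v" if v: "v:ZZ V ?N gr ?d g" for v
 proof -
 have vV: "v:Ch V gr g" "rst V (d v):N" using v by (auto simp: ZZ_def)
 have vP: "v:Ch P gr g" using Ch_mono[OF split_sub(2) vV(1)] .
 have dv: "rst U (d v) + rst V (d v) = d v" by (rule split_rst[OF cpx_d_cs[OF C Ch_cs[OF vP]]])
 have "d (rst U (d v)) + d (rst V (d v)) = 0" using cpx_dd[OF C Ch_cs[OF vP]] lin_add[OF cpx_lin[OF C]] dv by metis
 then have "d (rst U (d v)) = - d (rst V (d v))" by (simp add: eq_neg_iff_add_eq_0)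
 then have "d (rst U (d v)):N" using cpx_dN[OF C vV(2)] by (simp add: lsub_minus cpx_N[OF C])
 then have "rst U (d v):ZZ U (N Int cs U) gr d (g + dl)"
 using rst_Ch_sub[OF cpx_d_Ch[OF C vP] split_sub(1)] split_dU rst_cs by (auto simp: ZZ_def)
 then have "rst U (d v):BB U (N Int cs U) gr dl d (g + dl)" using acU unfolding acyc_def by blast
 then obtain b where b: "b:Ch U gr g" "rst U (d v) - d b:N"
 by (rule BBE[OF split_cpx_U]) auto
 have "d (v - b) = (rst U (d v) - d b) + rst V (d v)" using dv by (simp add: lin_diff cpx_lin[OF C] algebra_simps)
 also have "...:N" using b vV by (simp add: lsub_add cpx_N[OF C])
 finally have "v - b:ZZ P N gr d g" using vP Ch_mono[OF split_sub(1) b(1)] by (simp add: ZZ_def lsub_diff)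
 moreover have "rst V (v - b) = v"
 using split_rstV_U[OF Ch_cs[OF b(1)]] split_rstV_V[OF Ch_cs[OF vV(1)]] by (simp add: lin_diff)
 ultimately show ?thesis by (intro bexI[of _ "v - b"]) auto
 qed
 have eq: "u:BB P N gr dl d g <-> rst V u:BB V ?N gr dl ?d g" if u: "u:ZZ P N gr d g" for u
 proof
 assume "rst V u:BB V ?N gr dl ?d g"
 then obtain b n where bn: "b:Ch V gr (g - dl)" "n:N" "n:Ch V gr g" "rst V u = rst V (d b) + n"
 unfolding BB_def by blast
 have bP: "b:Ch P gr (g - dl)" "n:Ch P gr g" using bn by (auto intro: Ch_mono[OF split_sub(2)])
 have B1: "d b + n:BB P N gr dl d g" unfolding BB_def using bP bn by blast
 \<comment> \<open>Subtracting the boundary found in \<open>V\<close> leaves a cycle supported in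
   \<open>U\<close>, which is a boundary by acyclicity.\<close>
 define w where "w = u - (d b + n)"
 have "rst V w = 0" using bn split_rstV_V[OF Ch_cs[OF bn(3)]] by (simp add: w_def lin_simps)
 have wZ: "w:ZZ P N gr d g" unfolding w_def using u B1 BB_ZZ[OF C] by (intro lsub_diff[OF lsub_ZZ[OF C]]) auto
 then have "w:cs U" using split_rst[of w] \<open>rst V w = 0\<close> rst_cs[of U w] Ch_cs[of w P gr g] by (simp add: ZZ_def)
 then have "w:BB U (N Int cs U) gr dl d g" using acU wZ split_ZU unfolding acyc_def by blast
 then have "w + (d b + n):BB P N gr dl d g" by (rule lsub_add[OF lsub_BB[OF C] split_BU B1])
 then show "u:BB P N gr dl d g" by (simp add: w_def)
 qed (rule split_BV)
 show ?thesis unfolding coh_def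
 proof
 assume "qb (ZZ P N gr d g) (BB P N gr dl d g) B"
 then show "qb (ZZ V ?N gr ?d g) (BB V ?N gr dl ?d g) B"
 by (rule qb_rel[where R = "%v u. ?R u v", rotated -1]) (use lV lsub_ZZ[OF C] l r eq in \<open>auto simp: lin_simps\<close>)
 next
 assume "qb (ZZ V ?N gr ?d g) (BB V ?N gr dl ?d g) B"
 then show "qb (ZZ P N gr d g) (BB P N gr dl d g) B"
 by (rule qb_rel[where R = ?R, rotated -1]) (use lV lsub_ZZ[OF C] l r eq in \<open>auto simp: lin_simps\<close>)
 qed
qed

text \<open>The connecting homomorphism of the long exact sequence is bijective when the middle term
  is acyclic. It appears as the relation that the \<open>U\<close>-part of \<open>d v\<close>
  represents the class of \<open>u\<close>.\<close>

lemma coh_connecting: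
 assumes acP: "acyc P N gr dl d"
 shows "coh V (N Int cs V) gr dl (%c. rst V (d c)) g B <-> coh U (N Int cs U) gr dl d (g + dl) B"
proof -
 let ?N = "N Int cs V" and ?d = "%c. rst V (d c)"
 let ?BU = "BB U (N Int cs U) gr dl d (g + dl)" and ?ZU = "ZZ U (N Int cs U) gr d (g + dl)"
 let ?BV = "BB V ?N gr dl ?d g" and ?ZV = "ZZ V ?N gr ?d g"
 let ?R = "%v u. u - rst U (d v):?BU"
 have lBU: "lsub ?BU" using lsub_BB[OF split_cpx_U] by simp
 have zero: "?R 0 0" using lBU by (simp add: lin_0 cpx_lin[OF C] lsub_0)
 have ZV: "v:Ch V gr g" "v:Ch P gr g" "rst V (d v):N" "d v:Ch P gr (g + dl)"
 "rst U (d v) + rst V (d v) = d v" if "v:?ZV" for v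
 proof -
 show 1: "v:Ch V gr g" "rst V (d v):N" using that by (auto simp: ZZ_def)
 show 2: "v:Ch P gr g" by (rule Ch_mono[OF split_sub(2) 1(1)])
 then show "d v:Ch P gr (g + dl)" by (rule cpx_d_Ch[OF C])
 then show "rst U (d v) + rst V (d v) = d v" by (intro split_rst) (rule Ch_cs)
 qed
 have dZU: "rst U (d v):?ZU" if v: "v:?ZV" for v
 proof -
 note vV = ZV[OF v]
 have "d (rst U (d v)) + d (rst V (d v)) = 0" using cpx_dd[OF C Ch_cs[OF vV(2)]] lin_add[OF cpx_lin[OF C]] vV(5) by metis
 then have "d (rst U (d v)) = - d (rst V (d v))" by (simp add: eq_neg_iff_add_eq_0)
 then have "d (rst U (d v)):N" using cpx_dN[OF C vV(3)] by (simp add: lsub_minus cpx_N[OF C])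
 then show ?thesis
 using rst_Ch_sub[OF vV(4) split_sub(1)] split_dU rst_cs by (auto simp: ZZ_def)
 qed
 have l: "EX u:?ZU. ?R v u" if v: "v:?ZV" for v
 using dZU[OF v] lBU by (intro bexI[of _ "rst U (d v)"]) (auto simp: lsub_0)
 have r: "EX v:?ZV. ?R v u" if u: "u:?ZU" for u
 proof -
 have uU: "u:cs U" "u:ZZ P N gr d (g + dl)" using u split_ZU by auto
 then obtain b where b: "b:Ch P gr g" "u - d b:N" "u:Ch P gr (g + dl)"
 proof -
 have "u:BB P N gr dl d (g + dl)" using acP uU(2) unfolding acyc_def by blast
 then show ?thesis using that by (rule BBE[OF C]) simp
 qed
 define bU bV where "bU = rst U b" and "bV = rst V b"
 have bb: "b = bU + bV" "bU:Ch U gr g" "bV:Ch V gr g"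
 using split_rst[OF Ch_cs[OF b(1)]] rst_Ch_sub[OF b(1)] split_sub by (simp_all add: bU_def bV_def)
 have n: "rst V (u - d b):N" "rst U (u - d b):N" using split_NV NU b(2) by auto
 have dU0: "rst V (d bU) = 0" "rst U (d bU) = d bU" "rst V u = 0" "rst U u = u"
 using split_rstV_U[OF split_dU[OF Ch_cs[OF bb(2)]]] split_rstV_U[OF uU(1)]
 rst_id[OF split_dU[OF Ch_cs[OF bb(2)]]] rst_id[OF uU(1)] by simp_all
 have "rst V (u - d b) = - rst V (d bV)" by (simp add: bb(1) lin_simps cpx_lin[OF C] dU0)
 then have "rst V (d bV):N" using lsub_minus[OF cpx_N[OF C] n(1)] by simp
 then have "bV:?ZV" using bb by (simp add: ZZ_def rst_cs)
 moreover have "(u - rst U (d bV)) - d bU = rst U (u - d b)" by (simp add: bb(1) lin_simps cpx_lin[OF C] dU0)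
 then have "?R bV u"
 using n(2) bb(2) uU(1) u rst_Ch_sub[OF cpx_d_Ch[OF C Ch_mono[OF split_sub(2) bb(3)]] split_sub(1)]
 by (intro BBI[OF split_cpx_U, of bU]) (auto simp: rst_cs ZZ_def lsub_diff)
 ultimately show ?thesis by blast
 qed
 have eq: "v:?BV <-> u:?BU" if uv: "v:?ZV" "u:?ZU" "?R v u" for u v
 proof -
 note vV = ZV[OF uv(1)]
 have "u:?BU <-> rst U (d v):?BU"
 using uv(3) lsub_diff[OF lBU _ uv(3), of u] lsub_add[OF lBU uv(3), of "rst U (d v)"] by auto
 also have "... <-> v:?BV"
 proof
 assume "v:?BV"
 then obtain b' n where b': "b':Ch V gr (g - dl)" "n:N" "n:Ch V gr g" "v = rst V (d b') + n"
 unfolding BB_def by blast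
 have b'P: "b':Ch P gr (g - dl)" using Ch_mono[OF split_sub(2) b'(1)] .
 \<comment> \<open>Because \<open>d (d b') = 0\<close>, the two parts of \<open>d b'\<close> have
   opposite differentials, so \<open>- w\<close> bounds the \<open>U\<close>-part of
   \<open>d v\<close> up to relations.\<close>
 define w where "w = rst U (d b')"
 have w: "w:Ch U gr g" unfolding w_def by (rule rst_Ch_sub[OF cpx_d_Ch'[OF C b'P] split_sub(1)])
 have "d w + d (rst V (d b')) = 0"
 unfolding w_def using cpx_dd[OF C Ch_cs[OF b'P]] split_rst[OF cpx_d_cs[OF C Ch_cs[OF b'P]]] lin_add[OF cpx_lin[OF C]] by metis
 then have "d v = d n - d w" by (simp add: b'(4) lin_simps cpx_lin[OF C]) (simp add: algebra_simps eq_neg_iff_add_eq_0)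
 then have "rst U (d v) - d (- w) = rst U (d n)"
 using rst_id[OF split_dU[OF Ch_cs[OF w]]] by (simp add: lin_simps cpx_lin[OF C])
 then show "rst U (d v):?BU"
 using w NU[OF cpx_dN[OF C b'(2)]] rst_Ch_sub[OF vV(4) split_sub(1)]
 by (intro BBI[OF split_cpx_U, of "- w"]) (auto simp: rst_cs lsub_minus)
 next
 assume "rst U (d v):?BU"
 then obtain b where b: "b:Ch U gr g" "rst U (d v) - d b:N"
 by (rule BBE[OF split_cpx_U]) auto
 have "d (v - b) = (rst U (d v) - d b) + rst V (d v)" using vV(5) by (simp add: lin_diff cpx_lin[OF C] algebra_simps)
 also have "...:N" using b vV by (simp add: lsub_add cpx_N[OF C])
 finally have "v - b:ZZ P N gr d g" using vV Ch_mono[OF split_sub(1) b(1)] by (simp add: ZZ_def lsub_diff)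
 then have "v - b:BB P N gr dl d g" using acP unfolding acyc_def by blast
 from split_BV[OF this] show "v:?BV"
 using split_rstV_U[OF Ch_cs[OF b(1)]] split_rstV_V[OF Ch_cs[OF vV(1)]] by (simp add: lin_diff)
 qed
 finally show ?thesis by blast
 qed
 have lU: "lsub ?ZU" "lsub ?ZV" using lsub_ZZ[OF split_cpx_U] lsub_ZZ[OF split_cpx_V] by simp_all
 have add: "?R (a + a') (b + b')" if "?R a b" "?R a' b'" for a b a' b'
 using lsub_add[OF lBU that] by (simp add: algebra_simps lin_simps cpx_lin[OF C])
 have scl: "?R (sc c a) (sc c b)" if "?R a b" for a b c
 using lsub_sc[OF lBU that] by (simp add: sc_diff lin_simps cpx_lin[OF C])
 show ?thesis unfolding coh_def
 proof
 assume "qb ?ZV ?BV B"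
 then show "qb ?ZU ?BU B"
 by (rule qb_rel[where R = "%u v. ?R v u", rotated -1]) (use lU l r eq add scl zero in auto)
 next
 assume "qb ?ZU ?BU B"
 then show "qb ?ZV ?BV B"
 by (rule qb_rel[where R = ?R, rotated -1]) (use lU l r eq add scl zero in auto)
 qed
qed

end

section \<open>Deformation retractions and the Kuenneth formula\<close>

text \<open>Over a field a complex is homotopy equivalent to its cohomology. The data \<open>f\<close>, \<open>G\<close>, \<open>s\<close> below
 express this, and they can be multiplied.\<close>

definition sdr :: "'x set=>('x, 'k::field) pm set=>('x=>'g::ab_group_add)=>'g=>
 (('x, 'k) pm=>('x, 'k) pm)=>'b set=>('b=>'g)=>
 (('x, 'k) pm=>('b, 'k) pm)=>(('b, 'k) pm=>('x, 'k) pm)=>(('x, 'k) pm=>('x, 'k) pm)=>bool" where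
 "sdr P N gr dl d B gB f G s <-> lin f&lin G&lin s &
 (ALL x:P. f (single x 1):cs {b:B. gB b = gr x})&(ALL n:N. f n = 0)&(ALL c:cs P. f (d c) = 0) &
 (ALL b:B. G (single b 1):cs {x:P. gr x = gB b}&d (G (single b 1)):N&f (G (single b 1)) = single b 1) &
 (ALL x:P. s (single x 1):cs {y:P. gr y = gr x - dl})&(ALL n:N. s n:N) &
 (ALL c:cs P. c - G (f c) - d (s c) - s (d c):N)"

text \<open>Linear choices over the field: \<open>sg\<close> picks primitives of boundaries and
  \<open>Gg\<close> picks representing cycles. Subtracting a primitive of \<open>d c\<close> turns
  any cochain into a cycle, whose class gives \<open>f\<close> and whose remaining boundary gives
  \<open>s\<close>.\<close>

lemma sdr_of_coh:
 fixes P :: "'x set" and N :: "('x, 'k::field) pm set" and gr :: "'x=>'g::ab_group_add" and B :: "'g=>'b set"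
 assumes C: "cpx P N gr dl d" and coh: "!!g. coh P N gr dl d g (B g)"
 shows "EX f G s. sdr P N gr dl d (Sigma UNIV B) fst f G s"
proof -
 let ?Z = "ZZ P N gr d" and ?B = "BB P N gr dl d" and ?C = "Ch P gr"
 note ld = cpx_lin[OF C] and lN = cpx_N[OF C]
 have "ALL g. EX f. lin f&f ` ?Z g = cs (B g)&(ALL u:?Z g. f u = 0 <-> u:?B g)"
 using coh unfolding coh_def qb_def by blast
 then obtain fg where fg: "ALL g. lin (fg g)&fg g ` ?Z g = cs (B g)&(ALL u:?Z g. fg g u = 0 <-> u:?B g)"
 using choice[of "%g f. lin f&f ` ?Z g = cs (B g)&(ALL u:?Z g. f u = 0 <-> u:?B g)"] by blast
 have lf: "lin (fg g)" for g using fg by blast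
 have fg_cs: "fg g u:cs (B g)" if "u:?Z g" for u g using fg that by blast
 have fg_ker: "fg g u = 0 <-> u:?B g" if "u:?Z g" for u g using fg that by blast
 have fg_sur: "EX u:?Z g. fg g u = w" if "w:cs (B g)" for w g
 proof -
 have "w:fg g ` ?Z g" using fg that by simp
 then show ?thesis by blast
 qed
 have "ALL g. EX sg. lin sg&(ALL u:N Int ?C g. sg u = 0)&(ALL u:?B g. sg u:?C (g - dl)&u - d (sg u):N)"
 proof
 fix g
 show "EX sg. lin sg&(ALL u:N Int ?C g. sg u = 0)&(ALL u:?B g. sg u:?C (g - dl)&u - d (sg u):N)"
 proof (rule linear_choice[OF lsub_BB[OF C]])
 show "lsub (N Int ?C g)" by (simp add: lsub_Int lN)
 show "N Int ?C g <= ?B g" using N_BB[OF C] by blast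
 show "EX v. v:?C (g - dl)&u - d v:N" if "u:?B g" for u
 using that by (rule BBE[OF C]) blast
 show "0:?C (g - dl)&u - d 0:N" if "u:N Int ?C g" for u
 using that by (simp add: lsub_0 lin_0 ld)
 show "b + b':?C (g - dl)&a + a' - d (b + b'):N"
 if "b:?C (g - dl)&a - d b:N" "b':?C (g - dl)&a' - d b':N" for a b a' b'
 proof -
 have "a + a' - d (b + b') = (a - d b) + (a' - d b')" by (simp add: lin_add[OF ld])
 moreover have "...:N" using that by (intro lsub_add[OF lN]) auto
 ultimately have "a + a' - d (b + b'):N" by (simp only:)
 then show ?thesis using that by (auto intro: lsub_add[OF lsub_Ch])
 qed
 show "sc c b:?C (g - dl)&sc c a - d (sc c b):N" if "b:?C (g - dl)&a - d b:N" for c a b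
 proof -
 have "sc c a - d (sc c b) = sc c (a - d b)" by (simp add: lin_sc[OF ld] sc_diff)
 moreover have "...:N" using that by (intro lsub_sc[OF lN]) auto
 ultimately have "sc c a - d (sc c b):N" by (simp only:)
 then show ?thesis using that by (auto intro: lsub_sc[OF lsub_Ch])
 qed
 qed
 qed
 then obtain sg where sg: "ALL g. lin (sg g)&(ALL u:N Int ?C g. sg g u = 0)&(ALL u:?B g. sg g u:?C (g - dl)&u - d (sg g u):N)"
 using choice[of "%g sg. lin sg&(ALL u:N Int ?C g. sg u = 0)&(ALL u:?B g. sg u:?C (g - dl)&u - d (sg u):N)"] by blast
 have lsg: "lin (sg g)" for g using sg by blast
 have sgN: "sg g u = 0" if "u:N" "u:?C g" for u g using sg that by blast
 have sgB: "sg g u:?C (g - dl)" "u - d (sg g u):N" if "u:?B g" for u g using sg that by blast+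
 have "ALL g. EX G. lin G&(ALL w:{0}. G w = 0)&(ALL w:cs (B g). G w:?Z g&fg g (G w) = w)"
 proof
 fix g
 show "EX G. lin G&(ALL w:{0}. G w = 0)&(ALL w:cs (B g). G w:?Z g&fg g (G w) = w)"
 by (rule linear_choice[OF lsub_cs])
 (use fg_sur in \<open>auto simp: lsub_0 lsub_add lsub_sc lsub_ZZ[OF C] lin_simps lf, simp add: lsub_def\<close>)
 qed
 then obtain Gg where Gg: "ALL g. lin (Gg g)&(ALL w:{0}. Gg g w = 0)&(ALL w:cs (B g). Gg g w:?Z g&fg g (Gg g w) = w)"
 using choice[of "%g G. lin G&(ALL w:{0}. G w = 0)&(ALL w:cs (B g). G w:?Z g&fg g (G w) = w)"] by blast
 have lG: "lin (Gg g)" for g using Gg by blast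
 have GgZ: "Gg g w:?Z g" "fg g (Gg g w) = w" if "w:cs (B g)" for w g using Gg that by blast+
 \<comment> \<open>A projection of cochains to cycles; it fixes cycles because \<open>sg\<close>
   vanishes on \<open>N\<close>.\<close>
 define r where "r g c = c - sg (g + dl) (d c)" for g c
 have lr: "lin (r g)" for g
 unfolding r_def by (rule lin_sub[OF lin_id lin_comp[OF lsg ld]])
 have sgd: "sg (g + dl) (d c):?C g" "d c - d (sg (g + dl) (d c)):N" if "c:?C g" for c g
 using sgB[OF d_BB[OF C that]] by simp_all
 have rZ: "r g c:?Z g" if "c:?C g" for g c
 using that sgd[OF that] by (simp add: ZZ_def r_def lin_diff ld lsub_diff)
 have r_id: "r g c = c" if "c:?Z g" for g c
 using that sgN[of "d c" "g + dl"] cpx_d_Ch[OF C] by (simp add: ZZ_def r_def)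
 define F where "F g c = fg g (r g c)" for g c
 have lF: "lin (F g)" for g unfolding F_def by (rule lin_comp[OF lf lr])
 \<comment> \<open>Without its representing cycle, \<open>r g c\<close> is a boundary, and the
   chosen primitive of it is the homotopy.\<close>
 define S where "S g c = sg g (r g c - Gg g (F g c))" for g c
 have lS: "lin (S g)" for g unfolding S_def by (rule lin_comp[OF lsg lin_sub[OF lr lin_comp[OF lG lF]]])
 have F_cs: "F g c:cs (B g)" if "c:?C g" for g c
 unfolding F_def by (rule fg_cs[OF rZ[OF that]])
 have y: "r g c - Gg g (F g c):?B g" if "c:?C g" for g c
 proof -
 have 1: "r g c - Gg g (F g c):?Z g"
 using rZ[OF that] GgZ[OF F_cs[OF that]] by (simp add: lsub_diff lsub_ZZ[OF C])
 moreover have "fg g (r g c - Gg g (F g c)) = 0"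
 using GgZ(2)[OF F_cs[OF that]] by (simp add: lin_diff lf F_def)
 ultimately show ?thesis using fg_ker[OF 1] by simp
 qed
 have S_C: "S g c:?C (g - dl)" if "c:?C g" for g c
 unfolding S_def by (rule sgB[OF y[OF that]])
 have F_B: "F g c = 0" if "c:?B g" for g c
 using that fg_ker[of c g] BB_ZZ[OF C, of g] r_id[of c g] by (auto simp: F_def)
 have hom: "c - Gg g (F g c) - d (S g c) - S (g + dl) (d c):N" if c: "c:?C g" for g c
 proof -
 have dB: "d c:?B (g + dl)" by (rule d_BB[OF C c])
 have dr: "r (g + dl) (d c) = d c" using dB BB_ZZ[OF C] by (intro r_id) blast
 have "S (g + dl) (d c) = sg (g + dl) (d c)"
 by (simp add: S_def dr F_B[OF dB] lin_0 lG)
 then have "c - Gg g (F g c) - d (S g c) - S (g + dl) (d c)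
 = (r g c - Gg g (F g c)) - d (sg g (r g c - Gg g (F g c)))"
 by (simp add: S_def r_def)
 then show ?thesis using sgB(2)[OF y[OF c]] by (simp only:)
 qed
 \<comment> \<open>The degreewise maps are glued along the degrees of the keys; a basis index is
   paired with its degree.\<close>
 define f where "f = lext (%x. tag (gr x) (F (gr x) (single x 1)))"
 define G where "G = lext (%(g, b). Gg g (single b 1))"
 define s where "s = lext (%x. S (gr x) (single x 1))"
 have l: "lin f" "lin G" "lin s" by (simp_all add: f_def G_def s_def)
 have f: "f c = tag g (F g c)" if "c:?C g" for c g
 using that unfolding Ch_def by (rule lin_cs_eqI[OF _ l(1) lin_comp[OF lin_tag lF]]) (simp add: f_def)
 have s: "s c = S g c" if "c:?C g" for c g
 using that unfolding Ch_def by (rule lin_cs_eqI[OF _ l(3) lS]) (simp add: s_def)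
 have G: "G (tag g w) = Gg g w" for g w
 by (rule lin_eqI[OF lin_comp[OF l(2) lin_tag] lG]) (simp add: G_def tag_def)
 \<comment> \<open>\<open>N\<close> contains the homogeneous parts of its elements, so vanishing is
   tested on these.\<close>
 have N_parts: "N <= {n. K n = 0}" if "lin K" "!!n g. n:N==>n:?C g==>K n = 0" for K :: "('x, 'k) pm=>('y, 'k) pm"
 proof
 fix n assume n: "n:N"
 show "n:{n. K n = 0}"
 proof (rule lsub_by_parts[OF lsub_ker[OF that(1)], where h = gr])
 fix g show "rst {x. gr x = g} n:{n. K n = 0}"
 using that(2)[of "rst {x. gr x = g} n" g] cpx_hom[OF C n] rst_Ch[of n P gr g] cpx_NP[OF C] n by auto
 qed
 qed
 have "sdr P N gr dl d (Sigma UNIV B) fst f G s" unfolding sdr_def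
 proof (intro conjI ballI)
 show "lin f" "lin G" "lin s" by fact+
 fix x assume x: "x:P"
 note xC = single_Ch[OF x, of 1 gr]
 have "tag (gr x) (F (gr x) (single x 1)):cs (Sigma {gr x} B)"
 using tag_cs[of "gr x" "{gr x}" _ B] F_cs[OF xC] by simp
 then show "f (single x 1):cs {b:Sigma UNIV B. fst b = gr x}"
 unfolding f[OF xC] by (rule cs_mono[rotated]) auto
 show "s (single x 1):cs {y:P. gr y = gr x - dl}"
 using S_C[OF xC] unfolding s[OF xC] by (simp add: Ch_def)
 next
 fix n assume n: "n:N"
 have "n:{n. f n = 0}"
 using N_parts[OF l(1)] n f F_B N_BB[OF C] by (force simp: lin_0)
 then show "f n = 0" by simp
 have "s n = 0" if "n:N" "n:?C g" for n g
 proof -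
 have nB: "n:?B g" using that N_BB[OF C] by blast
 then have "r g n = n" using BB_ZZ[OF C] by (intro r_id) blast
 then show ?thesis using that F_B[OF nB] sgN by (simp add: s[OF that(2)] S_def lin_0 lG)
 qed
 then have "n:{n. s n = 0}" using N_parts[OF l(3)] n by blast
 then show "s n:N" using lN by (simp add: lsub_0)
 next
 fix c :: "('x, 'k) pm" assume c: "c:cs P"
 have "c:{c. f (d c) = 0}"
 proof (rule cs_induct[OF c lsub_ker[OF lin_comp[OF l(1) ld]]])
 fix x assume "x:P"
 then have "d (single x 1):?B (gr x + dl)" by (intro d_BB[OF C] single_Ch)
 then show "single x 1:{c. f (d c) = 0}"
 using f[of "d (single x 1)" "gr x + dl"] F_B BB_ZZ[OF C] by (auto simp: ZZ_def lin_0)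
 qed
 then show "f (d c) = 0" by simp
 have "c:{c. c - G (f c) - d (s c) - s (d c):N}"
 proof (rule cs_induct[OF c])
 show "lsub {c. c - G (f c) - d (s c) - s (d c):N}"
 by (intro lsub_vimage lin_sub lin_id lin_comp[of G f] lin_comp[of d s] lin_comp[of s d] l ld lN)
 fix x assume "x:P"
 note xC = single_Ch[OF this, of 1 gr]
 show "single x 1:{c. c - G (f c) - d (s c) - s (d c):N}"
 using hom[OF xC] by (simp add: f[OF xC] G s[OF xC] s[OF cpx_d_Ch[OF C xC]])
 qed
 then show "c - G (f c) - d (s c) - s (d c):N" by simp
 next
 fix x assume "x:Sigma UNIV B"
 then obtain g b where x: "x = (g, b)" "b:B g" by auto
 have w: "single b 1:cs (B g)" using x by (simp add: single_cs)
 have Gx: "G (single x 1) = Gg g (single b 1)" by (simp add: G_def x)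
 note z = GgZ[OF w]
 have zC: "Gg g (single b 1):?C g" using z by (simp add: ZZ_def)
 show "G (single x 1):cs {y:P. gr y = fst x}" using zC unfolding Gx by (simp add: Ch_def x)
 show "d (G (single x 1)):N" using z unfolding Gx by (simp add: ZZ_def)
 show "f (G (single x 1)) = single x 1"
 unfolding Gx f[OF zC] F_def r_id[OF z(1)] z(2) by (simp add: tag_def x)
 qed
 then show ?thesis by blast
qed

text \<open>Up to homotopy the complex is the span of \<open>B\<close> with zero differential. The
  additive map \<open>ph\<close> coarsens the grading; it will later forget the exponent of
  t.\<close>

lemma coh_of_sdr:
 fixes P :: "'x set" and N :: "('x, 'k::field) pm set" and gr :: "'x=>'g::ab_group_add" and B :: "'b set"
 and ph :: "'g=>'h::ab_group_add"
 assumes ld: "lin d" and lN: "lsub N" and dC: "!!x. x:P==>d (single x 1):cs {y:P. gr y = gr x + dl}"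
 and S: "sdr P N gr dl d B gB f G s" and ph: "!!a b. ph (a + b) = ph a + ph b"
 shows "coh P N (%x. ph (gr x)) (ph dl) d h {b:B. ph (gB b) = h}"
proof -
 let ?C = "Ch P (%x. ph (gr x))" and ?Bh = "{b:B. ph (gB b) = h}"
 have phm: "ph (a - b) = ph a - ph b" for a b using ph[of "a - b" b] by simp
 have l: "lin f" "lin G" "lin s" using S by (simp_all add: sdr_def)
 have fN: "f n = 0" "s n:N" if "n:N" for n using S that by (simp_all add: sdr_def)
 have fd: "f (d c) = 0" "c - G (f c) - d (s c) - s (d c):N" if "c:cs P" for c using S that by (simp_all add: sdr_def)
 have Gb: "G (single b 1):cs {x:P. gr x = gB b}" "d (G (single b 1)):N" "f (G (single b 1)) = single b 1"
 if "b:B" for b using S that by (simp_all add: sdr_def)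
 have fC: "f c:cs ?Bh" if "c:?C h" for c
 using that unfolding Ch_def
 proof (rule lin_cs_mem[OF _ l(1) lsub_cs])
 fix x assume x: "x:{x:P. ph (gr x) = h}"
 then have "f (single x 1):cs {b:B. gB b = gr x}" using S by (simp add: sdr_def)
 then show "f (single x 1):cs ?Bh" by (rule cs_mono[rotated]) (use x in auto)
 qed
 have sC: "s c:?C (h - ph dl)" if "c:?C h" for c h
 using that unfolding Ch_def
 proof (rule lin_cs_mem[OF _ l(3) lsub_cs])
 fix x assume x: "x:{x:P. ph (gr x) = h}"
 then have "s (single x 1):cs {y:P. gr y = gr x - dl}" using S by (simp add: sdr_def)
 then show "s (single x 1):cs {y:P. ph (gr y) = h - ph dl}" by (rule cs_mono[rotated]) (use x phm in auto)
 qed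
 have dC': "d c:?C (h + ph dl)" if "c:?C h" for c h
 using that unfolding Ch_def
 proof (rule lin_cs_mem[OF _ ld lsub_cs])
 fix x assume x: "x:{x:P. ph (gr x) = h}"
 then have "d (single x 1):cs {y:P. gr y = gr x + dl}" using dC by simp
 then show "d (single x 1):cs {y:P. ph (gr y) = h + ph dl}" by (rule cs_mono[rotated]) (use x ph in auto)
 qed
 have dC'': "d c:?C h" if "c:?C (h - ph dl)" for c h using dC'[OF that] by simp
 have sur: "cs ?Bh <= f ` ZZ P N (%x. ph (gr x)) d h"
 proof
 fix w :: "('b, 'k) pm" assume w: "w:cs ?Bh"
 have "G w:{c:?C h. d c:N}"
 proof (rule lin_cs_mem[OF w l(2)])
 show "lsub {c:?C h. d c:N}" using lsub_Int[OF lsub_Ch lsub_vimage[OF ld lN]] by (simp add: Int_def)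
 fix b assume b: "b:?Bh"
 then have "G (single b 1):?C h" unfolding Ch_def using Gb(1)[of b] by (intro cs_mono[rotated, OF Gb(1)]) auto
 then show "G (single b 1):{c:?C h. d c:N}" using Gb(2) b by simp
 qed
 moreover have "f (G w) = w"
 by (rule lin_cs_eqI[OF w lin_comp[OF l(1,2)] lin_id]) (use Gb in auto)
 ultimately show "w:f ` ZZ P N (%x. ph (gr x)) d h" unfolding ZZ_def by (metis (no_types, lifting) imageI)
 qed
 have ker: "f c = 0 <-> c:BB P N (%x. ph (gr x)) (ph dl) d h" if c: "c:ZZ P N (%x. ph (gr x)) d h" for c
 proof
 assume "c:BB P N (%x. ph (gr x)) (ph dl) d h"
 then obtain b n where "b:?C (h - ph dl)" "n:N" "c = d b + n" unfolding BB_def by blast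
 then show "f c = 0" using fd(1)[OF Ch_cs] fN l by (simp add: lin_add)
 next
 assume f0: "f c = 0"
 have cC: "c:?C h" "d c:N" using c by (simp_all add: ZZ_def)
 define n where "n = c - d (s c)"
 have "n = (c - G (f c) - d (s c) - s (d c)) + s (d c)" using f0 l by (simp add: n_def lin_0)
 also have "...:N" by (rule lsub_add[OF lN fd(2)[OF Ch_cs[OF cC(1)]] fN(2)[OF cC(2)]])
 finally have "n:N" .
 moreover have "n:?C h" unfolding n_def using cC(1) dC''[OF sC[OF cC(1)]] by (simp add: lsub_diff)
 moreover have "c = d (s c) + n" by (simp add: n_def)
 ultimately show "c:BB P N (%x. ph (gr x)) (ph dl) d h" unfolding BB_def using sC[OF cC(1)] by blast
 qed
 have "f ` ZZ P N (%x. ph (gr x)) d h = cs ?Bh" using sur fC by (auto simp: ZZ_def)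
 then show ?thesis unfolding coh_def qb_def using l(1) ker by blast
qed

section \<open>The tensor product of two complexes with relations\<close>

definition tmap :: "(('x, 'k::field) pm=>('a, 'k) pm)=>(('y, 'k) pm=>('b, 'k) pm)=>
 ('x \<times> 'y \<Rightarrow>\<^sub>0 'k)=>('a \<times> 'b \<Rightarrow>\<^sub>0 'k)" where
 "tmap f g = lext (%(x, y). tens (f (single x 1)) (g (single y 1)))"

lemma lin_tmap [simp]: "lin (tmap f g)"
 by (simp add: tmap_def)

lemma tmap_tens:
 assumes "lin f" "lin g"
 shows "tmap f g (tens u v) = tens (f u) (g v)"
proof (rule lin_eqI[where f = "%u. tmap f g (tens u v)" and g = "%u. tens (f u) (g v)"])
 show "lin (%u. tmap f g (tens u v))" by (rule lin_comp[OF lin_tmap lin_tens1])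
 show "lin (%u. tens (f u) (g v))" by (rule lin_comp[OF lin_tens1 assms(1)])
 fix x
 show "tmap f g (tens (single x 1) v) = tens (f (single x 1)) (g v)"
 proof (rule lin_eqI[where f = "%v. tmap f g (tens (single x 1) v)" and g = "%v. tens (f (single x 1)) (g v)"])
 show "lin (%v. tmap f g (tens (single x 1) v))" by (rule lin_comp[OF lin_tmap lin_tens2])
 show "lin (%v. tens (f (single x 1)) (g v))" by (rule lin_comp[OF lin_tens2 assms(2)])
 qed (simp add: tmap_def)
qed

text \<open>The kernel of the map from the tensor product of two free spaces to the tensor product
  of their quotients.\<close>

definition tN :: "'x set=>('x, 'k::field) pm set=>'y set=>('y, 'k) pm set=>('x \<times> 'y \<Rightarrow>\<^sub>0 'k) set" where
 "tN P1 N1 P2 N2 = pm.span ({tens u v | u v. u:N1&v:cs P2} Un {tens u v | u v. u:cs P1&v:N2})"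

text \<open>The Koszul sign. The parity \<open>par\<close> is abstract because degrees will lie in a
  product of three copies of the integers.\<close>

definition sgn_op :: "('g=>'k)=>('x=>'g)=>('x, 'k::field) pm=>('x, 'k) pm" where
 "sgn_op par gr = lext (%x. single x (par (gr x)))"

definition td :: "('g=>'k)=>('x=>'g)=>(('x, 'k) pm=>('x, 'k::field) pm)=>
 (('y, 'k) pm=>('y, 'k) pm)=>('x \<times> 'y \<Rightarrow>\<^sub>0 'k)=>('x \<times> 'y \<Rightarrow>\<^sub>0 'k)" where
 "td par gr1 d1 d2 c = tmap d1 (%v. v) c + tmap (sgn_op par gr1) d2 c"

lemma lin_sgn_op [simp]: "lin (sgn_op par gr)"
 by (simp add: sgn_op_def)

lemma lin_td: "lin (td par gr1 d1 d2)"
 unfolding td_def by (rule lin_plus) simp_all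

context
 fixes P1 :: "'x set" and N1 :: "('x, 'k::field) pm set" and gr1 :: "'x=>'g::ab_group_add" and dl d1
 and P2 :: "'y set" and N2 :: "('y, 'k::field) pm set" and gr2 :: "'y=>'g::ab_group_add" and d2
 and par :: "'g=>'k"
 assumes C1: "cpx P1 N1 gr1 dl d1" and C2: "cpx P2 N2 gr2 dl d2"
 and par: "!!g. par (g + dl) = - par g" "!!g. par g * par g = 1"
begin

lemma sgn_Ch: "c:Ch P1 gr1 g==>sgn_op par gr1 c = sc (par g) c"
 unfolding Ch_def
 by (erule lin_cs_eqI[OF _ lin_sgn_op lin_smult[OF lin_id]]) (simp add: sgn_op_def)

lemma sgn_cs: "c:cs P1==>sgn_op par gr1 c:cs P1"
 by (erule lin_cs_mem) (simp_all add: sgn_op_def single_cs)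

lemma sgn_sgn: "sgn_op par gr1 (sgn_op par gr1 c) = c"
 by (rule lin_eqI[OF lin_comp[OF lin_sgn_op lin_sgn_op] lin_id]) (simp add: sgn_op_def par(2))

lemma sgn_d: "c:cs P1==>d1 (sgn_op par gr1 c) = - sgn_op par gr1 (d1 c)"
proof -
 assume c: "c:cs P1"
 have "c:{c. d1 (sgn_op par gr1 c) + sgn_op par gr1 (d1 c) = 0}"
 proof (rule cs_induct[OF c])
 show "lsub {c. d1 (sgn_op par gr1 c) + sgn_op par gr1 (d1 c) = 0}"
 by (intro lsub_ker lin_plus lin_comp[of d1 "sgn_op par gr1"] lin_comp[of "sgn_op par gr1" d1] lin_sgn_op cpx_lin[OF C1])
 fix x assume "x:P1"
 note xC = single_Ch[OF this, of 1 gr1]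
 show "single x 1:{c. d1 (sgn_op par gr1 c) + sgn_op par gr1 (d1 c) = 0}"
 using sgn_Ch[OF xC] sgn_Ch[OF cpx_d_Ch[OF C1 xC]] par(1)[of "gr1 x"]
 by (simp add: lin_sc[OF cpx_lin[OF C1]] sc_uminus del: sc_single)
 qed
 then show ?thesis by (simp add: eq_neg_iff_add_eq_0)
qed

text \<open>The operator is a scalar on each homogeneous part, and \<open>N\<close> contains the
  parts of its elements.\<close>

lemma sgn_N: "n:N1==>sgn_op par gr1 n:N1"
proof -
 assume n: "n:N1"
 let ?G = "gr1 ` keys n"
 have "n = (\<Sum>g\<in>?G. rst {x. gr1 x = g} n)" by (rule rst_partition) auto
 then have "sgn_op par gr1 n = (\<Sum>g\<in>?G. sgn_op par gr1 (rst {x. gr1 x = g} n))"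
 by (metis lin_sum lin_sgn_op)
 also have "... = (\<Sum>g\<in>?G. sc (par g) (rst {x. gr1 x = g} n))"
 using n cpx_NP[OF C1] by (intro sum.cong refl sgn_Ch rst_Ch) auto
 also have "...:N1" using n by (intro lsub_sum lsub_sc cpx_N[OF C1] cpx_hom[OF C1])
 finally show ?thesis .
qed

lemma td_tens: "td par gr1 d1 d2 (tens u v) = tens (d1 u) v + tens (sgn_op par gr1 u) (d2 v)"
 by (simp add: td_def tmap_tens cpx_lin[OF C1] cpx_lin[OF C2] lin_id)

lemma tN1: "u:N1==>v:cs P2==>tens u v:tN P1 N1 P2 N2"
 and tN2: "u:cs P1==>v:N2==>tens u v:tN P1 N1 P2 N2"
 unfolding tN_def by (blast intro: pm.span_base)+

lemma lsub_tN [simp]: "lsub (tN P1 N1 P2 N2)"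
 by (simp add: tN_def)

lemma tN_into:
 assumes "lin h" "lsub U" "!!u v. u:N1==>v:cs P2==>h (tens u v):U"
 "!!u v. u:cs P1==>v:N2==>h (tens u v):U" "n:tN P1 N1 P2 N2"
 shows "h n:U"
proof -
 have "tN P1 N1 P2 N2 <= {n. h n:U}"
 unfolding tN_def by (rule span_subset[OF lsub_vimage[OF assms(1,2)]]) (use assms(3,4) in auto)
 then show ?thesis using assms(5) by auto
qed

text \<open>The homotopy deforms the second factor to its cohomology, and then the first one with
  the second already replaced by \<open>G2 (f2 v)\<close>. The Koszul sign cancels the mixed
  terms.\<close>

lemma sdr_tensor:
 assumes S1: "sdr P1 N1 gr1 dl d1 B1 gB1 f1 G1 s1" and S2: "sdr P2 N2 gr2 dl d2 B2 gB2 f2 G2 s2"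
 shows "sdr (P1 \<times> P2) (tN P1 N1 P2 N2) (%(x, y). gr1 x + gr2 y) dl (td par gr1 d1 d2)
 (B1 \<times> B2) (%(a, b). gB1 a + gB2 b) (tmap f1 f2) (tmap G1 G2)
 (%c. tmap s1 (%v. G2 (f2 v)) c + tmap (sgn_op par gr1) s2 c)"
proof -
 let ?\<epsilon> = "sgn_op par gr1" and ?N = "tN P1 N1 P2 N2" and ?d = "td par gr1 d1 d2"
 let ?s = "%c. tmap s1 (%v. G2 (f2 v)) c + tmap ?\<epsilon> s2 c"
 have l: "lin f1" "lin G1" "lin s1" "lin f2" "lin G2" "lin s2" "lin d1" "lin d2"
 using S1 S2 cpx_lin[OF C1] cpx_lin[OF C2] by (simp_all add: sdr_def)
 have lGf: "lin (%v. G2 (f2 v))" using l by (simp add: lin_comp)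
 have s_tens: "?s (tens u v) = tens (s1 u) (G2 (f2 v)) + tens (?\<epsilon> u) (s2 v)" for u v
 by (simp add: tmap_tens l lGf)
 have s1P: "s1 c:cs P1" "f1 c:cs B1" if "c:cs P1" for c
 proof -
 show "s1 c:cs P1" using that
 by (rule lin_cs_mem[OF _ l(3) lsub_cs]) (use S1 in \<open>auto simp: sdr_def intro: cs_mono[rotated]\<close>)
 show "f1 c:cs B1" using that
 by (rule lin_cs_mem[OF _ l(1) lsub_cs]) (use S1 in \<open>auto simp: sdr_def intro: cs_mono[rotated]\<close>)
 qed
 have s2P: "s2 c:cs P2" "f2 c:cs B2" if "c:cs P2" for c
 proof -
 show "s2 c:cs P2" using that
 by (rule lin_cs_mem[OF _ l(6) lsub_cs]) (use S2 in \<open>auto simp: sdr_def intro: cs_mono[rotated]\<close>)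
 show "f2 c:cs B2" using that
 by (rule lin_cs_mem[OF _ l(4) lsub_cs]) (use S2 in \<open>auto simp: sdr_def intro: cs_mono[rotated]\<close>)
 qed
 have G2P: "G2 w:cs P2" "d2 (G2 w):N2" if "w:cs B2" for w
 proof -
 show "G2 w:cs P2" using that
 by (rule lin_cs_mem[OF _ l(5) lsub_cs]) (use S2 in \<open>auto simp: sdr_def intro: cs_mono[rotated]\<close>)
 show "d2 (G2 w):N2" using that
 by (rule lin_cs_mem[OF _ lin_comp[OF l(8,5)] cpx_N[OF C2]]) (use S2 in \<open>auto simp: sdr_def\<close>)
 qed
 have gr_tens: "tens u v:cs {x:A \<times> B. (case x of (a, b)=>ga a + gb b) = g + h}"
 if "u:cs {a:A. ga a = g}" "v:cs {b:B. gb b = h}"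
 for u v A B g h and ga :: "'i=>'g" and gb :: "'j=>'g"
 by (rule cs_mono[OF _ tens_cs[OF that]]) auto
 show ?thesis unfolding sdr_def
 proof (intro conjI ballI)
 show "lin (tmap f1 f2)" "lin (tmap G1 G2)" "lin ?s" by (simp_all add: lin_plus)
 fix x assume "x:P1 \<times> P2"
 then obtain a b where x: "x = (a, b)" "a:P1" "b:P2" by auto
 have "tens (f1 (single a 1)) (f2 (single b 1)):cs {y:B1 \<times> B2. (case y of (a, b)=>gB1 a + gB2 b) = gr1 a + gr2 b}"
 by (rule gr_tens) (use S1 S2 x in \<open>auto simp: sdr_def\<close>)
 then show "tmap f1 f2 (single x 1):cs {y:B1 \<times> B2. (case y of (a, b)=>gB1 a + gB2 b) = (case x of (x, y)=>gr1 x + gr2 y)}"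
 by (simp add: tmap_def x)
 have s1a: "s1 (single a 1):cs {y:P1. gr1 y = gr1 a - dl}" and s2b: "s2 (single b 1):cs {y:P2. gr2 y = gr2 b - dl}"
 and f2b: "f2 (single b 1):cs {y:B2. gB2 y = gr2 b}"
 using S1 S2 x by (auto simp: sdr_def)
 have Gf: "G2 (f2 (single b 1)):cs {y:P2. gr2 y = gr2 b}"
 using f2b
 proof (rule lin_cs_mem[OF _ l(5) lsub_cs])
 fix y assume y: "y:{y:B2. gB2 y = gr2 b}"
 have "G2 (single y 1):cs {x:P2. gr2 x = gB2 y}" using S2 y unfolding sdr_def by blast
 then show "G2 (single y 1):cs {y:P2. gr2 y = gr2 b}" using y by simp
 qed
 have "single a (par (gr1 a)):cs {y:P1. gr1 y = gr1 a}" using x by (simp add: single_cs)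
 from gr_tens[OF this s2b] gr_tens[OF s1a Gf]
 have "tens (s1 (single a 1)) (G2 (f2 (single b 1))) + tens (?\<epsilon> (single a 1)) (s2 (single b 1)):
 cs {y:P1 \<times> P2. (case y of (x, y)=>gr1 x + gr2 y) = gr1 a + gr2 b - dl}"
 by (intro lsub_add[OF lsub_cs]) (simp_all add: sgn_op_def algebra_simps)
 then show "?s (single x 1):cs {y:P1 \<times> P2. (case y of (x, y)=>gr1 x + gr2 y) = (case x of (x, y)=>gr1 x + gr2 y) - dl}"
 by (simp add: tmap_def x)
 next
 fix n assume n: "n:?N"
 have "tmap f1 f2 n:{0}"
 by (rule tN_into[OF _ _ _ _ n]) (use S1 S2 in \<open>auto simp: tmap_tens l sdr_def lsub_def\<close>)
 then show "tmap f1 f2 n = 0" by simp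
 show "?s n:?N"
 proof (rule tN_into[OF _ _ _ _ n])
 fix u and v :: "('y, 'k) pm" assume "u:N1" "v:cs P2"
 then show "?s (tens u v):?N"
 using S1 sgn_N s2P G2P unfolding s_tens by (intro lsub_add[OF lsub_tN] tN1) (auto simp: sdr_def)
 next
 fix u :: "('x, 'k) pm" and v assume "u:cs P1" "v:N2"
 moreover from this have "f2 v = 0" "s2 v:N2" using S2 by (auto simp: sdr_def)
 ultimately show "?s (tens u v):?N"
 using sgn_cs unfolding s_tens by (intro lsub_add[OF lsub_tN] tN2) (auto simp: l lin_0 lsub_0 cpx_N[OF C2] s1P)
 qed (simp_all add: lin_plus)
 next
 fix c :: "'x \<times> 'y \<Rightarrow>\<^sub>0 'k" assume c: "c:cs (P1 \<times> P2)"
 have "c:{c. tmap f1 f2 (?d c) = 0}"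
 proof (rule cs_induct[OF c lsub_ker[OF lin_comp[OF lin_tmap lin_td]]])
 fix x assume "x:P1 \<times> P2"
 then obtain a b where x: "x = (a, b)" "a:P1" "b:P2" by auto
 have "tmap f1 f2 (?d (tens (single a 1) (single b 1))) = 0"
 using x S1 S2 unfolding td_tens by (simp add: lin_add tmap_tens l sdr_def single_cs)
 then show "single x 1:{c. tmap f1 f2 (?d c) = 0}" by (simp add: x)
 qed
 then show "tmap f1 f2 (?d c) = 0" by simp
 let ?h = "%c. c - tmap G1 G2 (tmap f1 f2 c) - ?d (?s c) - ?s (?d c)"
 have "c:{c. ?h c:?N}"
 proof (rule cs_induct[OF c])
 show "lsub {c. ?h c:?N}"
 by (intro lsub_vimage[OF _ lsub_tN] lin_sub lin_id lin_comp[of "tmap G1 G2" "tmap f1 f2"]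
 lin_comp[of ?d ?s] lin_comp[of ?s ?d] lin_td lin_tmap lin_plus)
 fix x assume "x:P1 \<times> P2"
 then obtain a' b' where x: "x = (a', b')" "a':P1" "b':P2" by auto
 define a b where "a = single a' (1::'k)" and "b = single b' (1::'k)"
 have ab: "a:cs P1" "b:cs P2" using x by (simp_all add: a_def b_def single_cs)
 have ds: "?d (?s (tens a b)) = tens (d1 (s1 a)) (G2 (f2 b)) + tens (?\<epsilon> (s1 a)) (d2 (G2 (f2 b)))
 - tens (?\<epsilon> (d1 a)) (s2 b) + tens a (d2 (s2 b))"
 using ab by (simp add: s_tens lin_add[OF lin_td] td_tens sgn_sgn sgn_d tens_minus1)
 have sd: "?s (?d (tens a b)) = tens (s1 (d1 a)) (G2 (f2 b)) + tens (?\<epsilon> (d1 a)) (s2 b) + tens a (s2 (d2 b))"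
 proof -
 have "f2 (d2 b) = 0" using S2 ab by (simp add: sdr_def)
 moreover have ls: "lin ?s" by (simp add: lin_plus)
 ultimately show ?thesis 
 unfolding td_tens lin_add[OF ls] s_tens by (simp add: sgn_sgn l lin_0)
 qed
 \<comment> \<open>The summands are the homotopy relation of the second factor, that of the first,
   and a term containing \<open>d2 (G2 _)\<close>, which is a relation because representatives are
   cycles.\<close>
 have "?h (tens a b) = tens a (b - G2 (f2 b) - d2 (s2 b) - s2 (d2 b))
 + tens (a - G1 (f1 a) - d1 (s1 a) - s1 (d1 a)) (G2 (f2 b)) - tens (?\<epsilon> (s1 a)) (d2 (G2 (f2 b)))"
 unfolding ds sd by (simp add: tmap_tens l tens_diff1 tens_diff2)
 also have "...:?N"
 proof (rule lsub_diff[OF lsub_tN lsub_add[OF lsub_tN]])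
 show "tens a (b - G2 (f2 b) - d2 (s2 b) - s2 (d2 b)):?N" 
 using S2 ab by (intro tN2) (simp_all add: sdr_def)
 show "tens (a - G1 (f1 a) - d1 (s1 a) - s1 (d1 a)) (G2 (f2 b)):?N"
 using S1 ab s2P G2P by (intro tN1) (simp_all add: sdr_def)
 show "tens (?\<epsilon> (s1 a)) (d2 (G2 (f2 b))):?N"
 using ab s1P s2P G2P sgn_cs by (intro tN2) simp_all
 qed
 finally show "single x 1:{c. ?h c:?N}" by (simp add: x a_def b_def)
 qed
 then show "?h c:?N" by simp
 next
 fix w assume "w:B1 \<times> B2"
 then obtain a b where x: "w = (a, b)" "a:B1" "b:B2" by auto
 have G: "tmap G1 G2 (single w 1) = tens (G1 (single a 1)) (G2 (single b 1))"
 by (simp add: tmap_def x)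
 have Ga: "G1 (single a 1):cs {x:P1. gr1 x = gB1 a}" "d1 (G1 (single a 1)):N1" "f1 (G1 (single a 1)) = single a 1"
 and Gb: "G2 (single b 1):cs {x:P2. gr2 x = gB2 b}" "d2 (G2 (single b 1)):N2" "f2 (G2 (single b 1)) = single b 1"
 using S1 S2 x by (auto simp: sdr_def)
 show "tmap G1 G2 (single w 1):cs {x:P1 \<times> P2. (case x of (x, y)=>gr1 x + gr2 y) = (case w of (a, b)=>gB1 a + gB2 b)}"
 unfolding G using gr_tens[OF Ga(1) Gb(1)] by (simp add: x)
 have "G1 (single a 1):cs P1" "G2 (single b 1):cs P2" using Ga Gb by (auto intro: cs_mono[rotated])
 then show "?d (tmap G1 G2 (single w 1)):?N"
 unfolding G td_tens using Ga Gb sgn_cs by (intro lsub_add[OF lsub_tN] tN1 tN2) auto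
 show "tmap f1 f2 (tmap G1 G2 (single w 1)) = single w 1"
 unfolding G by (simp add: tmap_tens l Ga Gb x)
 qed
qed

lemma td_Ch:
 assumes "x:P1 \<times> P2"
 shows "td par gr1 d1 d2 (single x 1):cs {y:P1 \<times> P2. (case y of (x, y)=>gr1 x + gr2 y) = (case x of (x, y)=>gr1 x + gr2 y) + dl}"
proof -
 obtain a b where x: "x = (a, b)" "a:P1" "b:P2" using assms by auto
 have da: "d1 (single a 1):cs {y:P1. gr1 y = gr1 a + dl}" "d2 (single b 1):cs {y:P2. gr2 y = gr2 b + dl}"
 using C1 C2 x by (auto simp: cpx_def)
 have sg: "single b 1:cs {y:P2. gr2 y = gr2 b}" "single a (par (gr1 a)):cs {y:P1. gr1 y = gr1 a}"
 using x by (simp_all add: single_cs)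
 have "tens (d1 (single a 1)) (single b 1):cs {y:P1 \<times> P2. (case y of (x, y)=>gr1 x + gr2 y) = gr1 a + gr2 b + dl}"
 by (rule cs_mono[OF _ tens_cs[OF da(1) sg(1)]]) (auto simp: algebra_simps)
 moreover have "tens (sgn_op par gr1 (single a 1)) (d2 (single b 1)):cs {y:P1 \<times> P2. (case y of (x, y)=>gr1 x + gr2 y) = gr1 a + gr2 b + dl}"
 by (rule cs_mono[OF _ tens_cs[of _ "{y:P1. gr1 y = gr1 a}"]]) (use da sg in \<open>auto simp: algebra_simps sgn_op_def\<close>)
 moreover have "td par gr1 d1 d2 (single x 1) = tens (d1 (single a 1)) (single b 1) + tens (sgn_op par gr1 (single a 1)) (d2 (single b 1))"
 using td_tens[of "single a 1" "single b 1"] by (simp add: x)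
 ultimately show ?thesis by (simp add: x lsub_add)
qed

end

section \<open>Cubical complexes\<close>

definition sgnS :: "nat set=>nat=>'k::field" where
 "sgnS S j = (- 1) ^ card {k:S. k < j}"

lemma sgnS_sq [simp]: "sgnS S j * sgnS S j = 1"
 by (simp add: sgnS_def flip: power_mult_distrib)

lemma sgnS_insert:
 assumes "finite S" "k ~: S"
 shows "sgnS (insert k S) j = (if k < j then - sgnS S j else sgnS S j)"
proof (cases "k < j")
 case True
 then have "{i:insert k S. i < j} = insert k {i:S. i < j}" by auto
 then show ?thesis using assms True by (simp add: sgnS_def)
next
 case False
 then have "{i:insert k S. i < j} = {i:S. i < j}" by auto
 then show ?thesis using False by (simp add: sgnS_def)
qed

lemma sgnS_swap:
 assumes "finite R" "i ~: R" "j ~: R" "i ~= j"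
 shows "sgnS (insert j R) i * sgnS (insert i R) j = - (sgnS R j * sgnS R i)"
 using assms by (auto simp: sgnS_insert)

text \<open>The ordered coboundary on all subsets of \<open>X\<close>, the empty one included. The
  second entry of a key is carried along unchanged, since edge maps will be induced by
  inclusions.\<close>

definition dX :: "nat set=>(nat set \<times> 'e \<Rightarrow>\<^sub>0 'k::field)=>(nat set \<times> 'e \<Rightarrow>\<^sub>0 'k)" where
 "dX X = lext (%(S, e). \<Sum>j\<in>X - S. single (insert j S, e) (sgnS S j))"

lemma lin_dX [simp]: "lin (dX X)"
 by (simp add: dX_def)

lemma slice_single: "slice T (single (S, e) a) = (if S = T then single e a else 0)"
 by (rule pmI) (simp add: lookup_slice lookup_single when_def)

lemma slice_eqI: "(!!S. slice S c = slice S c')==>c = c'"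
proof (rule pmI)
 fix x :: "'a \<times> 'b" assume a: "!!S. slice S c = slice S c'"
 obtain S e where "x = (S, e)" by (cases x)
 then show "lookup c x = lookup c' x" using a[of S] by (metis lookup_slice)
qed

lemma lin_sum_fun: "(!!i. i:A==>lin (f i))==>lin (%x. \<Sum>i\<in>A. f i x)"
 by (induction A rule: infinite_finite_induct) (simp_all add: lin_const0 lin_plus)

lemma slice_dX:
 assumes "finite X"
 shows "slice T (dX X c) = (\<Sum>j\<in>T Int X. sc (sgnS (T - {j}) j) (slice (T - {j}) c))"
proof (rule lin_eqI[where f = "%c. slice T (dX X c)" and g = "%c. \<Sum>j\<in>T Int X. sc (sgnS (T - {j}) j) (slice (T - {j}) c)"])
 show "lin (%c. slice T (dX X c))" by (rule lin_comp[OF lin_slice lin_dX])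
 show "lin (%c. \<Sum>j\<in>T Int X. sc (sgnS (T - {j}) j) (slice (T - {j}) c))"
 by (intro lin_sum_fun lin_smult lin_slice)
 fix x :: "nat set \<times> 'a"
 obtain S e where x: "x = (S, e)" by (cases x)
 have "slice T (dX X (single x 1)) = (\<Sum>j\<in>X - S. if insert j S = T then single e (sgnS S j) else 0)"
 by (simp add: x dX_def lin_sum slice_single)
 also have "... = (\<Sum>j\<in>{j:X - S. insert j S = T}. single e (sgnS S j))"
 using assms by (intro sum.mono_neutral_cong_right) auto
 also have "... = (\<Sum>j\<in>{j:T Int X. S = T - {j}}. single e (sgnS (T - {j}) j))"
 by (intro sum.cong) auto
 also have "... = (\<Sum>j\<in>T Int X. if S = T - {j} then single e (sgnS (T - {j}) j) else 0)"
 using assms by (intro sum.mono_neutral_cong_left) auto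
 also have "... = (\<Sum>j\<in>T Int X. sc (sgnS (T - {j}) j) (slice (T - {j}) (single x 1)))"
 by (intro sum.cong) (auto simp: x slice_single)
 finally show "slice T (dX X (single x 1)) = ..." .
qed

lemma sum_pairs_zero:
 fixes a :: "nat=>nat=>'v::ab_group_add"
 assumes "finite T" "!!j k. j:T==>k:T==>j ~= k==>a j k + a k j = 0"
 shows "(\<Sum>j\<in>T. \<Sum>k\<in>T - {j}. a j k) = 0"
 using assms
proof (induction T)
 case (insert x T)
 have "(\<Sum>j\<in>T. \<Sum>k\<in>insert x T - {j}. a j k) = (\<Sum>j\<in>T. a j x + (\<Sum>k\<in>T - {j}. a j k))"
 proof (rule sum.cong)
 fix j assume "j:T"
 then have "insert x T - {j} = insert x (T - {j})" using insert.hyps by auto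
 then show "(\<Sum>k\<in>insert x T - {j}. a j k) = a j x + (\<Sum>k\<in>T - {j}. a j k)"
 using insert.hyps by simp
 qed simp
 moreover have "insert x T - {x} = T" using insert.hyps by auto
 ultimately have "(\<Sum>j\<in>insert x T. \<Sum>k\<in>insert x T - {j}. a j k) = (\<Sum>k\<in>T. a x k) + ((\<Sum>j\<in>T. a j x) + (\<Sum>j\<in>T. \<Sum>k\<in>T - {j}. a j k))"
 using insert.hyps by (simp add: sum.distrib)
 also have "... = (\<Sum>k\<in>T. a x k + a k x)" using insert by (simp add: sum.distrib)
 also have "... = 0" using insert by (intro sum.neutral) auto
 finally show ?case .
qed simp

text \<open>Adding \<open>j\<close> and then \<open>k\<close> has the sign opposite to adding
  \<open>k\<close> and then \<open>j\<close>.\<close>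

lemma dX_dX:
 assumes "finite X" "c:cs {(S, e). S <= X}"
 shows "dX X (dX X c) = 0"
proof (rule slice_eqI)
 fix T
 show "slice T (dX X (dX X c)) = slice T 0"
 proof (cases "T <= X")
 case False
 have "slice (T - {j} - {k}) c = 0" if "j:X" "k:X" for j k
 proof -
 have "~ T - {j} - {k} <= X" using False that by blast
 then show ?thesis using assms(2) by (intro pmI) (auto simp: lookup_slice cs_iff_lookup)
 qed
 then show ?thesis using assms(1) by (simp add: slice_dX lin_0)
 next
 case True
 then have fin: "finite T" and TX: "T Int X = T" "!!j. (T - {j}) Int X = T - {j}"
 using assms(1) finite_subset by auto
 have "slice T (dX X (dX X c)) = (\<Sum>j\<in>T. \<Sum>k\<in>T - {j}. sc (sgnS (T - {j}) j * sgnS (T - {j} - {k}) k) (slice (T - {j} - {k}) c))"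
 using assms(1) by (simp add: slice_dX TX sc_sum)
 also have "... = 0"
 proof (rule sum_pairs_zero[OF fin])
 fix j k assume jk: "j:T" "k:T" "j ~= k"
 define R where "R = T - {j} - {k}"
 have R: "T - {j} = insert k R" "T - {k} = insert j R" "T - {k} - {j} = R" "finite R" "j ~: R" "k ~: R"
 using jk fin by (auto simp: R_def)
 have "insert k R - {k} = R" "insert j R - {j} = R" using R by auto
 moreover have "sgnS (insert k R) j * sgnS R k + sgnS (insert j R) k * sgnS R j = (0::'b)"
 using R jk by (auto simp: sgnS_insert)
 ultimately show "sc (sgnS (T - {j}) j * sgnS (T - {j} - {k}) k) (slice (T - {j} - {k}) c) +
 sc (sgnS (T - {k}) k * sgnS (T - {k} - {j}) j) (slice (T - {k} - {j}) c) = 0"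
 unfolding R by (simp flip: sc_add_left)
 qed
 finally show ?thesis by (simp add: lin_0)
 qed
qed

definition hT :: "nat=>(nat set \<times> 'e \<Rightarrow>\<^sub>0 'k::field)=>(nat set \<times> 'e \<Rightarrow>\<^sub>0 'k)" where
 "hT i = lext (%(S, e). if i:S then single (S - {i}, e) (sgnS (S - {i}) i) else 0)"

lemma lin_hT [simp]: "lin (hT i)"
 by (simp add: hT_def)

lemma slice_hT: "slice T (hT i c) = (if i:T then 0 else sc (sgnS T i) (slice (insert i T) c))"
proof (rule lin_eqI[where f = "%c. slice T (hT i c)" and g = "%c. if i:T then 0 else sc (sgnS T i) (slice (insert i T) c)"])
 show "lin (%c. slice T (hT i c))" by (rule lin_comp[OF lin_slice lin_hT])
 show "lin (%c. if i:T then 0 else sc (sgnS T i) (slice (insert i T) c))"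
 by (cases "i:T") (auto intro: lin_const0 lin_smult)
 fix x :: "nat set \<times> 'a"
 obtain S e where x: "x = (S, e)" by (cases x)
 show "slice T (hT i (single x 1)) = (if i:T then 0 else sc (sgnS T i) (slice (insert i T) (single x 1)))"
 by (auto simp: x hT_def slice_single lin_0)
qed

text \<open>For \<open>j\<close> different from \<open>i\<close>, adding \<open>j\<close> before or
  after the removal of \<open>i\<close> gives cancelling terms; \<open>j = i\<close> leaves the
  identity. So the whole cube is contractible in each of its directions.\<close>

lemma hT_dX:
 assumes "finite X" "i:X" "c:cs {(S, e). S <= X}"
 shows "dX X (hT i c) + hT i (dX X c) = c"
proof (rule slice_eqI)
 fix T
 have z: "slice S c = 0" if "~ S <= X" for S
 using assms(3) that by (intro pmI) (auto simp: lookup_slice cs_iff_lookup)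
 show "slice T (dX X (hT i c) + hT i (dX X c)) = slice T c"
 proof (cases "T <= X")
 case False
 then have "~ insert i (T - {j}) <= X" "~ insert i T - {j} <= X" if "j:X" for j using that assms(2) by auto
 then have "slice T (dX X (hT i c)) = 0" "slice T (hT i (dX X c)) = 0"
 using assms(1) by (auto simp: slice_dX slice_hT z intro!: sum.neutral)
 then show ?thesis using z[OF False] by (simp add: lin_add)
 next
 case True
 then have fin: "finite T" and TX: "T Int X = T" "insert i T Int X = insert i T"
 using assms(1,2) finite_subset by auto
 show ?thesis
 proof (cases "i:T")
 case i: True
 have "slice T (dX X (hT i c)) = (\<Sum>j\<in>T. if j = i then slice T c else 0)"
 unfolding slice_dX[OF assms(1)] TX
 proof (rule sum.cong)
 fix j assume j: "j:T"
 show "sc (sgnS (T - {j}) j) (slice (T - {j}) (hT i c)) = (if j = i then slice T c else 0)"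
 using i by (auto simp: slice_hT insert_absorb)
 qed simp
 then show ?thesis using i fin by (simp add: lin_add slice_hT)
 next
 case i: False
 have "slice T (dX X (hT i c)) = (\<Sum>j\<in>T. sc (sgnS (T - {j}) j * sgnS (T - {j}) i) (slice (insert i (T - {j})) c))"
 unfolding slice_dX[OF assms(1)] TX using i by (simp add: slice_hT)
 moreover have "slice T (hT i (dX X c)) = slice T c + (\<Sum>j\<in>T. sc (sgnS T i * sgnS (insert i T - {j}) j) (slice (insert i T - {j}) c))"
 using i fin by (simp add: slice_hT slice_dX[OF assms(1)] TX sc_sum sc_add)
 moreover have "(\<Sum>j\<in>T. sc (sgnS (T - {j}) j * sgnS (T - {j}) i) (slice (insert i (T - {j})) c))
 + (\<Sum>j\<in>T. sc (sgnS T i * sgnS (insert i T - {j}) j) (slice (insert i T - {j}) c)) = 0"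
 unfolding sum.distrib[symmetric]
 proof (rule sum.neutral, rule ballI)
 fix j assume j: "j:T"
 define R where "R = T - {j}"
 have R: "T = insert j R" "insert i T - {j} = insert i R" "finite R" "j ~: R" "i ~: R" "i ~= j"
 using j i fin by (auto simp: R_def)
 have "sgnS (insert j R) i * sgnS (insert i R) j = - (sgnS R j * sgnS R i :: 'b)"
 by (rule sgnS_swap) (use R in auto)
 then have "sgnS R j * sgnS R i + sgnS (insert j R) i * sgnS (insert i R) j = (0::'b)"
 by simp
 then show "sc (sgnS (T - {j}) j * sgnS (T - {j}) i) (slice (insert i (T - {j})) c)
 + sc (sgnS T i * sgnS (insert i T - {j}) j) (slice (insert i T - {j}) c) = 0"
 unfolding R(2) R_def[symmetric] using R(1) by (simp flip: sc_add_left)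
 qed
 ultimately show ?thesis by (simp add: lin_add algebra_simps)
 qed
 qed
qed

lemma coh_cong:
 assumes "!!c. c:cs P==>d c = d' c"
 shows "coh P N gr dl d g B = coh P N gr dl d' g B"
proof -
 have "ZZ P N gr d g = ZZ P N gr d' g" unfolding ZZ_def using assms Ch_cs by fastforce
 moreover have "BB P N gr dl d g = BB P N gr dl d' g" unfolding BB_def using assms Ch_cs by fastforce
 ultimately show ?thesis by (simp add: coh_def)
qed

lemma acyc_cong:
 assumes "!!c. c:cs P==>d c = d' c"
 shows "acyc P N gr dl d = acyc P N gr dl d'"
proof -
 have "ZZ P N gr d g = ZZ P N gr d' g" for g unfolding ZZ_def using assms Ch_cs by fastforce
 moreover have "BB P N gr dl d g = BB P N gr dl d' g" for g unfolding BB_def using assms Ch_cs by fastforce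
 ultimately show ?thesis by (simp add: acyc_def)
qed

text \<open>As a cohomology with empty basis, acyclicity is transported by every statement that
  compares cohomology.\<close>

lemma acyc_iff_coh:
 assumes "cpx P N gr dl d"
 shows "acyc P N gr dl d <-> (ALL g. coh P N gr dl d g ({} :: unit set))"
proof -
 have cs0: "cs {} = {0}" by (auto simp: cs_def)
 have "ZZ P N gr d g <= BB P N gr dl d g <-> coh P N gr dl d g ({} :: unit set)" for g
 proof
 assume a: "ZZ P N gr d g <= BB P N gr dl d g"
 have "0:ZZ P N gr d g" using lsub_ZZ[OF assms] by (rule lsub_0)
 then show "coh P N gr dl d g ({} :: unit set)" unfolding coh_def qb_def cs0
 using a by (intro exI[of _ "%_. 0"]) (auto simp: lin_const0)
 next
 assume "coh P N gr dl d g ({} :: unit set)"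
 then show "ZZ P N gr d g <= BB P N gr dl d g" unfolding coh_def qb_def cs0 by blast
 qed
 then show ?thesis by (simp add: acyc_def)
qed

text \<open>\<open>E S\<close> and \<open>NS S\<close> present the vector space at the vertex \<open>S\<close> of the cube; the maps along
 the edges are induced by the inclusions.\<close>

locale cube =
 fixes X :: "nat set" and E :: "nat set=>'e set" and NS :: "nat set=>('e, 'k::field) pm set"
 and gr :: "nat set \<times> 'e=>'g::ab_group_add" and dl :: 'g
 assumes finX: "finite X"
 and E_mono: "!!S T. S <= T==>T <= X==>E S <= E T"
 and NS_mono: "!!S T. S <= T==>T <= X==>NS S <= NS T"
 and lsub_NS: "!!S. S <= X==>lsub (NS S)"
 and gr_ins: "!!S e j. S <= X==>j:X - S==>gr (insert j S, e) = gr (S, e) + dl"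
 and NS_hom: "!!S g n. S <= X==>n:NS S==>n:cs (E S)==>rst {e. gr (S, e) = g} n:NS S"
begin

definition PP :: "(nat set \<times> 'e) set" where "PP = {(S, e). S <= X&e:E S}"

text \<open>For a suitable family \<open>F\<close> of faces these keys span a subquotient of the
  cube complex, with differential \<open>dQ F\<close>.\<close>

definition QQ :: "nat set set=>(nat set \<times> 'e) set" where "QQ F = {(S, e). S <= X&e:E S&S:F}"

definition NN :: "(nat set \<times> 'e \<Rightarrow>\<^sub>0 'k) set" where "NN = {c:cs PP. \<forall>S\<subseteq>X. slice S c:NS S}"

definition dQ :: "nat set set=>(nat set \<times> 'e \<Rightarrow>\<^sub>0 'k)=>(nat set \<times> 'e \<Rightarrow>\<^sub>0 'k)" where
 "dQ F c = rst (QQ F) (dX X c)"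

definition cohF :: "nat set set=>'g=>'b set=>bool" where
 "cohF F g B <-> coh (QQ F) (NN Int cs (QQ F)) gr dl (dQ F) g B"

definition acF :: "nat set set=>bool" where
 "acF F <-> acyc (QQ F) (NN Int cs (QQ F)) gr dl (dQ F)"

text \<open>The differential enlarges faces, so a subfamily that is closed upwards in
  \<open>F\<close> spans a subcomplex.\<close>

definition up_in :: "nat set set=>nat set set=>bool" where
 "up_in F D <-> D <= F&(ALL S:D. ALL T:F. S <= T --> T:D)"

lemma QQ_PP: "QQ F <= PP" and QQ_UNIV: "QQ UNIV = PP"
 by (auto simp: QQ_def PP_def)

lemma lsub_NN: "lsub NN"
 by (rule lsubI) (simp_all add: NN_def lsub_0 lsub_add lsub_sc lsub_NS lin_simps)

lemma slice_rst_QQ: "c:cs PP==>slice S (rst (QQ F) c) = (if S:F then slice S c else 0)"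
 by (rule pmI) (auto simp: lookup_slice lookup_rst cs_iff_lookup QQ_def PP_def)

lemma rst_QQ_NN: "n:NN==>rst (QQ F) n:NN"
 using rst_cs_Int[of n PP "QQ F"] 
 by (auto simp: NN_def slice_rst_QQ lsub_0 lsub_NS intro: cs_mono[rotated])

lemma slice_cs_PP: "c:cs PP==>S <= X==>slice S c:cs (E S)"
 by (auto simp: cs_iff_lookup lookup_slice PP_def)

lemma PP_sub: "c:cs PP==>c:cs {(S, e). S <= X}"
 by (erule cs_mono[rotated]) (auto simp: PP_def)

lemma dX_single_mem:
 assumes "(S, e):PP"
 shows "dX X (single (S, e) 1):cs {y:PP. gr y = gr (S, e) + dl&S <= fst y}"
proof -
 have "single (insert j S, e) (sgnS S j):cs {y:PP. gr y = gr (S, e) + dl&S <= fst y}" if "j:X - S" for j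
 using assms that E_mono[of S "insert j S"] gr_ins[of S j e]
 by (intro single_cs) (auto simp: PP_def)
 then have "(\<Sum>j\<in>X - S. single (insert j S, e) (sgnS S j)):cs {y:PP. gr y = gr (S, e) + dl&S <= fst y}"
 by (intro lsub_sum[OF lsub_cs])
 then show ?thesis by (simp add: dX_def)
qed

lemma dX_NN: "n:NN==>dX X n:NN"
proof -
 assume n: "n:NN"
 have "dX X n:cs PP"
 proof (rule lin_cs_mem[of n PP])
 show "n:cs PP" using n by (simp add: NN_def)
 show "!!x. x:PP==>dX X (single x 1):cs PP"
 using dX_single_mem by (fastforce intro: cs_mono[rotated])
 qed simp_all
 moreover have "slice T (dX X n):NS T" if "T <= X" for T
 unfolding slice_dX[OF finX]
 proof (intro lsub_sum lsub_sc lsub_NS[OF that])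
 fix j assume "j:T Int X"
 have "T - {j} <= X" using that by auto
 then show "slice (T - {j}) n:NS T" using n that NS_mono[of "T - {j}" T] unfolding NN_def by blast
 qed
 ultimately show ?thesis by (simp add: NN_def)
qed

lemma cpx_PP: "cpx PP NN gr dl (dX X)"
 unfolding cpx_def
proof (intro conjI ballI allI)
 show "lin (dX X)" "lsub NN" by (simp_all add: lsub_NN)
 show "NN <= cs PP" by (auto simp: NN_def)
 fix x assume x: "x:PP"
 then show "dX X (single x 1):cs {y:PP. gr y = gr x + dl}"
 using dX_single_mem[of "fst x" "snd x"] by (auto intro: cs_mono[rotated])
 show "dX X (dX X (single x 1)) = 0"
 by (rule dX_dX[OF finX PP_sub]) (use x in \<open>simp add: single_cs\<close>)
next
 fix n assume n: "n:NN"
 then show "dX X n:NN" by (rule dX_NN)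
 fix g
 have "slice S (rst {x. gr x = g} n) = rst {e. gr (S, e) = g} (slice S n)" for S
 by (rule pmI) (simp add: lookup_slice lookup_rst)
 moreover have "rst {x. gr x = g} n:cs PP" using n by (auto simp: NN_def cs_iff_lookup lookup_rst)
 moreover have "rst {e. gr (S, e) = g} (slice S n):NS S" if "S <= X" for S
 using n that by (intro NS_hom slice_cs_PP) (auto simp: NN_def)
 ultimately show "rst {x. gr x = g} n:NN"
 by (simp add: NN_def)
qed

lemma cpx_up:
 assumes "up_in UNIV D"
 shows "cpx (QQ D) (NN Int cs (QQ D)) gr dl (dX X)"
proof (rule split_cpx_U[OF cpx_PP, where V = "QQ (- D)"])
 show "PP = QQ D Un QQ (- D)" "QQ D Int QQ (- D) = {}" by (auto simp: QQ_def PP_def)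
 show "rst (QQ D) n:NN" if "n:NN" for n using that by (rule rst_QQ_NN)
 show "dX X (single x 1):cs (QQ D)" if xQ: "x:QQ D" for x
 proof -
 obtain S e where x: "x = (S, e)" "(S, e):PP" "S:D" using xQ by (cases x) (auto simp: QQ_def PP_def)
 show ?thesis unfolding x(1)
 proof (rule cs_mono[OF _ dX_single_mem[OF x(2)]], rule subsetI)
 fix y assume y: "y:{y:PP. gr y = gr (S, e) + dl&S <= fst y}"
 obtain T f where T: "y = (T, f)" by (cases y)
 have "S <= T" using y T by simp
 then have "T:D" using assms x(3) unfolding up_in_def by (meson UNIV_I)
 then show "y:QQ (D)" using y unfolding T by (simp add: QQ_def PP_def)
 qed
 qed
qed

text \<open>Convexity makes \<open>F\<close> the difference of two upward closed families, so that
  it carries a quotient of a subcomplex.\<close>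

definition conv :: "nat set set=>bool" where
 "conv F <-> (ALL S:F. ALL T:F. ALL R. S <= R --> R <= T --> R:F)"

lemma cpx_conv:
 assumes "conv F"
 shows "cpx (QQ F) (NN Int cs (QQ F)) gr dl (dQ F)"
proof -
 define D where "D = {T. EX S:F. S <= T}"
 have D: "up_in UNIV D" unfolding D_def up_in_def by blast
 have W: "up_in UNIV (D - F)" unfolding D_def up_in_def using assms unfolding conv_def by blast
 have "cpx (QQ F) (NN Int cs (QQ D) Int cs (QQ F)) gr dl (%c. rst (QQ F) (dX X c))"
 proof (rule split_cpx_V[OF cpx_up[OF D], where U = "QQ (D - F)"])
 show "QQ D = QQ (D - F) Un QQ F" "QQ (D - F) Int QQ F = {}" by (auto simp: QQ_def D_def)
 show "rst (QQ (D - F)) n:NN Int cs (QQ D)" if "n:NN Int cs (QQ D)" for n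
 proof -
 have "QQ (D - F) <= QQ D" by (auto simp: QQ_def)
 then show ?thesis using that rst_QQ_NN[of n "D - F"] cs_mono[OF _ rst_cs] by blast
 qed
 show "dX X (single x 1):cs (QQ (D - F))" if xQ: "x:QQ (D - F)" for x
 proof -
 obtain S e where x: "x = (S, e)" "(S, e):PP" "S:D - F" using xQ by (cases x) (auto simp: QQ_def PP_def)
 show ?thesis unfolding x(1)
 proof (rule cs_mono[OF _ dX_single_mem[OF x(2)]], rule subsetI)
 fix y assume y: "y:{y:PP. gr y = gr (S, e) + dl&S <= fst y}"
 obtain T f where T: "y = (T, f)" by (cases y)
 have "S <= T" using y T by simp
 then have "T:D - F" using W x(3) unfolding up_in_def by (meson UNIV_I)
 then show "y:QQ (D - F)" using y unfolding T by (simp add: QQ_def PP_def)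
 qed
 qed
 qed
 moreover have "NN Int cs (QQ D) Int cs (QQ F) = NN Int cs (QQ F)"
 unfolding Int_assoc cs_Int by (rule arg_cong[where f = "%A. NN Int cs A"]) (auto simp: QQ_def D_def)
 ultimately show ?thesis by (simp add: dQ_def[abs_def])
qed

section \<open>Exact sequences for an upward closed subfamily\<close>

context
 fixes F D
 assumes F: "conv F" and D: "up_in F D"
begin

lemma conv_D: "conv D" and conv_FD: "conv (F - D)"
 using F D unfolding conv_def up_in_def by blast+

lemma splitF:
 "QQ F = QQ D Un QQ (F - D)" "QQ D Int QQ (F - D) = {}"
 "x:QQ D==>dQ F (single x 1):cs (QQ D)"
 "n:NN Int cs (QQ F)==>rst (QQ D) n:NN Int cs (QQ F)"
proof -
 show Q: "QQ F = QQ D Un QQ (F - D)" "QQ D Int QQ (F - D) = {}" using D by (auto simp: QQ_def up_in_def)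
 show "rst (QQ D) n:NN Int cs (QQ F)" if "n:NN Int cs (QQ F)"
 using that rst_QQ_NN[of n D] rst_cs[of "QQ D" n] Q by (auto intro: cs_mono[rotated])
 show "dQ F (single x 1):cs (QQ D)" if "x:QQ D"
 proof -
 obtain S e where x: "x = (S, e)" by (cases x)
 have "dQ F (single x 1):cs ({y:PP. gr y = gr (S, e) + dl&S <= fst y} Int QQ F)"
 unfolding dQ_def x by (rule rst_cs_Int[OF dX_single_mem]) (use that x in \<open>auto simp: QQ_def PP_def\<close>)
 then show ?thesis by (rule cs_mono[rotated]) (use D that x in \<open>auto simp: QQ_def up_in_def\<close>)
 qed
qed

lemma split_N: "NN Int cs (QQ F) Int cs (QQ D) = NN Int cs (QQ D)"
 "NN Int cs (QQ F) Int cs (QQ (F - D)) = NN Int cs (QQ (F - D))"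
 unfolding Int_assoc cs_Int using splitF(1) by (auto simp: Int_absorb1)

lemma split_dV: "(%c. rst (QQ (F - D)) (dQ F c)) = dQ (F - D)"
proof
 fix c
 have "QQ (F - D) Int QQ F = QQ (F - D)" using splitF(1) by auto
 then show "rst (QQ (F - D)) (dQ F c) = dQ (F - D) c" by (simp add: dQ_def rst_rst)
qed

lemma split_dUF: "c:cs (QQ D)==>dQ F c = dQ D c"
proof -
 assume c: "c:cs (QQ D)"
 have "dQ F c:cs (QQ D)" by (rule split_dU[OF cpx_conv[OF F] splitF c])
 then have "rst (QQ D) (dQ F c) = dQ F c" by (simp add: rst_id)
 moreover have "QQ D Int QQ F = QQ D" using splitF(1) by auto
 ultimately show ?thesis by (simp add: dQ_def rst_rst)
qed

lemma acF_iff: "acF D <-> acyc (QQ D) (NN Int cs (QQ F) Int cs (QQ D)) gr dl (dQ F)"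
 unfolding acF_def split_N by (rule acyc_cong) (simp add: split_dUF)

lemma cohF_quotient: "acF D==>cohF F g B <-> cohF (F - D) g B"
 using coh_quotient[OF cpx_conv[OF F] splitF, of g B] unfolding acF_iff cohF_def split_N split_dV by simp

lemma cohF_connecting: "acF F==>cohF (F - D) g B <-> cohF D (g + dl) B"
 using coh_connecting[OF cpx_conv[OF F] splitF, of g B] coh_cong[OF split_dUF]
 unfolding acF_def cohF_def split_N split_dV by simp

lemma acF_quotient: "acF D==>acF F <-> acF (F - D)"
 using cohF_quotient[where B = "{} :: unit set"] acyc_iff_coh[OF cpx_conv[OF F]] acyc_iff_coh[OF cpx_conv[OF conv_FD]]
 unfolding acF_def cohF_def by blast

end

text \<open>The faces come in pairs that differ by \<open>i\<close>, and adding \<open>i\<close>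
  enlarges neither the spaces nor the relations. The edge maps in direction \<open>i\<close> are
  thus bijective, and removing \<open>i\<close> contracts the complex.\<close>

lemma acF_toggle:
 assumes i: "i:X" and F: "conv F" and tog: "!!S. S <= X==>insert i S:F <-> S - {i}:F"
 and E: "!!S. S <= X==>S:F==>E (insert i S) <= E (S - {i})"
 and NS: "!!S. S <= X==>S:F==>NS (insert i S) Int cs (E (insert i S)) <= NS (S - {i})"
 shows "acF F"
 unfolding acF_def acyc_def
proof (intro allI subsetI)
 fix g c assume c: "c:ZZ (QQ F) (NN Int cs (QQ F)) gr (dQ F) g"
 note C = cpx_conv[OF F]
 have tog': "S:F <-> S - {i}:F" "S:F <-> insert i S:F" if "S <= X" for S
 using tog[OF that] that by (cases "i:S"; simp add: insert_absorb)+
 have cC: "c:Ch (QQ F) gr g" "dQ F c:NN" "dQ F c:cs (QQ F)" using c by (auto simp: ZZ_def)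
 have cQ: "c:cs (QQ F)" using cC(1) by (rule Ch_cs)
 then have cP: "c:cs PP" using QQ_PP by (auto intro: cs_mono[rotated])
 have hQ: "hT i x:cs (QQ F)" if "x:cs (QQ F)" for x
 using that
 proof (rule lin_cs_mem[OF _ lin_hT lsub_cs])
 fix y assume y: "y:QQ F"
 then obtain S e where S: "y = (S, e)" "S <= X" "e:E S" "S:F" by (auto simp: QQ_def)
 then show "hT i (single y 1):cs (QQ F)"
 using E[of S] tog'[of S] by (auto simp: hT_def QQ_def insert_absorb lsub_0 intro!: single_cs)
 qed
 have hC: "hT i x:Ch (QQ F) gr (g - dl)" if "x:Ch (QQ F) gr g" for x g
 using that unfolding Ch_def
 proof (rule lin_cs_mem[OF _ lin_hT lsub_cs])
 fix y assume y: "y:{x:QQ F. gr x = g}"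
 then obtain S e where S: "y = (S, e)" "S <= X" "e:E S" "S:F" "gr (S, e) = g" by (auto simp: QQ_def)
 show "hT i (single y 1):cs {x:QQ F. gr x = g - dl}"
 proof (cases "i:S")
 case True
 then have "gr (S, e) = gr (S - {i}, e) + dl" using gr_ins[of "S - {i}" i e] S i by (auto simp: insert_absorb)
 then have "gr (S - {i}, e) = g - dl" using S by (simp add: algebra_simps)
 then show ?thesis using E[of S] tog'[of S] S True
 by (auto simp: hT_def QQ_def insert_absorb intro!: single_cs)
 qed (simp add: S hT_def lsub_0)
 qed
 \<comment> \<open>Removing \<open>i\<close> commutes with the restriction to \<open>F\<close>
   because \<open>F\<close> contains both faces of a pair or neither.\<close>
 have comm: "rst (QQ F) (hT i x) = hT i (rst (QQ F) x)" if "x:cs PP" for x :: "nat set \<times> 'e \<Rightarrow>\<^sub>0 'k"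
 proof -
 have "hT i x:cs {(S, e). S <= X}"
 using PP_sub[OF that] by (rule lin_cs_mem[OF _ lin_hT lsub_cs]) (auto simp: hT_def lsub_0 intro!: single_cs)
 show ?thesis
 proof (rule pmI)
 fix y :: "nat set \<times> 'e" obtain S e where y: "y = (S, e)" by (cases y)
 have L: "lookup (hT i z) (S, e) = (if i:S then 0 else sgnS S i * lookup z (insert i S, e))" for z :: "nat set \<times> 'e \<Rightarrow>\<^sub>0 'k"
 unfolding lookup_slice[symmetric] slice_hT by simp
 show "lookup (rst (QQ F) (hT i x)) y = lookup (hT i (rst (QQ F) x)) y"
 proof (cases "i:S \<or> lookup x (insert i S, e) = 0")
 case True
 then show ?thesis by (auto simp: y lookup_rst L)
 next
 case False
 then have "(insert i S, e):PP" using that unfolding cs_iff_lookup by blast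
 then have "insert i S <= X" "e:E (insert i S)" by (auto simp: PP_def)
 then have S: "S <= X" and iS: "insert i S <= X" "e:E (insert i S)" by auto
 have "e:E S" if "S:F" using E[OF iS(1)] that tog'(2)[OF S] iS False by auto
 then have "(S, e):QQ F <-> S:F" using S by (auto simp: QQ_def)
 moreover have "(insert i S, e):QQ F <-> S:F" using iS tog'(2)[OF S] by (auto simp: QQ_def)
 ultimately show ?thesis using False by (simp add: y lookup_rst L)
 qed
 qed
 qed
 have dP: "dX X c:cs PP" by (rule cpx_d_cs[OF cpx_PP cP])
 have "rst (QQ F) c = rst (QQ F) (dX X (hT i c)) + rst (QQ F) (hT i (dX X c))"
 using hT_dX[OF finX i PP_sub[OF cP]] by (metis lin_add lin_rst)
 then have "c = dQ F (hT i c) + hT i (dQ F c)"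
 using rst_id[OF cQ order_refl] by (simp add: dQ_def comm[OF dP])
 \<comment> \<open>\<open>dQ F c\<close> is a relation; once \<open>hT i\<close> is seen to preserve
   this, \<open>hT i c\<close> is a primitive of \<open>c\<close>.\<close>
 then have *: "c - dQ F (hT i c) = hT i (dQ F c)" by (metis add_diff_cancel_left')
 have "hT i (dQ F c):NN"
 proof -
 define z where "z = dQ F c"
 have z: "z:NN" "z:cs (QQ F)" using cC by (simp_all add: z_def)
 have "slice S (hT i z):NS S" if S: "S <= X" for S
 proof (cases "i:S \<or> S ~: F")
 case True
 have "slice (insert i S) z = 0" if "S ~: F"
 using z(2) tog'[OF S] that by (intro pmI) (auto simp: lookup_slice cs_iff_lookup QQ_def)
 then show ?thesis using True lsub_NS[OF S] by (auto simp: slice_hT lsub_0)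
 next
 case False
 have iS: "insert i S <= X" using i S by simp
 have "slice (insert i S) z:NS (insert i S) Int cs (E (insert i S))"
 using z(1) iS slice_cs_PP[OF _ iS] by (auto simp: NN_def)
 then have "slice (insert i S) z:NS S" using NS[OF S] False by auto
 then show ?thesis using False lsub_NS[OF S] by (simp add: slice_hT lsub_sc)
 qed
 moreover have "hT i z:cs PP" using hQ[OF z(2)] QQ_PP by (auto intro: cs_mono[rotated])
 ultimately show ?thesis by (simp add: NN_def z_def)
 qed
 then show "c:BB (QQ F) (NN Int cs (QQ F)) gr dl (dQ F) g"
 using hQ[OF cC(3)] cC(1) hC[OF cC(1)] * by (intro BBI[OF C, of "hT i c"]) auto
qed

end

section \<open>Localizations and the Cech complex\<close>

text \<open>An abelian monoid with scalars is all that is checked for a localization; negatives are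
  obtained from the scalar -1, as in \<open>ev_eq_iff\<close>.\<close>

locale kmod = abelian_monoid L for L :: "('k::field, 'v, 'm) module_scheme" (structure) +
 assumes sm_closed [simp]: "x:carrier L==>c \<odot> x:carrier L"
 and sm_add: "x:carrier L==>y:carrier L==>c \<odot> (x \<oplus> y) = c \<odot> x \<oplus> c \<odot> y"
 and sm_add_left: "x:carrier L==>(c + c') \<odot> x = c \<odot> x \<oplus> c' \<odot> x"
 and sm_sm: "x:carrier L==>c \<odot> (c' \<odot> x) = (c * c') \<odot> x"
 and sm_1 [simp]: "x:carrier L==>1 \<odot> x = x"
 and sm_0 [simp]: "x:carrier L==>0 \<odot> x = \<zero>"
begin

lemma sm_zero [simp]: "c \<odot> \<zero> = \<zero>"
 using sm_sm[of \<zero> c 0] by simp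

definition ev :: "('e=>'v)=>('e, 'k) pm=>'v" where
 "ev v c = (\<Oplus>e\<in>keys c. lookup c e \<odot> v e)"

lemma ev_superset:
 assumes "finite A" "keys c <= A" "!!e. e:A==>v e:carrier L"
 shows "ev v c = (\<Oplus>e\<in>A. lookup c e \<odot> v e)"
 unfolding ev_def using assms
 by (intro add.finprod_mono_neutral_cong_left) (auto simp: in_keys_iff)

lemma ev_closed: "c:cs P==>(!!e. e:P==>v e:carrier L)==>ev v c:carrier L"
 unfolding ev_def by (rule finsum_closed) (auto simp: cs_def)

lemma ev_add:
 assumes "c:cs P" "c':cs P" "!!e. e:P==>v e:carrier L"
 shows "ev v (c + c') = ev v c \<oplus> ev v c'"
proof -
 let ?A = "keys c Un keys c'"
 have A: "finite ?A" "!!e. e:?A==>v e:carrier L" using assms by (auto simp: cs_def)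
 have "ev v (c + c') = (\<Oplus>e\<in>?A. lookup (c + c') e \<odot> v e)"
 by (rule ev_superset) (use A keys_add[of c c'] in auto)
 also have "... = (\<Oplus>e\<in>?A. lookup c e \<odot> v e \<oplus> lookup c' e \<odot> v e)"
 by (rule add.finprod_cong) (use A in \<open>auto simp: lookup_add sm_add_left simp_implies_def\<close>)
 also have "... = (\<Oplus>e\<in>?A. lookup c e \<odot> v e) \<oplus> (\<Oplus>e\<in>?A. lookup c' e \<odot> v e)"
 by (rule add.finprod_multf) (use A in auto)
 also have "(\<Oplus>e\<in>?A. lookup c e \<odot> v e) = ev v c"
 by (rule ev_superset[symmetric]) (use A in auto)
 also have "(\<Oplus>e\<in>?A. lookup c' e \<odot> v e) = ev v c'"
 by (rule ev_superset[symmetric]) (use A in auto)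
 finally show ?thesis .
qed

lemma sm_finsum: 
 assumes "finite A" "!!e. e:A==>g e:carrier L"
 shows "a \<odot> (\<Oplus>e\<in>A. g e) = (\<Oplus>e\<in>A. a \<odot> g e)"
 using assms
proof (induction A)
 case (insert x F)
 then have "g:F \<rightarrow> carrier L" "(%e. a \<odot> g e):F \<rightarrow> carrier L" "g x:carrier L" by auto
 then show ?case using insert by (simp add: sm_add)
qed simp

lemma ev_sc:
 assumes "c:cs P" "!!e. e:P==>v e:carrier L"
 shows "ev v (sc a c) = a \<odot> ev v c"
proof -
 have A: "!!e. e:keys c==>v e:carrier L" using assms by (auto simp: cs_def)
 have "ev v (sc a c) = (\<Oplus>e\<in>keys c. lookup (sc a c) e \<odot> v e)"
 by (rule ev_superset) (use A keys_sc[of a c] in auto)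
 also have "... = (\<Oplus>e\<in>keys c. a \<odot> (lookup c e \<odot> v e))"
 by (rule add.finprod_cong) (use A in \<open>auto simp: sm_sm simp_implies_def\<close>)
 finally show ?thesis unfolding ev_def using A by (simp add: sm_finsum)
qed

lemma ev_0 [simp]: "ev v 0 = \<zero>"
 by (simp add: ev_def)

lemma ev_single: "v e:carrier L==>ev v (single e a) = a \<odot> v e"
 using ev_superset[of "{e}" "single e a" v] by simp

lemma ev_eq_iff:
 assumes "c:cs P" "c':cs P" "!!e. e:P==>v e:carrier L"
 shows "ev v (c - c') = \<zero> <-> ev v c = ev v c'"
proof
 have m: "ev v (c - c') = ev v c \<oplus> (- 1) \<odot> ev v c'"
 proof -
 have "c - c' = c + sc (- 1) c'" by (simp add: sc_m1)
 moreover have "ev v (c + sc (- 1) c') = ev v c \<oplus> ev v (sc (- 1) c')"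
 by (rule ev_add[OF assms(1) lsub_sc[OF lsub_cs assms(2)]]) (rule assms(3))
 moreover have "ev v (sc (- 1) c') = (- 1) \<odot> ev v c'" by (rule ev_sc[OF assms(2)]) (rule assms(3))
 ultimately show ?thesis by simp
 qed
 have z: "x \<oplus> (- 1) \<odot> x = \<zero>" if "x:carrier L" for x
 using sm_add_left[of x 1 "- 1"] that by simp
 have cl: "ev v c:carrier L" "ev v c':carrier L" using assms ev_closed by blast+
 show "ev v (c - c') = \<zero>" if "ev v c = ev v c'" using m that z cl by simp
 assume "ev v (c - c') = \<zero>"
 then have "(ev v c \<oplus> (- 1) \<odot> ev v c') \<oplus> ev v c' = ev v c'" using m cl by simp
 moreover have "(ev v c \<oplus> M) \<oplus> ev v c' = ev v c \<oplus> (ev v c' \<oplus> M)" if "M:carrier L" for M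
 using cl that by (simp add: a_assoc a_comm[of M])
 ultimately have "ev v c \<oplus> (ev v c' \<oplus> (- 1) \<odot> ev v c') = ev v c'" using cl by simp
 then show "ev v c = ev v c'" using z cl by simp
qed

lemma ev_lsub:
 assumes "!!e. e:P==>v e:carrier L"
 shows "lsub {c:cs P. ev v c = \<zero>}"
 by (rule lsubI) (use assms in \<open>simp_all add: lsub_0 lsub_add lsub_sc ev_add[where P = P] ev_sc[where P = P]\<close>)

end

text \<open>The projections \<open>pr a\<close> express that the graded components are independent:
  an element of two different degrees is zero, and an identity can be compared in a single
  degree.\<close>

locale galg = cring R for R :: "('k::field, 'r) graded_algebra" (structure) +
 fixes pr :: "int=>'r=>'r"
 assumes rs_closed [simp]: "x:carrier R==>c \<odot> x:carrier R"
 and rs_add: "x:carrier R==>y:carrier R==>c \<odot> (x \<oplus> y) = c \<odot> x \<oplus> c \<odot> y"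
 and rs_add_left: "x:carrier R==>(c + c') \<odot> x = c \<odot> x \<oplus> c' \<odot> x"
 and rs_rs: "x:carrier R==>c \<odot> (c' \<odot> x) = (c * c') \<odot> x"
 and rs_1 [simp]: "x:carrier R==>1 \<odot> x = x"
 and rs_mult: "x:carrier R==>y:carrier R==>(c \<odot> x) \<otimes> y = c \<odot> (x \<otimes> y)"
 and g_carrier: "gcomp R a <= carrier R"
 and g_zero: "\<zero>:gcomp R a"
 and g_add: "x:gcomp R a==>y:gcomp R a==>x \<oplus> y:gcomp R a"
 and g_smult: "x:gcomp R a==>c \<odot> x:gcomp R a"
 and g_mult: "x:gcomp R a==>y:gcomp R b==>x \<otimes> y:gcomp R (a + b)"
 and g_one: "\<one>:gcomp R 0"
 and pr_mem: "x:carrier R==>pr a x:gcomp R a"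
 and pr_add: "x:carrier R==>y:carrier R==>pr a (x \<oplus> y) = pr a x \<oplus> pr a y"
 and pr_same: "x:gcomp R a==>pr a x = x"
 and pr_other: "x:gcomp R a==>b ~= a==>pr b x = \<zero>"
 and pr_mult: "x:carrier R==>y:gcomp R b==>pr a (x \<otimes> y) = pr (a - b) x \<otimes> y"
begin

lemma g_closed: "x:gcomp R a==>x:carrier R"
 using g_carrier by blast

lemma rs_0 [simp]: "x:carrier R==>0 \<odot> x = \<zero>"
 using rs_add_left[of x 0 0] add.l_cancel_one[of "0 \<odot> x" "0 \<odot> x"] by simp

lemma rs_mult2: "x:carrier R==>y:carrier R==>x \<otimes> (c \<odot> y) = c \<odot> (x \<otimes> y)"
 using rs_mult[of y x c] by (simp add: m_comm)

section \<open>Fractions over a multiplicative set\<close>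

definition mset :: "'r set=>bool" where
 "mset Sg <-> Sg <= carrier R&\<one>:Sg&(ALL s:Sg. ALL t:Sg. s \<otimes> t:Sg)"

context
 fixes Sg
 assumes Sg: "mset Sg"
begin

lemma ms_car [simp]: "s:Sg==>s:carrier R" and ms_one [simp]: "\<one>:Sg"
 and ms_mult [simp]: "s:Sg==>t:Sg==>s \<otimes> t:Sg"
 using Sg by (auto simp: mset_def)

lemma frac_mem: "(r', s'):frac R Sg r s <->
 r':carrier R&s':Sg&(EX u:Sg. u \<otimes> (r \<otimes> s') = u \<otimes> (r' \<otimes> s))"
 by (auto simp: frac_def)

lemma frac_sub:
 assumes "r:carrier R" "r':carrier R" "s:Sg" "s':Sg" "u:Sg" "u \<otimes> (r \<otimes> s') = u \<otimes> (r' \<otimes> s)"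
 shows "frac R Sg r s <= frac R Sg r' s'"
proof
 fix z assume z: "z:frac R Sg r s"
 obtain x y where xy: "z = (x, y)" by (cases z)
 from z obtain v where v: "x:carrier R" "y:Sg" "v:Sg" "v \<otimes> (r \<otimes> y) = v \<otimes> (x \<otimes> s)"
 unfolding xy frac_mem by blast
 have c: "u:carrier R" "v:carrier R" "y:carrier R" "s:carrier R" "s':carrier R" using assms v by simp_all
 note c = c assms(1,2) v(1)
 \<comment> \<open>Transitivity of equality of fractions: the middle denominator \<open>s\<close>
   has to be included in the witness so that both given identities apply.\<close>
 have "(u \<otimes> v \<otimes> s) \<otimes> (r' \<otimes> y) = v \<otimes> y \<otimes> (u \<otimes> (r' \<otimes> s))"
 using c by (simp add: m_ac)
 also have "... = u \<otimes> s' \<otimes> (v \<otimes> (r \<otimes> y))" using c unfolding assms(6)[symmetric] by (simp add: m_ac)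
 also have "... = (u \<otimes> v \<otimes> s) \<otimes> (x \<otimes> s')" unfolding v(4) using c by (simp add: m_ac)
 finally show "z:frac R Sg r' s'" unfolding xy frac_mem using v assms by (intro conjI bexI[of _ "u \<otimes> v \<otimes> s"]) auto
qed

lemma frac_eqI:
 assumes "r:carrier R" "r':carrier R" "s:Sg" "s':Sg" "u:Sg" "u \<otimes> (r \<otimes> s') = u \<otimes> (r' \<otimes> s)"
 shows "frac R Sg r s = frac R Sg r' s'"
 using frac_sub[OF assms] frac_sub[OF assms(2,1,4,3,5) assms(6)[symmetric]] by blast

lemma frac_self: "r:carrier R==>s:Sg==>(r, s):frac R Sg r s"
 unfolding frac_mem by (intro conjI bexI[of _ \<one>]) auto

lemma frac_eq_iff:
 assumes "r:carrier R" "r':carrier R" "s:Sg" "s':Sg"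
 shows "frac R Sg r s = frac R Sg r' s' <-> (EX u:Sg. u \<otimes> (r \<otimes> s') = u \<otimes> (r' \<otimes> s))"
proof
 assume "frac R Sg r s = frac R Sg r' s'"
 then have "(r', s'):frac R Sg r s" using frac_self assms by simp
 then show "EX u:Sg. u \<otimes> (r \<otimes> s') = u \<otimes> (r' \<otimes> s)" unfolding frac_mem by blast
qed (use frac_eqI assms in blast)

lemma loc_simps:
 "carrier (localization R Sg) = {frac R Sg r s | r s. r:carrier R&s:Sg}"
 "\<zero>\<^bsub>localization R Sg\<^esub> = frac R Sg \<zero> \<one>"
 "gcomp (localization R Sg) a = {frac R Sg r s | r s d. s:Sg&s:gcomp R d&r:gcomp R (a + d)}"
 by (simp_all add: localization_def)

lemma locE:
 assumes "x:carrier (localization R Sg)"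
 obtains r s where "x = frac R Sg r s" "r:carrier R" "s:Sg"
 using assms unfolding loc_simps by blast

lemma loc_add:
 assumes "r:carrier R" "r':carrier R" "s:Sg" "s':Sg"
 shows "frac R Sg r s \<oplus>\<^bsub>localization R Sg\<^esub> frac R Sg r' s' = frac R Sg (r \<otimes> s' \<oplus> r' \<otimes> s) (s \<otimes> s')"
proof -
 have *: "frac R Sg (x \<otimes> y' \<oplus> x' \<otimes> y) (y \<otimes> y') = frac R Sg (r \<otimes> s' \<oplus> r' \<otimes> s) (s \<otimes> s')"
 if xy: "(x, y):frac R Sg r s" "(x', y'):frac R Sg r' s'" for x y x' y'
 proof -
 obtain u where u: "x:carrier R" "y:Sg" "u:Sg" "u \<otimes> (r \<otimes> y) = u \<otimes> (x \<otimes> s)"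
 using xy unfolding frac_mem by blast
 obtain u' where u': "x':carrier R" "y':Sg" "u':Sg" "u' \<otimes> (r' \<otimes> y') = u' \<otimes> (x' \<otimes> s')"
 using xy unfolding frac_mem by blast
 have c: "u:carrier R" "u':carrier R" "y:carrier R" "y':carrier R" "s:carrier R" "s':carrier R"
 "x:carrier R" "x':carrier R" "r:carrier R" "r':carrier R"
 using assms u u' by simp_all
 have "(u \<otimes> u') \<otimes> ((x \<otimes> y' \<oplus> x' \<otimes> y) \<otimes> (s \<otimes> s'))
 = (u \<otimes> (x \<otimes> s)) \<otimes> (u' \<otimes> y' \<otimes> s') \<oplus> (u' \<otimes> (x' \<otimes> s')) \<otimes> (u \<otimes> y \<otimes> s)"
 using c by (simp add: l_distr r_distr m_ac)
 also have "... = (u \<otimes> u') \<otimes> ((r \<otimes> s' \<oplus> r' \<otimes> s) \<otimes> (y \<otimes> y'))"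
 unfolding u(4)[symmetric] u'(4)[symmetric] using c by (simp add: l_distr r_distr m_ac)
 finally show ?thesis using c u u' assms by (intro frac_eqI[where u = "u \<otimes> u'"]) auto
 qed
 have "frac R Sg r s \<oplus>\<^bsub>localization R Sg\<^esub> frac R Sg r' s' =
 (\<Union>(x, y)\<in>frac R Sg r s. \<Union>(x', y')\<in>frac R Sg r' s'. frac R Sg (r \<otimes> s' \<oplus> r' \<otimes> s) (s \<otimes> s'))"
 unfolding localization_def using * by (auto simp: split_def)
 then show ?thesis using frac_self[OF assms(1,3)] frac_self[OF assms(2,4)] by fastforce
qed

lemma loc_smult:
 assumes "r:carrier R" "s:Sg"
 shows "c \<odot>\<^bsub>localization R Sg\<^esub> frac R Sg r s = frac R Sg (c \<odot> r) s"
proof -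
 have *: "frac R Sg (c \<odot> x) y = frac R Sg (c \<odot> r) s" if xy: "(x, y):frac R Sg r s" for x y
 proof -
 obtain u where u: "x:carrier R" "y:Sg" "u:Sg" "u \<otimes> (r \<otimes> y) = u \<otimes> (x \<otimes> s)"
 using xy unfolding frac_mem by blast
 have "u \<otimes> ((c \<odot> x) \<otimes> s) = u \<otimes> ((c \<odot> r) \<otimes> y)"
 using u assms by (simp add: rs_mult rs_mult2)
 then show ?thesis using u assms by (intro frac_eqI[where u = u]) auto
 qed
 have "c \<odot>\<^bsub>localization R Sg\<^esub> frac R Sg r s = (\<Union>(x, y)\<in>frac R Sg r s. frac R Sg (c \<odot> r) s)"
 unfolding localization_def using * by (auto simp: split_def)
 then show ?thesis using frac_self[OF assms] by fastforce
qed

lemma loc_map: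
 assumes T: "mset T" "Sg <= T" and "r:carrier R" "s:Sg"
 shows "localization_map R T (frac R Sg r s) = frac R T r s"
proof -
 have *: "frac R T x y = frac R T r s" if xy: "(x, y):frac R Sg r s" for x y
 proof -
 obtain u where u: "x:carrier R" "y:Sg" "u:Sg" "u \<otimes> (r \<otimes> y) = u \<otimes> (x \<otimes> s)"
 using xy unfolding frac_mem by blast
 then show ?thesis using assms u(4)[symmetric] by (intro galg.frac_eqI[OF galg_axioms T(1), where u = u]) auto
 qed
 have "localization_map R T (frac R Sg r s) = (\<Union>(x, y)\<in>frac R Sg r s. frac R T r s)"
 unfolding localization_map_def using * by (auto simp: split_def)
 then show ?thesis using frac_self[OF assms(3,4)] by fastforce
qed

lemma loc_zeroI: "r:carrier R==>s:Sg==>u:Sg==>u \<otimes> r = \<zero>==>frac R Sg r s = \<zero>\<^bsub>localization R Sg\<^esub>"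
 unfolding loc_simps by (intro frac_eqI[where u = u]) auto

lemma loc_zero_iff: "r:carrier R==>s:Sg==>
 frac R Sg r s = \<zero>\<^bsub>localization R Sg\<^esub> <-> (EX u:Sg. u \<otimes> r = \<zero>)"
 unfolding loc_simps by (subst frac_eq_iff) auto

lemma loc_add_same:
 assumes "r:carrier R" "r':carrier R" "s:Sg"
 shows "frac R Sg r s \<oplus>\<^bsub>localization R Sg\<^esub> frac R Sg r' s = frac R Sg (r \<oplus> r') s"
 unfolding loc_add[OF assms(1,2,3,3)] using assms
 by (intro frac_eqI[where u = \<one>]) (auto simp: l_distr r_distr m_ac)

lemma loc_kmod: "kmod (localization R Sg)"
proof -
 let ?L = "localization R Sg"
 have "abelian_monoid ?L"
 proof (rule abelian_monoidI)
 show "x \<oplus>\<^bsub>?L\<^esub> y:carrier ?L" if "x:carrier ?L" "y:carrier ?L" for x y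
 proof -
 from that(1) obtain r s where "x = frac R Sg r s" "r:carrier R" "s:Sg" by (rule locE)
 moreover from that(2) obtain r' s' where "y = frac R Sg r' s'" "r':carrier R" "s':Sg" by (rule locE)
 ultimately have "x \<oplus>\<^bsub>?L\<^esub> y = frac R Sg (r \<otimes> s' \<oplus> r' \<otimes> s) (s \<otimes> s')"
 "r \<otimes> s' \<oplus> r' \<otimes> s:carrier R" "s \<otimes> s':Sg" by (simp_all add: loc_add)
 then show ?thesis unfolding loc_simps by blast
 qed
 show "\<zero>\<^bsub>?L\<^esub>:carrier ?L" unfolding loc_simps by (intro CollectI exI[of _ \<zero>] exI[of _ \<one>]) auto
 show "x \<oplus>\<^bsub>?L\<^esub> y \<oplus>\<^bsub>?L\<^esub> z = x \<oplus>\<^bsub>?L\<^esub> (y \<oplus>\<^bsub>?L\<^esub> z)" if "x:carrier ?L" "y:carrier ?L" "z:carrier ?L" for x y z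
 proof -
 from that(1) obtain r s where "x = frac R Sg r s" "r:carrier R" "s:Sg" by (rule locE)
 moreover from that(2) obtain r' s' where "y = frac R Sg r' s'" "r':carrier R" "s':Sg" by (rule locE)
 moreover from that(3) obtain r'' s'' where "z = frac R Sg r'' s''" "r'':carrier R" "s'':Sg" by (rule locE)
 ultimately show ?thesis by (simp add: loc_add) (rule arg_cong2[where f = "frac R Sg"], simp_all add: l_distr r_distr m_ac a_ac)
 qed
 show "\<zero>\<^bsub>?L\<^esub> \<oplus>\<^bsub>?L\<^esub> x = x" if "x:carrier ?L" for x
 proof -
 from that obtain r s where "x = frac R Sg r s" "r:carrier R" "s:Sg" by (rule locE)
 then show ?thesis by (simp add: loc_simps(2) loc_add)
 qed
 show "x \<oplus>\<^bsub>?L\<^esub> y = y \<oplus>\<^bsub>?L\<^esub> x" if "x:carrier ?L" "y:carrier ?L" for x y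
 proof -
 from that(1) obtain r s where "x = frac R Sg r s" "r:carrier R" "s:Sg" by (rule locE)
 moreover from that(2) obtain r' s' where "y = frac R Sg r' s'" "r':carrier R" "s':Sg" by (rule locE)
 ultimately show ?thesis by (simp add: loc_add) (rule arg_cong2[where f = "frac R Sg"], simp_all add: m_ac a_ac)
 qed
 qed
 moreover have "kmod_axioms ?L"
 proof
 fix c c' x assume "x:carrier ?L"
 then obtain r s where x: "x = frac R Sg r s" "r:carrier R" "s:Sg" unfolding loc_simps by blast
 have "c \<odot>\<^bsub>?L\<^esub> x = frac R Sg (c \<odot> r) s" "c \<odot> r:carrier R" using x by (simp_all add: loc_smult)
 then show "c \<odot>\<^bsub>?L\<^esub> x:carrier ?L" unfolding loc_simps using x(3) by blast
 show "(c + c') \<odot>\<^bsub>?L\<^esub> x = c \<odot>\<^bsub>?L\<^esub> x \<oplus>\<^bsub>?L\<^esub> c' \<odot>\<^bsub>?L\<^esub> x" using x by (simp add: loc_smult loc_add_same rs_add_left)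
 show "c \<odot>\<^bsub>?L\<^esub> (c' \<odot>\<^bsub>?L\<^esub> x) = (c * c') \<odot>\<^bsub>?L\<^esub> x" using x by (simp add: loc_smult rs_rs)
 show "1 \<odot>\<^bsub>?L\<^esub> x = x" using x by (simp add: loc_smult)
 show "0 \<odot>\<^bsub>?L\<^esub> x = \<zero>\<^bsub>?L\<^esub>" using x by (simp add: loc_smult loc_zeroI[where u = \<one>])
 next
 fix c x y assume xy: "x:carrier ?L" "y:carrier ?L"
 obtain r s where x: "x = frac R Sg r s" "r:carrier R" "s:Sg" using xy(1) unfolding loc_simps by blast
 obtain r' s' where y: "y = frac R Sg r' s'" "r':carrier R" "s':Sg" using xy(2) unfolding loc_simps by blast
 from x y show "c \<odot>\<^bsub>?L\<^esub> (x \<oplus>\<^bsub>?L\<^esub> y) = c \<odot>\<^bsub>?L\<^esub> x \<oplus>\<^bsub>?L\<^esub> c \<odot>\<^bsub>?L\<^esub> y"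
 by (simp add: loc_add loc_smult rs_add rs_mult)
 qed
 ultimately show ?thesis by (rule kmod.intro)
qed

lemma loc_gcomp_carrier: "gcomp (localization R Sg) a <= carrier (localization R Sg)"
 unfolding loc_simps using g_closed by blast

end

lemma loc_map_hom:
 assumes S: "mset Sg" and T: "mset T" "Sg <= T" and x: "x:carrier (localization R Sg)"
 shows "localization_map R T x:carrier (localization R T)"
 and "localization_map R T (c \<odot>\<^bsub>localization R Sg\<^esub> x) = c \<odot>\<^bsub>localization R T\<^esub> localization_map R T x"
 and "y:carrier (localization R Sg)==>
 localization_map R T (x \<oplus>\<^bsub>localization R Sg\<^esub> y) = localization_map R T x \<oplus>\<^bsub>localization R T\<^esub> localization_map R T y"
 and "localization_map R T \<zero>\<^bsub>localization R Sg\<^esub> = \<zero>\<^bsub>localization R T\<^esub>"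
proof -
 obtain r s where x: "x = frac R Sg r s" "r:carrier R" "s:Sg" using x unfolding loc_simps[OF S] by blast
 have s: "s:T" using x T by auto
 note lm = loc_map[OF S T]
 show "localization_map R T x:carrier (localization R T)" unfolding x(1) lm[OF x(2,3)] loc_simps(1)[OF T(1)] using x(2) s by blast
 show "localization_map R T (c \<odot>\<^bsub>localization R Sg\<^esub> x) = c \<odot>\<^bsub>localization R T\<^esub> localization_map R T x"
 unfolding x(1) loc_smult[OF S x(2,3)] lm[OF rs_closed[OF x(2)] x(3)] lm[OF x(2,3)] loc_smult[OF T(1) x(2) s] ..
 show "localization_map R T \<zero>\<^bsub>localization R Sg\<^esub> = \<zero>\<^bsub>localization R T\<^esub>"
 unfolding loc_simps(2)[OF S] loc_simps(2)[OF T(1)] by (rule lm[OF zero_closed ms_one[OF S]])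
 assume "y:carrier (localization R Sg)"
 then obtain r' s' where y: "y = frac R Sg r' s'" "r':carrier R" "s':Sg" unfolding loc_simps[OF S] by blast
 have s': "s':T" using y T by auto
 have "s \<otimes> s':Sg" "r \<otimes> s' \<oplus> r' \<otimes> s:carrier R" using x(2,3) y(2,3) by (simp_all add: ms_car[OF S] ms_mult[OF S])
 then show "localization_map R T (x \<oplus>\<^bsub>localization R Sg\<^esub> y) = localization_map R T x \<oplus>\<^bsub>localization R T\<^esub> localization_map R T y"
 unfolding x(1) y(1) loc_add[OF S x(2) y(2) x(3) y(3)] lm[OF x(2,3)] lm[OF y(2,3)]
 loc_add[OF T(1) x(2) y(2) s s'] by (rule lm[rotated])
qed

section \<open>Monomials in a list of elements\<close>

definition mon :: "'r list=>nat set=>(nat=>nat)=>'r" where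
 "mon fs S ep = (\<Otimes>i\<in>S. (fs ! i) [^] ep i)"

lemma monomials_mon: "monomials R fs S = range (mon fs S)"
 by (auto simp: monomials_def mon_def)

context
 fixes fs :: "'r list"
 assumes fs: "set fs <= carrier R"
begin

lemma fs_car: "S <= {..<length fs}==>i:S==>fs ! i:carrier R"
 using fs nth_mem by blast

lemma mon_closed: "S <= {..<length fs}==>mon fs S ep:carrier R"
 unfolding mon_def using fs_car by (intro finprod_closed) auto

lemma mon_mult: "S <= {..<length fs}==>mon fs S ep \<otimes> mon fs S ep' = mon fs S (%i. ep i + ep' i)"
proof -
 assume S: "S <= {..<length fs}"
 have c: "(%i. (fs ! i) [^] e i):S \<rightarrow> carrier R" for e :: "nat=>nat" using fs_car[OF S] by auto
 have "mon fs S (%i. ep i + ep' i) = (\<Otimes>i\<in>S. (fs ! i) [^] ep i \<otimes> (fs ! i) [^] ep' i)"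
 unfolding mon_def using fs_car[OF S] by (intro finprod_cong') (auto simp: nat_pow_mult)
 then show ?thesis unfolding mon_def using finprod_multf[OF c c] by simp
qed

lemma mon_0: "S <= {..<length fs}==>mon fs S (%i. 0) = \<one>"
 unfolding mon_def by (simp add: finprod_one)

lemma mon_mono:
 assumes "S <= T" "T <= {..<length fs}" "!!i. i ~: S==>ep i = 0"
 shows "mon fs S ep = mon fs T ep"
 unfolding mon_def using fs_car[OF assms(2)] assms finite_subset[OF assms(2)]
 by (intro finprod_mono_neutral_cong_left) auto

lemma mset_monomials: "S <= {..<length fs}==>mset (monomials R fs S)"
 unfolding mset_def monomials_mon using mon_closed mon_mult mon_0
 by (auto intro: range_eqI[of _ _ "%i. 0"])

lemma mon_restrict: "mon fs S ep = mon fs S (%i. if i:S then ep i else 0)" if "S <= {..<length fs}"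
 unfolding mon_def using fs_car[OF that] by (intro finprod_cong') auto

lemma monomials_mono:
 assumes "S <= T" "T <= {..<length fs}"
 shows "monomials R fs S <= monomials R fs T"
proof
 fix x assume "x:monomials R fs S"
 then obtain ep where "x = mon fs S ep" unfolding monomials_mon by blast
 then have "x = mon fs S (%i. if i:S then ep i else 0)" using mon_restrict[of S ep] assms by simp
 also have "... = mon fs T (%i. if i:S then ep i else 0)" using assms by (intro mon_mono) auto
 finally show "x:monomials R fs T" unfolding monomials_mon by blast
qed

lemma mon_degree:
 assumes "S <= {..<length fs}" "!!i. i:S==>fs ! i:gcomp R (dg i)"
 shows "mon fs S ep:gcomp R (\<Sum>i\<in>S. int (ep i) * dg i)"
proof -
 have pw: "x [^] (n::nat):gcomp R (int n * d)" if "x:gcomp R d" for x n d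
 proof (induction n)
 case (Suc n)
 show ?case using g_mult[OF Suc that] by (simp add: algebra_simps)
 qed (simp add: g_one)
 have "finite S" using assms(1) finite_subset by auto
 then show ?thesis using assms unfolding mon_def
 proof (induction S)
 case (insert x F)
 have "(%i. fs ! i [^] ep i):F \<rightarrow> carrier R" "fs ! x [^] ep x:carrier R"
 using insert.prems(1) fs_car[of "insert x F"] by auto
 then have "(\<Otimes>i\<in>insert x F. fs ! i [^] ep i) = (fs ! x [^] ep x) \<otimes> (\<Otimes>i\<in>F. fs ! i [^] ep i)"
 using insert.hyps by simp
 moreover have "(\<Otimes>i\<in>F. fs ! i [^] ep i):gcomp R (\<Sum>i\<in>F. int (ep i) * dg i)"
 using insert by auto
 ultimately show ?case using g_mult[OF pw[OF insert.prems(2)[of x]]] insert.hyps by simp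
 qed (simp add: g_one)
qed

end

end

lemma cech_index_finite: "finite (cech_index fs p)"
 by (rule finite_subset[of _ "Pow {..<length fs}"]) (auto simp: cech_index_def)

context galg
begin

text \<open>A presentation of the Cech complex: the keys \<open>x\<close> with \<open>sp x = S\<close> index generators
 \<open>val x\<close> of the localization at \<open>S\<close>.\<close>

lemma cech_cohomology_free:
 fixes fs :: "'r list" and P :: "'x set" and sp :: "'x=>nat set" and B :: "'b set"
 defines "L == %S. cech_localization R fs S" and "X == {..<length fs}"
 assumes fs: "set fs <= carrier R"
 and sp: "!!x. x:P==>sp x <= X"
 and ins: "!!x j. x:P==>j:X - sp x==>ins j x:P&sp (ins j x) = insert j (sp x)"
 and val: "!!x. x:P==>val x:gcomp (L (sp x)) a"
 and val_ins: "!!x j. x:P==>j:X - sp x==>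
 val (ins j x) = localization_map R (monomials R fs (insert j (sp x))) (val x)"
 and sur: "!!S Y. S <= X==>Y:gcomp (L S) a==>EX w:cs {x:P. sp x = S}. kmod.ev (L S) val w = Y"
 and ld: "lin d"
 and d: "!!x. x:P==>d (single x 1) = (\<Sum>j\<in>X - sp x. single (ins j x) (sgnS (sp x) j))"
 and dd: "!!x. x:P==>d (d (single x 1)) = 0"
 and N: "N = {c:cs P. \<forall>S\<subseteq>X. kmod.ev (L S) val (rst {x. sp x = S} c) = \<zero>\<^bsub>L S\<^esub>}"
 and coh: "coh P N (%x. int (card (sp x))) 1 d p B"
 shows "is_free (cech_cohomology R fs p a) B"
proof -
 let ?gr = "%x. int (card (sp x))"
 let ?C = "Ch P ?gr" and ?I = "cech_index fs"
 have ms: "mset (monomials R fs S)" if "S <= X" for S using mset_monomials[OF fs] that by (simp add: X_def)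
 have Lk: "kmod (L S)" if "S <= X" for S using loc_kmod[OF ms[OF that]] by (simp add: L_def cld)
 have finX: "finite X" by (simp add: X_def)
 have I: "S:?I p <-> S <= X&int (card S) = p" for S p by (simp add: cech_index_def X_def)
 have vcar: "val x:carrier (L S)" if "x:{x:P. sp x = S}" for x S
 using val[of x] sp[of x] that loc_gcomp_carrier[OF ms, of S a] by (auto simp: L_def cld)
 have gL: "gcomp (L S) a <= carrier (L S)" if "S <= X" for S
 using loc_gcomp_carrier[OF ms[OF that]] by (simp add: L_def cld)
 define blk :: "nat set=>('x, 'k) pm=>('x, 'k) pm" where "blk S = rst {x. sp x = S}" for S
 have lblk [simp]: "lin (blk S)" for S by (simp add: blk_def)
 have blk_cs: "blk S c:cs {x:P. sp x = S}" if "c:cs P" for c S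
 unfolding blk_def using rst_cs_Int[OF that, of "{x. sp x = S}"] by (rule cs_mono[rotated]) auto
 \<comment> \<open>The value at the face \<open>S\<close> of the formal cochain \<open>c\<close>;
   \<open>N\<close> consists of the cochains all of whose values vanish.\<close>
 define E where "E S c = kmod.ev (L S) val (blk S c)" for S c
 have E_add: "E S (c + c') = E S c \<oplus>\<^bsub>L S\<^esub> E S c'" if "S <= X" "c:cs P" "c':cs P" for S c c'
 unfolding E_def lin_add[OF lblk]
 by (rule kmod.ev_add[OF Lk[OF that(1)] blk_cs[OF that(2)] blk_cs[OF that(3)] vcar])
 have E_sc: "E S (sc b c) = b \<odot>\<^bsub>L S\<^esub> E S c" if "S <= X" "c:cs P" for S b c
 unfolding E_def lin_sc[OF lblk] by (rule kmod.ev_sc[OF Lk[OF that(1)] blk_cs[OF that(2)] vcar])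
 have E_car: "E S c:carrier (L S)" if "S <= X" "c:cs P" for S c
 unfolding E_def by (rule kmod.ev_closed[OF Lk[OF that(1)] blk_cs[OF that(2)] vcar])
 have E_0: "E S 0 = \<zero>\<^bsub>L S\<^esub>" if "S <= X" for S
 unfolding E_def by (simp add: lin_0 kmod.ev_0[OF Lk[OF that]])
 have E_single: "E S (single x 1) = (if sp x = S then val x else \<zero>\<^bsub>L S\<^esub>)" if "S <= X" "x:P" for S x
 using kmod.ev_single[OF Lk[OF that(1)], of val x 1] kmod.sm_1[OF Lk[OF that(1)]] vcar[of x S] that
 by (auto simp: E_def blk_def rst_single kmod.ev_0[OF Lk[OF that(1)]])
 have L_g: "\<zero>\<^bsub>L S\<^esub>:gcomp (L S) a"
 "u:gcomp (L S) a==>v:gcomp (L S) a==>u \<oplus>\<^bsub>L S\<^esub> v:gcomp (L S) a"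
 "u:gcomp (L S) a==>b \<odot>\<^bsub>L S\<^esub> u:gcomp (L S) a" if S: "S <= X" for S u v b
 proof -
 note ls = loc_simps[OF ms[OF S]]
 have Lf: "L S = localization R (monomials R fs S)" by (simp add: L_def cld)
 show "\<zero>\<^bsub>L S\<^esub>:gcomp (L S) a" unfolding Lf ls
 using ms_one[OF ms[OF S]] g_one g_zero by blast
 show "b \<odot>\<^bsub>L S\<^esub> u:gcomp (L S) a" if "u:gcomp (L S) a"
 proof -
 from that obtain r s dd where "u = frac R (monomials R fs S) r s" "s:monomials R fs S" "s:gcomp R dd" "r:gcomp R (a + dd)"
 unfolding Lf ls by blast
 then show ?thesis unfolding Lf ls using loc_smult[OF ms[OF S], of r s b] g_closed g_smult by blast
 qed
 show "u \<oplus>\<^bsub>L S\<^esub> v:gcomp (L S) a" if uv: "u:gcomp (L S) a" "v:gcomp (L S) a"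
 proof -
 from uv(1) obtain r s dd where 1: "u = frac R (monomials R fs S) r s" "s:monomials R fs S" "s:gcomp R dd" "r:gcomp R (a + dd)"
 unfolding Lf ls by blast
 from uv(2) obtain r' s' dd' where 2: "v = frac R (monomials R fs S) r' s'" "s':monomials R fs S" "s':gcomp R dd'" "r':gcomp R (a + dd')"
 unfolding Lf ls by blast
 have "r \<otimes> s' \<oplus> r' \<otimes> s:gcomp R (a + (dd + dd'))"
 using g_add[OF g_mult[OF 1(4) 2(3)], of "r' \<otimes> s"] g_mult[OF 2(4) 1(3)] by (simp add: algebra_simps)
 moreover have "s \<otimes> s':gcomp R (dd + dd')" "s \<otimes> s':monomials R fs S"
 using g_mult[OF 1(3) 2(3)] ms_mult[OF ms[OF S] 1(2) 2(2)] by auto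
 ultimately show ?thesis unfolding Lf ls 1(1) 2(1)
 using loc_add[OF ms[OF S] g_closed[OF 1(4)] g_closed[OF 2(4)] 1(2) 2(2)] by blast
 qed
 qed
 have E_g: "E S c:gcomp (L S) a" if "S <= X" "c:cs P" for S c
 proof -
 have "c:{c:cs P. E S c:gcomp (L S) a}"
 proof (rule cs_induct[OF that(2)])
 show "lsub {c:cs P. E S c:gcomp (L S) a}"
 by (rule lsubI) (use that L_g[OF that(1)] in \<open>simp_all add: E_0 E_add E_sc lsub_0 lsub_add lsub_sc\<close>)
 show "single x 1:{c:cs P. E S c:gcomp (L S) a}" if "x:P" for x
 using that \<open>S <= X\<close> val[OF that] L_g(1) by (auto simp: single_cs E_single)
 qed
 then show ?thesis by simp
 qed
 have N': "c:N <-> c:cs P&(\<forall>S\<subseteq>X. E S c = \<zero>\<^bsub>L S\<^esub>)" for c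
 by (simp add: N E_def blk_def)
 have lN: "lsub N"
 proof (rule lsubI)
 show "0:N" by (simp add: N' E_0 lsub_0)
 show "u + v:N" if "u:N" "v:N" for u v
 using that unfolding N'
 by (auto simp: E_add lsub_add abelian_monoid.l_zero[OF kmod.axioms(1)[OF Lk]] abelian_monoid.zero_closed[OF kmod.axioms(1)[OF Lk]])
 show "sc c u:N" if "u:N" for c u
 using that unfolding N' by (auto simp: E_sc lsub_sc kmod.sm_zero[OF Lk])
 qed
 have dP: "d c:cs P" "c:?C q==>d c:?C (q + 1)" if "c:cs P" for c q
 proof -
 have 1: "d (single x 1):cs {y:P. ?gr y = ?gr x + 1}" if "x:P" for x
 unfolding d[OF that]
 proof (intro lsub_sum[OF lsub_cs] single_cs)
 fix j assume "j:X - sp x"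
 then show "ins j x:{y:P. ?gr y = ?gr x + 1}"
 using ins[OF that] finite_subset[OF sp[OF that] finX] by auto
 qed
 show "d c:cs P" using that
 by (rule lin_cs_mem[OF _ ld lsub_cs]) (use 1 in \<open>auto intro: cs_mono[rotated]\<close>)
 show "d c:?C (q + 1)" if "c:?C q"
 using that unfolding Ch_def by (rule lin_cs_mem[OF _ ld lsub_cs]) (use 1 in auto)
 qed
 \<comment> \<open>A surjection from formal cochains onto Cech cochains, to which
   \<open>quot_free\<close> is applied at the end.\<close>
 define e where "e q c = (\<lambda>S\<in>?I q. E S c)" for q c
 have e_diff: "cech_differential R fs q (e q c) = e (q + 1) (d c)" if c: "c:?C q" for q c
 proof
 fix T
 show "cech_differential R fs q (e q c) T = e (q + 1) (d c) T"
 proof (cases "T:?I (q + 1)")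
 case False
 then show ?thesis by (simp add: cech_differential_def e_def)
 next
 case T: True
 then have TX: "T <= X" "int (card T) = q + 1" using I by auto
 have finT: "finite T" using TX finX finite_subset by blast
 interpret LT: kmod "L T" by (rule Lk[OF TX(1)])
 let ?lm = "localization_map R (monomials R fs T)"
 \<comment> \<open>The summand of the Cech differential at \<open>T\<close> that comes from the face
   without \<open>i\<close>. It is linear in \<open>c\<close>, so the comparison with
   \<open>E T (d c)\<close> reduces to basis vectors.\<close>
 define K where "K c i = ((- 1) ^ card {j:T. j < i}) \<odot>\<^bsub>L T\<^esub> ?lm (E (T - {i}) c)" for c i
 have sub: "T - {i} <= X" for i using TX by auto
 have mm: "monomials R fs (T - {i}) <= monomials R fs T" for i
 using monomials_mono[OF fs, of "T - {i}" T] TX by (auto simp: X_def)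
 have Lf: "L S = localization R (monomials R fs S)" for S by (simp add: L_def cld)
 note hom = loc_map_hom[OF ms[OF sub] ms[OF TX(1)] mm, folded Lf]
 have K_car: "K c i:carrier (L T)" if "c:cs P" for c i
 unfolding K_def by (rule LT.sm_closed[OF hom(1)[OF E_car[OF sub that]]])
 have K_add: "K (c + c') i = K c i \<oplus>\<^bsub>L T\<^esub> K c' i" if "c:cs P" "c':cs P" for c c' i
 unfolding K_def E_add[OF sub that] hom(3)[OF E_car[OF sub that(1)] E_car[OF sub that(2)]]
 by (rule LT.sm_add[OF hom(1)[OF E_car[OF sub that(1)]] hom(1)[OF E_car[OF sub that(2)]]])
 have K_sc: "K (sc b c) i = b \<odot>\<^bsub>L T\<^esub> K c i" if "c:cs P" for b c i
 unfolding K_def E_sc[OF sub that] hom(2)[OF E_car[OF sub that]]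
 using hom(1)[OF E_car[OF sub that]] by (simp add: LT.sm_sm mult.commute)
 have K_single: "K (single x 1) i = (if sp x = T - {i} then sgnS (sp x) i \<odot>\<^bsub>L T\<^esub> val (ins i x) else \<zero>\<^bsub>L T\<^esub>)"
 if x: "x:P" and i: "i:T" for x i
 proof (cases "sp x = T - {i}")
 case True
 have ij: "i:X - sp x" "insert i (sp x) = T" using True i TX by auto
 have "{j:T. j < i} = {k:sp x. k < i}" using True by auto
 then show ?thesis using True val_ins[OF x ij(1)] ij(2) by (simp add: K_def E_single[OF sub x] sgnS_def)
 next
 case False
 have "?lm \<zero>\<^bsub>L (T - {i})\<^esub> = \<zero>\<^bsub>L T\<^esub>" by (rule hom(4)[OF E_car[OF sub, of 0]]) (simp add: lsub_0)
 then show ?thesis using False by (simp add: K_def E_single[OF sub x])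
 qed
 have key: "(\<Oplus>\<^bsub>L T\<^esub>i\<in>T. K c i) = E T (d c)" if "c:cs P" for c
 proof -
 have "c:{c:cs P. (\<Oplus>\<^bsub>L T\<^esub>i\<in>T. K c i) = E T (d c)}"
 proof (rule cs_induct[OF that])
 have Kf: "(%i. K c i):T \<rightarrow> carrier (L T)" if "c:cs P" for c using K_car[OF that] by auto
 have K0: "K 0 i = \<zero>\<^bsub>L T\<^esub>" for i using K_sc[of 0 0 i] K_car[of 0 i] by (simp add: lsub_0)
 show "lsub {c:cs P. (\<Oplus>\<^bsub>L T\<^esub>i\<in>T. K c i) = E T (d c)}"
 proof (rule lsubI)
 show "0:{c:cs P. (\<Oplus>\<^bsub>L T\<^esub>i\<in>T. K c i) = E T (d c)}"
 proof -
 have "(\<Oplus>\<^bsub>L T\<^esub>i\<in>T. K 0 i) = \<zero>\<^bsub>L T\<^esub>" by (rule LT.add.finprod_one_eqI) (simp add: K0)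
 then show ?thesis by (simp add: lsub_0 lin_0[OF ld] E_0[OF TX(1)])
 qed
 show "u + v:{c:cs P. (\<Oplus>\<^bsub>L T\<^esub>i\<in>T. K c i) = E T (d c)}"
 if uv: "u:{c:cs P. (\<Oplus>\<^bsub>L T\<^esub>i\<in>T. K c i) = E T (d c)}" "v:{c:cs P. (\<Oplus>\<^bsub>L T\<^esub>i\<in>T. K c i) = E T (d c)}" for u v
 proof -
 have uv': "u:cs P" "v:cs P" using uv by auto
 have "(\<Oplus>\<^bsub>L T\<^esub>i\<in>T. K (u + v) i) = (\<Oplus>\<^bsub>L T\<^esub>i\<in>T. K u i \<oplus>\<^bsub>L T\<^esub> K v i)"
 by (simp add: K_add[OF uv'])
 also have "... = (\<Oplus>\<^bsub>L T\<^esub>i\<in>T. K u i) \<oplus>\<^bsub>L T\<^esub> (\<Oplus>\<^bsub>L T\<^esub>i\<in>T. K v i)"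
 by (rule LT.add.finprod_multf[OF Kf[OF uv'(1)] Kf[OF uv'(2)]])
 also have "... = E T (d (u + v))"
 using uv by (simp add: lin_add[OF ld] E_add[OF TX(1) dP(1)[OF uv'(1)] dP(1)[OF uv'(2)]])
 finally show ?thesis using uv' by (simp add: lsub_add)
 qed
 show "sc b u:{c:cs P. (\<Oplus>\<^bsub>L T\<^esub>i\<in>T. K c i) = E T (d c)}"
 if u: "u:{c:cs P. (\<Oplus>\<^bsub>L T\<^esub>i\<in>T. K c i) = E T (d c)}" for b u
 proof -
 have u': "u:cs P" using u by auto
 have "(\<Oplus>\<^bsub>L T\<^esub>i\<in>T. K (sc b u) i) = b \<odot>\<^bsub>L T\<^esub> (\<Oplus>\<^bsub>L T\<^esub>i\<in>T. K u i)"
 using LT.sm_finsum[OF finT K_car[OF u']] by (simp add: K_sc[OF u'])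
 then show ?thesis using u by (simp add: lin_sc[OF ld] E_sc[OF TX(1) dP(1)[OF u']] lsub_sc)
 qed
 qed
 fix x assume x: "x:P"
 \<comment> \<open>For a single key at most one \<open>i\<close> contributes, namely the one with
   \<open>T = insert i (sp x)\<close>.\<close>
 have eq1: "E T (d (single x 1)) = (\<Oplus>\<^bsub>L T\<^esub>i\<in>T. K (single x 1) i)"
 proof (cases "EX j:X - sp x. T = insert j (sp x)")
 case True
 then obtain j where j: "j:X - sp x" "T = insert j (sp x)" by blast
 have "blk T (d (single x 1)) = (\<Sum>i\<in>X - sp x. if i = j then single (ins j x) (sgnS (sp x) j) else 0)"
 unfolding d[OF x] lin_sum[OF lblk]
 proof (rule sum.cong)
 fix i assume i: "i:X - sp x"
 have "insert i (sp x) = T <-> i = j" using i j by auto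
 then show "blk T (single (ins i x) (sgnS (sp x) i)) = (if i = j then single (ins j x) (sgnS (sp x) j) else 0)"
 using ins[OF x i] by (auto simp: blk_def rst_single)
 qed simp
 then have "blk T (d (single x 1)) = single (ins j x) (sgnS (sp x) j)" using j finX by simp
 then have "E T (d (single x 1)) = sgnS (sp x) j \<odot>\<^bsub>L T\<^esub> val (ins j x)"
 using LT.ev_single[of val "ins j x"] vcar[of "ins j x" T] ins[OF x j(1)] j(2) by (simp add: E_def)
 moreover have "(\<Oplus>\<^bsub>L T\<^esub>i\<in>T. K (single x 1) i) = (\<Oplus>\<^bsub>L T\<^esub>i\<in>T. if j = i then K (single x 1) i else \<zero>\<^bsub>L T\<^esub>)"
 proof (rule LT.add.finprod_cong')
 fix i assume i: "i:T"
 show "K (single x 1) i = (if j = i then K (single x 1) i else \<zero>\<^bsub>L T\<^esub>)"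
 using K_single[OF x i] j i by auto
 qed (use K_car[OF single_cs[OF x]] in auto)
 moreover have "... = K (single x 1) j"
 by (rule LT.add.finprod_singleton) (use j finT K_car[OF single_cs[OF x]] in auto)
 moreover have "sp x = T - {j}" using j by auto
 moreover have "j:T" using j(2) by simp
 ultimately show ?thesis using K_single[OF x, of j] by presburger
 next
 case False
 have "blk T (d (single x 1)) = 0"
 unfolding d[OF x] lin_sum[OF lblk] using ins[OF x] False
 by (intro sum.neutral) (auto simp: blk_def rst_single)
 moreover have "K (single x 1) i = \<zero>\<^bsub>L T\<^esub>" if "i:T" for i
 proof -
 have "sp x ~= T - {i}" using False that TX by (auto simp: insert_absorb)
 then show ?thesis using K_single[OF x that] by simp
 qed
 then have "(\<Oplus>\<^bsub>L T\<^esub>i\<in>T. K (single x 1) i) = \<zero>\<^bsub>L T\<^esub>" by (rule LT.add.finprod_one_eqI)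
 ultimately show ?thesis by (simp add: E_def)
 qed
 show "single x 1:{c:cs P. (\<Oplus>\<^bsub>L T\<^esub>i\<in>T. K c i) = E T (d c)}"
 using x eq1 by (simp add: single_cs)
 qed
 then show ?thesis by simp
 qed
 have eT: "e q c (T - {i}) = E (T - {i}) c" if "i:T" for i
 proof -
 have "card T = Suc (card (T - {i}))" using that finT by (metis card.remove)
 then show ?thesis using TX sub[of i] by (simp add: e_def I)
 qed
 have "cech_differential R fs q (e q c) T = (\<Oplus>\<^bsub>L T\<^esub>i\<in>T. K c i)"
 unfolding cech_differential_def restrict_apply'[OF T] L_def[symmetric]
 by (rule LT.add.finprod_cong') (use K_car[OF Ch_cs[OF c]] eT in \<open>auto simp: K_def\<close>)
 then show ?thesis using key[OF Ch_cs[OF c]] T by (simp add: e_def)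
 qed
 qed
 let ?V = "cech_cochains R fs"
 have zeroV: "\<zero>\<^bsub>?V q a\<^esub> = (\<lambda>S\<in>?I q. \<zero>\<^bsub>L S\<^esub>)" for q
 by (simp add: cech_cochains_def graded_piece_def L_def)
 have addV: "u \<oplus>\<^bsub>?V q a\<^esub> v = (\<lambda>S\<in>?I q. u S \<oplus>\<^bsub>L S\<^esub> v S)" for q u v
 by (simp add: cech_cochains_def graded_piece_def L_def)
 have smV: "b \<odot>\<^bsub>?V q a\<^esub> u = (\<lambda>S\<in>?I q. b \<odot>\<^bsub>L S\<^esub> u S)" for q u b
 by (simp add: cech_cochains_def graded_piece_def L_def)
 have carV: "carrier (?V q a) = (\<Pi>\<^sub>E S\<in>?I q. gcomp (L S) a)" for q
 proof -
 have "finite {i:?I q. Q i}" for Q by (rule finite_subset[OF _ cech_index_finite[of fs q]]) auto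
 then show ?thesis by (simp add: cech_cochains_def graded_piece_def L_def)
 qed
 have e_im: "e q ` ?C q = carrier (?V q a)" for q
 proof
 have "e q c:carrier (?V q a)" if c: "c:?C q" for c
 unfolding carV e_def using E_g[OF _ Ch_cs[OF c]] I by (auto simp: PiE_def Pi_def)
 then show "e q ` ?C q <= carrier (?V q a)" by blast
 show "carrier (?V q a) <= e q ` ?C q"
 proof
 fix Y assume Y: "Y:carrier (?V q a)"
 have "ALL S:?I q. EX w. w:cs {x:P. sp x = S}&kmod.ev (L S) val w = Y S"
 proof
 fix S assume S: "S:?I q"
 then have "Y S:gcomp (L S) a" "S <= X" using Y unfolding carV by (auto simp: I PiE_def Pi_def)
 from sur[OF this(2,1)] show "EX w. w:cs {x:P. sp x = S}&kmod.ev (L S) val w = Y S" by blast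
 qed
 then obtain w where w: "ALL S:?I q. w S:cs {x:P. sp x = S}&kmod.ev (L S) val (w S) = Y S"
 unfolding bchoice_iff by blast
 define c where "c = (\<Sum>S\<in>?I q. w S)"
 have wC: "w S:?C q" if S: "S:?I q" for S
 proof -
 have "w S:cs {x:P. sp x = S}" using w S by blast
 then show ?thesis unfolding Ch_def by (rule cs_mono[rotated]) (use S I in auto)
 qed
 have cC: "c:?C q" unfolding c_def by (intro lsub_sum[OF lsub_Ch] wC)
 have "E S c = Y S" if S: "S:?I q" for S
 proof -
 have "blk S c = (\<Sum>S'\<in>?I q. if S' = S then w S else 0)"
 unfolding c_def lin_sum[OF lblk]
 proof (rule sum.cong)
 fix S' assume S': "S':?I q"
 then have "w S':cs {x:P. sp x = S'}" using w by blast
 then show "blk S (w S') = (if S' = S then w S else 0)"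
 unfolding blk_def by (auto intro: rst_disjoint rst_id)
 qed simp
 then have "blk S c = w S" using S cech_index_finite[of fs q] by simp
 then show ?thesis using w S by (simp add: E_def)
 qed
 then have "Y = e q c" using Y unfolding carV e_def by (auto simp: PiE_def extensional_def fun_eq_iff)
 then show "Y:e q ` ?C q" using cC by blast
 qed
 qed
 have e_zero: "e q c = \<zero>\<^bsub>?V q a\<^esub> <-> c:N" if c: "c:?C q" for q c
 proof
 assume z: "e q c = \<zero>\<^bsub>?V q a\<^esub>"
 have "E S c = \<zero>\<^bsub>L S\<^esub>" if S: "S <= X" for S
 proof (cases "S:?I q")
 case True
 then show ?thesis using fun_cong[OF z, of S] by (simp add: e_def zeroV)
 next
 case False
 have "blk S c = 0" unfolding blk_def
 using c unfolding Ch_def by (rule rst_disjoint) (use False S in \<open>auto simp: I\<close>)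
 then show ?thesis by (simp add: E_def kmod.ev_0[OF Lk[OF S]])
 qed
 then show "c:N" using Ch_cs[OF c] by (simp add: N')
 next
 assume "c:N"
 then show "e q c = \<zero>\<^bsub>?V q a\<^esub>" unfolding N' zeroV e_def using I by (auto simp: fun_eq_iff)
 qed
 have e_add: "e q (u + v) = e q u \<oplus>\<^bsub>?V q a\<^esub> e q v" if "u:cs P" "v:cs P" for q u v
 unfolding addV e_def using I that by (auto simp: fun_eq_iff E_add)
 have e_sc: "e q (sc b u) = b \<odot>\<^bsub>?V q a\<^esub> e q u" if "u:cs P" for q u b
 unfolding smV e_def using I that by (auto simp: fun_eq_iff E_sc)
 let ?Z = "ZZ P N ?gr d p" and ?B = "BB P N ?gr 1 d p"
 have ZC: "u:?C p" "u:cs P" "d u:N" if "u:?Z" for u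
 using that Ch_cs[of u P] by (auto simp: ZZ_def)
 have B_Z: "u:?C p" "u:cs P" if "u:?B" for u
 proof -
 from that obtain b n where bn: "b:?C (p - 1)" "n:N Int ?C p" "u = d b + n" unfolding BB_def by blast
 have "d b:?C p" using dP(2)[OF Ch_cs[OF bn(1)] bn(1)] by simp
 then show "u:?C p" using bn by (simp add: lsub_add)
 then show "u:cs P" by (rule Ch_cs)
 qed
 define V' where "V' = ?V p a \<lparr>carrier := {c:carrier (?V p a). cech_differential R fs p c = \<zero>\<^bsub>?V (p + 1) a\<^esub>}\<rparr>"
 define W where "W = cech_differential R fs (p - 1) ` carrier (?V (p - 1) a)"
 have lZ: "lsub ?Z"
 proof -
 have "?Z = ?C p Int {c. d c:N}" by (auto simp: ZZ_def)
 then show ?thesis by (simp add: lsub_Int lsub_vimage ld lN)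
 qed
 have lB: "lsub ?B"
 proof -
 have "?B = {u + v | u v. u:d ` ?C (p - 1)&v:N Int ?C p}" by (auto simp: BB_def)
 then show ?thesis by (simp only:) (intro lsub_plus lsub_image lsub_Int ld lN lsub_Ch)
 qed
 have ddN: "d (d c) = 0" if c: "c:cs P" for c
 using lin_cs_eqI[OF c lin_comp[OF ld ld] lin_const0] dd by simp
 \<comment> \<open>\<open>e\<close> commutes with the differentials and has kernel \<open>N\<close>,
   so \<open>d\<close> preserves \<open>N\<close>.\<close>
 have dN: "d n:N" if n: "n:N" "n:?C q" for n q
 proof -
 have z: "0:?C q" for q by (simp add: lsub_0)
 have "e q n = e q 0" using e_zero[OF n(2)] e_zero[OF z] n(1) lN by (simp add: lsub_0)
 then have "e (q + 1) (d n) = e (q + 1) 0" using e_diff[OF n(2)] e_diff[OF z, of q] by (simp add: lin_0[OF ld])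
 then show ?thesis using e_zero[OF dP(2)[OF Ch_cs[OF n(2)] n(2)]] e_zero[OF z, of "q + 1"] lN by (simp add: lsub_0)
 qed
 have BZ: "?B <= ?Z"
 proof
 fix u assume u: "u:?B"
 then obtain b n where bn: "b:?C (p - 1)" "n:N Int ?C p" "u = d b + n" unfolding BB_def by blast
 have "d u = d n" using ddN[OF Ch_cs[OF bn(1)]] by (simp add: bn(3) lin_add[OF ld])
 then show "u:?Z" using B_Z[OF u] dN[of n p] bn(2) by (simp add: ZZ_def)
 qed
 have db: "d b:?B" if "b:?C (p - 1)" for b
 proof -
 have "d b = d b + 0" "0:N Int ?C p" using lN by (simp_all add: lsub_0)
 then show ?thesis unfolding BB_def using that by blast
 qed
 have W: "W = e p ` ?B"
 proof
 show "W <= e p ` ?B"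
 proof
 fix y assume "y:W"
 then obtain b where b: "b:?C (p - 1)" "y = cech_differential R fs (p - 1) (e (p - 1) b)"
 unfolding W_def e_im[symmetric] by blast
 then show "y:e p ` ?B" using e_diff[OF b(1)] db[OF b(1)] by auto
 qed
 show "e p ` ?B <= W"
 proof
 fix y assume "y:e p ` ?B"
 then obtain b n where bn: "b:?C (p - 1)" "n:N Int ?C p" "y = e p (d b + n)" unfolding BB_def by blast
 have dbP: "d b:cs P" "n:cs P" using dP(1)[OF Ch_cs[OF bn(1)]] bn(2) Ch_cs by auto
 have "E S (d b + n) = E S (d b)" if S: "S <= X" for S
 using bn(2) that E_add[OF S dbP] E_car[OF S dbP(1)] abelian_monoid.r_zero[OF kmod.axioms(1)[OF Lk[OF S]]] by (simp add: N')
 then have "e p (d b + n) = e p (d b)" using I by (auto simp: e_def fun_eq_iff)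
 then have "y = cech_differential R fs (p - 1) (e (p - 1) b)" using e_diff[OF bn(1)] bn(3) by simp
 then show "y:W" unfolding W_def e_im[symmetric] using bn(1) by blast
 qed
 qed
 have img: "img V' ?Z (e p)" unfolding img_def
 proof (intro conjI ballI allI)
 show "lsub ?Z" by (rule lZ)
 have "e p ` ?Z = {c:e p ` ?C p. cech_differential R fs p c = \<zero>\<^bsub>?V (p + 1) a\<^esub>}"
 proof (intro equalityI subsetI)
 fix y assume "y:e p ` ?Z"
 then obtain u where u: "u:?Z" "y = e p u" by blast
 then show "y:{c:e p ` ?C p. cech_differential R fs p c = \<zero>\<^bsub>?V (p + 1) a\<^esub>}"
 using ZC[OF u(1)] e_diff[OF ZC(1)[OF u(1)]] e_zero[OF dP(2)[OF ZC(2,1)[OF u(1)]]] by simp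
 next
 fix y assume "y:{c:e p ` ?C p. cech_differential R fs p c = \<zero>\<^bsub>?V (p + 1) a\<^esub>}"
 then obtain u where u: "u:?C p" "y = e p u" "cech_differential R fs p (e p u) = \<zero>\<^bsub>?V (p + 1) a\<^esub>" by auto
 then have "d u:N" using e_diff[OF u(1)] e_zero[OF dP(2)[OF Ch_cs[OF u(1)] u(1)]] by simp
 then show "y:e p ` ?Z" using u by (auto simp: ZZ_def)
 qed
 then show "e p ` ?Z = carrier V'" unfolding V'_def e_im[symmetric] by simp
 fix u assume u: "u:?Z"
 show "e p (sc b u) = b \<odot>\<^bsub>V'\<^esub> e p u" for b using e_sc[OF ZC(2)[OF u]] by (simp add: V'_def)
 show "e p (u + v) = e p u \<oplus>\<^bsub>V'\<^esub> e p v" if v: "v:?Z" for v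
 using e_add[OF ZC(2)[OF u] ZC(2)[OF v]] by (simp add: V'_def)
 qed
 have ker: "u:?B" if u: "u:?Z" "e p u:W" for u
 proof -
 from u(2) obtain b where b: "b:?C (p - 1)" "e p u = e p (d b)"
 unfolding W_def e_im[symmetric] using e_diff by fastforce
 have dbC: "d b:?C p" using dP(2)[OF Ch_cs[OF b(1)] b(1)] by simp
 have uC: "u:?C p" using ZC(1)[OF u(1)] .
 have "u - d b:N"
 proof -
 have "E S (u - d b) = \<zero>\<^bsub>L S\<^esub>" if S: "S <= X" for S
 proof (cases "S:?I p")
 case True
 then have "E S u = E S (d b)" using fun_cong[OF b(2), of S] by (simp add: e_def)
 then show ?thesis
 unfolding E_def lin_diff[OF lblk]
 by (subst kmod.ev_eq_iff[OF Lk[OF S] blk_cs[OF Ch_cs[OF uC]] blk_cs[OF Ch_cs[OF dbC]] vcar])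
 next
 case False
 have "u - d b:?C p" using uC dbC by (rule lsub_diff[OF lsub_Ch])
 then have "blk S (u - d b) = 0" unfolding blk_def Ch_def
 by (rule rst_disjoint) (use False S in \<open>auto simp: I\<close>)
 then show ?thesis by (simp add: E_def kmod.ev_0[OF Lk[OF S]])
 qed
 then show ?thesis using lsub_diff[OF lsub_cs Ch_cs[OF uC] Ch_cs[OF dbC]] by (simp add: N')
 qed
 moreover have "u - d b:?C p" using uC dbC by (rule lsub_diff[OF lsub_Ch])
 ultimately have "d b + (u - d b):?B" unfolding BB_def using b(1) by blast
 then show ?thesis by simp
 qed
 have "qb ?Z ?B B" using coh by (simp add: coh_def)
 from quot_free[OF img lB BZ W ker this] show ?thesis
 unfolding cech_cohomology_def V'_def W_def .
qed

end

section \<open>Evaluation of formal combinations, and Cech complexes inside cubes\<close>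

lemma coh_cong_gr:
 fixes N :: "('x, 'k::field) pm set"
 assumes "!!x. x:P==>gr x = gr' x"
 shows "coh P N gr dl d g B = coh P N gr' dl d g B"
proof -
 have "(Ch P gr g :: ('x, 'k) pm set) = Ch P gr' g" for g
 unfolding Ch_def by (rule arg_cong[where f = cs]) (use assms in auto)
 then show ?thesis by (simp add: coh_def ZZ_def BB_def)
qed

lemma tag_slice: "tag S (slice S c) = rst {x. fst x = S} c"
 by (rule pmI) (auto simp: lookup_tag lookup_slice lookup_rst)

lemma (in kmod) ev_tag:
 assumes "w:cs P" "!!e. e:P==>v (S, e):carrier L"
 shows "ev v (tag S w) = ev (%e. v (S, e)) w"
proof -
 have "keys (tag S w) = Pair S ` keys w" by (auto simp: in_keys_iff lookup_tag split: if_splits)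
 then have "ev v (tag S w) = (\<Oplus>x\<in>Pair S ` keys w. lookup (tag S w) x \<odot> v x)" by (simp add: ev_def)
 also have "... = (\<Oplus>e\<in>keys w. lookup (tag S w) (S, e) \<odot> v (S, e))"
 using assms by (intro add.finprod_reindex) (auto simp: cs_def inj_on_def)
 finally show ?thesis by (simp add: ev_def lookup_tag)
qed

lemma ev_hom:
 assumes L: "kmod L" and L': "kmod L'"
 and v: "!!e. e:P==>v e:carrier L" and w: "w:cs P"
 and h: "!!x. x:carrier L==>h x:carrier L'"
 "!!x y. x:carrier L==>y:carrier L==>h (x \<oplus>\<^bsub>L\<^esub> y) = h x \<oplus>\<^bsub>L'\<^esub> h y"
 "!!c x. x:carrier L==>h (c \<odot>\<^bsub>L\<^esub> x) = c \<odot>\<^bsub>L'\<^esub> h x" "h \<zero>\<^bsub>L\<^esub> = \<zero>\<^bsub>L'\<^esub>"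
 and lg: "lin g" and g: "!!e. e:P==>g (single e 1):cs P'"
 and v': "!!e. e:P'==>v' e:carrier L'"
 and base: "!!e. e:P==>kmod.ev L' v' (g (single e 1)) = h (v e)"
 shows "kmod.ev L' v' (g w) = h (kmod.ev L v w)"
proof -
 interpret L: kmod L by fact
 interpret L': kmod L' by fact
 have gw: "g w:cs P'" if "w:cs P" for w
 using that by (rule lin_cs_mem[OF _ lg lsub_cs]) (rule g)
 have "w:{w:cs P. L'.ev v' (g w) = h (L.ev v w)}"
 proof (rule cs_induct[OF w])
 show "lsub {w:cs P. L'.ev v' (g w) = h (L.ev v w)}"
 proof (rule lsubI)
 show "0:{w:cs P. L'.ev v' (g w) = h (L.ev v w)}" by (simp add: lsub_0 lin_0[OF lg] h(4))
 show "a + b:{w:cs P. L'.ev v' (g w) = h (L.ev v w)}"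
 if ab: "a:{w:cs P. L'.ev v' (g w) = h (L.ev v w)}" "b:{w:cs P. L'.ev v' (g w) = h (L.ev v w)}" for a b
 proof -
 have c: "a:cs P" "b:cs P" using ab by auto
 have "L'.ev v' (g (a + b)) = L'.ev v' (g a) \<oplus>\<^bsub>L'\<^esub> L'.ev v' (g b)"
 unfolding lin_add[OF lg] by (rule L'.ev_add[OF gw[OF c(1)] gw[OF c(2)] v'])
 moreover have "L.ev v (a + b) = L.ev v a \<oplus>\<^bsub>L\<^esub> L.ev v b" by (rule L.ev_add[OF c v])
 ultimately show ?thesis using ab h(2)[OF L.ev_closed[OF c(1) v] L.ev_closed[OF c(2) v]] by (simp add: lsub_add)
 qed
 show "sc k a:{w:cs P. L'.ev v' (g w) = h (L.ev v w)}"
 if a: "a:{w:cs P. L'.ev v' (g w) = h (L.ev v w)}" for k a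
 proof -
 have c: "a:cs P" using a by auto
 have "L'.ev v' (g (sc k a)) = k \<odot>\<^bsub>L'\<^esub> L'.ev v' (g a)"
 unfolding lin_sc[OF lg] by (rule L'.ev_sc[OF gw[OF c] v'])
 moreover have "L.ev v (sc k a) = k \<odot>\<^bsub>L\<^esub> L.ev v a" by (rule L.ev_sc[OF c v])
 ultimately show ?thesis using a h(3)[OF L.ev_closed[OF c v]] by (simp add: lsub_sc)
 qed
 qed
 show "single e 1:{w:cs P. L'.ev v' (g w) = h (L.ev v w)}" if "e:P" for e
 using that base[OF that] L.ev_single[of v e 1, OF v[OF that]] v[OF that] by (simp add: single_cs)
 qed
 then show ?thesis by simp
qed

text \<open>Multiplication by the fraction \<open>x/t\<close> on a localization, with the union over
  representatives as in \<open>localization_map\<close>.\<close>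

definition xm :: "('k, 'r) graded_algebra=>'r set=>'r=>'r=>('r \<times> 'r) set=>('r \<times> 'r) set" where
 "xm R Sg x t Y = (\<Union>(r, s)\<in>Y. frac R Sg (x \<otimes>\<^bsub>R\<^esub> r) (t \<otimes>\<^bsub>R\<^esub> s))"

context galg
begin

lemma xm_frac:
 assumes Sg: "mset Sg" and x: "x:carrier R" and t: "t:Sg" and r: "r:carrier R" and s: "s:Sg"
 shows "xm R Sg x t (frac R Sg r s) = frac R Sg (x \<otimes> r) (t \<otimes> s)"
proof -
 note ms = ms_car[OF Sg] ms_mult[OF Sg]
 have *: "frac R Sg (x \<otimes> r') (t \<otimes> s') = frac R Sg (x \<otimes> r) (t \<otimes> s)" if xy: "(r', s'):frac R Sg r s" for r' s'
 proof -
 obtain u where u: "r':carrier R" "s':Sg" "u:Sg" "u \<otimes> (r \<otimes> s') = u \<otimes> (r' \<otimes> s)"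
 using xy unfolding frac_mem[OF Sg] by blast
 have c: "u:carrier R" "s':carrier R" "s:carrier R" "t:carrier R" using u s t ms by auto
 have "u \<otimes> ((x \<otimes> r') \<otimes> (t \<otimes> s)) = x \<otimes> t \<otimes> (u \<otimes> (r' \<otimes> s))" using c u(1-3) x r by (simp add: m_ac)
 also have "... = u \<otimes> ((x \<otimes> r) \<otimes> (t \<otimes> s'))" unfolding u(4)[symmetric] using c u(1-3) x r by (simp add: m_ac)
 finally show ?thesis using u x r s t ms by (intro frac_eqI[OF Sg, where u = u]) auto
 qed
 have "xm R Sg x t (frac R Sg r s) = (\<Union>(r', s')\<in>frac R Sg r s. frac R Sg (x \<otimes> r) (t \<otimes> s))"
 unfolding xm_def using * by (auto simp: split_def)
 then show ?thesis using frac_self[OF Sg r s] by fastforce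
qed

lemma xm_hom:
 assumes Sg: "mset Sg" and x: "x:carrier R" and t: "t:Sg" and Y: "Y:carrier (localization R Sg)"
 shows "xm R Sg x t Y:carrier (localization R Sg)"
 and "xm R Sg x t (c \<odot>\<^bsub>localization R Sg\<^esub> Y) = c \<odot>\<^bsub>localization R Sg\<^esub> xm R Sg x t Y"
 and "Z:carrier (localization R Sg)==>
 xm R Sg x t (Y \<oplus>\<^bsub>localization R Sg\<^esub> Z) = xm R Sg x t Y \<oplus>\<^bsub>localization R Sg\<^esub> xm R Sg x t Z"
 and "xm R Sg x t \<zero>\<^bsub>localization R Sg\<^esub> = \<zero>\<^bsub>localization R Sg\<^esub>"
proof -
 note ms = ms_car[OF Sg] ms_mult[OF Sg]
 from Y obtain r s where rs: "Y = frac R Sg r s" "r:carrier R" "s:Sg" by (rule locE[OF Sg])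
 note X = xm_frac[OF Sg x t]
 have tc: "t:carrier R" "s:carrier R" using t rs ms by auto
 show "xm R Sg x t Y:carrier (localization R Sg)"
 unfolding rs(1) X[OF rs(2,3)] loc_simps(1)[OF Sg] using rs ms t x by blast
 show "xm R Sg x t (c \<odot>\<^bsub>localization R Sg\<^esub> Y) = c \<odot>\<^bsub>localization R Sg\<^esub> xm R Sg x t Y"
 using rs x t by (simp add: rs(1) X loc_smult[OF Sg] ms rs_mult2)
 show "xm R Sg x t \<zero>\<^bsub>localization R Sg\<^esub> = \<zero>\<^bsub>localization R Sg\<^esub>"
 unfolding loc_simps(2)[OF Sg] X[OF zero_closed ms_one[OF Sg]]
 using x t tc by (intro frac_eqI[OF Sg, where u = \<one>]) (auto simp: ms ms_one[OF Sg])
 assume "Z:carrier (localization R Sg)"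
 then obtain r' s' where rs': "Z = frac R Sg r' s'" "r':carrier R" "s':Sg" by (rule locE[OF Sg])
 have tc': "s':carrier R" using rs' ms by auto
 have "xm R Sg x t (Y \<oplus>\<^bsub>localization R Sg\<^esub> Z) = frac R Sg (x \<otimes> (r \<otimes> s' \<oplus> r' \<otimes> s)) (t \<otimes> (s \<otimes> s'))"
 unfolding rs(1) rs'(1) loc_add[OF Sg rs(2) rs'(2) rs(3) rs'(3)] using rs rs' tc tc' ms by (intro X) auto
 also have "... = frac R Sg ((x \<otimes> r) \<otimes> (t \<otimes> s') \<oplus> (x \<otimes> r') \<otimes> (t \<otimes> s)) ((t \<otimes> s) \<otimes> (t \<otimes> s'))"
 using rs rs' tc tc' ms x t
 by (intro frac_eqI[OF Sg, where u = \<one>]) (auto simp: ms_one[OF Sg] l_distr r_distr m_ac)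
 also have "... = xm R Sg x t Y \<oplus>\<^bsub>localization R Sg\<^esub> xm R Sg x t Z"
 unfolding rs(1) rs'(1) X[OF rs(2,3)] X[OF rs'(2,3)] using rs rs' ms x t by (intro loc_add[OF Sg, symmetric]) auto
 finally show "xm R Sg x t (Y \<oplus>\<^bsub>localization R Sg\<^esub> Z) = xm R Sg x t Y \<oplus>\<^bsub>localization R Sg\<^esub> xm R Sg x t Z" .
qed

text \<open>The list \<open>hs\<close> occupies a block of positions, starting at \<open>k\<close>,
  in a larger cube; its Cech complex is the part over the faces inside this block. Different lists
  can thus be compared within one cube. \<open>sh\<close> and \<open>us\<close> translate
  positions.\<close>

lemma cech_cube_free:
 fixes hs :: "'r list" and val :: "nat set=>'e=>('r \<times> 'r) set" and k :: nat
 defines "sh == %S. (%i. i - k) ` S" and "F == {S. S <= {k..<k + length hs}}"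
 assumes cube: "cube X E NS (%(S, e). int (card S)) 1"
 and hs: "set hs <= carrier R" and X: "{k..<k + length hs} <= X"
 and val: "!!S e. S:F==>e:E S==>val S e:gcomp (cech_localization R hs (sh S)) a"
 and val_ins: "!!S e j. insert j S:F==>j ~: S==>e:E S==>
 val (insert j S) e = localization_map R (monomials R hs (sh (insert j S))) (val S e)"
 and sur: "!!S Y. S:F==>Y:gcomp (cech_localization R hs (sh S)) a==>
 EX w:cs (E S). kmod.ev (cech_localization R hs (sh S)) (val S) w = Y"
 and NS: "!!S w. S:F==>w:cs (E S)==>
 w:NS S <-> kmod.ev (cech_localization R hs (sh S)) (val S) w = \<zero>\<^bsub>cech_localization R hs (sh S)\<^esub>"
 and coh: "cube.cohF X E NS (%(S, e). int (card S)) 1 F p B"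
 shows "is_free (cech_cohomology R hs p a) B"
proof -
 interpret cube X E NS "%(S, e). int (card S)" 1 by (rule cube)
 let ?X = "{..<length hs}" and ?L = "%S. cech_localization R hs S"
 define us where "us T = (%i. i + k) ` T" for T :: "nat set"
 have sh_us: "sh (us T) = T" for T by (auto simp: sh_def us_def image_image)
 have us_sh: "us (sh S) = S" if "S:F" for S
 proof -
 have "us (sh S) = (%i. i - k + k) ` S" by (simp add: us_def sh_def image_image)
 also have "... = (%i. i) ` S" by (rule image_cong) (use that in \<open>auto simp: F_def\<close>)
 finally show ?thesis by simp
 qed
 have us_F: "us T:F" if "T <= ?X" for T using that by (auto simp: us_def F_def)
 have sh_X: "sh S <= ?X" if "S:F" for S
 proof
 fix y assume "y:sh S"
 then obtain i where "i:S" "y = i - k" by (auto simp: sh_def)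
 moreover from this have "i:{k..<k + length hs}" using that by (auto simp: F_def)
 ultimately show "y:?X" by auto
 qed
 have card_sh: "card (sh S) = card S" if "S:F" for S
 proof -
 have "inj_on (%i. i - k) S"
 proof (rule inj_onI)
 fix x y assume "x:S" "y:S" "x - k = y - k"
 moreover from this have "k <= x" "k <= y" using that by (auto simp: F_def)
 ultimately show "x = y" by simp
 qed
 then show ?thesis unfolding sh_def by (rule card_image)
 qed
 have FX: "S <= X" if "S:F" for S using that X by (auto simp: F_def)
 have cF: "conv F" unfolding conv_def F_def by blast
 define P where "P = QQ F"
 have P: "(S, e):P <-> S:F&e:E S" for S e using FX by (auto simp: P_def QQ_def)
 define sp where "sp = (%x :: nat set \<times> 'e. sh (fst x))"
 define ins where "ins j x = (insert (j + k) (fst x), snd x)" for j and x :: "nat set \<times> 'e"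
 define vl where "vl x = val (fst x) (snd x)" for x
 have Lk: "kmod (?L S)" if "S <= ?X" for S
 unfolding cld by (rule loc_kmod[OF mset_monomials[OF hs that]])
 have gL: "gcomp (?L S) a <= carrier (?L S)" if "S <= ?X" for S
 unfolding cld by (rule loc_gcomp_carrier[OF mset_monomials[OF hs that]])
 have vcar: "val S e:carrier (?L (sh S))" if "S:F" "e:E S" for S e
 using val[OF that] gL[OF sh_X[OF that(1)]] by blast
 have blk: "{x:P. sp x = T} = {us T} \<times> E (us T)" if "T <= ?X" for T
 using us_F[OF that] us_sh sh_us by (auto simp: P sp_def)
 have slc: "slice S c:cs (E S)" if "c:cs P" "S:F" for c :: "nat set \<times> 'e \<Rightarrow>\<^sub>0 'k" and S
 using that(1) by (auto simp: cs_iff_lookup lookup_slice P)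
 have evr: "kmod.ev (?L T) vl (rst {x. sp x = T} c) = kmod.ev (?L T) (val (us T)) (slice (us T) c)"
 if c: "c:cs P" and T: "T <= ?X" for c :: "nat set \<times> 'e \<Rightarrow>\<^sub>0 'k" and T
 proof -
 have "rst {x. sp x = T} c = rst {x. fst x = us T} c"
 proof (rule pmI)
 fix x show "lookup (rst {x. sp x = T} c) x = lookup (rst {x. fst x = us T} c) x"
 using c us_sh sh_us P by (cases x) (auto simp: lookup_rst sp_def cs_iff_lookup)
 qed
 also have "... = tag (us T) (slice (us T) c)" by (simp add: tag_slice)
 finally show ?thesis
 using kmod.ev_tag[OF Lk[OF T] slc[OF c us_F[OF T]], of vl] vcar[OF us_F[OF T]] by (simp add: sh_us vl_def)
 qed
 have inF: "insert (j + k) S:F" "j + k ~: S" "sh (insert (j + k) S) = insert j (sh S)"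
 if "S:F" "j:?X - sh S" for j S
 proof -
 show "insert (j + k) S:F" using that by (auto simp: F_def)
 show "sh (insert (j + k) S) = insert j (sh S)" by (simp add: sh_def)
 show "j + k ~: S"
 proof
 assume "j + k:S"
 then have "j + k - k:sh S" unfolding sh_def by (rule imageI)
 then show False using that by simp
 qed
 qed
 show ?thesis
 proof (rule cech_cohomology_free[where P = P and sp = sp and ins = ins and val = vl and d = "dQ F" and N = "NN Int cs (QQ F)"])
 show "set hs <= carrier R" by (rule hs)
 fix x assume x: "x:P"
 obtain S e where S: "x = (S, e)" "S:F" "e:E S" using x P by (cases x) auto
 show "sp x <= ?X" using sh_X S by (simp add: sp_def)
 show "vl x:gcomp (?L (sp x)) a" using val S by (simp add: vl_def sp_def)
 show "dQ F (dQ F (single x 1)) = 0" using cpx_conv[OF cF] x unfolding cpx_def P_def by blast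
 show "dQ F (single x 1) = (\<Sum>j\<in>?X - sp x. single (ins j x) (sgnS (sp x) j))"
 proof -
 have "dQ F (single x 1) = (\<Sum>j\<in>X - S. if insert j S:F then single (insert j S, e) (sgnS S j) else 0)"
 unfolding dQ_def S dX_def by (simp add: lin_sum rst_single, rule sum.cong)
 (use E_mono FX S in \<open>auto simp: QQ_def, metis insert_subset subset_insertI subsetD\<close>)
 also have "... = (\<Sum>j\<in>{k..<k + length hs} - S. single (insert j S, e) (sgnS S j))"
 using finX X S by (intro sum.mono_neutral_cong_right) (auto simp: F_def)
 also have "... = (\<Sum>j\<in>?X - sp x. single (ins j x) (sgnS (sp x) j))"
 proof (rule sum.reindex_bij_witness[where i = "%j. j + k" and j = "%j. j - k"])
 fix j assume j: "j:{k..<k + length hs} - S"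
 then show "j - k + k = j" by simp
 show "j - k:?X - sp x"
 proof -
 have "j - k ~: sh S"
 proof
 assume "j - k:sh S"
 then have "j - k + k:us (sh S)" unfolding us_def by (rule imageI)
 then show False using us_sh[OF S(2)] j by simp
 qed
 then show ?thesis using j by (auto simp: sp_def S)
 qed
 have "card {i:sh S. i < j - k} = card {i:S. i < j}"
 proof (rule bij_betw_same_card[of "%i. i + k"], rule bij_betw_imageI)
 show "(%i. i + k) ` {i:sh S. i < j - k} = {i:S. i < j}"
 proof (intro equalityI subsetI)
 fix y assume "y:(%i. i + k) ` {i:sh S. i < j - k}"
 then obtain i where "i:sh S" "i < j - k" "y = i + k" by blast
 moreover from this have "y:us (sh S)" by (auto simp: us_def)
 ultimately show "y:{i:S. i < j}" using us_sh[OF S(2)] by auto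
 next
 fix y assume y: "y:{i:S. i < j}"
 then have "y:us (sh S)" using us_sh[OF S(2)] by simp
 then obtain i where "i:sh S" "y = i + k" by (auto simp: us_def)
 then show "y:(%i. i + k) ` {i:sh S. i < j - k}" using y j by auto
 qed
 qed (simp add: inj_on_def)
 then show "single (ins (j - k) x) (sgnS (sp x) (j - k)) = single (insert j S, e) (sgnS S j)"
 using j by (simp add: ins_def S sp_def sgnS_def)
 next
 fix j assume j: "j:?X - sp x"
 then show "j + k - k = j" by simp
 show "j + k:{k..<k + length hs} - S" using inF(2)[OF S(2), of j] j by (auto simp: sp_def S)
 qed
 finally show ?thesis .
 qed
 fix j assume j: "j:?X - sp x"
 then have jS: "j:?X - sh S" by (simp add: sp_def S)
 note iF = inF[OF S(2) jS]
 show "ins j x:P&sp (ins j x) = insert j (sp x)"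
 using iF E_mono[of S "insert (j + k) S"] FX[OF iF(1)] S by (auto simp: ins_def P sp_def)
 show "vl (ins j x) = localization_map R (monomials R hs (insert j (sp x))) (vl x)"
 using val_ins[OF iF(1,2) S(3)] iF(3) by (simp add: vl_def ins_def S sp_def)
 next
 fix T Y assume T: "T <= ?X" and Y: "Y:gcomp (?L T) a"
 obtain w where w: "w:cs (E (us T))" "kmod.ev (?L T) (val (us T)) w = Y"
 using sur[OF us_F[OF T], of Y] Y by (auto simp: sh_us)
 have "tag (us T) w:cs {x:P. sp x = T}" 
 proof -
 have "Sigma {us T} E = {us T} \<times> E (us T)" by auto
 then show ?thesis unfolding blk[OF T] using tag_cs[of "us T" "{us T}" w E] w(1) by (simp only: singletonI)
 qed
 moreover have "kmod.ev (?L T) vl (tag (us T) w) = Y"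
 using kmod.ev_tag[OF Lk[OF T] w(1), of vl] vcar[OF us_F[OF T]] w(2) by (simp add: sh_us vl_def)
 ultimately show "EX w:cs {x:P. sp x = T}. kmod.ev (?L T) vl w = Y" by blast
 next
 show "lin (dQ F)" using cpx_conv[OF cF] by (simp add: cpx_def)
 show "NN Int cs (QQ F) = {c:cs P. \<forall>S\<subseteq>?X. kmod.ev (?L S) vl (rst {x. sp x = S} c) = \<zero>\<^bsub>?L S\<^esub>}"
 proof (intro equalityI subsetI)
 fix c assume "c:NN Int cs (QQ F)"
 then have c: "c:NN" "c:cs P" by (auto simp: P_def)
 have "kmod.ev (?L T) vl (rst {x. sp x = T} c) = \<zero>\<^bsub>?L T\<^esub>" if T: "T <= ?X" for T
 proof -
 have "slice (us T) c:NS (us T)" using c(1) FX[OF us_F[OF T]] by (simp add: NN_def)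
 then show ?thesis using NS[OF us_F[OF T] slc[OF c(2) us_F[OF T]]] evr[OF c(2) T] by (simp add: sh_us)
 qed
 then show "c:{c:cs P. \<forall>S\<subseteq>?X. kmod.ev (?L S) vl (rst {x. sp x = S} c) = \<zero>\<^bsub>?L S\<^esub>}" using c by simp
 next
 fix c assume "c:{c:cs P. \<forall>S\<subseteq>?X. kmod.ev (?L S) vl (rst {x. sp x = S} c) = \<zero>\<^bsub>?L S\<^esub>}"
 then have c: "c:cs P" and z: "!!T. T <= ?X==>kmod.ev (?L T) vl (rst {x. sp x = T} c) = \<zero>\<^bsub>?L T\<^esub>" by auto
 have cPP: "c:cs PP" using c QQ_PP unfolding P_def by (blast intro: cs_mono)
 have "slice S c:NS S" if S: "S <= X" for S
 proof (cases "S:F")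
 case True
 then show ?thesis using NS[OF True slc[OF c True]] evr[OF c sh_X[OF True]] z[OF sh_X[OF True]] us_sh[OF True] by simp
 next
 case False
 then have "slice S c = 0" using c by (intro pmI) (auto simp: lookup_slice cs_iff_lookup P)
 then show ?thesis using lsub_NS[OF S] by (simp add: lsub_0)
 qed
 then show "c:NN Int cs (QQ F)" using c cPP by (simp add: NN_def P_def)
 qed
 have "coh (QQ F) (NN Int cs (QQ F)) (%(S, e). int (card S)) 1 (dQ F) p B" using coh by (simp add: cohF_def)
 then show "coh P (NN Int cs (QQ F)) (%x. int (card (sp x))) 1 (dQ F) p B"
 unfolding P_def
 by (subst (asm) coh_cong_gr[where gr' = "%x. int (card (sp x))"]) (auto simp: sp_def QQ_def card_sh)
 qed
qed

end

section \<open>Independence of the generators\<close>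

context galg
begin

text \<open>Elements of an ideal are finite sums of multiples of generators; the inductive form
  allows \<open>acU_F\<close> to argue summand by summand.\<close>

inductive_set sums :: "'r set=>'r set" for W where
 sums_zero: "\<zero>:sums W"
| sums_step: "c:sums W==>w:W==>c \<oplus> w:sums W"

lemma sums_car: "W <= carrier R==>c:sums W==>c:carrier R"
 by (rotate_tac, induction rule: sums.induct) auto

lemma sums_add: "W <= carrier R==>c:sums W==>c':sums W==>c \<oplus> c':sums W"
proof (rotate_tac 2, induction rule: sums.induct)
 case sums_zero
 then show ?case using sums_car by simp
next
 case (sums_step c' w)
 have "c \<oplus> (c' \<oplus> w) = (c \<oplus> c') \<oplus> w" using sums_step sums_car by (intro a_assoc[symmetric]) auto
 then show ?case using sums.sums_step[OF sums_step.IH[OF sums_step.prems] sums_step.hyps(2)] by simp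
qed

lemma ideal_sums:
 assumes "G <= carrier R"
 shows "Idl G <= sums {r \<otimes> f | r f. r:carrier R&f:G}"
proof -
 let ?W = "{r \<otimes> f | r f. r:carrier R&f:G}"
 have W: "?W <= carrier R" using assms by auto
 have mult: "y \<otimes> c:sums ?W" if "y:carrier R" "c:sums ?W" for y c
 using that(2)
 proof (induction rule: sums.induct)
 case sums_zero
 then show ?case using that(1) sums.sums_zero by simp
 next
 case (sums_step c w)
 obtain r f where w: "w = r \<otimes> f" "r:carrier R" "f:G" using sums_step.hyps(2) by blast
 have c: "c:carrier R" "f:carrier R" using sums_car[OF W sums_step.hyps(1)] w assms by auto
 have "y \<otimes> (c \<oplus> w) = y \<otimes> c \<oplus> (y \<otimes> r) \<otimes> f" using c w that(1) by (simp add: r_distr m_assoc)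
 moreover have "(y \<otimes> r) \<otimes> f:?W" using w that(1) by blast
 ultimately show ?case using sums.sums_step[OF sums_step.IH] by simp
 qed
 have "ideal (sums ?W) R"
 proof (rule idealI)
 show "ring R" by (rule ring_axioms)
 show "subgroup (sums ?W) (add_monoid R)"
 proof (rule subgroup.intro)
 show "sums ?W <= carrier (add_monoid R)" using sums_car[OF W] by auto
 show "x \<otimes>\<^bsub>add_monoid R\<^esub> y:sums ?W" if "x:sums ?W" "y:sums ?W" for x y
 using sums_add[OF W that] by simp
 show "\<one>\<^bsub>add_monoid R\<^esub>:sums ?W" by (simp add: sums.sums_zero)
 show "inv\<^bsub>add_monoid R\<^esub> x:sums ?W" if "x:sums ?W" for x
 proof -
 have x: "x:carrier R" by (rule sums_car[OF W that])
 have "inv\<^bsub>add_monoid R\<^esub> x = (\<ominus> \<one>) \<otimes> x" using x by (simp add: a_inv_def[symmetric] l_minus)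
 then show ?thesis using mult[OF _ that, of "\<ominus> \<one>"] by simp
 qed
 qed
 show "x \<otimes> c:sums ?W" "c \<otimes> x:sums ?W" if "c:sums ?W" "x:carrier R" for c x
 using mult[OF that(2,1)] m_comm[OF that(2) sums_car[OF W that(1)]] by auto
 qed
 moreover have "G <= sums ?W"
 proof
 fix f assume "f:G"
 then have "\<one> \<otimes> f:?W" "f:carrier R" using assms by blast+
 then show "f:sums ?W" using sums.sums_step[OF sums.sums_zero, of "\<one> \<otimes> f" ?W] by simp
 qed
 ultimately show ?thesis by (rule genideal_minimal)
qed

text \<open>The Cech complex of an arbitrary list of homogeneous elements is presented by all fractions
 \<open>r / f\<^bsup>\<epsilon>\<^esup>\<close>; the exponent \<open>\<epsilon>\<close> is part of the key, so that the degree is well-defined even if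
 the denominator vanishes.\<close>

context
 fixes fs :: "'r list" and dg :: "nat=>int"
 assumes fsdg: "!!i. i < length fs==>fs ! i:gcomp R (dg i)"
begin

abbreviation (input) "XX == {..<length fs}"

definition de :: "(nat=>nat)=>int" where "de ep = (\<Sum>i\<in>XX. int (ep i) * dg i)"

definition EU :: "int=>nat set=>('r \<times> (nat=>nat)) set" where
 "EU a S = {(r, ep). (ALL i. i ~: S --> ep i = 0)&r:gcomp R (a + de ep)}"

definition LS :: "nat set=>('k, ('r \<times> 'r) set) graded_algebra" where "LS S = cech_localization R fs S"

definition vU :: "nat set=>'r \<times> (nat=>nat)=>('r \<times> 'r) set" where
 "vU S = (%(r, ep). frac R (monomials R fs S) r (mon fs XX ep))"

definition NU :: "int=>nat set=>('r \<times> (nat=>nat) \<Rightarrow>\<^sub>0 'k) set" where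
 "NU a S = {w:cs (EU a S). kmod.ev (LS S) (vU S) w = \<zero>\<^bsub>LS S\<^esub>}"

lemma fsU: "set fs <= carrier R"
 using fsdg g_closed by (metis in_set_conv_nth subsetI)

lemma fsc: "i < length fs==>fs ! i:carrier R"
 using fsdg g_closed by blast

lemma msU: "S <= XX==>mset (monomials R fs S)"
 by (rule mset_monomials[OF fsU])

lemma LkU: "S <= XX==>kmod (LS S)"
 unfolding LS_def cld by (rule loc_kmod[OF msU])

lemma mon_mem: "S <= XX==>(ALL i. i ~: S --> ep i = 0)==>mon fs XX ep:monomials R fs S"
 using mon_mono[OF fsU, of S XX ep] unfolding monomials_mon by (metis rangeI subset_refl)

lemma monX_car: "mon fs XX ep:carrier R"
 by (rule mon_closed[OF fsU]) simp

lemma monX_mult: "mon fs XX ep \<otimes> mon fs XX ep' = mon fs XX (%i. ep i + ep' i)"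
 by (rule mon_mult[OF fsU]) simp

lemma monX_deg: "mon fs XX ep:gcomp R (de ep)"
 unfolding de_def by (rule mon_degree[OF fsU]) (auto intro: fsdg)

lemma monX_single: "i < length fs==>mon fs XX (%j. if j = i then n else 0) = (fs ! i) [^] n"
proof -
 assume i: "i < length fs"
 have "mon fs XX (%j. if j = i then n else 0) = (\<Otimes>j\<in>XX. if i = j then (fs ! j) [^] n else \<one>)"
 unfolding mon_def using fsc by (intro finprod_cong') auto
 also have "... = (fs ! i) [^] n" using i fsc by (intro finprod_singleton) auto
 finally show ?thesis .
qed

lemma de_add: "de (%i. ep i + ep' i) = de ep + de ep'"
 by (simp add: de_def sum.distrib algebra_simps)

lemma de_single: "i < length fs==>de (%j. if j = i then n else 0) = int n * dg i"
proof -
 assume "i < length fs"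
 have "de (%j. if j = i then n else 0) = (\<Sum>j\<in>XX. if j = i then int n * dg i else 0)"
 unfolding de_def by (rule sum.cong) auto
 then show ?thesis using \<open>i < length fs\<close> by simp
qed

lemma vU_car: "S <= XX==>e:EU a S==>vU S e:gcomp (LS S) a&vU S e:carrier (LS S)"
proof -
 assume S: "S <= XX" and e: "e:EU a S"
 obtain r ep where e': "e = (r, ep)" "ALL i. i ~: S --> ep i = 0" "r:gcomp R (a + de ep)" using e by (cases e) (auto simp: EU_def)
 have m: "mon fs XX ep:monomials R fs S" by (rule mon_mem[OF S e'(2)])
 show ?thesis
 unfolding LS_def cld loc_simps[OF msU[OF S]] vU_def e' prod.case
 using m monX_deg[of ep] e'(3) g_closed by blast
qed

lemma EU_mono: "S <= T==>EU a S <= EU a T"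
 by (auto simp: EU_def)

lemma vU_map: "S <= T==>T <= XX==>e:EU a S==>localization_map R (monomials R fs T) (vU S e) = vU T e"
proof -
 assume S: "S <= T" "T <= XX" and e: "e:EU a S"
 obtain r ep where e': "e = (r, ep)" "ALL i. i ~: S --> ep i = 0" "r:gcomp R (a + de ep)" using e by (cases e) (auto simp: EU_def)
 have SX: "S <= XX" using S by blast
 show ?thesis unfolding vU_def e'(1) prod.case
 by (rule loc_map[OF msU[OF SX] msU[OF S(2)] monomials_mono[OF fsU S] g_closed[OF e'(3)] mon_mem[OF SX e'(2)]])
qed

lemma ev_map:
 assumes S: "S <= T" "T <= XX" and w: "w:cs (EU a S)"
 shows "kmod.ev (LS T) (vU T) w = localization_map R (monomials R fs T) (kmod.ev (LS S) (vU S) w)"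
proof -
 have SX: "S <= XX" using S by blast
 note hom = loc_map_hom[OF msU[OF SX] msU[OF S(2)] monomials_mono[OF fsU S], folded cld, folded LS_def]
 show ?thesis
 proof (rule ev_hom[OF LkU[OF SX] LkU[OF S(2)] _ w, where g = "%w. w" and P' = "EU a T"])
 show "vU S e:carrier (LS S)" if "e:EU a S" for e using vU_car[OF SX that] by blast
 show "vU T e:carrier (LS T)" if "e:EU a T" for e using vU_car[OF S(2) that] by blast
 show "lin (%w. w)" by (rule lin_id)
 show "single e 1:cs (EU a T)" if "e:EU a S" for e using that EU_mono[OF S(1)] by (intro single_cs) blast
 have z: "\<zero>\<^bsub>LS S\<^esub>:carrier (LS S)" using LkU[OF SX] by (simp add: kmod_def abelian_monoid.zero_closed)
 show "localization_map R (monomials R fs T) \<zero>\<^bsub>LS S\<^esub> = \<zero>\<^bsub>LS T\<^esub>" using hom(4)[OF z] .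
 show "kmod.ev (LS T) (vU T) (single e 1) = localization_map R (monomials R fs T) (vU S e)" if e: "e:EU a S" for e
 proof -
 have eT: "vU T e:carrier (LS T)" using vU_car[OF S(2)] EU_mono[OF S(1)] e by blast
 show ?thesis using kmod.ev_single[of "LS T" "vU T" e 1, OF LkU[OF S(2)] eT] kmod.sm_1[OF LkU[OF S(2)] eT] vU_map[OF S e] by simp
 qed
 qed (use hom in auto)
qed

lemma lsub_NU: "S <= XX==>lsub (NU a S)"
 unfolding NU_def by (rule kmod.ev_lsub[OF LkU]) (use vU_car in auto)

lemma cubeU: "cube XX (EU a) (NU a) (%(S, e). int (card S)) 1"
proof
 show "finite XX" by simp
 show "EU a S <= EU a T" if "S <= T" for S T using EU_mono[OF that] .
 show "NU a S <= NU a T" if "S <= T" "T <= XX" for S T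
 proof
 fix w assume "w:NU a S"
 then have w: "w:cs (EU a S)" "kmod.ev (LS S) (vU S) w = \<zero>\<^bsub>LS S\<^esub>" by (auto simp: NU_def)
 have SX: "S <= XX" using that by blast
 have z: "\<zero>\<^bsub>LS S\<^esub>:carrier (LS S)" using LkU[OF SX] by (simp add: kmod_def abelian_monoid.zero_closed)
 have "localization_map R (monomials R fs T) \<zero>\<^bsub>LS S\<^esub> = \<zero>\<^bsub>LS T\<^esub>"
 using loc_map_hom(4)[OF msU[OF SX] msU[OF that(2)] monomials_mono[OF fsU that], folded cld, folded LS_def, OF z] .
 then show "w:NU a T" using ev_map[OF that w(1)] w cs_mono[OF EU_mono[OF that(1)]] by (simp add: NU_def)
 qed
 show "lsub (NU a S)" if "S <= XX" for S by (rule lsub_NU[OF that])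
 show "(case (insert j S, e) of (S, e)=>int (card S)) = (case (S, e) of (S, e)=>int (card S)) + 1"
 if "S <= XX" "j:XX - S" for S j and e :: "'r \<times> (nat=>nat)"
 using that finite_subset[OF that(1)] by simp
 show "rst {e. (case (S, e) of (S, e)=>int (card S)) = g} n:NU a S" if "S <= XX" "n:NU a S" for S g n
 proof (cases "int (card S) = g")
 case True
 then show ?thesis using that rst_id[of n UNIV UNIV] by (simp add: cs_def)
 next
 case False
 then have "rst {e. (case (S, e) of (S, e)=>int (card S)) = g} n = 0"
 by (intro pmI) (simp add: lookup_rst)
 then show ?thesis using lsub_NU[OF that(1)] by (simp add: lsub_0)
 qed
qed

abbreviation (input) "QU a == cube.QQ XX (EU a)"
abbreviation (input) "NNU a == cube.NN XX (EU a) (NU a)"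
abbreviation (input) "dU a == cube.dQ XX (EU a)"
abbreviation (input) "cohU a == cube.cohF XX (EU a) (NU a) (%(S, e). int (card S)) 1"
abbreviation (input) "acU a == cube.acF XX (EU a) (NU a) (%(S, e). int (card S)) 1"

text \<open>Multiplication by \<open>x / f\<^bsup>\<eta>\<^esup>\<close>.\<close>

definition op :: "'r=>(nat=>nat)=>(nat set \<times> ('r \<times> (nat=>nat)) \<Rightarrow>\<^sub>0 'k)=>(nat set \<times> ('r \<times> (nat=>nat)) \<Rightarrow>\<^sub>0 'k)" where
 "op x eta = lext (%(S, r, ep). single (S, x \<otimes> r, %i. ep i + eta i) 1)"

definition om :: "'r=>(nat=>nat)=>('r \<times> (nat=>nat) \<Rightarrow>\<^sub>0 'k)=>('r \<times> (nat=>nat) \<Rightarrow>\<^sub>0 'k)" where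
 "om x eta = lext (%(r, ep). single (x \<otimes> r, %i. ep i + eta i) 1)"

lemma lin_op [simp]: "lin (op x eta)" and lin_om [simp]: "lin (om x eta)"
 by (simp_all add: op_def om_def)

lemma slice_op: "slice S (op x eta c) = om x eta (slice S c)"
proof (rule lin_eqI[where f = "%c. slice S (op x eta c)" and g = "%c. om x eta (slice S c)"])
 fix y :: "nat set \<times> ('r \<times> (nat=>nat))"
 obtain T r ep where y: "y = (T, r, ep)" by (cases y) auto
 show "slice S (op x eta (single y 1)) = om x eta (slice S (single y 1))"
 by (simp add: y op_def om_def slice_single lin_0)
qed (auto intro: lin_comp)

lemma om_cs:
 assumes "x:gcomp R D" "ALL i. i ~: S --> eta i = 0" "w:cs (EU a S)"
 shows "om x eta w:cs (EU (a + D - de eta) S)"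
 using assms(3)
proof (rule lin_cs_mem[OF _ lin_om lsub_cs])
 fix e assume "e:EU a S"
 then obtain r ep where e: "e = (r, ep)" "ALL i. i ~: S --> ep i = 0" "r:gcomp R (a + de ep)" by (cases e) (auto simp: EU_def)
 have "x \<otimes> r:gcomp R (a + D - de eta + de (%i. ep i + eta i))"
 using g_mult[OF assms(1) e(3)] by (simp add: de_add algebra_simps)
 then show "om x eta (single e 1):cs (EU (a + D - de eta) S)"
 using e assms(2) by (simp add: om_def single_cs EU_def)
qed

lemma om_ev:
 assumes S: "S <= XX" and x: "x:gcomp R D" and eta: "ALL i. i ~: S --> eta i = 0" and w: "w:cs (EU a S)"
 shows "kmod.ev (LS S) (vU S) (om x eta w) = xm R (monomials R fs S) x (mon fs XX eta) (kmod.ev (LS S) (vU S) w)"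
proof -
 note m = mon_mem[OF S eta]
 note hom = xm_hom[OF msU[OF S] g_closed[OF x] m, folded cld, folded LS_def]
 show ?thesis
 proof (rule ev_hom[OF LkU[OF S] LkU[OF S] _ w, where g = "om x eta" and P' = "EU (a + D - de eta) S"])
 show "vU S e:carrier (LS S)" if "e:EU a S" for a e using vU_car[OF S that] by blast
 then show "vU S e:carrier (LS S)" if "e:EU (a + D - de eta) S" for e using that by blast
 show "lin (om x eta)" by simp
 show sc1: "om x eta (single e 1):cs (EU (a + D - de eta) S)" if "e:EU a S" for e
 by (rule om_cs[OF x eta single_cs[OF that]])
 have z: "\<zero>\<^bsub>LS S\<^esub>:carrier (LS S)" using LkU[OF S] by (simp add: kmod_def abelian_monoid.zero_closed)
 show "xm R (monomials R fs S) x (mon fs XX eta) \<zero>\<^bsub>LS S\<^esub> = \<zero>\<^bsub>LS S\<^esub>" using hom(4)[OF z] .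
 show "kmod.ev (LS S) (vU S) (om x eta (single e 1)) = xm R (monomials R fs S) x (mon fs XX eta) (vU S e)" if e: "e:EU a S" for e
 proof -
 obtain r ep where e': "e = (r, ep)" "ALL i. i ~: S --> ep i = 0" "r:gcomp R (a + de ep)" using e by (cases e) (auto simp: EU_def)
 let ?e = "(x \<otimes> r, %i. ep i + eta i)"
 have "om x eta (single e 1) = single ?e 1" by (simp add: om_def e')
 moreover have eT: "vU S ?e:carrier (LS S)"
 proof -
 have "x \<otimes> r:gcomp R (a + D - de eta + de (%i. ep i + eta i))"
 using g_mult[OF x e'(3)] by (simp add: de_add algebra_simps)
 then have "?e:EU (a + D - de eta) S" using e'(2) eta by (simp add: EU_def)
 then show ?thesis using vU_car[OF S] by blast
 qed
 moreover have "vU S ?e = xm R (monomials R fs S) x (mon fs XX eta) (vU S e)"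
 unfolding vU_def e'(1) prod.case xm_frac[OF msU[OF S] g_closed[OF x] m g_closed[OF e'(3)] mon_mem[OF S e'(2)]]
 by (simp add: monX_mult add.commute)
 ultimately show ?thesis using kmod.ev_single[of "LS S" "vU S" ?e 1, OF LkU[OF S] eT] kmod.sm_1[OF LkU[OF S] eT] by simp
 qed
 qed (use hom in auto)
qed

lemma om_NU:
 assumes S: "S <= XX" and x: "x:gcomp R D" and eta: "ALL i. i ~: S --> eta i = 0" and w: "w:NU a S"
 shows "om x eta w:NU (a + D - de eta) S"
proof -
 have w': "w:cs (EU a S)" "kmod.ev (LS S) (vU S) w = \<zero>\<^bsub>LS S\<^esub>" using w by (auto simp: NU_def)
 have z: "\<zero>\<^bsub>LS S\<^esub>:carrier (LS S)" using LkU[OF S] by (simp add: kmod_def abelian_monoid.zero_closed)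
 show ?thesis using om_ev[OF S x eta w'(1)] om_cs[OF x eta w'(1)] w'(2)
 xm_hom(4)[OF msU[OF S] g_closed[OF x] mon_mem[OF S eta], folded cld, folded LS_def, OF z]
 by (simp add: NU_def)
qed

text \<open>The exponents \<open>eta\<close> are supported in every face of \<open>F\<close>, so
  that division by f^eta makes sense at all those faces.\<close>

definition okF :: "nat set set=>(nat=>nat)=>bool" where
 "okF F eta <-> (ALL S:F. ALL i. i ~: S --> eta i = 0)"

lemma QU_mem: "(S, e):QU a F <-> S <= XX&e:EU a S&S:F"
 by (simp add: cube.QQ_def[OF cubeU])

lemma NNU_iff: "c:cs (QU a F)==>c:NNU a <-> (ALL S:F. S <= XX --> slice S c:NU a S)"
proof -
 assume c: "c:cs (QU a F)"
 have "c:cs (cube.PP XX (EU a))" using c cube.QQ_PP[OF cubeU] by (blast intro: cs_mono)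
 moreover have "slice S c:NU a S" if "S ~: F" "S <= XX" for S
 proof -
 have "slice S c = 0" using c that by (intro pmI) (auto simp: lookup_slice cs_iff_lookup QU_mem)
 then show ?thesis using lsub_NU[OF that(2)] by (simp add: lsub_0)
 qed
 ultimately show ?thesis unfolding cube.NN_def[OF cubeU] by blast
qed

lemma slice_QU: "c:cs (QU a F)==>slice S c:cs (EU a S)"
 by (auto simp: cs_iff_lookup lookup_slice QU_mem)

context
 fixes F x D eta
 assumes x: "x:gcomp R D" and eta: "okF F eta"
begin

lemma op_cs: "c:cs (QU a F)==>op x eta c:cs (QU (a + D - de eta) F)"
proof (erule lin_cs_mem[OF _ lin_op lsub_cs])
 fix y assume y: "y:QU a F"
 then obtain S r ep where y': "y = (S, r, ep)" by (cases y) auto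
 have S: "S <= XX" "(r, ep):EU a S" "S:F" using y by (auto simp: y' QU_mem)
 have eta': "ALL i. i ~: S --> eta i = 0" using eta S(3) by (auto simp: okF_def)
 have "(x \<otimes> r, %i. ep i + eta i):EU (a + D - de eta) S"
 using om_cs[OF x eta' single_cs[OF S(2), of 1]] by (simp add: om_def cs_def)
 then show "op x eta (single y 1):cs (QU (a + D - de eta) F)"
 using S by (simp add: y' op_def single_cs QU_mem)
qed

lemma op_NN: "c:cs (QU a F)==>c:NNU a==>op x eta c:NNU (a + D - de eta)"
proof -
 assume c: "c:cs (QU a F)" "c:NNU a"
 have "slice S (op x eta c):NU (a + D - de eta) S" if "S:F" "S <= XX" for S
 proof -
 have eta': "ALL i. i ~: S --> eta i = 0" using eta that(1) by (auto simp: okF_def)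
 have "slice S c:NU a S" using NNU_iff[OF c(1)] c(2) that by blast
 then show ?thesis unfolding slice_op by (rule om_NU[OF that(2) x eta'])
 qed
 then show ?thesis using NNU_iff[OF op_cs[OF c(1)]] by blast
qed

lemma op_d: "c:cs (QU a F)==>op x eta (dU a F c) = dU (a + D - de eta) F (op x eta c)"
proof (rule slice_eqI)
 fix T assume c: "c:cs (QU a F)"
 have cP: "c:cs (cube.PP XX (EU a))" using c cube.QQ_PP[OF cubeU] by (blast intro: cs_mono)
 have cP': "op x eta c:cs (cube.PP XX (EU (a + D - de eta)))"
 using op_cs[OF c] cube.QQ_PP[OF cubeU] by (blast intro: cs_mono)
 have dP: "dX XX c:cs (cube.PP XX (EU a))" by (rule cpx_d_cs[OF cube.cpx_PP[OF cubeU] cP])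
 have dP': "dX XX (op x eta c):cs (cube.PP XX (EU (a + D - de eta)))"
 by (rule cpx_d_cs[OF cube.cpx_PP[OF cubeU] cP'])
 show "slice T (op x eta (dU a F c)) = slice T (dU (a + D - de eta) F (op x eta c))"
 unfolding slice_op cube.dQ_def[OF cubeU] cube.slice_rst_QQ[OF cubeU dP] cube.slice_rst_QQ[OF cubeU dP']
 by (simp add: slice_dX slice_op lin_sum lin_sc lin_0)
qed

lemma op_Ch: "c:Ch (QU a F) (%(S, e). int (card S)) g==>op x eta c:Ch (QU (a + D - de eta) F) (%(S, e). int (card S)) g"
proof -
 assume c: "c:Ch (QU a F) (%(S, e). int (card S)) g"
 have "slice S (op x eta c) = 0" if "int (card S) ~= g" for S
 proof -
 have "slice S c = 0" using c that by (intro pmI) (auto simp: lookup_slice Ch_def cs_iff_lookup)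
 then show ?thesis by (simp add: slice_op lin_0)
 qed
 then have "lookup (op x eta c) (S, e) = 0" if "int (card S) ~= g" for S e
 using that by (metis lookup_slice lookup_zero)
 then show ?thesis using op_cs[OF Ch_cs[OF c]] unfolding Ch_def cs_iff_lookup by auto
qed

end

lemma okF_0: "okF F (%i. 0)" by (simp add: okF_def)

lemma de_0: "de (%i. 0) = 0" by (simp add: de_def)


section \<open>The action of ring elements on formal cochains\<close>

abbreviation (input) "grU == (%(S, e). int (card S))"
abbreviation (input) "ZU a F == ZZ (QU a F) (NNU a Int cs (QU a F)) grU (dU a F)"
abbreviation (input) "BU a F == BB (QU a F) (NNU a Int cs (QU a F)) grU 1 (dU a F)"
abbreviation (input) "mu x == op x (%i. 0)"

lemma mu_mu: "x:carrier R==>y:carrier R==>c:cs (QU a F)==>mu x (mu y c) = mu (x \<otimes> y) c"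
proof (erule lin_cs_eqI[OF _ lin_comp[OF lin_op lin_op] lin_op])
 fix z assume z: "z:QU a F" and xy: "x:carrier R" "y:carrier R"
 obtain S r ep where z': "z = (S, r, ep)" by (cases z) auto
 have "r:carrier R" using z g_closed by (auto simp: z' QU_mem EU_def)
 then show "mu x (mu y (single z 1)) = mu (x \<otimes> y) (single z 1)"
 using xy by (simp add: z' op_def m_assoc)
qed

lemma mu_one: "c:cs (QU a F)==>mu \<one> c = c"
proof (erule lin_cs_eqI[OF _ lin_op lin_id])
 fix z assume z: "z:QU a F"
 obtain S r ep where z': "z = (S, r, ep)" by (cases z) auto
 have "r:carrier R" using z g_closed by (auto simp: z' QU_mem EU_def)
 then show "mu \<one> (single z 1) = single z 1" by (simp add: z' op_def)
qed

lemma tag_NNU: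
 assumes "S <= XX" "S:F" "w:NU a S"
 shows "tag S w:NNU a Int cs (QU a F)"
proof -
 have w: "w:cs (EU a S)" using assms(3) by (simp add: NU_def)
 have c: "tag S w:cs (QU a F)" using w assms(1,2) by (auto simp: cs_iff_lookup lookup_tag QU_mem)
 have "slice T (tag S w):NU a T" if "T <= XX" for T
 using assms(3) lsub_NU[OF that] by (auto simp: slice_tag lsub_0)
 then show ?thesis using NNU_iff[OF c] c by blast
qed

lemma single_NU:
 assumes S: "S <= XX" and e: "e:EU a S" "e':EU a S" and eq: "vU S e = vU S e'"
 shows "single e 1 - single e' 1:NU a S"
proof -
 have c: "single e 1:cs (EU a S)" "single e' 1:cs (EU a S)" using e by (simp_all add: single_cs)
 have v: "vU S x:carrier (LS S)" if "x:EU a S" for x using vU_car[OF S that] by blast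
 have "kmod.ev (LS S) (vU S) (single x 1) = vU S x" if "x:EU a S" for x
 using kmod.ev_single[of "LS S" "vU S" x 1, OF LkU[OF S] v[OF that]] kmod.sm_1[OF LkU[OF S] v[OF that]] by simp
 then have "kmod.ev (LS S) (vU S) (single e 1 - single e' 1) = \<zero>\<^bsub>LS S\<^esub>"
 using kmod.ev_eq_iff[OF LkU[OF S] c, of "vU S"] v e eq by simp
 then show ?thesis using lsub_diff[OF lsub_cs c] by (simp add: NU_def)
qed

lemma lsub_NQ: "lsub (NNU a Int cs (QU a F))"
 by (rule lsub_Int[OF cube.lsub_NN[OF cubeU] lsub_cs])

text \<open>The numerator is part of a formal key, so multiplication by a sum is additive only
  modulo the relations of the localizations.\<close>

lemma mu_add:
 assumes x: "x:gcomp R D" "y:gcomp R D" and c: "c:cs (QU a F)"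
 shows "mu (x \<oplus> y) c - (mu x c + mu y c):NNU (a + D) Int cs (QU (a + D) F)"
proof (rule lin_cs_mem[OF c, where f = "%c. mu (x \<oplus> y) c - (mu x c + mu y c)"])
 show "lin (%c. mu (x \<oplus> y) c - (mu x c + mu y c))" by (intro lin_sub lin_plus lin_op)
 show "lsub (NNU (a + D) Int cs (QU (a + D) F))" by (rule lsub_NQ)
 fix z assume z: "z:QU a F"
 obtain S r ep where z': "z = (S, r, ep)" by (cases z) auto
 have S: "S <= XX" "S:F" "ALL i. i ~: S --> ep i = 0" "r:gcomp R (a + de ep)" using z by (auto simp: z' QU_mem EU_def)
 have rc: "x:carrier R" "y:carrier R" "r:carrier R" using x S(4) g_closed by auto
 have e: "(t \<otimes> r, ep):EU (a + D) S" if "t:gcomp R D" for t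
 using g_mult[OF that S(4)] S(3) by (simp add: EU_def algebra_simps)
 note E = e[OF x(1)] e[OF x(2)] e[OF g_add[OF x]]
 have v: "vU S u:carrier (LS S)" if "u:EU (a + D) S" for u using vU_car[OF S(1) that] by blast
 let ?w = "single ((x \<oplus> y) \<otimes> r, ep) 1 - (single (x \<otimes> r, ep) 1 + single (y \<otimes> r, ep) 1)"
 have ev1: "kmod.ev (LS S) (vU S) (single u 1) = vU S u" if "u:EU (a + D) S" for u
 using kmod.ev_single[of "LS S" "vU S" u 1, OF LkU[OF S(1)] v[OF that]] kmod.sm_1[OF LkU[OF S(1)] v[OF that]] by simp
 have cc: "single (x \<otimes> r, ep) 1:cs (EU (a + D) S)" "single (y \<otimes> r, ep) 1:cs (EU (a + D) S)"
 "single ((x \<oplus> y) \<otimes> r, ep) 1:cs (EU (a + D) S)" using E by (simp_all add: single_cs)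
 have "vU S ((x \<oplus> y) \<otimes> r, ep) = vU S (x \<otimes> r, ep) \<oplus>\<^bsub>LS S\<^esub> vU S (y \<otimes> r, ep)"
 unfolding vU_def prod.case LS_def cld
 using loc_add_same[OF msU[OF S(1)], of "x \<otimes> r" "y \<otimes> r" "mon fs XX ep"] rc mon_mem[OF S(1,3)] by (simp add: l_distr)
 also have "... = kmod.ev (LS S) (vU S) (single (x \<otimes> r, ep) 1 + single (y \<otimes> r, ep) 1)"
 using kmod.ev_add[OF LkU[OF S(1)] cc(1,2), of "vU S"] v ev1 E by simp
 finally have "kmod.ev (LS S) (vU S) ?w = \<zero>\<^bsub>LS S\<^esub>"
 using kmod.ev_eq_iff[OF LkU[OF S(1)] cc(3) lsub_add[OF lsub_cs cc(1,2)], of "vU S"] v ev1 E by simp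
 then have "?w:NU (a + D) S" using lsub_diff[OF lsub_cs cc(3) lsub_add[OF lsub_cs cc(1,2)]] unfolding NU_def by blast
 from tag_NNU[OF S(1,2) this]
 show "mu (x \<oplus> y) (single z 1) - (mu x (single z 1) + mu y (single z 1)):NNU (a + D) Int cs (QU (a + D) F)"
 by (simp add: z' op_def tag_def lin_simps)
qed

lemma op_divide:
 assumes j: "j < length fs" and F: "!!S. S:F==>j:S" and c: "c:cs (QU a F)"
 shows "op \<one> (%i. if i = j then n else 0) (mu ((fs ! j) [^] n) c) - c:NNU a Int cs (QU a F)"
proof (rule lin_cs_mem[OF c, where f = "%c. op \<one> (%i. if i = j then n else 0) (mu ((fs ! j) [^] n) c) - c"])
 show "lin (%c. op \<one> (%i. if i = j then n else 0) (mu ((fs ! j) [^] n) c) - c)"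
 by (intro lin_sub lin_id lin_comp[OF lin_op lin_op])
 show "lsub (NNU a Int cs (QU a F))" by (rule lsub_NQ)
 fix z assume z: "z:QU a F"
 obtain S r ep where z': "z = (S, r, ep)" by (cases z) auto
 have S: "S <= XX" "S:F" "ALL i. i ~: S --> ep i = 0" "r:gcomp R (a + de ep)" using z by (auto simp: z' QU_mem EU_def)
 let ?eta = "%i. if i = j then n else 0" and ?x = "(fs ! j) [^] n"
 have jS: "j:S" using F S(2) by blast
 have xm: "mon fs XX ?eta = ?x" by (rule monX_single[OF j])
 have xd: "?x:gcomp R (int n * dg j)" using monX_deg[of ?eta] xm de_single[OF j] by simp
 have c: "?x:carrier R" "r:carrier R" "mon fs XX ep:carrier R" using g_closed[OF xd] g_closed[OF S(4)] monX_car by auto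
 let ?e = "(\<one> \<otimes> (?x \<otimes> r), %i. ep i + ?eta i)"
 have sup: "ALL i. i ~: S --> ep i + ?eta i = 0" using S(3) jS by auto
 have e: "?e:EU a S"
 using g_mult[OF xd S(4)] sup c by (simp add: EU_def de_add de_single[OF j] algebra_simps)
 have "vU S ?e = vU S (r, ep)"
 unfolding vU_def prod.case monX_mult[symmetric] xm
 proof (rule frac_eqI[OF msU[OF S(1)], where u = \<one>])
 show "mon fs XX ep \<otimes> ?x:monomials R fs S" using mon_mem[OF S(1) sup] monX_mult[of ep ?eta] xm by simp
 show "mon fs XX ep:monomials R fs S" by (rule mon_mem[OF S(1,3)])
 qed (use c ms_one[OF msU[OF S(1)]] in \<open>auto simp: m_ac\<close>)
 from single_NU[OF S(1) e _ this] have "single ?e 1 - single (r, ep) 1:NU a S" using S(3,4) by (simp add: EU_def)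
 from tag_NNU[OF S(1,2) this]
 show "op \<one> ?eta (mu ?x (single z 1)) - single z 1:NNU a Int cs (QU a F)"
 by (simp add: z' op_def tag_def lin_simps)
qed

lemma pow_deg: "x:gcomp R D==>x [^] (n::nat):gcomp R (int n * D)"
proof (induction n)
 case (Suc n)
 then show ?case using g_mult[of "x [^] n" "int n * D" x D] by (simp add: algebra_simps)
qed (simp add: g_one)

text \<open>Up to a power of \<open>f\<^sub>i\<close> a cochain has no denominators \<open>f\<^sub>i\<close>.\<close>

lemma clear_denominators:
 assumes i: "i < length fs" and c: "c:cs (QU a F)"
 shows "EX n. \<exists>c' \<in> cs {(S, r, ep). (S, r, ep) \<in> QU (a + int n * dg i) F&ep i = 0}.
 c' - mu ((fs ! i) [^] n) c:NNU (a + int n * dg i) Int cs (QU (a + int n * dg i) F)"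
proof -
 \<comment> \<open>A bound for the exponents of f_i in all denominators of \<open>c\<close>.\<close>
 define n where "n = (\<Sum>(S, r, ep)\<in>keys c. ep i)"
 let ?a = "a + int n * dg i"
 let ?P = "{(S, r, ep). (S, r, ep):QU a F&ep i <= n}"
 have cP: "c:cs ?P"
 proof -
 have "ep i <= n" if "(S, r, ep):keys c" for S r ep
 unfolding n_def using member_le_sum[of "(S, r, ep)" "keys c" "%(S, r, ep). ep i"] that by simp
 then show ?thesis using c by (auto simp: cs_def)
 qed
 \<comment> \<open>In f_i^n r / f^ep the power of f_i is cancelled: \<open>ep i\<close> factors
   leave the denominator, and \<open>n - ep i\<close> stay in the numerator.\<close>
 define th :: "(nat set \<times> 'r \<times> (nat=>nat) \<Rightarrow>\<^sub>0 'k)=>(nat set \<times> 'r \<times> (nat=>nat) \<Rightarrow>\<^sub>0 'k)"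
 where "th = lext (%(S, r, ep). single (S, (fs ! i) [^] (n - ep i) \<otimes> r, ep(i := 0)) 1)"
 have lth: "lin th" by (simp add: th_def)
 let ?Q = "{(S, r, ep). (S, r, ep):QU ?a F&ep i = 0}"
 have key: "th (single z 1):cs ?Q&th (single z 1) - mu ((fs ! i) [^] n) (single z 1):NNU ?a Int cs (QU ?a F)"
 if z: "z:?P" for z
 proof -
 obtain S r ep where z': "z = (S, r, ep)" by (cases z) auto
 have S: "S <= XX" "S:F" "ALL i. i ~: S --> ep i = 0" "r:gcomp R (a + de ep)" "ep i <= n"
 using z by (auto simp: z' QU_mem EU_def)
 let ?ep = "ep(i := 0)" and ?m = "ep i"
 have ep: "ep = (%j. ?ep j + (if j = i then ?m else 0))" by auto
 have dep: "de ep = de ?ep + int ?m * dg i" using de_add[of ?ep "%j. if j = i then ?m else 0"] ep de_single[OF i] by simp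
 have mep: "mon fs XX ep = mon fs XX ?ep \<otimes> (fs ! i) [^] ?m"
 using monX_mult[of ?ep "%j. if j = i then ?m else 0"] ep monX_single[OF i] by simp
 have fic: "fs ! i:carrier R" by (rule fsc[OF i])
 have sup: "ALL i. i ~: S --> ?ep i = 0" using S(3) by simp
 let ?x = "(fs ! i) [^] (n - ?m)"
 have xd: "?x:gcomp R (int (n - ?m) * dg i)" and yd: "(fs ! i) [^] n:gcomp R (int n * dg i)" using pow_deg[OF fsdg[OF i]] by auto
 have e: "(?x \<otimes> r, ?ep):EU ?a S"
 using g_mult[OF xd S(4)] sup S(5) by (simp add: EU_def dep of_nat_diff algebra_simps)
 have e': "((fs ! i) [^] n \<otimes> r, ep):EU ?a S"
 using g_mult[OF yd S(4)] S(3) by (simp add: EU_def algebra_simps)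
 have c: "r:carrier R" "mon fs XX ?ep:carrier R" using g_closed[OF S(4)] monX_car by auto
 have "vU S (?x \<otimes> r, ?ep) = vU S ((fs ! i) [^] n \<otimes> r, ep)"
 unfolding vU_def prod.case
 proof (rule frac_eqI[OF msU[OF S(1)], where u = \<one>])
 show "mon fs XX ?ep:monomials R fs S" by (rule mon_mem[OF S(1) sup])
 show "mon fs XX ep:monomials R fs S" by (rule mon_mem[OF S(1,3)])
 have "?x \<otimes> (fs ! i) [^] ?m = (fs ! i) [^] n" using S(5) fic by (simp add: nat_pow_mult)
 then have "(fs ! i) [^] n \<otimes> r \<otimes> mon fs XX ?ep = (?x \<otimes> (fs ! i) [^] ?m) \<otimes> r \<otimes> mon fs XX ?ep" by simp
 then show "\<one> \<otimes> (?x \<otimes> r \<otimes> mon fs XX ep) = \<one> \<otimes> ((fs ! i) [^] n \<otimes> r \<otimes> mon fs XX ?ep)"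
 unfolding mep using c fic by (simp add: m_ac)
 qed (use c fic ms_one[OF msU[OF S(1)]] in auto)
 from tag_NNU[OF S(1,2) single_NU[OF S(1) e e' this]]
 have "th (single z 1) - mu ((fs ! i) [^] n) (single z 1):NNU ?a Int cs (QU ?a F)"
 by (simp add: z' th_def op_def tag_def lin_simps)
 moreover have "th (single z 1):cs ?Q" using e S by (simp add: z' th_def single_cs QU_mem)
 ultimately show ?thesis by blast
 qed
 have "th c:cs ?Q" by (rule lin_cs_mem[OF cP lth lsub_cs]) (use key in blast)
 moreover have "th c - mu ((fs ! i) [^] n) c:NNU ?a Int cs (QU ?a F)"
 by (rule lin_cs_mem[OF cP, where f = "%c. th c - mu ((fs ! i) [^] n) c"])
 (use key lth in \<open>auto intro: lin_sub lsub_NQ\<close>)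
 ultimately show ?thesis by blast
qed

lemma om_om: "x:carrier R==>y:carrier R==>w:cs (EU a S)==>om x (%i. 0) (om y (%i. 0) w) = om (x \<otimes> y) (%i. 0) w"
proof (erule lin_cs_eqI[OF _ lin_comp[OF lin_om lin_om] lin_om])
 fix z assume z: "z:EU a S" and xy: "x:carrier R" "y:carrier R"
 obtain r ep where z': "z = (r, ep)" by (cases z) auto
 have "r:carrier R" using z g_closed by (auto simp: z' EU_def)
 then show "om x (%i. 0) (om y (%i. 0) (single z 1)) = om (x \<otimes> y) (%i. 0) (single z 1)"
 using xy by (simp add: z' om_def m_assoc)
qed

text \<open>An element that vanishes when f_i is inverted is killed by a monomial. The factor of
  that monomial without f_i is already invertible at \<open>S - {i}\<close>, so a power of f_i
  suffices.\<close>

lemma kill_power: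
 assumes i: "i < length fs" and S: "S <= XX" and w: "w:cs (EU a (S - {i}))" and z: "w:NU a (insert i S)"
 shows "EX m. om ((fs ! i) [^] m) (%i. 0) w:NU (a + int m * dg i) S"
proof -
 let ?T = "S - {i}" and ?U = "insert i S"
 have T: "?T <= XX" "?U <= XX" "?T <= ?U" using S i by auto
 have fic: "fs ! i:carrier R" by (rule fsc[OF i])
 have Yc: "kmod.ev (LS ?T) (vU ?T) w:carrier (LS ?T)"
 using kmod.ev_closed[OF LkU[OF T(1)] w, of "vU ?T"] vU_car[OF T(1)] by blast
 then obtain r s where rs: "kmod.ev (LS ?T) (vU ?T) w = frac R (monomials R fs ?T) r s" "r:carrier R" "s:monomials R fs ?T"
 unfolding LS_def cld by (rule locE[OF msU[OF T(1)]])
 have sU: "s:monomials R fs ?U" using rs(3) monomials_mono[OF fsU T(3,2)] by blast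
 have "frac R (monomials R fs ?U) r s = \<zero>\<^bsub>LS ?U\<^esub>"
 using z ev_map[OF T(3,2) w] loc_map[OF msU[OF T(1)] msU[OF T(2)] monomials_mono[OF fsU T(3,2)] rs(2,3)] rs(1)
 by (simp add: NU_def)
 then obtain u where u: "u:monomials R fs ?U" "u \<otimes> r = \<zero>"
 using loc_zero_iff[OF msU[OF T(2)] rs(2) sU] unfolding LS_def cld by blast
 from u(1) obtain ze where "u = mon fs ?U ze" unfolding monomials_mon by blast
 then have "u = mon fs ?U (%j. if j:?U then ze j else 0)" using mon_restrict[OF fsU, of ?U ze] T by simp
 also have "... = mon fs XX (%j. if j:?U then ze j else 0)" by (rule mon_mono[OF fsU T(2)]) auto
 also have "(%j. if j:?U then ze j else 0) = (%j. (if j:?T then ze j else 0) + (if j = i then ze i else 0))" by auto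
 also have "mon fs XX ... = mon fs XX (%j. if j:?T then ze j else 0) \<otimes> (fs ! i) [^] ze i"
 by (simp only: monX_mult[symmetric] monX_single[OF i])
 finally have ueq: "u = mon fs XX (%j. if j:?T then ze j else 0) \<otimes> (fs ! i) [^] ze i" .
 define m where "m = ze i"
 let ?v = "mon fs XX (%j. if j:?T then ze j else 0)"
 have vm: "?v:monomials R fs ?T" by (rule mon_mem[OF T(1)]) auto
 have vz: "?v \<otimes> ((fs ! i) [^] m \<otimes> r) = \<zero>"
 using u(2) unfolding ueq m_def using monX_car fic rs(2) by (simp add: m_assoc)
 have xd: "(fs ! i) [^] m:gcomp R (int m * dg i)" using pow_deg[OF fsdg[OF i]] .
 have m0: "mon fs XX (%i. 0) = \<one>" by (rule mon_0[OF fsU]) simp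
 have "kmod.ev (LS ?T) (vU ?T) (om ((fs ! i) [^] m) (%i. 0) w) = xm R (monomials R fs ?T) ((fs ! i) [^] m) \<one> (frac R (monomials R fs ?T) r s)"
 using om_ev[OF T(1) xd _ w, of "%i. 0"] unfolding rs(1) m0 by simp
 also have "... = frac R (monomials R fs ?T) ((fs ! i) [^] m \<otimes> r) (\<one> \<otimes> s)"
 by (rule xm_frac[OF msU[OF T(1)] g_closed[OF xd] ms_one[OF msU[OF T(1)]] rs(2,3)])
 also have "... = \<zero>\<^bsub>LS ?T\<^esub>"
 unfolding LS_def cld
 using loc_zeroI[OF msU[OF T(1)] _ _ vm vz] fic rs ms_mult[OF msU[OF T(1)] ms_one[OF msU[OF T(1)]] rs(3)] by simp
 finally have "om ((fs ! i) [^] m) (%i. 0) w:NU (a + int m * dg i) ?T"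
 using om_cs[OF xd _ w, of "%i. 0"] by (simp add: NU_def de_0)
 moreover have "NU (a + int m * dg i) ?T <= NU (a + int m * dg i) S" by (rule cube.NS_mono[OF cubeU]) (use S in auto)
 ultimately show ?thesis by blast
qed


text \<open>The part of the complex without denominators \<open>f\<^sub>i\<close>, modulo the elements killed by a power of
 \<open>f\<^sub>i\<close>, is contractible.\<close>

lemma cubeV:
 assumes i: "i < length fs"
 shows "cube XX (%S. EU a (S - {i})) (%S. NU a (insert i S) Int cs (EU a (S - {i}))) (%(S, e). int (card S)) 1"
proof
 show "finite XX" by simp
 show "EU a (S - {i}) <= EU a (T - {i})" if "S <= T" for S T using EU_mono that by (meson Diff_mono subset_refl)
 show "NU a (insert i S) Int cs (EU a (S - {i})) <= NU a (insert i T) Int cs (EU a (T - {i}))" if "S <= T" "T <= XX" for S T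
 proof -
 have "NU a (insert i S) <= NU a (insert i T)" by (rule cube.NS_mono[OF cubeU]) (use that i in auto)
 moreover have "EU a (S - {i}) <= EU a (T - {i})" by (rule EU_mono) (use that in auto)
 ultimately show ?thesis using cs_mono by blast
 qed
 show "lsub (NU a (insert i S) Int cs (EU a (S - {i})))" if "S <= XX" for S
 using lsub_NU[of "insert i S" a] that i by (simp add: lsub_Int)
 show "(case (insert j S, e) of (S, e)=>int (card S)) = (case (S, e) of (S, e)=>int (card S)) + 1"
 if "S <= XX" "j:XX - S" for S j and e :: "'r \<times> (nat=>nat)"
 using that finite_subset[OF that(1)] by simp
 show "rst {e. (case (S, e) of (S, e)=>int (card S)) = g} n:NU a (insert i S) Int cs (EU a (S - {i}))"
 if "S <= XX" "n:NU a (insert i S) Int cs (EU a (S - {i}))" for S g n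
 proof (cases "int (card S) = g")
 case True
 then show ?thesis using that rst_id[of n UNIV UNIV] by (simp add: cs_def)
 next
 case False
 then have "rst {e. (case (S, e) of (S, e)=>int (card S)) = g} n = 0"
 by (intro pmI) (simp add: lookup_rst)
 then show ?thesis using lsub_NU[of "insert i S" a] that i by (simp add: lsub_0)
 qed
qed

abbreviation (input) "QV i a == cube.QQ XX (%S. EU a (S - {i}))"
abbreviation (input) "NNV i a == cube.NN XX (%S. EU a (S - {i})) (%S. NU a (insert i S) Int cs (EU a (S - {i})))"
abbreviation (input) "dV i a == cube.dQ XX (%S. EU a (S - {i}))"

lemma QV_mem: "i < length fs==>(S, r, ep):QV i a F <-> (S, r, ep):QU a F&ep i = 0"
 unfolding QU_mem using cube.QQ_def[OF cubeV[of i]] by (auto simp: EU_def)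

lemma dV_dU:
 fixes c :: "nat set \<times> 'r \<times> (nat=>nat) \<Rightarrow>\<^sub>0 'k"
 assumes i: "i < length fs" and c: "c:cs (QV i a F)"
 shows "dV i a F c = dU a F c"
proof -
 have "dX XX c:cs {(S, r, ep). ep i = 0}"
 using c
 proof (rule lin_cs_mem[OF _ lin_dX lsub_cs])
 fix z assume z: "z:QV i a F"
 obtain S r ep where z': "z = (S, r, ep)" by (cases z) auto
 then have "ep i = 0" using z QV_mem[OF i] by simp
 then show "dX XX (single z 1):cs {(S, r, ep). ep i = 0}"
 by (simp add: z' dX_def) (intro lsub_sum[OF lsub_cs] single_cs, auto)
 qed
 then have L: "lookup (rst (QV i a F) (dX XX c)) (S, r, ep) = lookup (rst (QU a F) (dX XX c)) (S, r, ep)" for S r ep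
 using QV_mem[OF i, of S r ep a F] by (auto simp: lookup_rst cs_iff_lookup)
 show ?thesis unfolding cube.dQ_def[OF cubeV[OF i]] cube.dQ_def[OF cubeU]
 proof (rule pmI)
 fix x :: "nat set \<times> 'r \<times> (nat=>nat)"
 obtain S r ep where "x = (S, r, ep)" by (cases x) auto
 then show "lookup (rst (QV i a F) (dX XX c)) x = lookup (rst (QU a F) (dX XX c)) x" using L by simp
 qed
qed

section \<open>Acyclicity of the faces through a redundant generator\<close>

context
 fixes j :: nat and Y :: "nat set" and F :: "nat set set"
 assumes j: "j < length fs" "j ~: Y" and Y: "Y <= XX" and F: "F = {S. j:S&S <= insert j Y}"
begin

lemma convF: "cube.conv F"
 unfolding cube.conv_def[OF cubeU] F by blast

lemma cpxF: "cpx (QU a F) (NNU a Int cs (QU a F)) grU 1 (dU a F)"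
 by (rule cube.cpx_conv[OF cubeU convF])

lemma F_XX: "S:F==>S <= XX"
 using j Y unfolding F by auto

lemma mu_BU: "x:gcomp R D==>c:BU a F g==>mu x c:BU (a + D) F g"
proof -
 assume x: "x:gcomp R D" and c: "c:BU a F g"
 note op = op_cs[OF x okF_0, of _ a F, unfolded de_0] op_NN[OF x okF_0, of _ a F, unfolded de_0]
 op_d[OF x okF_0, of _ a F, unfolded de_0] op_Ch[OF x okF_0, of _ a F, unfolded de_0]
 from c obtain b where b: "b:Ch (QU a F) grU (g - 1)" "c - dU a F b:NNU a Int cs (QU a F)" "c:Ch (QU a F) grU g"
 by (rule BBE[OF cpxF])
 have "mu x c - dU (a + D) F (mu x b) = mu x (c - dU a F b)"
 using op(3)[OF Ch_cs[OF b(1)]] by (simp add: lin_diff)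
 also have "...:NNU (a + D) Int cs (QU (a + D) F)" using op(1,2) b(2) by simp
 finally show "mu x c:BU (a + D) F g"
 using op(4)[OF b(1)] op(4)[OF b(3)] by (intro BBI[OF cpxF, of "mu x b"]) simp_all
qed

lemma mu_ZU: "x:gcomp R D==>c:ZU a F g==>mu x c:ZU (a + D) F g"
proof -
 assume x: "x:gcomp R D" and c: "c:ZU a F g"
 note op = op_cs[OF x okF_0, of _ a F, unfolded de_0] op_NN[OF x okF_0, of _ a F, unfolded de_0]
 op_d[OF x okF_0, of _ a F, unfolded de_0] op_Ch[OF x okF_0, of _ a F, unfolded de_0]
 have cC: "c:Ch (QU a F) grU g" "dU a F c:NNU a" "dU a F c:cs (QU a F)" using c by (auto simp: ZZ_def)
 show "mu x c:ZU (a + D) F g"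
 using op(4)[OF cC(1)] op(3)[OF Ch_cs[OF cC(1)], symmetric] op(1,2) cC(2,3) by (simp add: ZZ_def)
qed

text \<open>f_i acts locally nilpotently on the cohomology over \<open>F\<close>. Cleared of
  denominators f_i, a cocycle lives in the cube of \<open>cubeV\<close>, where toggling
  \<open>i\<close> provides a primitive; the error vanishes once f_i is inverted, so a further power
  of f_i removes it.\<close>

lemma local_nil:
 assumes i: "i:Y" and c: "c:ZU a F g"
 shows "EX n. mu ((fs ! i) [^] (n::nat)) c:BU (a + int n * dg i) F g"
proof -
 have il: "i < length fs" and ij: "i ~= j" using i j Y by auto
 have cC: "c:Ch (QU a F) grU g" "dU a F c:NNU a" "dU a F c:cs (QU a F)" using c by (auto simp: ZZ_def)
 note cQ = Ch_cs[OF cC(1)]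
 obtain n c0 where n: "c0:cs {(S, r, ep). (S, r, ep):QU (a + int n * dg i) F&ep i = 0}"
 "c0 - mu ((fs ! i) [^] n) c:NNU (a + int n * dg i) Int cs (QU (a + int n * dg i) F)"
 using clear_denominators[OF il cQ] by blast
 let ?a = "a + int n * dg i" and ?x = "(fs ! i) [^] n"
 have xd: "?x:gcomp R (int n * dg i)" by (rule pow_deg[OF fsdg[OF il]])
 have xc: "mu ?x c:ZU ?a F g" by (rule mu_ZU[OF xd c])
 define c' where "c' = rst {z. grU z = g} c0"
 have QV: "{(S, r, ep). (S, r, ep):QU ?a F&ep i = 0} = QV i ?a F"
 using QV_mem[OF il] by auto
 have QVU: "QV i b F <= QU b F" for b using QV_mem[OF il] by auto
 have c'V: "c':cs (QV i ?a F)" using n(1) unfolding QV c'_def by (auto simp: cs_iff_lookup lookup_rst)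
 have "rst {z. grU z = g} (mu ?x c) = mu ?x c" using xc unfolding ZZ_def Ch_def by (intro rst_id[of _ "{x:QU ?a F. grU x = g}"]) auto
 then have c'n: "c' - mu ?x c:NNU ?a Int cs (QU ?a F)"
 using cpx_hom[OF cpxF n(2), of g] by (simp add: c'_def lin_diff)
 have c'C: "c':Ch (QU ?a F) grU g" "c':Ch (QV i ?a F) grU g"
 using rst_Ch[of c0 "QV i ?a F" grU g] n(1) Ch_mono[OF QVU] unfolding QV c'_def by auto
 have "dU ?a F c' = dU ?a F (c' - mu ?x c) + dU ?a F (mu ?x c)" by (simp add: lin_diff[OF cpx_lin[OF cpxF]])
 also have "...:NNU ?a Int cs (QU ?a F)"
 using cpx_dN[OF cpxF c'n] xc by (intro lsub_add[OF lsub_NQ]) (auto simp: ZZ_def)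
 finally have dc': "dU ?a F c':NNU ?a Int cs (QU ?a F)" .
 have cpxV: "cpx (QV i ?a F) (NNV i ?a Int cs (QV i ?a F)) grU 1 (dV i ?a F)"
 by (rule cube.cpx_conv[OF cubeV[OF il] convF])
 have ac: "cube.acF XX (%S. EU ?a (S - {i})) (%S. NU ?a (insert i S) Int cs (EU ?a (S - {i}))) grU 1 F"
 proof (rule cube.acF_toggle[OF cubeV[OF il]])
 show "i:XX" using il by simp
 show "cube.conv F" by (rule convF)
 show "insert i S:F <-> S - {i}:F" for S using i ij unfolding F by auto
 show "EU ?a (insert i S - {i}) <= EU ?a (S - {i} - {i})" for S by simp
 show "NU ?a (insert i (insert i S)) Int cs (EU ?a (insert i S - {i})) Int cs (EU ?a (insert i S - {i}))
 <= NU ?a (insert i (S - {i})) Int cs (EU ?a (S - {i} - {i}))" for S by simp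
 qed
 have PPV: "cs (QV i ?a F) <= cs (cube.PP XX (%S. EU ?a (S - {i})))"
 using cube.QQ_PP[OF cubeV[OF il]] cs_mono by blast
 have dV': "dV i ?a F c':NNV i ?a Int cs (QV i ?a F)"
 proof -
 have q: "dV i ?a F c':cs (QV i ?a F)" by (rule cpx_d_cs[OF cpxV c'V])
 have "slice S (dV i ?a F c'):NU ?a (insert i S) Int cs (EU ?a (S - {i}))" if S: "S <= XX" for S
 proof -
 have "slice S (dU ?a F c'):NU ?a S"
 using dc' S lsub_NU[OF S] unfolding cube.NN_def[OF cubeU] by auto
 moreover have "NU ?a S <= NU ?a (insert i S)" by (rule cube.NS_mono[OF cubeU]) (use S il in auto)
 moreover have "slice S (dV i ?a F c'):cs (EU ?a (S - {i}))"
 by (rule cube.slice_cs_PP[OF cubeV[OF il] _ S]) (use q PPV in blast)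
 ultimately show ?thesis using dV_dU[OF il c'V] by auto
 qed
 then show ?thesis using q PPV unfolding cube.NN_def[OF cubeV[OF il]] by blast
 qed
 have "c':ZZ (QV i ?a F) (NNV i ?a Int cs (QV i ?a F)) grU (dV i ?a F) g" using c'C dV' by (simp add: ZZ_def)
 then have "c':BB (QV i ?a F) (NNV i ?a Int cs (QV i ?a F)) grU 1 (dV i ?a F) g"
 using ac unfolding cube.acF_def[OF cubeV[OF il]] acyc_def by blast
 then obtain b where b: "b:Ch (QV i ?a F) grU (g - 1)" "c' - dV i ?a F b:NNV i ?a Int cs (QV i ?a F)"
 by (rule BBE[OF cpxV])
 \<comment> \<open>The error is a relation only after f_i is inverted. Each of the finitely many
   faces needs some power of f_i by \<open>kill_power\<close>, and the sum \<open>m\<close> of these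
   powers serves all faces.\<close>
 define nu where "nu = c' - dU ?a F b"
 have nu: "nu:NNV i ?a" "nu:cs (QV i ?a F)" using b(2) dV_dU[OF il Ch_cs[OF b(1)]] by (auto simp: nu_def)
 have bC: "b:Ch (QU ?a F) grU (g - 1)" using Ch_mono[OF QVU b(1)] .
 have "ALL S:F. EX m. om ((fs ! i) [^] m) (%i. 0) (slice S nu):NU (?a + int m * dg i) S"
 proof
 fix S assume "S:F"
 then have S: "S <= XX" by (rule F_XX)
 then have "slice S nu:NU ?a (insert i S) Int cs (EU ?a (S - {i}))" using nu(1) unfolding cube.NN_def[OF cubeV[OF il]] by blast
 then show "EX m. om ((fs ! i) [^] m) (%i. 0) (slice S nu):NU (?a + int m * dg i) S"
 using kill_power[OF il S] by blast
 qed
 then obtain mf where mf: "!!S. S:F==>om ((fs ! i) [^] (mf S :: nat)) (%i. 0) (slice S nu):NU (?a + int (mf S) * dg i) S"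
 unfolding bchoice_iff by blast
 have finF: "finite F" by (rule finite_subset[of _ "Pow XX"]) (use F_XX in auto)
 define m where "m = (\<Sum>S\<in>F. mf S)"
 let ?y = "(fs ! i) [^] m"
 have yd: "?y:gcomp R (int m * dg i)" by (rule pow_deg[OF fsdg[OF il]])
 have nuQ: "nu:cs (QU ?a F)" using nu(2) QVU cs_mono by blast
 note opy = op_cs[OF yd okF_0, of _ ?a F, unfolded de_0] op_NN[OF yd okF_0, of _ ?a F, unfolded de_0]
 op_d[OF yd okF_0, of _ ?a F, unfolded de_0] op_Ch[OF yd okF_0, of _ ?a F, unfolded de_0]
 have ynu: "mu ?y nu:NNU (?a + int m * dg i)"
 proof -
 have "slice S (mu ?y nu):NU (?a + int m * dg i) S" if "S:F" for S
 proof -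
 have S: "S <= XX" using F_XX that .
 have le: "mf S <= m" unfolding m_def using finF that by (intro member_le_sum) auto
 let ?k = "m - mf S"
 have kd: "(fs ! i) [^] ?k:gcomp R (int ?k * dg i)" by (rule pow_deg[OF fsdg[OF il]])
 have "om ((fs ! i) [^] ?k) (%i. 0) (om ((fs ! i) [^] mf S) (%i. 0) (slice S nu)):NU (?a + int (mf S) * dg i + int ?k * dg i) S"
 using om_NU[OF S kd _ mf[OF that], of "%i. 0"] by (simp add: de_0)
 moreover have "om ((fs ! i) [^] ?k) (%i. 0) (om ((fs ! i) [^] mf S) (%i. 0) (slice S nu)) = om ?y (%i. 0) (slice S nu)"
 using om_om[OF _ _ slice_QU[OF nuQ]] fsc[OF il] le by (simp add: nat_pow_mult)
 moreover have "int (mf S) * dg i + int ?k * dg i = int m * dg i" using le by (simp add: of_nat_diff algebra_simps)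
 ultimately show ?thesis by (simp add: slice_op add.assoc)
 qed
 then show ?thesis using NNU_iff[of "mu ?y nu" "?a + int m * dg i" F] opy(1)[OF nuQ] by simp
 qed
 have eq: "?a + int m * dg i = a + int (m + n) * dg i" by (simp add: algebra_simps)
 have "mu ?y (mu ?x c) - dU (?a + int m * dg i) F (mu ?y b) = mu ?y nu - mu ?y (c' - mu ?x c)"
 using opy(3)[OF Ch_cs[OF bC]] by (simp add: nu_def lin_diff)
 also have "...:NNU (?a + int m * dg i) Int cs (QU (?a + int m * dg i) F)"
 using ynu opy(1)[OF nuQ] opy(1,2)[of "c' - mu ?x c"] c'n by (intro lsub_diff[OF lsub_NQ]) auto
 finally have "mu ?y (mu ?x c):BU (?a + int m * dg i) F g"
 using opy(4)[OF bC] opy(4)[of "mu ?x c" g] xc by (intro BBI[OF cpxF, of "mu ?y b"]) (auto simp: ZZ_def)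
 moreover have "mu ?y (mu ?x c) = mu ((fs ! i) [^] (m + n)) c"
 using mu_mu[OF _ _ cQ, of ?y ?x] fsc[OF il] by (simp add: nat_pow_mult)
 ultimately show ?thesis unfolding eq by (intro exI[of _ "m + n"]) simp
qed

text \<open>This replaces the binomial theorem: one factor of
  \<open>(x \<oplus> y) [^] (p + q)\<close> is split off, after which \<open>mu x c\<close> needs
  one power of \<open>x\<close> less and \<open>mu y c\<close> one power of \<open>y\<close>
  less.\<close>

lemma nil_add:
 assumes x: "x:gcomp R D" "y:gcomp R D"
 shows "c:ZU a F g==>mu (x [^] p) c:BU (a + int p * D) F g==>mu (y [^] q) c:BU (a + int q * D) F g==>
 mu ((x \<oplus> y) [^] (p + q)) c:BU (a + int (p + q) * D) F g"
proof (induction "p + q" arbitrary: p q a c)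
 case 0
 then show ?case by simp
next
 case (Suc N)
 have xc: "x:carrier R" "y:carrier R" using x g_closed by auto
 have cQ: "c:cs (QU a F)" using Suc.prems(1) by (auto simp: ZZ_def Ch_cs)
 have xy: "x \<oplus> y:gcomp R D" using g_add[OF x] .
 show ?case
 proof (cases "p = 0 \<or> q = 0")
 case True
 then have "c:BU a F g" using Suc.prems mu_one[OF cQ] by auto
 then show ?thesis by (rule mu_BU[OF pow_deg[OF xy]])
 next
 case False
 then obtain p' q' where pq: "p = Suc p'" "q = Suc q'" by (metis not0_implies_Suc)
 have comm: "mu u (mu v c) = mu v (mu u c)" if "u:carrier R" "v:carrier R" for u v
 using mu_mu[OF _ _ cQ] that by (simp add: m_comm)
 have zx: "mu x c:ZU (a + D) F g" "mu y c:ZU (a + D) F g" using mu_ZU[OF _ Suc.prems(1)] x by auto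
 have 1: "mu ((x \<oplus> y) [^] (p' + q)) (mu x c):BU (a + D + int (p' + q) * D) F g"
 proof (rule Suc.hyps(1)[OF _ zx(1)])
 show "N = p' + q" using Suc.hyps(2) pq by simp
 have "mu (x [^] p') (mu x c) = mu (x [^] p) c" using mu_mu[OF _ _ cQ, of "x [^] p'" x] xc by (simp add: pq)
 moreover have "a + D + int p' * D = a + int p * D" by (simp add: pq algebra_simps)
 ultimately show "mu (x [^] p') (mu x c):BU (a + D + int p' * D) F g" using Suc.prems(2) by (simp only:)
 have "mu (y [^] q) (mu x c) = mu x (mu (y [^] q) c)" using comm xc by simp
 moreover have "a + D + int q * D = a + int q * D + D" by simp
 ultimately show "mu (y [^] q) (mu x c):BU (a + D + int q * D) F g" using mu_BU[OF x(1) Suc.prems(3)] by (simp only:)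
 qed
 have 2: "mu ((x \<oplus> y) [^] (p + q')) (mu y c):BU (a + D + int (p + q') * D) F g"
 proof (rule Suc.hyps(1)[OF _ zx(2)])
 show "N = p + q'" using Suc.hyps(2) pq by simp
 have "mu (y [^] q') (mu y c) = mu (y [^] q) c" using mu_mu[OF _ _ cQ, of "y [^] q'" y] xc by (simp add: pq)
 moreover have "a + D + int q' * D = a + int q * D" by (simp add: pq algebra_simps)
 ultimately show "mu (y [^] q') (mu y c):BU (a + D + int q' * D) F g" using Suc.prems(3) by (simp only:)
 have "mu (x [^] p) (mu y c) = mu y (mu (x [^] p) c)" using comm xc by simp
 moreover have "a + D + int p * D = a + int p * D + D" by simp
 ultimately show "mu (x [^] p) (mu y c):BU (a + D + int p * D) F g" using mu_BU[OF x(2) Suc.prems(2)] by (simp only:)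
 qed
 have N: "p' + q = N" "p + q' = N" "p + q = Suc N" using Suc.hyps(2) pq by auto
 let ?z = "(x \<oplus> y) [^] N"
 have zd: "?z:gcomp R (int N * D)" by (rule pow_deg[OF xy])
 have nn: "mu (x \<oplus> y) c - (mu x c + mu y c):NNU (a + D) Int cs (QU (a + D) F)" by (rule mu_add[OF x cQ])
 have "mu (x \<oplus> y) c - (mu x c + mu y c):Ch (QU (a + D) F) grU g"
 using zx mu_ZU[OF xy Suc.prems(1)] by (intro lsub_diff[OF lsub_Ch] lsub_add[OF lsub_Ch]) (auto simp: ZZ_def)
 from N_BB[OF cpxF nn this] have "mu ?z (mu (x \<oplus> y) c - (mu x c + mu y c)):BU (a + D + int N * D) F g"
 by (rule mu_BU[OF zd])
 from lsub_add[OF lsub_BB[OF cpxF] this lsub_add[OF lsub_BB[OF cpxF] 1[unfolded N] 2[unfolded N]]]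
 have "mu ?z (mu (x \<oplus> y) c):BU (a + D + int N * D) F g" by (simp add: lin_simps)
 moreover have "mu ?z (mu (x \<oplus> y) c) = mu ((x \<oplus> y) [^] Suc N) c"
 using mu_mu[OF _ _ cQ, of ?z "x \<oplus> y"] xc by simp
 moreover have "a + D + int N * D = a + int (Suc N) * D" by (simp add: algebra_simps)
 ultimately show ?thesis unfolding N by (simp only:)
 qed
qed


text \<open>The f_i with \<open>i\<close> in \<open>Y\<close> act locally nilpotently on cohomology,
  and so does f_j as a homogeneous combination of some of them. But f_j is invertible at every face
  of \<open>F\<close>, so nothing survives.\<close>

lemma acU_F:
 assumes Y': "Y' <= Y" and fj: "fs ! j:Idl ((!) fs ` Y')"
 shows "acU a F"
 unfolding cube.acF_def[OF cubeU] acyc_def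
proof (intro allI subsetI)
 fix g c assume c: "c:ZU a F g"
 let ?G = "(!) fs ` Y'"
 let ?W = "{r \<otimes> f | r f. r:carrier R&f:?G}"
 let ?WD = "%D. {r \<otimes> fs ! i | r i. i:Y'&r:gcomp R (D - dg i)}"
 have Yl: "i < length fs" if "i:Y'" for i using that Y' Y by auto
 have G: "?G <= carrier R" using Yl fsc by auto
 have W: "?W <= carrier R" using G by auto
 \<comment> \<open>The coefficients that express f_j can be taken homogeneous, by projecting each to
   the complementary degree.\<close>
 have prs: "pr D z:sums (?WD D)" if "z:sums ?W" for z D
 using that
 proof (induction rule: sums.induct)
 case sums_zero
 then show ?case using pr_same[OF g_zero] sums.sums_zero by simp
 next
 case (sums_step z w)
 obtain r i where w: "w = r \<otimes> fs ! i" "r:carrier R" "i:Y'" using sums_step.hyps(2) by blast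
 have "pr D (z \<oplus> w) = pr D z \<oplus> pr (D - dg i) r \<otimes> fs ! i"
 using pr_add[OF sums_car[OF W sums_step.hyps(1)], of w D] pr_mult[OF w(2) fsdg[OF Yl[OF w(3)]], of D] w fsc[OF Yl[OF w(3)]] by simp
 moreover have "pr (D - dg i) r \<otimes> fs ! i:?WD D" using w pr_mem by blast
 ultimately show ?case using sums.sums_step[OF sums_step.IH] by simp
 qed
 let ?D = "dg j"
 have "fs ! j:sums (?WD ?D)"
 using prs[of "fs ! j" ?D] subsetD[OF ideal_sums[OF G] fj] pr_same[OF fsdg[OF j(1)]] by simp
 then have "fs ! j:gcomp R ?D&(EX n. mu (fs ! j [^] (n::nat)) c:BU (a + int n * ?D) F g)"
 proof (induction rule: sums.induct)
 case sums_zero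
 have "\<zero> [^] (1::nat) = \<zero>" by simp
 have cQ: "c:Ch (QU a F) grU g" using c by (auto simp: ZZ_def)
 \<comment> \<open>Formal keys with numerator zero do not vanish; additivity for 0 + 0 = 0 shows
   that they are relations.\<close>
 have "mu \<zero> c - (mu \<zero> c + mu \<zero> c):NNU (a + ?D) Int cs (QU (a + ?D) F)"
 using mu_add[OF g_zero g_zero Ch_cs[OF cQ]] by simp
 from lsub_minus[OF lsub_NQ this] have "mu \<zero> c:NNU (a + ?D) Int cs (QU (a + ?D) F)" by simp
 moreover have "mu \<zero> c:Ch (QU (a + ?D) F) grU g" using mu_ZU[OF g_zero c] by (auto simp: ZZ_def)
 ultimately have "mu \<zero> c:BU (a + ?D) F g" by (rule N_BB[OF cpxF])
 then show ?case using g_zero by (intro conjI exI[of _ 1]) simp_all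
 next
 case (sums_step z w)
 obtain r i where w: "w = r \<otimes> fs ! i" "r:gcomp R (?D - dg i)" "i:Y'" using sums_step.hyps(2) by blast
 have il: "i < length fs" by (rule Yl[OF w(3)])
 have iY: "i:Y" using w(3) Y' by blast
 have wD: "w:gcomp R ?D" using g_mult[OF w(2) fsdg[OF il]] w(1) by simp
 obtain n where n: "mu ((fs ! i) [^] (n::nat)) c:BU (a + int n * dg i) F g" using local_nil[OF iY c] by blast
 have "mu (r [^] n) (mu ((fs ! i) [^] n) c):BU (a + int n * dg i + int n * (?D - dg i)) F g"
 by (rule mu_BU[OF pow_deg[OF w(2)] n])
 moreover have "mu (r [^] n) (mu ((fs ! i) [^] n) c) = mu (w [^] n) c"
 proof -
 have "c:cs (QU a F)" using c by (auto simp: ZZ_def intro: Ch_cs)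
 then show ?thesis using mu_mu[of "r [^] n" "(fs ! i) [^] n" c a F] g_closed[OF w(2)] fsc[OF il]
 by (simp add: w(1) nat_pow_distrib)
 qed
 moreover have "a + int n * dg i + int n * (?D - dg i) = a + int n * ?D" by (simp add: algebra_simps)
 ultimately have wn: "mu (w [^] n) c:BU (a + int n * ?D) F g" by (simp only:)
 obtain k where k: "z:gcomp R ?D" "mu (z [^] (k::nat)) c:BU (a + int k * ?D) F g" using sums_step.IH by blast
 show ?case using nil_add[OF k(1) wD c k(2) wn] g_add[OF k(1) wD] by blast
 qed
 then obtain n where n: "mu (fs ! j [^] (n::nat)) c:BU (a + int n * ?D) F g" by blast
 \<comment> \<open>A primitive of f_j^n c, divided by f_j^n, is a primitive of \<open>c\<close>
   modulo relations.\<close>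
 let ?a = "a + int n * ?D" and ?x = "(fs ! j) [^] n" and ?eta = "%i. if i = j then n else 0"
 have cC: "c:Ch (QU a F) grU g" using c by (auto simp: ZZ_def)
 obtain b where b: "b:Ch (QU ?a F) grU (g - 1)" "mu ?x c - dU ?a F b:NNU ?a Int cs (QU ?a F)"
 using n by (rule BBE[OF cpxF])
 have ok: "okF F ?eta" unfolding okF_def F by auto
 have da: "?a + 0 - de ?eta = a" using de_single[OF j(1)] by simp
 note opd = op_cs[OF g_one ok, of _ ?a, unfolded da] op_NN[OF g_one ok, of _ ?a, unfolded da]
 op_d[OF g_one ok, of _ ?a, unfolded da] op_Ch[OF g_one ok, of _ ?a, unfolded da]
 let ?b = "op \<one> ?eta b"
 have "c - dU a F ?b = op \<one> ?eta (mu ?x c - dU ?a F b) - (op \<one> ?eta (mu ?x c) - c)"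
 using opd(3)[OF Ch_cs[OF b(1)]] by (simp add: lin_diff)
 also have "...:NNU a Int cs (QU a F)"
 proof (rule lsub_diff[OF lsub_NQ])
 show "op \<one> ?eta (mu ?x c - dU ?a F b):NNU a Int cs (QU a F)" using opd(1,2) b(2) by blast
 show "op \<one> ?eta (mu ?x c) - c:NNU a Int cs (QU a F)"
 by (rule op_divide[OF j(1) _ Ch_cs[OF cC]]) (simp add: F)
 qed
 finally show "c:BU a F g" using opd(4)[OF b(1)] cC by (intro BBI[OF cpxF, of ?b]) simp_all
qed

text \<open>The faces through the redundant generator \<open>j\<close> form an acyclic upward closed
  family; dividing it out leaves the faces inside \<open>Y\<close>.\<close>

lemma cohU_insert:
 assumes "Y' <= Y" "fs ! j:Idl ((!) fs ` Y')"
 shows "cohU a {S. S <= insert j Y} g B <-> cohU a {S. S <= Y} g B"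
proof -
 have "cube.conv {S. S <= insert j Y}" unfolding cube.conv_def[OF cubeU] by blast
 moreover have "cube.up_in {S. S <= insert j Y} F" unfolding cube.up_in_def[OF cubeU] F by blast
 moreover have "{S. S <= insert j Y} - F = {S. S <= Y}" unfolding F using j by auto
 ultimately show ?thesis using cube.cohF_quotient[OF cubeU _ _ acU_F[OF assms]] by metis
qed

end

end

end

section \<open>Sublists, and the comparison of two systems of generators\<close>

context galg
begin

lemma monomials_shift:
 assumes "S <= {k..<k + length hs}" and nth: "!!i. i < length hs==>hs ! i = fs ! (i + k)"
 and fs: "!!i. i:S==>fs ! i:carrier R"
 shows "monomials R hs ((%i. i - k) ` S) = monomials R fs S"
proof -
 have inj: "inj_on (%i. i - k) S"
 using assms(1) by (intro inj_onI) (metis atLeastLessThan_iff eq_diff_iff subsetD)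
 have hf: "hs ! (i - k) = fs ! i" if "i:S" for i
 proof -
 have "k <= i" "i < k + length hs" using assms(1) that by auto
 then show ?thesis using nth[of "i - k"] by simp
 qed
 have 1: "mon hs ((%i. i - k) ` S) ep = mon fs S (%i. ep (i - k))" for ep
 proof -
 have "mon hs ((%i. i - k) ` S) ep = (\<Otimes>i\<in>S. (hs ! (i - k)) [^] ep (i - k))"
 unfolding mon_def by (rule finprod_reindex[OF _ inj]) (use hf fs in auto)
 also have "... = mon fs S (%i. ep (i - k))"
 unfolding mon_def by (rule finprod_cong') (use hf fs in auto)
 finally show ?thesis .
 qed
 have 2: "mon fs S ep = mon hs ((%i. i - k) ` S) (%i. ep (i + k))" for ep
 proof -
 have "i - k + k = i" if "i:S" for i using that assms(1) by auto
 then show ?thesis unfolding 1 unfolding mon_def by (intro finprod_cong') (use fs in auto)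
 qed
 show ?thesis unfolding monomials_mon
 proof (intro equalityI subsetI)
 fix x
 show "x:range (mon fs S)" if "x:range (mon hs ((%i. i - k) ` S))" using that 1 by auto
 assume "x:range (mon fs S)"
 then obtain ep where "x = mon fs S ep" by auto
 then show "x:range (mon hs ((%i. i - k) ` S))" unfolding 2 by simp
 qed
qed

lemma cech_sublist_free:
 assumes fsdg: "!!i. i < length fs==>fs ! i:gcomp R (dg i)"
 and k: "k + length hs <= length fs" and nth: "!!i. i < length hs==>hs ! i = fs ! (i + k)"
 and coh: "cube.cohF {..<length fs} (EU fs dg a) (NU fs dg a) (%(S, e). int (card S)) 1 {S. S <= {k..<k + length hs}} p B"
 shows "is_free (cech_cohomology R hs p a) B"
proof -
 let ?X = "{..<length fs}" and ?F = "{S. S <= {k..<k + length hs}}" and ?sh = "%S. (%i. i - k) ` S"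
 have FX: "S <= ?X" if "S:?F" for S using that k by auto
 have fc: "fs ! i:carrier R" if "i < length fs" for i using fsdg[OF that] g_closed by blast
 have mons: "monomials R hs (?sh S) = monomials R fs S" if "S:?F" for S
 by (rule monomials_shift[OF _ nth]) (use that FX[OF that] fc in auto)
 have L: "cech_localization R hs (?sh S) = LS fs S" if "S:?F" for S
 using mons[OF that] by (simp add: LS_def[OF fsdg] cld)
 have hsc: "set hs <= carrier R"
 proof
 fix x assume "x:set hs"
 then obtain i where "i < length hs" "x = hs ! i" by (metis in_set_conv_nth)
 then show "x:carrier R" using nth fc k by auto
 qed
 show ?thesis
 proof (rule cech_cube_free[OF cubeU[OF fsdg] hsc, where val = "vU fs" and k = k])
 show "{k..<k + length hs} <= ?X" using k by auto
 fix S assume S: "S:?F"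
 show "vU fs S e:gcomp (cech_localization R hs (?sh S)) a" if "e:EU fs dg a S" for e
 unfolding L[OF S] using vU_car[OF fsdg FX[OF S] that] by simp
 show "w:NU fs dg a S <-> kmod.ev (cech_localization R hs (?sh S)) (vU fs S) w = \<zero>\<^bsub>cech_localization R hs (?sh S)\<^esub>"
 if "w:cs (EU fs dg a S)" for w
 unfolding L[OF S] using that by (simp add: NU_def[OF fsdg])
 show "EX w:cs (EU fs dg a S). kmod.ev (cech_localization R hs (?sh S)) (vU fs S) w = Y"
 if Y: "Y:gcomp (cech_localization R hs (?sh S)) a" for Y
 proof -
 have ms: "mset (monomials R fs S)" by (rule msU[OF fsdg FX[OF S]])
 have Lk: "kmod (LS fs S)" by (rule LkU[OF fsdg FX[OF S]])
 obtain r s d where rs: "Y = frac R (monomials R fs S) r s" "s:monomials R fs S" "s:gcomp R d" "r:gcomp R (a + d)"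
 using Y unfolding cld mons[OF S] loc_simps(3)[OF ms] by blast
 have fsU: "set fs <= carrier R" by (rule fsU[OF fsdg])
 from rs(2) obtain ze where "s = mon fs S ze" unfolding monomials_mon by blast
 then have "s = mon fs S (%i. if i:S then ze i else 0)" using mon_restrict[OF fsU FX[OF S]] by simp
 also have "... = mon fs ?X (%i. if i:S then ze i else 0)" by (rule mon_mono[OF fsU FX[OF S]]) auto
 finally obtain ep where ep: "s = mon fs ?X ep" "ALL i. i ~: S --> ep i = 0" by (metis (mono_tags, lifting))
 show ?thesis
 \<comment> \<open>A zero denominator has no determined degree, so no key need match it; but then
   \<open>Y\<close> is zero and the empty combination represents it.\<close>
 proof (cases "s = \<zero>")
 case True
 then have "Y = \<zero>\<^bsub>LS fs S\<^esub>"
 unfolding rs(1) L[OF S, symmetric] cld mons[OF S]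
 using rs g_closed by (intro loc_zeroI[OF ms, where u = s]) auto
 then show ?thesis unfolding L[OF S] using kmod.ev_0[OF Lk] lsub_0[OF lsub_cs] by (metis (no_types, lifting))
 next
 case False
 have sd: "s:gcomp R (de fs dg ep)" unfolding ep(1) by (rule monX_deg[OF fsdg])
 have "d = de fs dg ep" using False pr_same[OF rs(3)] pr_other[OF sd, of d] by metis
 then have e: "(r, ep):EU fs dg a S" using rs(4) ep(2) by (simp add: EU_def[OF fsdg])
 have v: "vU fs S (r, ep):carrier (LS fs S)" using vU_car[OF fsdg FX[OF S] e] by simp
 have "kmod.ev (LS fs S) (vU fs S) (single (r, ep) 1) = Y"
 using kmod.ev_single[of "LS fs S" "vU fs S" "(r, ep)" 1, OF Lk v] kmod.sm_1[OF Lk v]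
 by (simp add: vU_def[OF fsdg] rs(1) ep(1))
 then show ?thesis unfolding L[OF S] using single_cs[OF e] by blast
 qed
 qed
 next
 fix S e j assume S: "insert j S:?F" "j ~: S" and e: "e:EU fs dg a S"
 show "vU fs (insert j S) e = localization_map R (monomials R hs (?sh (insert j S))) (vU fs S e)"
 unfolding mons[OF S(1)] by (rule vU_map[OF fsdg _ FX[OF S(1)] e, symmetric]) auto
 qed (use coh in simp_all)
qed

text \<open>In the cube of the concatenated list, the elements of \<open>gs\<close> are added to
  \<open>hs\<close> one at a time, and then those of \<open>hs\<close> are dropped. Each is
  redundant because the ideals agree.\<close>

theorem cech_generators:
 assumes hs: "set hs <= (\<Union>d. gcomp R d)" and gs: "set gs <= (\<Union>d. gcomp R d)"
 and eq: "Idl (set hs) = Idl (set gs)"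
 shows "\<exists>B :: (nat set \<times> 'r \<times> (nat=>nat) \<Rightarrow>\<^sub>0 'k) set. is_free (cech_cohomology R hs p a) B&is_free (cech_cohomology R gs p a) B"
proof -
 define fs where "fs = hs @ gs"
 let ?N = "length hs" and ?M = "length gs"
 have "ALL i. EX d. i < length fs --> fs ! i:gcomp R d"
 proof
 fix i
 have "i < length fs==>fs ! i:(\<Union>d. gcomp R d)" using nth_mem[of i fs] hs gs by (auto simp: fs_def)
 then show "EX d. i < length fs --> fs ! i:gcomp R d" by blast
 qed
 then obtain dg where "ALL i. i < length fs --> fs ! i:gcomp R (dg i)" by metis
 then have dg: "!!i. i < length fs==>fs ! i:gcomp R (dg i)" by blast
 let ?X = "{..<length fs}"
 let ?coh = "%Y. cube.cohF ?X (EU fs dg a) (NU fs dg a) (%(S, e). int (card S)) 1 {S. S <= Y} p"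
 have lfs: "length fs = ?N + ?M" by (simp add: fs_def)
 have hsc: "set hs <= carrier R" "set gs <= carrier R" using hs gs g_closed by auto
 have hI: "(!) fs ` {..<?N} = set hs" by (auto simp: fs_def nth_append set_conv_nth)
 have gI: "(!) fs ` {?N..<?N + ?M} = set gs"
 proof -
 have "(!) fs ` {?N..<?N + ?M} = (%i. fs ! (i + ?N)) ` {..<?M}"
 by (auto simp: image_iff) (metis add.commute le_Suc_ex nat_add_left_cancel_less lessThan_iff)
 then show ?thesis by (auto simp: fs_def nth_append set_conv_nth)
 qed
 have inI: "fs ! i:Idl (set hs)" if "i < length fs" for i
 proof (cases "i < ?N")
 case True
 then have "fs ! i:set hs" by (simp add: fs_def nth_append)
 then show ?thesis using genideal_self[OF hsc(1)] by blast
 next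
 case False
 then have "fs ! i:set gs" using that by (simp add: fs_def nth_append)
 then show ?thesis using genideal_self[OF hsc(2)] eq by blast
 qed
 have up: "?coh {..<?N + m} B <-> ?coh {..<?N} B" if "m <= ?M" for m and B :: "(nat set \<times> 'r \<times> (nat=>nat) \<Rightarrow>\<^sub>0 'k) set"
 using that
 proof (induction m)
 case (Suc m)
 have "?coh (insert (?N + m) {..<?N + m}) B <-> ?coh {..<?N + m} B"
 by (rule cohU_insert[OF dg _ _ _ refl, where Y' = "{..<?N}"])
 (use Suc.prems inI[of "?N + m"] in \<open>auto simp: hI lfs\<close>)
 moreover have "insert (?N + m) {..<?N + m} = {..<?N + Suc m}" by auto
 ultimately show ?case using Suc by simp
 qed simp
 have down: "?coh {i..<?N + ?M} B <-> ?coh {..<?N + ?M} B" if "i <= ?N" for i and B :: "(nat set \<times> 'r \<times> (nat=>nat) \<Rightarrow>\<^sub>0 'k) set"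
 using that
 proof (induction i)
 case 0
 then show ?case by (simp add: lessThan_atLeast0)
 next
 case (Suc i)
 have "?coh (insert i {Suc i..<?N + ?M}) B <-> ?coh {Suc i..<?N + ?M} B"
 by (rule cohU_insert[OF dg _ _ _ refl, where Y' = "{?N..<?N + ?M}"])
 (use Suc.prems inI[of i] eq in \<open>auto simp: gI lfs\<close>)
 moreover have "insert i {Suc i..<?N + ?M} = {i..<?N + ?M}" using Suc.prems by auto
 ultimately show ?case using Suc by simp
 qed
 have "cube.conv {S. S <= {..<?N}}" by (simp add: cube.conv_def[OF cubeU[OF dg]]) blast
 from coh_exists[OF cube.cpx_conv[OF cubeU[OF dg] this]]
 obtain B :: "(nat set \<times> 'r \<times> (nat=>nat) \<Rightarrow>\<^sub>0 'k) set" where B: "?coh {..<?N} B"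
 by (auto simp: cube.cohF_def[OF cubeU[OF dg]])
 have B': "?coh {?N..<?N + ?M} B" using down[of ?N B] up[of ?M B] B by simp
 have "is_free (cech_cohomology R hs p a) B"
 by (rule cech_sublist_free[OF dg, where k = 0]) (use B in \<open>auto simp: fs_def nth_append lessThan_atLeast0\<close>)
 moreover have "is_free (cech_cohomology R gs p a) B"
 by (rule cech_sublist_free[OF dg, where k = ?N]) (use B' in \<open>auto simp: fs_def nth_append\<close>)
 ultimately show ?thesis by blast
qed

end

section \<open>Monomial presentations\<close>

lemma sc_mult: "sc a c = single 0 a * (c :: ('e::comm_monoid_add \<Rightarrow>\<^sub>0 'k::field))"
 unfolding sc_def by (rule mult_map_scale_conv_mult)

lemma sc_mult_left: "sc a c * d = sc a (c * d :: ('e::comm_monoid_add \<Rightarrow>\<^sub>0 'k::field))"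
 by (simp add: sc_mult mult.assoc)

lemma lin_mult [simp]: "lin (%c. p * (c :: ('e::comm_monoid_add \<Rightarrow>\<^sub>0 'k::field)))"
 and lin_mult2 [simp]: "lin (%c. c * (p :: ('e::comm_monoid_add \<Rightarrow>\<^sub>0 'k::field)))"
 by (rule linI; simp add: sc_mult algebra_simps)+

lemma cs_mult:
 assumes "c:cs A" "c':cs B" "!!a b. a:A==>b:B==>a + b:C"
 shows "c * c':cs (C :: 'e::comm_monoid_add set)"
 using keys_mult[of c c'] assms unfolding cs_def by blast

lemma cs_shift: "c:cs A==>(!!a. a:A==>e + a:C)==>single e 1 * c:cs (C :: 'e::comm_monoid_add set)"
 by (rule cs_mult[OF single_cs[of e "{e}"]]) auto

lemma single_shift [simp]: "single f 1 * (single e 1 * h) = single (f + e :: 'e::comm_monoid_add) 1 * (h :: ('e, 'k::field) pm)"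
 unfolding mult.assoc[symmetric] single_mult by simp

type_synonym ex = "nat \<Rightarrow>\<^sub>0 int"

text \<open>The exponents of the monomials in the variables \<open>W\<close> and \<open>t\<close>, which is the variable \<open>0\<close>, when
 \<open>t\<close> and the variables in \<open>U\<close> are inverted.\<close>

definition LL :: "nat set=>nat set=>ex set" where
 "LL W U = {e. keys e <= insert 0 W&(ALL v:W - U. 0 <= lookup e v)}"

text \<open>The ideal generated by \<open>H\<close> in the partial Laurent ring with monomials
  \<open>LL W U\<close>, written as a span so that linear arguments apply.\<close>

definition NL :: "nat set=>(ex \<Rightarrow>\<^sub>0 'k::field) set=>nat set=>(ex \<Rightarrow>\<^sub>0 'k) set" where
 "NL W H U = pm.span {single e 1 * h | e h. e:LL W U&h:H}"

definition wt :: "nat set=>ex=>int" where "wt W e = (\<Sum>v\<in>W. lookup e v)"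

lemma wt_add [simp]: "wt W (e + f) = wt W e + wt W f" and wt_diff [simp]: "wt W (e - f) = wt W e - wt W f"
 and wt_0 [simp]: "wt W 0 = 0"
 by (simp_all add: wt_def lookup_add lookup_minus sum.distrib sum_subtractf)

lemma LL_add: "e:LL W U==>f:LL W U==>e + f:LL W U"
 using keys_add[of e f] by (auto simp: LL_def lookup_add)

lemma LL_mono: "U <= U'==>LL W U <= LL W U'" by (auto simp: LL_def)

lemma lsub_NL [simp]: "lsub (NL W H U)"
 by (simp add: NL_def)

lemma NL_gen: "e:LL W U==>h:H==>single e 1 * h:NL W H U"
 unfolding NL_def by (rule pm.span_base) blast

lemma NL_into:
 assumes "w:NL W H U" "lsub N" "!!e h. e:LL W U==>h:H==>single e 1 * h:N"
 shows "w:N"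
 using assms(1) span_subset[OF assms(2), of "{single e 1 * h | e h. e:LL W U&h:H}"] assms(3)
 unfolding NL_def by blast

lemma NL_mono: "LL W U <= LL W' U'==>H <= H'==>NL W H U <= NL W' H' U'"
 using NL_into[OF _ lsub_NL, of _ W H U W' H' U'] NL_gen by blast

lemma NL_shift:
 assumes "w:NL W H U" "f:LL W U"
 shows "single f 1 * w:NL W H U"
proof -
 have "w:{w. single f 1 * w:NL W H U}"
 proof (rule NL_into[OF assms(1)])
 fix e h assume eh: "e:LL W U" "h:H"
 show "single e 1 * h:{w. single f 1 * w:NL W H U}"
 using NL_gen[OF LL_add[OF assms(2) eh(1)] eh(2)] by simp
 qed (rule lsub_vimage[OF lin_mult lsub_NL])
 then show ?thesis by simp
qed

text \<open>A monomial multiple of a homogeneous \<open>h\<close> is homogeneous, so it lies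
  entirely inside or outside the degrees in \<open>D\<close>. The grading is arbitrary because the
  total degree, the t-exponent and pairs of these all occur.\<close>

lemma NL_hom:
 assumes w: "w:NL W H U" and f: "!!a b. f (a + b) = f a + f b"
 and H: "!!h. h:H==>EX d. h:cs {e. f e = (d :: 'g::ab_group_add)}"
 shows "rst {e. f e:D} w:NL W H U"
proof -
 have "w:{w. rst {e. f e:D} w:NL W H U}"
 proof (rule NL_into[OF w lsub_vimage[OF lin_rst lsub_NL]])
 fix e h assume eh: "e:LL W U" "h:H"
 obtain d where "h:cs {e. f e = d}" using H[OF eh(2)] by blast
 then have c: "single e 1 * h:cs {x. f x = f e + d}" by (rule cs_shift) (simp add: f)
 show "single e 1 * h:{w. rst {e. f e:D} w:NL W H U}"
 proof (cases "f e + d:D")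
 case True
 then have "rst {e. f e:D} (single e 1 * h) = single e 1 * h" by (intro rst_id[OF c]) auto
 then show ?thesis using NL_gen[OF eh] by simp
 next
 case False
 then have "rst {e. f e:D} (single e 1 * h) = 0" by (intro rst_disjoint[OF c]) auto
 then show ?thesis by (simp add: lsub_0)
 qed
 qed
 then show ?thesis by simp
qed

primrec npw :: "nat=>ex=>ex" where
 "npw 0 G = 0"
| "npw (Suc N) G = G + npw N G"

lemma lookup_npw [simp]: "lookup (npw N G) v = int N * lookup G v"
 by (induction N) (simp_all add: lookup_add algebra_simps)

lemma npw_add: "npw (M + N) G = npw M G + npw N G"
 by (rule pmI) (simp add: lookup_add algebra_simps)

lemma npw_LL: "G:LL W {}==>npw N G:LL W {}"
 by (induction N) (simp_all add: LL_add, simp add: LL_def)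

text \<open>A high power of a monomial \<open>G\<close> that contains every inverted variable
  removes the negative exponents from a multiple of one \<open>h\<close>; for a sum of two relations
  the two powers are added.\<close>

lemma NL_clear:
 assumes w: "w:NL W H U" and G: "G:LL W {}" "!!v. v:W Int U==>0 < lookup G v"
 shows "\<exists>N::nat. single (npw N G) 1 * w:NL W H {}"
proof -
 let ?n = "%N. npw N G"
 note nG = npw_LL[OF G(1)]
 have up: "single (?n (M + N)) 1 * w:NL W H {}" if "single (?n N) 1 * w:NL W H {}" for M N and w :: "ex \<Rightarrow>\<^sub>0 'a"
 using NL_shift[OF that nG[of M]] by (simp add: npw_add)
 have "w:{w. \<exists>N::nat. single (?n N) 1 * w:NL W H {}}"
 proof (rule NL_into[OF w])
 show "lsub {w. \<exists>N::nat. single (?n N) 1 * w:NL W H {}}"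
 proof (rule lsubI)
 show "0:{w. \<exists>N::nat. single (?n N) 1 * w:NL W H {}}" by (simp add: lsub_0)
 next
 fix u v assume "u:{w. \<exists>N::nat. single (?n N) 1 * w:NL W H {}}" "v:{w. \<exists>N::nat. single (?n N) 1 * w:NL W H {}}"
 then obtain M N where "single (?n M) 1 * u:NL W H {}" "single (?n N) 1 * v:NL W H {}" by blast
 then have "single (?n (N + M)) 1 * u + single (?n (M + N)) 1 * v:NL W H {}"
 by (intro lsub_add[OF lsub_NL] up)
 then have "single (?n (M + N)) 1 * (u + v):NL W H {}" by (simp only: distrib_left add.commute[of N M])
 then show "u + v:{w. \<exists>N::nat. single (?n N) 1 * w:NL W H {}}" by blast
 next
 fix c u assume "u:{w. \<exists>N::nat. single (?n N) 1 * w:NL W H {}}"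
 then obtain N where "single (?n N) 1 * u:NL W H {}" by blast
 then have "single (?n N) 1 * sc c u:NL W H {}" using lsub_sc[OF lsub_NL, of _ W H "{}" c] lin_sc[OF lin_mult] by metis
 then show "sc c u:{w. \<exists>N::nat. single (?n N) 1 * w:NL W H {}}" by blast
 qed
 next
 fix e h assume eh: "e:LL W U" "h:H"
 define N where "N = nat (\<Sum>v\<in>keys e. \<bar>lookup e v\<bar>)"
 have N: "- lookup e v <= int N" for v
 proof (cases "v:keys e")
 case True
 then have "\<bar>lookup e v\<bar> <= (\<Sum>v\<in>keys e. \<bar>lookup e v\<bar>)" by (intro member_le_sum) auto
 then show ?thesis by (simp add: N_def)
 qed (simp add: in_keys_iff)
 have "0 <= lookup (?n N + e) v" if v: "v:W" for v
 proof (cases "v:U")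
 case True
 then have "1 <= lookup G v" using G(2) v by force
 then have "int N * 1 <= int N * lookup G v" by (intro mult_left_mono) auto
 then show ?thesis using N[of v] by (simp add: lookup_add)
 next
 case False
 then have "0 <= lookup e v" "0 <= lookup (?n N) v" using eh(1) nG[of N] v by (auto simp: LL_def)
 then show ?thesis by (simp add: lookup_add)
 qed
 then have "?n N + e:LL W {}"
 using nG[of N] eh(1) keys_add[of "?n N" e] unfolding LL_def by blast
 then have "single (?n N + e) 1 * h:NL W H {}" by (rule NL_gen[OF _ eh(2)])
 then have "single (?n N) 1 * (single e 1 * h):NL W H {}" by simp
 then show "single e 1 * h:{w. \<exists>N::nat. single (?n N) 1 * w:NL W H {}}" by blast
 qed
 then show ?thesis by simp
qed

text \<open>\<open>R\<close> is spanned by the monomials in \<open>E\<close>, but its relations are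
  cut out by \<open>NL W H {}\<close>, where t is invertible. The Rees algebra forces this: for
  \<open>h\<close> of degree 2 in the variables of I, h t^2 is a relation although t^2 is not a
  monomial of the algebra.\<close>

locale mpres =
 fixes R :: "('k::field, 'r) graded_algebra" (structure) and W :: "nat set"
 and H :: "(ex \<Rightarrow>\<^sub>0 'k) set" and E :: "ex set" and Ph :: "(ex \<Rightarrow>\<^sub>0 'k)=>'r"
 assumes W0: "0 ~: W" and E0 [simp]: "0:E" and EE [simp]: "e:E==>f:E==>e + f:E" and EW: "E <= LL W {}"
 and Hd: "h:H==>EX d. h:cs {e. wt W e = d}"
 and car: "carrier R = Ph ` cs E" and gc: "gcomp R d = Ph ` cs {e:E. wt W e = d}"
 and hadd: "c:cs E==>c':cs E==>Ph (c + c') = Ph c \<oplus> Ph c'"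
 and hmult: "c:cs E==>c':cs E==>Ph (c * c') = Ph c \<otimes> Ph c'"
 and hsc: "c:cs E==>Ph (sc a c) = a \<odot> Ph c"
 and hzero: "Ph 0 = \<zero>" and hone: "Ph 1 = \<one>"
 and ker: "c:cs E==>c':cs E==>Ph c = Ph c' <-> c - c':NL W H {}"
begin

lemma csE [simp]: "c:cs E==>c':cs E==>c + c':cs E" "c:cs E==>c':cs E==>c * c':cs E"
 "c:cs E==>sc a c:cs E" "c:cs E==>- c:cs E" "c:cs E==>c':cs E==>c - c':cs E"
 "0:cs E" "1:cs E" "e:E==>single e a:cs E"
 using single_cs[OF E0, of "1 :: 'k"]
 by (auto simp flip: single_one intro: lsub_add lsub_sc lsub_diff lsub_minus lsub_0 cs_mult single_cs)

text \<open>The preimage is arbitrary; by \<open>pr_eq\<close> the result does not depend on it,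
  because the relations are homogeneous.\<close>

definition pr :: "int=>'r=>'r" where
 "pr a x = Ph (rst {e. wt W e = a} (SOME c. c:cs E&Ph c = x))"

lemma rstE [simp]: "c:cs E==>rst Q c:cs E"
 using rst_cs_Int[of c E Q] cs_mono[of "E Int Q" E] by blast

lemma pr_eq: "c:cs E==>pr a (Ph c) = Ph (rst {e. wt W e = a} c)"
proof -
 assume c: "c:cs E"
 let ?c = "SOME c'. c':cs E&Ph c' = Ph c"
 have "\<exists>c'. c':cs E&Ph c' = Ph c" using c by blast
 then have c': "?c:cs E" "Ph ?c = Ph c" using someI_ex[of "%c'. c':cs E&Ph c' = Ph c"] by blast+
 then have "?c - c:NL W H {}" using ker c by blast
 then have "rst {e. wt W e:{a}} (?c - c):NL W H {}" by (rule NL_hom) (use Hd in auto)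
 then have "rst {e. wt W e = a} ?c - rst {e. wt W e = a} c:NL W H {}" by (simp add: lin_diff)
 then show ?thesis unfolding pr_def using ker[OF rstE rstE] c c' by blast
qed

lemma cring: "cring R"
proof (rule cringI[OF abelian_groupI comm_monoidI])
 fix x assume "x:carrier R"
 then obtain c where "c:cs E" "x = Ph c" unfolding car by blast
 then show "EX y:carrier R. y \<oplus> x = \<zero>"
 unfolding car by (intro bexI[of _ "Ph (- c)"]) (simp_all add: hzero flip: hadd)
qed (auto simp: car simp flip: hadd hmult hzero hone simp: algebra_simps)

lemma gE: "x:gcomp R a==>EX c. c:cs E&rst {e. wt W e = a} c = c&x = Ph c"
proof -
 assume "x:gcomp R a"
 then obtain c where c: "x = Ph c" "c:cs {e:E. wt W e = a}" unfolding gc by blast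
 then have "rst {e. wt W e = a} c = c" by (intro rst_id) auto
 then show ?thesis using c cs_mono[of "{e:E. wt W e = a}" E] by blast
qed

lemma gI: "c:cs E==>rst {e. wt W e = a} c = c==>Ph c:gcomp R a"
 unfolding gc using rst_cs_Int[of c E "{e. wt W e = a}"] by (intro imageI) (simp add: Collect_conj_eq)

lemma rst_wt_mult:
 assumes "rst {e. wt W e = b} c' = c'"
 shows "rst {e. wt W e = a} (c * c') = rst {e. wt W e = a - b} c * c'"
proof (rule lin_eqI[where f = "%c. rst {e. wt W e = a} (c * c')" and g = "%c. rst {e. wt W e = a - b} c * c'"])
 show "lin (%c. rst {e. wt W e = a} (c * c'))" "lin (%c. rst {e. wt W e = a - b} c * c')"
 by (rule lin_comp[OF lin_rst lin_mult2], rule lin_comp[OF lin_mult2 lin_rst])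
 fix x :: ex
 have "c':cs {e. wt W e = b}" using rst_cs[of "{e. wt W e = b}" c'] assms by simp
 then have c: "single x 1 * c':cs {e. wt W e = wt W x + b}" by (rule cs_shift) simp
 show "rst {e. wt W e = a} (single x 1 * c') = rst {e. wt W e = a - b} (single x 1) * c'"
 proof (cases "wt W x = a - b")
 case True
 then show ?thesis using rst_id[OF c, of "{e. wt W e = a}"] by (simp add: rst_single)
 next
 case False
 then have "{e. wt W e = wt W x + b} Int {e. wt W e = a} = {}" by auto
 then show ?thesis using False rst_disjoint[OF c] by (simp add: rst_single)
 qed
qed

lemma galg: "galg R pr"
proof (rule galg.intro[OF cring], unfold_locales)
 interpret cring R by (rule cring)
 show "gcomp R a <= carrier R" for a using gE unfolding car by blast
 show "\<zero>:gcomp R a" for a using gI[of 0 a] by (simp add: hzero lin_0)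
 show "\<one>:gcomp R 0" using gI[of 1 0] rst_single[of "{e. wt W e = 0}" 0 "1 :: 'k"] by (simp add: hone)
 show "x \<oplus> y:gcomp R a" if xy: "x:gcomp R a" "y:gcomp R a" for x y a
 using gE[OF xy(1)] gE[OF xy(2)] gI[of _ a] by (auto simp: lin_add simp flip: hadd)
 show "c \<odot> x:gcomp R a" if x: "x:gcomp R a" for x a c
 using gE[OF x] gI[of _ a] by (auto simp: lin_sc simp flip: hsc)
 show "x \<otimes> y:gcomp R (a + b)" if xy: "x:gcomp R a" "y:gcomp R b" for x y a b
 using gE[OF xy(1)] gE[OF xy(2)] gI[of _ "a + b"] by (auto simp: rst_wt_mult simp flip: hmult)
 show "pr a x:gcomp R a" if "x:carrier R" for x a
 using that by (auto simp: car pr_eq intro!: gI simp: rst_rst)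
 show "pr a (x \<oplus> y) = pr a x \<oplus> pr a y" if "x:carrier R" "y:carrier R" for x y a
 using that by (auto simp: car pr_eq lin_add simp flip: hadd)
 show "pr a x = x" if x: "x:gcomp R a" for x a using gE[OF x] by (auto simp: pr_eq)
 show "pr b x = \<zero>" if x: "x:gcomp R a" "b ~= a" for x a b
 proof -
 obtain c where c: "c:cs E" "rst {e. wt W e = a} c = c" "x = Ph c" using gE[OF x(1)] by blast
 have "rst {e. wt W e = b} (rst {e. wt W e = a} c) = 0"
 by (rule rst_disjoint[OF rst_cs]) (use x(2) in auto)
 then show ?thesis using c by (simp add: pr_eq hzero)
 qed
 show "pr a (x \<otimes> y) = pr (a - b) x \<otimes> y" if "x:carrier R" "y:gcomp R b" for x y a b
 using gE[OF that(2)] that(1) by (auto simp: car pr_eq rst_wt_mult simp flip: hmult)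
qed (auto simp: car sc_add sc_add_left simp flip: hsc hadd hmult simp: sc_mult_left)

end

section \<open>Localizations of a presented algebra at monomials\<close>

context mpres
begin

interpretation galg R pr by (rule galg)

definition Xp :: "ex=>'r" where "Xp e = Ph (single e 1)"

lemma Xp_closed [simp]: "e:E==>Xp e:carrier R"
 by (simp add: Xp_def car)

lemma Phi_closed [simp]: "c:cs E==>Ph c:carrier R"
 by (simp add: car)

lemma Xp_Phi: "e:E==>c:cs E==>Xp e \<otimes> Ph c = Ph (single e 1 * c)"
 by (simp add: Xp_def hmult)

lemma Xp_mult: "e:E==>f:E==>Xp e \<otimes> Xp f = Xp (e + f)"
 by (simp add: Xp_def single_mult flip: hmult)

lemma Xp_gc: "e:E==>Xp e:gcomp R (wt W e)"
 unfolding Xp_def by (rule gI) (simp_all add: rst_single)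

context
 fixes gs :: "ex list" and tau :: ex
 assumes gs: "set gs <= E" and tau: "keys tau <= {0}"
begin

definition mx :: "nat set=>(nat=>nat)=>ex" where "mx S ep = (\<Sum>i\<in>S. npw (ep i) (gs ! i))"

lemma mx_add: "mx S ep + mx S ep' = mx S (%i. ep i + ep' i)"
 by (simp add: mx_def npw_add sum.distrib)

lemma npw_pow: "g:E==>npw n g:E&Xp g [^] n = Xp (npw n g)"
 by (induction n) (simp_all add: Xp_mult add.commute, simp add: Xp_def hone)

abbreviation "fs == map Xp gs"

lemma mon_mx:
 assumes "S <= {..<length gs}"
 shows "mx S ep:E&mon fs S ep = Xp (mx S ep)"
proof -
 have "finite S" using assms finite_subset by auto
 then show ?thesis using assms
 proof (induction S)
 case empty
 then show ?case by (simp add: mx_def mon_def Xp_def hone)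
 next
 case (insert x S)
 have g: "gs ! i:E" if "i:insert x S" for i using that insert.prems gs nth_mem by blast
 have c: "fs ! i [^] ep i:carrier R" if "i:insert x S" for i
 using g[OF that] that insert.prems by auto
 have "mon fs (insert x S) ep = fs ! x [^] ep x \<otimes> mon fs S ep"
 unfolding mon_def by (rule finprod_insert) (use insert.hyps c in auto)
 then show ?case using insert npw_pow[OF g[of x], of "ep x"] by (simp add: mx_def Xp_mult)
 qed
qed

lemma mx_E: "S <= {..<length gs}==>mx S ep:E" using mon_mx by blast

lemma mons: "S <= {..<length gs}==>monomials R fs S = (%ep. Xp (mx S ep)) ` UNIV"
 unfolding monomials_mon using mon_mx by auto

text \<open>Labels of the Laurent monomials in the localization at \<open>S\<close>: the label
  \<open>e\<close> stands for the exponent \<open>e - tau\<close>. The twist by a power of t makes a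
  strand of any t-exponent available as labels for an algebra without t.\<close>

definition ES :: "nat set=>ex set" where "ES S = {e. EX ep. e + mx S ep - tau:E}"

definition VS :: "nat set=>nat set" where "VS S = (\<Union>i\<in>S. keys (gs ! i))"

abbreviation "Lc S == cech_localization R fs S"

text \<open>The Laurent monomial with exponent \<open>e - tau\<close>, as a fraction over any
  monomial that makes the numerator lie in \<open>E\<close>; by \<open>vl_eq\<close> all such
  fractions are equal.\<close>

definition vl :: "nat set=>ex=>('r \<times> 'r) set" where
 "vl S e = (let ep = (SOME ep. e + mx S ep - tau:E)
 in frac R (monomials R fs S) (Xp (e + mx S ep - tau)) (Xp (mx S ep)))"

lemma fsc: "set fs <= carrier R" using gs by auto

lemma wt_tau: "wt W tau = 0"
proof -
 have "lookup tau v = 0" if "v:W" for v using that W0 tau by (auto simp flip: not_in_keys_iff_lookup_eq_zero)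
 then show ?thesis by (simp add: wt_def)
qed

lemma ES_mono: "insert j S <= {..<length gs}==>j ~: S==>mx S ep = mx (insert j S) (ep(j := 0))"
 unfolding mx_def by (subst sum.insert) (auto intro: finite_subset[of S "{..<length gs}"] sum.cong)

context
 fixes S assumes S: "S <= {..<length gs}"
begin

lemma ms: "mset (monomials R fs S)" by (rule mset_monomials[OF fsc]) (use S in simp)

lemma Xm [simp]: "Xp (mx S ep):monomials R fs S" unfolding mons[OF S] by blast

lemma Lk: "kmod (Lc S)" unfolding cld by (rule loc_kmod[OF ms])

lemma mxE [simp]: "mx S ep:E" by (rule mx_E[OF S])

lemma vl_eq:
 assumes ep: "e + mx S ep - tau:E"
 shows "vl S e = frac R (monomials R fs S) (Xp (e + mx S ep - tau)) (Xp (mx S ep))"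
proof -
 define ep' where "ep' = (SOME ep. e + mx S ep - tau:E)"
 have ep': "e + mx S ep' - tau:E" unfolding ep'_def by (rule someI[of "%ep. e + mx S ep - tau:E", OF ep])
 have "frac R (monomials R fs S) (Xp (e + mx S ep' - tau)) (Xp (mx S ep'))
 = frac R (monomials R fs S) (Xp (e + mx S ep - tau)) (Xp (mx S ep))"
 by (rule frac_eqI[OF ms, where u = \<one>])
 (use ep ep' ms_one[OF ms] in \<open>simp_all add: Xp_mult algebra_simps\<close>)
 then show ?thesis by (simp add: vl_def Let_def ep'_def)
qed

lemma vl_gc: "e:ES S==>vl S e:gcomp (Lc S) (wt W e)"
proof -
 assume "e:ES S"
 then obtain ep where ep: "e + mx S ep - tau:E" unfolding ES_def by blast
 have "Xp (e + mx S ep - tau):gcomp R (wt W e + wt W (mx S ep))" using Xp_gc[OF ep] wt_tau by simp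
 then show ?thesis unfolding vl_eq[OF ep] cld loc_simps[OF ms] using Xp_gc[OF mxE] Xm by blast
qed

lemma vl_car: "e:ES S==>vl S e:carrier (Lc S)"
 using vl_gc loc_gcomp_carrier[OF ms] unfolding cld by blast

text \<open>Finite support and \<open>mx_add\<close> give one denominator for all keys, so that
  evaluation becomes a single fraction.\<close>

lemma common:
 assumes "w:cs (ES S)"
 obtains ep where "w:cs {e. e + mx S ep - tau:E}"
proof -
 have "EX ep. ALL e:A. e + mx S ep - tau:E" if "finite A" "A <= ES S" for A
 using that
 proof (induction A)
 case (insert x A)
 then obtain ep ep' where ep: "x + mx S ep - tau:E" "ALL e:A. e + mx S ep' - tau:E" unfolding ES_def by blast
 let ?p = "%i. ep i + ep' i"
 have 1: "e + mx S ?p - tau = (e + mx S ep - tau) + mx S ep'" and 2: "e + mx S ?p - tau = (e + mx S ep' - tau) + mx S ep" for e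
 by (simp_all add: algebra_simps flip: mx_add)
 have "x + mx S ?p - tau:E" unfolding 1 by (rule EE[OF ep(1) mxE])
 moreover have "e + mx S ?p - tau:E" if "e:A" for e unfolding 2 by (rule EE[OF _ mxE]) (use ep(2) that in blast)
 ultimately show ?case by blast
 qed simp
 then obtain ep where "ALL e:keys w. e + mx S ep - tau:E" using assms unfolding cs_def by (metis finite_keys mem_Collect_eq)
 then show ?thesis using that[of ep] unfolding cs_def by blast
qed

lemma ev_vl:
 assumes w: "w:cs {e. e + mx S ep - tau:E}"
 shows "single (mx S ep - tau) 1 * w:cs E"
 and "kmod.ev (Lc S) (vl S) w = frac R (monomials R fs S) (Ph (single (mx S ep - tau) 1 * w)) (Xp (mx S ep))"
proof -
 let ?A = "{e. e + mx S ep - tau:E}" and ?g = "%w. single (mx S ep - tau) 1 * w"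
 let ?f = "%w. frac R (monomials R fs S) (Ph (?g w)) (Xp (mx S ep))"
 interpret Lc: kmod "Lc S" by (rule Lk)
 have sw: "?g w:cs E" if "w:cs ?A" for w :: "ex \<Rightarrow>\<^sub>0 'k" using that by (rule cs_shift) (simp add: algebra_simps)
 have A: "vl S e:carrier (Lc S)" if "e:?A" for e using that vl_car unfolding ES_def by blast
 show "?g w:cs E" by (rule sw[OF w])
 have "w:{w. w:cs ?A&Lc.ev (vl S) w = ?f w}"
 proof (rule cs_induct[OF w])
 show "lsub {w. w:cs ?A&Lc.ev (vl S) w = ?f w}"
 proof (rule lsubI)
 show "0:{w. w:cs ?A&Lc.ev (vl S) w = ?f w}"
 using loc_zeroI[OF ms _ Xm ms_one[OF ms], of \<zero>, symmetric] by (simp add: lsub_0 hzero) (simp add: cld)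
 next
 fix u v assume "u:{w. w:cs ?A&Lc.ev (vl S) w = ?f w}" "v:{w. w:cs ?A&Lc.ev (vl S) w = ?f w}"
 then have uv: "u:cs ?A" "v:cs ?A" "Lc.ev (vl S) u = ?f u" "Lc.ev (vl S) v = ?f v" by auto
 have 1: "Lc.ev (vl S) (u + v) = Lc.ev (vl S) u \<oplus>\<^bsub>Lc S\<^esub> Lc.ev (vl S) v" by (rule Lc.ev_add[OF uv(1,2) A])
 have "Lc.ev (vl S) (u + v) = ?f (u + v)"
 unfolding 1 uv(3,4) unfolding cld
 using loc_add_same[OF ms Phi_closed[OF sw[OF uv(1)]] Phi_closed[OF sw[OF uv(2)]] Xm]
 by (simp add: distrib_left hadd sw uv)
 then show "u + v:{w. w:cs ?A&Lc.ev (vl S) w = ?f w}" using uv lsub_add[OF lsub_cs] by blast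
 next
 fix c u assume "u:{w. w:cs ?A&Lc.ev (vl S) w = ?f w}"
 then have u: "u:cs ?A" "Lc.ev (vl S) u = ?f u" by auto
 have 1: "Lc.ev (vl S) (sc c u) = c \<odot>\<^bsub>Lc S\<^esub> Lc.ev (vl S) u" by (rule Lc.ev_sc[OF u(1) A])
 have "Lc.ev (vl S) (sc c u) = ?f (sc c u)"
 unfolding 1 u(2) lin_sc[OF lin_mult] hsc[OF sw[OF u(1)]] unfolding cld
 by (rule loc_smult[OF ms Phi_closed[OF sw[OF u(1)]] Xm])
 then show "sc c u:{w. w:cs ?A&Lc.ev (vl S) w = ?f w}" using u lsub_sc[OF lsub_cs] by blast
 qed
 next
 fix e assume e: "e:?A"
 have "?g (single e (1 :: 'k)) = single (e + mx S ep - tau) 1" by (simp add: single_mult algebra_simps)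
 then have "Lc.ev (vl S) (single e 1) = ?f (single e 1)"
 using Lc.ev_single[of "vl S" e 1, OF A[OF e]] Lc.sm_1[OF A[OF e]] vl_eq[of e ep] e by (simp add: Xp_def)
 then show "single e 1:{w. w:cs ?A&Lc.ev (vl S) w = ?f w}" using single_cs[OF e] by blast
 qed
 then show "Lc.ev (vl S) w = ?f w" by blast
qed

lemma mx_tau_LL: "mx S ep - tau:LL W {}" and tau_mx_LL: "tau - mx S ep:LL W (VS S)"
proof -
 have t: "lookup tau v = 0" if "v:W" for v using that W0 tau by (auto simp flip: not_in_keys_iff_lookup_eq_zero)
 have m: "mx S ep:LL W {}" using EW mxE by blast
 have z: "lookup (mx S ep) v = 0" if "v ~: VS S" for v
 proof -
 have "lookup (gs ! i) v = 0" if "i:S" for i using that \<open>v ~: VS S\<close> by (auto simp: VS_def in_keys_iff)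
 then show ?thesis by (simp add: mx_def lookup_sum)
 qed
 show "mx S ep - tau:LL W {}" "tau - mx S ep:LL W (VS S)"
 using m tau W0 t z keys_diff[of tau "mx S ep"] keys_diff[of "mx S ep" tau] by (auto simp: LL_def lookup_minus)
qed

text \<open>A fraction vanishes iff its numerator times a monomial in the generators of
  \<open>S\<close> is a relation. Undoing that monomial is a shift inside
  \<open>LL W (VS S)\<close>; conversely, \<open>NL_clear\<close> supplies such a monomial.\<close>

lemma ev_zero:
 assumes w: "w:cs (ES S)"
 shows "kmod.ev (Lc S) (vl S) w = \<zero>\<^bsub>Lc S\<^esub> <-> w:NL W H (VS S)"
proof -
 obtain ep where ep: "w:cs {e. e + mx S ep - tau:E}" using common[OF w] by blast
 let ?v = "single (mx S ep - tau) 1 * w"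
 have 0: "kmod.ev (Lc S) (vl S) w = \<zero>\<^bsub>Lc S\<^esub> <-> (\<exists>ep'. single (mx S ep' + (mx S ep - tau)) 1 * w:NL W H {})"
 proof -
 have "kmod.ev (Lc S) (vl S) w = \<zero>\<^bsub>Lc S\<^esub> <-> (EX u:monomials R fs S. u \<otimes> Ph ?v = \<zero>)"
 unfolding ev_vl(2)[OF ep] unfolding cld
 by (rule loc_zero_iff[OF ms]) (use ev_vl(1)[OF ep] in simp_all)
 also have "... <-> (\<exists>ep'. Xp (mx S ep') \<otimes> Ph ?v = \<zero>)" unfolding mons[OF S] by auto
 also have "... <-> (\<exists>ep'. single (mx S ep') 1 * ?v:NL W H {})"
 using ker[of _ 0] ev_vl(1)[OF ep] csE(2)[OF csE(8)[OF mxE] ev_vl(1)[OF ep]] by (simp add: Xp_Phi hzero del: single_shift)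
 finally show ?thesis by simp
 qed
 show ?thesis
 proof
 assume "kmod.ev (Lc S) (vl S) w = \<zero>\<^bsub>Lc S\<^esub>"
 then obtain ep' where "single (mx S ep' + (mx S ep - tau)) 1 * w:NL W H {}" unfolding 0 by blast
 then have "single (mx S (%i. ep' i + ep i) - tau) 1 * w:NL W H (VS S)"
 using NL_mono[OF LL_mono order_refl, of "{}" "VS S" W H] by (auto simp: algebra_simps simp flip: mx_add)
 then show "w:NL W H (VS S)"
 using NL_shift[OF _ tau_mx_LL[of "%i. ep' i + ep i"]] by fastforce
 next
 assume "w:NL W H (VS S)"
 \<comment> \<open>The product of all generators in \<open>S\<close> has a positive exponent at
   every inverted variable of \<open>W\<close>, as \<open>NL_clear\<close> requires.\<close>
 moreover have "mx S (%_. 1):LL W {}" using EW mxE by blast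
 moreover have "0 < lookup (mx S (%_. 1)) v" if v: "v:W Int VS S" for v
 proof -
 have nn: "0 <= lookup (gs ! i) v" if "i:S" for i
 proof -
 have "gs ! i:E" using that S gs nth_mem by blast
 then show ?thesis using EW v by (auto simp: LL_def)
 qed
 obtain i where "i:S" "lookup (gs ! i) v ~= 0" using v by (auto simp: VS_def in_keys_iff)
 then have "0 < (\<Sum>i\<in>S. lookup (gs ! i) v)" using nn finite_subset[OF S] by (intro sum_pos2[of S i]) (auto simp: order_less_le)
 then show ?thesis by (simp add: mx_def lookup_sum)
 qed
 ultimately obtain N where "single (npw N (mx S (%_. 1))) 1 * w:NL W H {}" using NL_clear by blast
 moreover have "npw N (mx S (%_. 1)) = mx S (%_. N)"
 by (rule pmI) (simp add: mx_def lookup_sum sum_distrib_left)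
 ultimately have "single (mx S ep - tau + mx S (%_. N)) 1 * w:NL W H {}"
 using NL_shift[OF _ mx_tau_LL[of ep]] by fastforce
 then show "kmod.ev (Lc S) (vl S) w = \<zero>\<^bsub>Lc S\<^esub>" unfolding 0 by (metis add.commute)
 qed
qed

lemma sur:
 assumes Y: "Y:gcomp (Lc S) a"
 shows "EX w:cs {e:ES S. wt W e = a}. kmod.ev (Lc S) (vl S) w = Y"
proof -
 obtain r s d where rs: "Y = frac R (monomials R fs S) r s" "s:monomials R fs S" "s:gcomp R d" "r:gcomp R (a + d)"
 using Y unfolding cld loc_simps(3)[OF ms] by blast
 obtain ep where ep: "s = Xp (mx S ep)" using rs(2) unfolding mons[OF S] by blast
 show ?thesis
 proof (cases "s = \<zero>")
 case True
 then have "Y = \<zero>\<^bsub>Lc S\<^esub>"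
 unfolding rs(1) cld using rs g_closed by (intro loc_zeroI[OF ms, where u = s]) auto
 then show ?thesis using kmod.ev_0[OF Lk] by (intro bexI[OF _ lsub_0[OF lsub_cs]]) simp
 next
 case False
 have "d = wt W (mx S ep)" using False pr_same[OF rs(3)] pr_other[OF Xp_gc[OF mxE[of ep]], of d] ep by metis
 then obtain c where c: "c:cs {e:E. wt W e = a + wt W (mx S ep)}" "r = Ph c" using rs(4) unfolding gc by blast
 let ?w = "single (tau - mx S ep) 1 * c"
 have w: "?w:cs {e. e + mx S ep - tau:E&wt W e = a}"
 using c(1) by (rule cs_shift) (simp add: wt_tau algebra_simps)
 have w1: "?w:cs {e. e + mx S ep - tau:E}" by (rule cs_mono[OF _ w]) auto
 have "kmod.ev (Lc S) (vl S) ?w = Y" unfolding ev_vl(2)[OF w1] rs(1) ep c(2) by simp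
 moreover have "?w:cs {e:ES S. wt W e = a}" by (rule cs_mono[OF _ w]) (auto simp: ES_def)
 ultimately show ?thesis by blast
 qed
qed

end

lemma vl_ins:
 assumes j: "insert j S <= {..<length gs}" "j ~: S" and e: "e:ES S"
 shows "e:ES (insert j S)"
 and "vl (insert j S) e = localization_map R (monomials R fs (insert j S)) (vl S e)"
proof -
 have S: "S <= {..<length gs}" using j by auto
 obtain ep where ep: "e + mx S ep - tau:E" using e unfolding ES_def by blast
 have m: "mx S ep = mx (insert j S) (ep(j := 0))" by (rule ES_mono[OF j])
 then show "e:ES (insert j S)" using ep unfolding ES_def by auto
 have "vl (insert j S) e = frac R (monomials R fs (insert j S)) (Xp (e + mx S ep - tau)) (Xp (mx S ep))"
 using vl_eq[OF j(1)] ep unfolding m by blast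
 also have "... = localization_map R (monomials R fs (insert j S)) (vl S e)"
 unfolding vl_eq[OF S ep]
 by (rule loc_map[OF ms[OF S] ms[OF j(1)] monomials_mono[OF fsc], symmetric]) (use ep j Xm[OF S] in auto)
 finally show "vl (insert j S) e = ..." .
qed

theorem cech_cube_pres:
 fixes k :: nat
 defines "sh == %S. (%i. i - k) ` S" and "F == {S. S <= {k..<k + length gs}}"
 assumes cube: "cube X E' NS (%(S, e). int (card S)) 1" and X: "{k..<k + length gs} <= X"
 and E': "!!S. S:F==>E' S = {e:ES (sh S). wt W e = a}"
 and NS: "!!S w. S:F==>w:cs (E' S)==>w:NS S <-> w:NL W H (VS (sh S))"
 and coh: "cube.cohF X E' NS (%(S, e). int (card S)) 1 F p B"
 shows "is_free (cech_cohomology R fs p a) B"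
proof -
 have sh: "sh S <= {..<length gs}" if "S:F" for S
 proof
 fix x assume "x:sh S"
 then obtain i where i: "x = i - k" "i:S" unfolding sh_def by blast
 then have "i:{k..<k + length gs}" using that unfolding F_def by blast
 then show "x:{..<length gs}" using i by auto
 qed
 show ?thesis
 proof (rule cech_cube_free[OF cube fsc, where val = "%S. vl (sh S)" and k = k])
 show "{k..<k + length fs} <= X" using X by simp
 show "cube.cohF X E' NS (%(S, e). int (card S)) 1 {S. S <= {k..<k + length fs}} p B" using coh by (simp add: F_def)
 fix S assume "S:{S. S <= {k..<k + length fs}}"
 then have S: "S:F" by (simp add: F_def)
 show "vl (sh S) e:gcomp (cech_localization R fs ((%i. i - k) ` S)) a" if "e:E' S" for e
 using that vl_gc[OF sh[OF S], of e] by (auto simp: E'[OF S] sh_def)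
 show "EX w:cs (E' S). kmod.ev (cech_localization R fs ((%i. i - k) ` S)) (vl (sh S)) w = Y"
 if "Y:gcomp (cech_localization R fs ((%i. i - k) ` S)) a" for Y
 using sur[OF sh[OF S]] that unfolding E'[OF S] sh_def by blast
 show "w:NS S <-> kmod.ev (cech_localization R fs ((%i. i - k) ` S)) (vl (sh S)) w
 = \<zero>\<^bsub>cech_localization R fs ((%i. i - k) ` S)\<^esub>" if w: "w:cs (E' S)" for w
 proof -
 have "w:cs (ES (sh S))" by (rule cs_mono[OF _ w]) (auto simp: E'[OF S])
 then show ?thesis using NS[OF S w] ev_zero[OF sh[OF S]] by (simp add: sh_def)
 qed
next
 fix S e j assume "insert j S:{S. S <= {k..<k + length fs}}" "j ~: S" "e:E' S"
 then have jS: "insert j S:F" "S:F" "j ~: S" "e:E' S" by (auto simp: F_def)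
 have "j - k ~: sh S"
 proof
 assume "j - k:sh S"
 then obtain i where "i:S" "i - k = j - k" by (auto simp: sh_def)
 moreover have "k <= i" "k <= j" using jS(1) \<open>i:S\<close> by (auto simp: F_def)
 ultimately show False using jS(3) by (metis le_add_diff_inverse)
 qed
 moreover have "sh (insert j S) = insert (j - k) (sh S)" by (simp add: sh_def)
 moreover have "sh (insert j S) <= {..<length gs}" by (rule sh[OF jS(1)])
 ultimately show "vl (sh (insert j S)) e = localization_map R (monomials R fs ((%i. i - k) ` insert j S)) (vl (sh S) e)"
 using vl_ins(2)[of "j - k" "sh S" e] jS(4) unfolding E'[OF jS(2)] by (simp add: sh_def)
qed
qed

text \<open>The keys need only map onto the pairs of a face and an exponent, so the keys of a tensor
  product can be used directly.\<close>

theorem cech_keys_pres: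
 fixes P :: "'x set"
 assumes sp: "!!x. x:P==>sp x <= {..<length gs}&xx x:ES (sp x)&wt W (xx x) = a"
 and onto: "!!S e. S <= {..<length gs}==>e:ES S==>wt W e = a==>EX x:P. sp x = S&xx x = e"
 and ins: "!!x j. x:P==>j:{..<length gs} - sp x==>ins j x:P&sp (ins j x) = insert j (sp x)&xx (ins j x) = xx x"
 and d: "lin d" "!!x. x:P==>d (single x 1) = (\<Sum>j\<in>{..<length gs} - sp x. single (ins j x) (sgnS (sp x) j))"
 "!!x. x:P==>d (d (single x 1)) = 0"
 and N: "N = {c:cs P. \<forall>S\<subseteq>{..<length gs}. lext (%x. single (xx x) 1) (rst {x. sp x = S} c):NL W H (VS S)}"
 and coh: "coh P N (%x. int (card (sp x))) 1 d p B"
 shows "is_free (cech_cohomology R fs p a) B"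
proof (rule cech_cohomology_free[OF fsc, where sp = sp and ins = ins and val = "%x. vl (sp x) (xx x)"])
 let ?val = "%x. vl (sp x) (xx x)" and ?g = "lext (%x. single (xx x) (1 :: 'k))"
 have ev: "?g w:cs (ES S)&kmod.ev (Lc S) ?val w = kmod.ev (Lc S) (vl S) (?g w)"
 if S: "S <= {..<length gs}" and w: "w:cs {x:P. sp x = S}" for S and w :: "('x, 'k) pm"
 proof -
 interpret Lc: kmod "Lc S" by (rule Lk[OF S])
 have v: "vl S e:carrier (Lc S)" if "e:ES S" for e by (rule vl_car[OF S that])
 have x: "xx x:ES S" if "x:{x:P. sp x = S}" for x using sp that by auto
 have "kmod.ev (Lc S) (vl S) (?g w) = id (kmod.ev (Lc S) ?val w)"
 by (rule ev_hom[OF Lk[OF S] Lk[OF S] _ w, where P' = "ES S"])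
 (use v x in \<open>auto simp: single_cs Lc.ev_single\<close>)
 moreover have "?g w:cs (ES S)" by (rule lin_cs_mem[OF w lin_lext lsub_cs]) (use x in \<open>auto intro: single_cs\<close>)
 ultimately show ?thesis by simp
 qed
 show "sp x <= {..<length fs}" if "x:P" for x using sp[OF that] by simp
 show "ins j x:P&sp (ins j x) = insert j (sp x)" if "x:P" "j:{..<length fs} - sp x" for x j
 using ins[OF that(1)] that(2) by simp
 show "?val x:gcomp (Lc (sp x)) a" if "x:P" for x using sp[OF that] vl_gc[of "sp x" "xx x"] by auto
 show "?val (ins j x) = localization_map R (monomials R fs (insert j (sp x))) (?val x)"
 if "x:P" "j:{..<length fs} - sp x" for x j
 using sp[OF that(1)] ins[OF that(1)] that(2) vl_ins(2)[of j "sp x" "xx x"] by auto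
 show "d (single x 1) = (\<Sum>j\<in>{..<length fs} - sp x. single (ins j x) (sgnS (sp x) j))" if "x:P" for x
 using d(2)[OF that] by simp
 show "EX w:cs {x:P. sp x = S}. kmod.ev (Lc S) ?val w = Y" if "S <= {..<length fs}" "Y:gcomp (Lc S) a" for S Y
 proof -
 note Y = that(2)
 have S: "S <= {..<length gs}" using that by simp
 from sur[OF S Y]
 obtain w where w: "w:cs {e:ES S. wt W e = a}" "kmod.ev (Lc S) (vl S) w = Y" by blast
 define q where "q e = (SOME x. x:P&sp x = S&xx x = e)" for e
 have q: "q e:{x:P. sp x = S}" "xx (q e) = e" if "e:{e:ES S. wt W e = a}" for e
 using someI_ex[of "%x. x:P&sp x = S&xx x = e"] onto[OF S, of e] that by (auto simp: q_def)
 let ?w = "lext (%e. single (q e) 1) w"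
 have w': "?w:cs {x:P. sp x = S}" by (rule lin_cs_mem[OF w(1) lin_lext lsub_cs]) (use q(1) in \<open>auto intro!: single_cs\<close>)
 have "?g ?w = w" by (rule lin_cs_eqI[OF w(1) lin_comp[OF lin_lext lin_lext] lin_id]) (use q(2) in simp)
 then have "kmod.ev (Lc S) ?val ?w = Y" using ev[OF S w'] w(2) by simp
 then show ?thesis using w' by blast
 qed
 show "N = {c:cs P. \<forall>S\<subseteq>{..<length fs}. kmod.ev (Lc S) ?val (rst {x. sp x = S} c) = \<zero>\<^bsub>Lc S\<^esub>}"
 proof -
 have "kmod.ev (Lc S) ?val (rst {x. sp x = S} c) = \<zero>\<^bsub>Lc S\<^esub> <-> ?g (rst {x. sp x = S} c):NL W H (VS S)"
 if "c:cs P" and S: "S <= {..<length gs}" for c S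
 proof -
 have "rst {x. sp x = S} c:cs {x:P. sp x = S}" using rst_cs_Int[OF that(1), of "{x. sp x = S}"] by (simp add: Collect_conj_eq)
 then show ?thesis using ev[OF S] ev_zero[OF S] by simp
 qed
 then show ?thesis unfolding N by auto
 qed
qed (use d coh in simp_all)

end

end

section \<open>Monomial ideals and local cohomology of presented algebras\<close>

context mpres
begin

interpretation galg R pr by (rule galg)

lemma ideal_Phi:
 assumes U: "lsub U" "U <= cs E" and sh: "!!e u. e:E==>u:U==>single e 1 * u:U"
 shows "ideal (Ph ` U) R"
proof (rule idealI[OF ring_axioms])
 have m: "c * u:U" if u: "u:U" and c: "c:cs E" for u c
 by (rule lin_cs_mem[OF c lin_mult2 U(1)]) (rule sh[OF _ u])
 show "x \<otimes> a:Ph ` U" "a \<otimes> x:Ph ` U" if ax: "a:Ph ` U" "x:carrier R" for a x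
 proof -
 obtain u c where u: "u:U" "a = Ph u" "c:cs E" "x = Ph c" using ax unfolding car by blast
 have "x \<otimes> a = Ph (c * u)" using u U by (subst hmult) auto
 moreover have "a \<otimes> x = x \<otimes> a" by (rule m_comm) (use u U in auto)
 ultimately show "x \<otimes> a:Ph ` U" "a \<otimes> x:Ph ` U" using m[OF u(1,3)] by auto
 qed
 show "subgroup (Ph ` U) (add_monoid R)"
 proof (rule add.subgroupI)
 show "Ph ` U <= carrier R" using U(2) by auto
 show "Ph ` U ~= {}" using lsub_0[OF U(1)] by blast
 fix a assume "a:Ph ` U"
 then obtain u where u: "u:U" "a = Ph u" "u:cs E" using U(2) by blast
 have "Ph (- u) \<oplus> a = \<zero>" using u by (simp add: hzero flip: hadd)
 then have "\<ominus> a = Ph (- u)" using u by (intro minus_equality) auto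
 then show "\<ominus> a:Ph ` U" using lsub_minus[OF U(1) u(1)] by blast
 show "a \<oplus> b:Ph ` U" if "b:Ph ` U" for b
 proof -
 from that obtain v where v: "v:U" "b = Ph v" "v:cs E" using U(2) by blast
 then have "a \<oplus> b = Ph (u + v)" using u by (simp add: hadd)
 then show ?thesis using lsub_add[OF U(1) u(1) v(1)] by blast
 qed
 qed
qed

lemma Idl_Phi:
 assumes H: "H0 <= cs E"
 shows "Idl (Ph ` H0) = Ph ` pm.span {single e 1 * h | e h. e:E&h:H0}" (is "_ = Ph ` ?U")
proof
 have "{single e 1 * h | e h. e:E&h:H0} <= cs E" using H by (auto intro!: csE)
 then have UE: "?U <= cs E" by (rule span_subset[OF lsub_cs])
 have id: "ideal (Ph ` ?U) R"
 proof (rule ideal_Phi[OF lsub_span UE])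
 fix e u assume e: "e:E" and u: "u:?U"
 have "?U <= {u. single e 1 * u:?U}"
 proof (rule span_subset[OF lsub_vimage[OF lin_mult lsub_span]], rule subsetI)
 fix x assume "x:{single e 1 * h | e h. e:E&h:H0}"
 then obtain f h where x: "x = single f 1 * h" "f:E" "h:H0" by blast
 then have "single e 1 * x = single (e + f) 1 * h" "e + f:E" using e by simp_all
 then show "x:{u. single e 1 * u:?U}" using x(3) by (auto intro!: pm.span_base)
 qed
 then show "single e 1 * u:?U" using u by blast
 qed
 have "h:?U" if "h:H0" for h
 proof -
 have "single 0 1 * h:?U" using that E0 by (intro pm.span_base) blast
 then show ?thesis by simp
 qed
 then show "Idl (Ph ` H0) <= Ph ` ?U" by (intro genideal_minimal[OF id]) blast
 have Hc: "Ph ` H0 <= carrier R" using H by auto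
 interpret I: ideal "Idl (Ph ` H0)" R by (rule genideal_ideal[OF Hc])
 have sm: "c \<odot> x:Idl (Ph ` H0)" if "x:Idl (Ph ` H0)" for c x
 proof -
 have "c \<odot> x = (c \<odot> \<one>) \<otimes> x" using I.Icarr[OF that] by (simp add: rs_mult)
 then show ?thesis using I.I_l_closed[OF that, of "c \<odot> \<one>"] by simp
 qed
 have "?U <= {u:cs E. Ph u:Idl (Ph ` H0)}"
 proof (rule span_subset)
 show "lsub {u:cs E. Ph u:Idl (Ph ` H0)}" by (rule lsubI) (auto simp: hzero hadd hsc sm)
 show "{single e 1 * h | e h. e:E&h:H0} <= {u:cs E. Ph u:Idl (Ph ` H0)}"
 proof
 fix x assume "x:{single e 1 * h | e h. e:E&h:H0}"
 then obtain e h where x: "x = single e 1 * h" "e:E" "h:H0" by blast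
 then have "h:cs E" "Ph h:Idl (Ph ` H0)" using H genideal_self[OF Hc] by auto
 then show "x:{u:cs E. Ph u:Idl (Ph ` H0)}" using x I.I_l_closed[of "Ph h" "Xp e"] by (simp add: Xp_Phi)
 qed
 qed
 then show "Ph ` ?U <= Idl (Ph ` H0)" by blast
qed

text \<open>A monomial ideal is the span of the multiples of its generators, and divisibility by the
  generator \<open>g\<close> reads \<open>e - g:E\<close>.\<close>

lemma Idl_Xp:
 assumes Q: "Q <= E" "!!e f. e:E==>f:Q==>e + f:Q" and G: "G <= Q" "!!e. e:Q==>EX g:G. e - g:E"
 shows "Idl (Xp ` G) = Ph ` cs Q"
proof -
 let ?T = "{single e 1 * h | e h. e:E&h:(%g. single g (1 :: 'k)) ` G}"
 have "?T <= cs Q" by (auto simp: single_mult intro!: single_cs) (use Q(2) G(1) in blast)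
 then have "pm.span ?T <= cs Q" by (rule span_subset[OF lsub_cs])
 moreover have "cs Q <= pm.span ?T"
 proof
 fix c :: "ex \<Rightarrow>\<^sub>0 'k" assume "c:cs Q"
 then show "c:pm.span ?T"
 proof (rule cs_induct[OF _ lsub_span])
 fix e assume "e:Q"
 then obtain g where g: "g:G" "e - g:E" using G(2) by blast
 have "single e (1 :: 'k) = single (e - g) 1 * single g 1" by (simp add: single_mult)
 then show "single e 1:pm.span ?T" using g by (intro pm.span_base) blast
 qed
 qed
 ultimately have "pm.span ?T = cs Q" by (rule equalityI)
 moreover have "Idl (Ph ` (%g. single g 1) ` G) = Ph ` pm.span ?T"
 by (rule Idl_Phi) (use Q G in \<open>auto intro!: csE\<close>)
 moreover have "Xp ` G = Ph ` (%g. single g 1) ` G" by (auto simp: Xp_def)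
 ultimately show ?thesis by simp
qed

text \<open>The system chosen by \<open>SOME\<close> is exchanged here for monomial generators, by
  means of \<open>cech_generators\<close>.\<close>

lemma lc_free:
 assumes gs: "set gs <= E" and M: "M = Idl (Xp ` set gs)" and B: "is_free (cech_cohomology R (map Xp gs) p a) (B :: 'b set)"
 shows "is_free (local_cohomology R M p a) B"
proof -
 have h: "homogeneous_generators R M (map Xp gs)"
 unfolding homogeneous_generators_def using gs Xp_gc M by auto
 define fs where "fs = (SOME fs. homogeneous_generators R M fs)"
 have fs: "homogeneous_generators R M fs" unfolding fs_def by (rule someI[of "homogeneous_generators R M", OF h])
 obtain B' :: "(nat set \<times> 'r \<times> (nat=>nat) \<Rightarrow>\<^sub>0 'k) set"
 where "is_free (cech_cohomology R (map Xp gs) p a) B'" "is_free (cech_cohomology R fs p a) B'"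
 using cech_generators[of "map Xp gs" fs p a] h fs unfolding homogeneous_generators_def by metis
 then show ?thesis unfolding local_cohomology_def fs_def[symmetric] using is_free_transfer[OF B] by blast
qed

lemma Phi_sum: "finite A==>(!!i. i:A==>c i:cs E)==>(\<Oplus>i\<in>A. Ph (c i)) = Ph (\<Sum>i\<in>A. c i)"
proof (induction A rule: finite_induct)
 case (insert x A)
 have "(\<Sum>i\<in>A. c i):cs E" by (rule lsub_sum[OF lsub_cs]) (use insert in auto)
 moreover have "(%i. Ph (c i)):A \<rightarrow> carrier R" "Ph (c x):carrier R" using insert.prems by auto
 ultimately show ?case using insert by (simp add: hadd)
qed (simp add: hzero)

end


subsection \<open>Quotients of polynomial rings\<close>

definition EV :: "nat set=>ex set" where "EV V = {e. keys e <= V&(ALL v. 0 <= lookup e v)}"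

text \<open>Polynomials are moved to integer exponents, where they share a type with Laurent
  monomials and t. The conversion truncates negative exponents, so it is injective and
  multiplicative only on \<open>cs (EV V)\<close>.\<close>

definition natp :: "(ex \<Rightarrow>\<^sub>0 'k::field)=>'k mpoly" where "natp = lext (%e. single (Poly_Mapping.map nat e) 1)"

definition intp :: "'k::field mpoly=>(ex \<Rightarrow>\<^sub>0 'k)" where "intp = lext (%e. single (Poly_Mapping.map int e) 1)"

lemma lookup_conv [simp]: "lookup (Poly_Mapping.map nat e) v = nat (lookup e v)" "lookup (Poly_Mapping.map int f) v = int (lookup f v)"
 by (simp_all add: map.rep_eq when_def)

lemma keys_int [simp]: "keys (Poly_Mapping.map int f) = keys f"
 by (auto simp: in_keys_iff)

lemma lin_natp [simp]: "lin natp" and lin_intp [simp]: "lin intp"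
 by (simp_all add: natp_def intp_def)

lemma EV_mem: "e:EV V==>lookup e v \<ge> 0" "e:EV V==>v ~: V==>lookup e v = 0"
 by (auto simp: EV_def in_keys_iff)

lemma EV_add: "e:EV V==>f:EV V==>e + f:EV V"
 using keys_add[of e f] by (auto simp: EV_def lookup_add)

lemma natp_intp: "natp (intp p) = p"
proof (rule lin_eqI[OF lin_comp[OF lin_natp lin_intp] lin_id])
 show "natp (intp (single x 1)) = single x 1" for x
 by (simp add: natp_def intp_def) (rule arg_cong[where f = "%x. single x 1"], rule pmI, simp)
qed

lemma intp_natp: "c:cs (EV V)==>intp (natp c) = c"
proof (erule lin_cs_eqI[OF _ lin_comp[OF lin_intp lin_natp] lin_id])
 show "intp (natp (single x 1)) = single x 1" if "x:EV V" for x
 using EV_mem(1)[OF that] by (simp add: natp_def intp_def) (rule arg_cong[where f = "%x. single x 1"], rule pmI, simp)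
qed

lemma natp_mult:
 assumes "c:cs (EV V)" "c':cs (EV V)"
 shows "natp (c * c') = natp c * natp c'"
proof (rule lin_cs_eqI[OF assms(1) lin_comp[OF lin_natp lin_mult2] lin_comp[OF lin_mult2 lin_natp]])
 fix x assume x: "x:EV V"
 show "natp (single x 1 * c') = natp (single x 1) * natp c'"
 proof (rule lin_cs_eqI[OF assms(2) lin_comp[OF lin_natp lin_mult] lin_comp[OF lin_mult lin_natp]])
 fix y assume y: "y:EV V"
 have "Poly_Mapping.map nat (x + y) = Poly_Mapping.map nat x + Poly_Mapping.map nat y"
 using EV_mem(1)[OF x] EV_mem(1)[OF y] by (intro pmI) (simp add: lookup_add nat_add_distrib)
 then show "natp (single x 1 * single y 1) = natp (single x 1) * natp (single y 1)"
 by (simp add: natp_def single_mult)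
 qed
qed

lemma natp_cs:
 assumes "!!e. e:EV V==>Q e <-> Q' (Poly_Mapping.map nat e)"
 shows "(natp :: (ex \<Rightarrow>\<^sub>0 'k::field)=>_) ` cs {e:EV V. Q e} = cs {e. keys e <= V&Q' e}"
proof
 show "(natp :: (ex \<Rightarrow>\<^sub>0 'k)=>_) ` cs {e:EV V. Q e} <= cs {e. keys e <= V&Q' e}"
 proof (rule image_subsetI)
 fix c :: "ex \<Rightarrow>\<^sub>0 'k" assume "c:cs {e:EV V. Q e}"
 then show "natp c:cs {e. keys e <= V&Q' e}"
 proof (rule lin_cs_mem[OF _ lin_natp lsub_cs])
 fix e assume e: "e:{e:EV V. Q e}"
 have "keys (Poly_Mapping.map nat e) <= V" using e EV_mem(2)[of e V] by (force simp: in_keys_iff)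
 then show "natp (single e 1):cs {e. keys e <= V&Q' e}" using e assms by (auto simp: natp_def intro!: single_cs)
 qed
 qed
 show "cs {e. keys e <= V&Q' e} <= (natp :: (ex \<Rightarrow>\<^sub>0 'k)=>_) ` cs {e:EV V. Q e}"
 proof
 fix p :: "(nat \<Rightarrow>\<^sub>0 nat) \<Rightarrow>\<^sub>0 'k" assume p: "p:cs {e. keys e <= V&Q' e}"
 have "intp p:cs {e:EV V. Q e}"
 proof (rule lin_cs_mem[OF p lin_intp lsub_cs])
 fix e assume e: "e:{e. keys e <= V&Q' e}"
 have "Poly_Mapping.map nat (Poly_Mapping.map int e) = e" by (rule pmI) simp
 moreover have "Poly_Mapping.map int e:EV V" using e by (auto simp: EV_def)
 ultimately show "intp (single e 1):cs {e:EV V. Q e}"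
 using e assms[of "Poly_Mapping.map int e"] by (auto simp: intp_def intro!: single_cs)
 qed
 then show "p:natp ` cs {e:EV V. Q e}" using natp_intp[of p] by (metis imageI)
 qed
qed

lemma poly_simps: "carrier (poly_algebra V) = cs {e. keys e <= V}"
 "gcomp (poly_algebra V) d = cs {e. keys e <= V&int (mono_degree e) = d}"
 by (auto simp: poly_algebra_def Let_def cs_def)

lemma mono_degree_nat:
 assumes "finite V" "e:EV V"
 shows "int (mono_degree (Poly_Mapping.map nat e)) = wt V e"
proof -
 have "keys (Poly_Mapping.map nat e) <= V" using EV_mem(2)[OF assms(2)] by (force simp: in_keys_iff)
 then have "mono_degree (Poly_Mapping.map nat e) = (\<Sum>v\<in>V. nat (lookup e v))"
 unfolding mono_degree_def using assms(1) by (intro sum.mono_neutral_cong_left) (auto simp: in_keys_iff)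
 then show ?thesis using EV_mem(1)[OF assms(2)] by (simp add: wt_def)
qed

lemma mpres_poly:
 assumes V: "finite V" "0 ~: V"
 shows "mpres (poly_algebra V :: ('k::field, 'k mpoly) graded_algebra) V {} (EV V) natp"
proof
 show "0 ~: V" "0:EV V" by (use V in \<open>auto simp: EV_def\<close>)
 show "e + f:EV V" if "e:EV V" "f:EV V" for e f by (rule EV_add[OF that])
 show "EV V <= LL V {}" by (auto simp: EV_def LL_def)
 show "carrier (poly_algebra V) = (natp :: (ex \<Rightarrow>\<^sub>0 'k)=>_) ` cs (EV V)"
 proof -
 have "(natp :: (ex \<Rightarrow>\<^sub>0 'k)=>_) ` cs {e:EV V. True} = cs {e. keys e <= V&True}" by (rule natp_cs) simp
 then show ?thesis by (simp add: poly_simps)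
 qed
 show "gcomp (poly_algebra V) d = (natp :: (ex \<Rightarrow>\<^sub>0 'k)=>_) ` cs {e:EV V. wt V e = d}" for d
 unfolding poly_simps by (rule natp_cs[symmetric]) (simp add: mono_degree_nat[OF V(1)])
 have "NL V {} {} = ({0} :: (ex \<Rightarrow>\<^sub>0 'k) set)" by (simp add: NL_def)
 moreover have "c = c'" if "natp c = natp c'" "c:cs (EV V)" "c':cs (EV V)" for c c' :: "ex \<Rightarrow>\<^sub>0 'k"
 using arg_cong[OF that(1), of intp] intp_natp[OF that(2)] intp_natp[OF that(3)] by simp
 ultimately show "natp c = natp c' <-> c - c':NL V {} {}" if "c:cs (EV V)" "c':cs (EV V)" for c c' :: "ex \<Rightarrow>\<^sub>0 'k"
 using that by auto
 have "natp (single 0 1 :: ex \<Rightarrow>\<^sub>0 'k) = single 0 1"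
 proof -
 have "Poly_Mapping.map nat (0 :: ex) = 0" by (rule pmI) simp
 then show ?thesis by (simp only: natp_def lext_single sc_1)
 qed
 then show "natp (1 :: ex \<Rightarrow>\<^sub>0 'k) = \<one>\<^bsub>poly_algebra V\<^esub>" by (simp add: poly_algebra_def Let_def)
qed (simp_all add: poly_algebra_def Let_def lin_add lin_sc lin_0 natp_mult sc_def[symmetric])

lemma (in mpres) mpres_quotient:
 assumes H0: "H = {}" and EW': "E = EV W" and H': "H' <= cs E" "!!h. h:H'==>EX d. h:cs {e. wt W e = d}"
 and J: "J = Idl (Ph ` H')"
 shows "mpres (quotient_algebra R J) W H' E (%w. J +> Ph w)"
proof -
 interpret galg R pr by (rule galg)
 let ?U = "pm.span {single e 1 * h | e h. e:E&h:H'}"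
 have Hc: "Ph ` H' <= carrier R" using H'(1) by auto
 interpret J: ideal J R unfolding J by (rule genideal_ideal[OF Hc])
 have JU: "J = Ph ` ?U" unfolding J by (rule Idl_Phi[OF H'(1)])
 have minus: "Ph c \<ominus> Ph c' = Ph (c - c')" if "c:cs E" "c':cs E" for c c'
 proof -
 have "Ph (c - c') \<oplus> Ph c' = Ph c" using that by (simp flip: hadd)
 then have "Ph c \<ominus> Ph c' = Ph (c - c') \<oplus> Ph c' \<ominus> Ph c'" by simp
 also have "... = Ph (c - c')" using that by (simp add: a_minus_def a_assoc r_neg)
 finally show ?thesis .
 qed
 have UE: "?U <= cs E" by (rule span_subset[OF lsub_cs]) (use H'(1) in \<open>auto intro!: csE\<close>)
 \<comment> \<open>\<open>NL\<close> also contains multiples by powers of t. As \<open>E\<close> and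
   \<open>H'\<close> contain no t, the part of t-exponent 0 recovers the multiples by monomials of
   \<open>E\<close>.\<close>
 have NU: "NL W H' {} Int cs E = ?U"
 proof
 have e0: "lookup e 0 = 0" if "e:E" for e using EV_mem(2)[of e W 0] W0 that EW' by simp
 have "rst {e. lookup e 0 = 0} w:?U" if "w:NL W H' {}" for w
 proof -
 have "w:{w. rst {e. lookup e 0 = 0} w:?U}"
 proof (rule NL_into[OF that lsub_vimage[OF lin_rst lsub_span]])
 fix e h assume eh: "e:LL W {}" "h:H'"
 have c: "single e 1 * h:cs {f. lookup f 0 = lookup e 0}"
 by (rule cs_shift[of _ E]) (use H'(1) eh e0 in \<open>auto simp: lookup_add\<close>)
 show "single e 1 * h:{w. rst {e. lookup e 0 = 0} w:?U}"
 proof (cases "lookup e 0 = 0")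
 case True
 then have "keys e <= W" "0 <= lookup e v" for v
 using eh(1) W0 by (auto simp: LL_def subset_iff in_keys_iff) (metis insertE le_less in_keys_iff)
 then have "e:E" unfolding EW' EV_def by blast
 moreover have "rst {e. lookup e 0 = 0} (single e 1 * h) = single e 1 * h" by (rule rst_id[OF c]) (use True in auto)
 ultimately show ?thesis using eh(2) by (auto intro!: pm.span_base)
 next
 case False
 then have "rst {e. lookup e 0 = 0} (single e 1 * h) = 0" by (intro rst_disjoint[OF c]) auto
 then show ?thesis by (simp add: lsub_0)
 qed
 qed
 then show ?thesis by blast
 qed
 moreover have "rst {e. lookup e 0 = 0} w = w" if "w:cs E" for w :: "ex \<Rightarrow>\<^sub>0 'k" by (rule rst_id[OF that]) (use e0 in auto)
 ultimately show "NL W H' {} Int cs E <= ?U" by (metis (no_types, lifting) IntE subsetI)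
 have "{single e 1 * h | e h. e:E&h:H'} <= NL W H' {}" using EW by (auto intro!: NL_gen)
 then have "?U <= NL W H' {}" by (rule span_subset[OF lsub_NL])
 then show "?U <= NL W H' {} Int cs E" using UE by (rule Int_greatest)
 qed
 have inj: "c = c'" if "Ph c = Ph c'" "c:cs E" "c':cs E" for c c'
 using ker[OF that(2,3)] that(1) by (simp add: H0 NL_def)
 have eqJ: "J +> x = J +> y <-> x \<ominus> y:J" if "x:carrier R" "y:carrier R" for x y
 using quotient_eq_iff_same_a_r_cos[OF J.ideal_axioms that] by simp
 show ?thesis
 proof
 show "J +> Ph c = J +> Ph c' <-> c - c':NL W H' {}" if c: "c:cs E" "c':cs E" for c c'
 proof -
 have "J +> Ph c = J +> Ph c' <-> Ph (c - c'):Ph ` ?U" using eqJ minus[OF c] c JU by simp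
 also have "... <-> c - c':?U" using inj csE(5)[OF c] UE by blast
 also have "... <-> c - c':NL W H' {}" using NU csE(5)[OF c] by blast
 finally show ?thesis .
 qed
 show "J +> Ph (sc a c) = a \<odot>\<^bsub>quotient_algebra R J\<^esub> (J +> Ph c)" if c: "c:cs E" for a c
 proof -
 \<comment> \<open>\<open>coset_smult\<close> is a union over all representatives, so each of them
   has to yield the same coset.\<close>
 have "J +> (a \<odot> x) = J +> Ph (sc a c)" if x: "x:J +> Ph c" for x
 proof -
 have xc: "x:carrier R" using x a_r_coset_subset_G[OF J.a_subset Phi_closed[OF c]] by blast
 then obtain c' where c': "x = Ph c'" "c':cs E" unfolding car by blast
 have "J +> x = J +> Ph c" using a_repr_independence[OF x Phi_closed[OF c] J.a_subgroup] by simp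
 then have "Ph (c' - c):J" using eqJ[OF xc Phi_closed[OF c]] minus[OF c'(2) c] c' by simp
 then have "(a \<odot> \<one>) \<otimes> Ph (c' - c):J" by (rule J.I_l_closed) simp
 then have "Ph (sc a c' - sc a c):J" using c c' by (simp add: rs_mult sc_diff flip: hsc)
 then show ?thesis using eqJ[of "a \<odot> x" "Ph (sc a c)"] minus[of "sc a c'" "sc a c"] c c' by (simp add: hsc)
 qed
 moreover have "Ph c:J +> Ph c" using c by (intro J.a_rcos_self) simp
 ultimately show ?thesis unfolding quotient_algebra_def coset_smult_def by auto
 qed
 show "J +> Ph 0 = \<zero>\<^bsub>quotient_algebra R J\<^esub>"
 using a_coset_add_zero[OF J.a_subset] by (simp add: hzero quotient_algebra_def FactRing_def)
 qed (use W0 EW H' in \<open>auto simp: quotient_algebra_def FactRing_def A_RCOSETS_def' car gc image_image hadd hmult hone J.a_rcos_sum J.rcoset_mult_add\<close>)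
qed

subsection \<open>The Rees algebra\<close>

text \<open>A monomial with t-exponent c lies in I^c t^c iff at least c of its factors are variables
  that generate I; hence the bound by the degree in \<open>V\<close>.\<close>

definition ER :: "nat set=>nat set=>ex set" where
 "ER W V = {e. keys e <= insert 0 W&(ALL v. 0 <= lookup e v)&lookup e 0 <= wt V e}"

definition tt :: "int=>ex" where "tt x = single 0 x"

lemma lookup_tt [simp]: "lookup (tt x) v = (if v = 0 then x else 0)"
 by (simp add: tt_def lookup_single when_def)

lemma tt_add: "tt (x + y) = tt x + tt y"
 by (simp add: tt_def single_add)

text \<open>\<open>tc l w\<close> is the coefficient of \<open>t\<^sup>l\<close> in \<open>w\<close>.\<close>

definition tc :: "nat=>(ex \<Rightarrow>\<^sub>0 'k::field)=>(ex \<Rightarrow>\<^sub>0 'k)" where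
 "tc l w = single (- tt (int l)) 1 * rst {e. lookup e 0 = int l} w"

lemma lin_tc [simp]: "lin (tc l)"
 unfolding tc_def by (rule lin_comp[OF lin_mult lin_rst])

lemma tc_single: "tc l (single e (1 :: 'k::field)) = (if lookup e 0 = int l then single (e - tt (int l)) 1 else 0)"
 by (simp add: tc_def rst_single single_mult)

lemma tc_cs: "w:cs A==>(!!e. e:A==>lookup e 0 = int l==>e - tt (int l):B)==>tc l w:cs B"
 by (erule lin_cs_mem[OF _ lin_tc lsub_cs]) (auto simp: tc_single lsub_0 intro: single_cs)

lemma tc_up:
 assumes c: "c:cs B" and B: "!!e. e:B==>lookup e 0 = 0"
 shows "tc l (single (tt (int l')) 1 * c) = (if l = l' then c else (0 :: ex \<Rightarrow>\<^sub>0 'k::field))"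
proof (rule lin_cs_eqI[OF c lin_comp[OF lin_tc lin_mult]])
 show "lin (%c. if l = l' then c else (0 :: ex \<Rightarrow>\<^sub>0 'k))" by (cases "l = l'") (simp_all add: lin_id lin_const0)
 show "tc l (single (tt (int l')) 1 * single x 1) = (if l = l' then single x 1 else (0 :: ex \<Rightarrow>\<^sub>0 'k))" if "x:B" for x
 using B[OF that] by (simp add: single_mult tc_single lookup_add)
qed

lemma tc_mult:
 assumes w: "w \<in> cs A" "w' \<in> cs A" and A: "\<And>e. e \<in> A \<Longrightarrow> 0 \<le> lookup e 0"
 shows "tc l (w * w') = (\<Sum>i\<le>l. tc i w * tc (l - i) w' :: ex \<Rightarrow>\<^sub>0 'k::field)"
proof (rule lin_cs_eqI[OF w(1) lin_comp[OF lin_tc lin_mult2] lin_sum_fun[OF lin_comp[OF lin_mult2 lin_tc]]])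
 fix x assume x: "x:A"
 show "tc l (single x 1 * w') = (\<Sum>i\<le>l. tc i (single x 1) * tc (l - i) w')"
 proof (rule lin_cs_eqI[OF w(2) lin_comp[OF lin_tc lin_mult] lin_sum_fun[OF lin_comp[OF lin_mult lin_tc]]])
 fix y assume y: "y:A"
 obtain a b where a: "lookup x 0 = int a" "lookup y 0 = int b" using A[OF x] A[OF y] by (metis nonneg_int_cases)
 let ?T = "%i. tc i (single x 1) * tc (l - i) (single y 1) :: ex \<Rightarrow>\<^sub>0 'k"
 have "(\<Sum>i\<le>l. ?T i) = (\<Sum>i\<le>l. if i = a then ?T a else 0)" by (rule sum.cong) (auto simp: tc_single a)
 also have "... = (if a <= l then ?T a else 0)" by simp
 also have "... = tc l (single x 1 * single y 1)"
 by (auto simp: single_mult tc_single a lookup_add of_nat_diff algebra_simps simp flip: tt_add)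
 finally show "tc l (single x 1 * single y 1) = (\<Sum>i\<le>l. ?T i)" by simp
 qed
qed

lemma wt_single: "finite V==>wt V (single v x) = (if v:V then x else 0)"
 by (simp add: wt_def lookup_single when_def)

lemma wt_pos:
 assumes "0 < wt V e"
 obtains v where "v:V" "0 < lookup e v"
 using assms sum_nonpos[of V "lookup e"] unfolding wt_def by force

lemma EV_iff: "e:EV V <-> (ALL v. 0 <= lookup e v)&(ALL v. v ~: V --> lookup e v = 0)"
 by (auto simp: EV_def in_keys_iff)

lemma ER_iff: "e:ER W V <-> (ALL v. 0 <= lookup e v)&(ALL v. v ~: insert 0 W --> lookup e v = 0)&lookup e 0 <= wt V e"
 by (auto simp: ER_def in_keys_iff)

lemma EV_minus: "e:EV V==>0 < lookup e v==>e - single v 1:EV V"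
 by (auto simp: EV_iff lookup_minus lookup_single when_def)

context mpres
begin

interpretation galg R pr by (rule galg)

section \<open>Powers of a monomial ideal and coefficients of powers of t\<close>

context
 fixes V1 I
 assumes EW': "E = EV W" and H0: "H <= cs {e. lookup e 0 = 0}" and V1: "V1 <= W" "finite W"
 and I: "I = Ph ` cs {e:E. 1 <= wt V1 e}"
begin

lemma fV1: "finite V1" using V1 finite_subset by blast

definition PhR :: "(ex \<Rightarrow>\<^sub>0 'k)=>nat=>'r" where "PhR w = (%l. Ph (tc l w))"

lemma E_0: "e:E==>lookup e 0 = 0" using EV_mem(2)[of e W 0] W0 EW' by simp

text \<open>Finitely many nonzero coefficients are assembled into one combination of monomials in x
  and t, from which \<open>tc\<close> recovers them.\<close>

lemma up_tc:
 assumes Q: "!!l. Q l <= E"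
 shows "{f:up R. ALL l. f l:Ph ` cs (Q l)}
 = PhR ` cs {e. 0 <= lookup e 0&e - tt (lookup e 0):Q (nat (lookup e 0))}" (is "_ = _ ` cs ?E")
proof (intro equalityI subsetI)
 fix f assume "f:PhR ` cs ?E"
 then obtain w where w: "f = PhR w" "w:cs ?E" by blast
 have 1: "tc l w:cs (Q l)" for l by (rule tc_cs[OF w(2)]) auto
 then have fl: "f l:Ph ` cs (Q l)" for l unfolding w PhR_def by blast
 moreover have "bound \<zero> (\<Sum>e\<in>keys w. nat (lookup e 0)) f"
 proof
 fix l assume l: "(\<Sum>e\<in>keys w. nat (lookup e 0)) < l"
 have "lookup e 0 ~= int l" if "e:keys w" for e
 using l member_le_sum[OF that, of "%e. nat (lookup e 0)"] by auto
 then have "rst {e. lookup e 0 = int l} w = 0" by (intro rst_disjoint[of w "keys w"]) (auto simp: cs_def)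
 then show "f l = \<zero>" by (simp add: w PhR_def tc_def hzero)
 qed
 moreover have "f l:carrier R" for l using fl[of l] cs_mono[OF Q[of l]] by (auto intro!: Phi_closed)
 ultimately show "f:{f:up R. ALL l. f l:Ph ` cs (Q l)}" unfolding up_def by blast
next
 fix f assume "f:{f:up R. ALL l. f l:Ph ` cs (Q l)}"
 then obtain n where n: "bound \<zero> n f" and f: "!!l. f l:Ph ` cs (Q l)" unfolding up_def by blast
 have "ALL l. EX c. c:cs (Q l)&f l = Ph c&(n < l --> c = 0)"
 proof
 fix l
 show "EX c. c:cs (Q l)&f l = Ph c&(n < l --> c = 0)"
 proof (cases "n < l")
 case True
 then have "f l = Ph 0" using n unfolding bound_def hzero by blast
 then show ?thesis using lsub_0[OF lsub_cs] by blast
 qed (use f[of l] in blast)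
 qed
 then obtain c where c: "!!l. c l:cs (Q l)" "!!l. f l = Ph (c l)" "!!l. n < l==>c l = 0"
 unfolding choice_iff by blast
 define w where "w = (\<Sum>l\<le>n. single (tt (int l)) 1 * c l)"
 have Q0: "lookup a 0 = 0" if "a:Q l" for a l using Q E_0 that by blast
 have w: "w:cs ?E" unfolding w_def
 by (rule lsub_sum[OF lsub_cs], rule cs_shift[OF c(1)]) (auto simp: lookup_add Q0)
 have "tc l w = c l" for l
 proof -
 have "tc l w = (\<Sum>l'\<le>n. if l = l' then c l' else 0)"
 unfolding w_def lin_sum[OF lin_tc] by (rule sum.cong[OF refl tc_up[OF c(1)]]) (use Q E_0 in blast)
 then show ?thesis using c(3)[of l] by simp
 qed
 then have "f = PhR w" by (intro ext) (simp add: PhR_def c(2))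
 then show "f:PhR ` cs ?E" using w by blast
qed

text \<open>A monomial of degree at least l + 1 in the variables \<open>V1\<close> contains one of
  them, and splitting it off leaves degree at least l.\<close>

lemma I_power: "I [^]\<^bsub>ideals_set R\<^esub> (l :: nat) = Ph ` cs {e:E. int l <= wt V1 e}"
proof (induction l)
 case 0
 have "{e:E. 0 <= wt V1 e} = E" using EV_mem(1)[of _ W] EW' by (auto simp: wt_def intro!: sum_nonneg)
 then show ?case by (simp add: nat_pow_def ideals_set_def car)
next
 case (Suc l)
 let ?A = "%l :: int. {e:E. l <= wt V1 e}"
 let ?K = "ideal_prod R (Ph ` cs (?A (int l))) I"
 have sub: "cs (?A n) <= cs E" for n using cs_mono[of "?A n" E] by auto
 have 1: "x:Ph ` cs (?A (int (Suc l)))" if "x:?K" for x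
 using that
 proof induction
 case (prod x y)
 then obtain u v where u: "x = Ph u" "u:cs (?A (int l))" "y = Ph v" "v:cs (?A 1)" unfolding I by blast
 moreover have "u:cs E" "v:cs E" using u sub by auto
 ultimately have "x \<otimes> y = Ph (u * v)" by (simp add: hmult)
 moreover have "u * v:cs (?A (int (Suc l)))" using u(2,4) by (rule cs_mult) auto
 ultimately show ?case by blast
 next
 case (sum x y)
 then obtain u v where u: "x = Ph u" "u:cs (?A (int (Suc l)))" "y = Ph v" "v:cs (?A (int (Suc l)))" by blast
 moreover have "u:cs E" "v:cs E" using u sub by auto
 ultimately have "x \<oplus> y = Ph (u + v)" by (simp add: hadd)
 then show ?case using lsub_add[OF lsub_cs u(2,4)] by blast
 qed
 then have Kc: "x:carrier R" if "x:?K" for x using sub that unfolding car by blast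
 \<comment> \<open>\<open>ideal_prod\<close> is defined by products and sums; closure under scalars
   is what makes the comparison with a span possible.\<close>
 have sm: "a \<odot> x:?K" if "x:?K" for a x
 using that
 proof induction
 case (prod x y)
 then obtain u v where u: "x = Ph u" "u:cs (?A (int l))" "y = Ph v" "v:cs (?A 1)" unfolding I by blast
 then have "u:cs E" "v:cs E" using sub by auto
 then have "a \<odot> (x \<otimes> y) = Ph (sc a u) \<otimes> y" using u by (simp add: hsc rs_mult)
 moreover have "Ph (sc a u):Ph ` cs (?A (int l))" using lsub_sc[OF lsub_cs u(2)] by blast
 ultimately show ?case using ideal_prod.prod[OF _ prod(2)] by metis
 next
 case (sum x y)
 then show ?case using rs_add[OF Kc Kc] ideal_prod.sum[OF sum.IH] by simp
 qed
 have "Ph c:?K" if "c:cs (?A (int (Suc l)))" for c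
 proof -
 have "c:{c. c:cs E&Ph c:?K}"
 proof (rule cs_induct[OF that])
 show "lsub {c. c:cs E&Ph c:?K}"
 proof (rule lsubI)
 have "Ph 0 \<otimes> Ph 0:?K" unfolding I by (intro ideal_prod.prod imageI lsub_0[OF lsub_cs])
 then show "0:{c. c:cs E&Ph c:?K}" by (simp add: hzero)
 qed (auto simp: hadd hsc sm intro: ideal_prod.sum)
 fix e assume e: "e:?A (int (Suc l))"
 then obtain v where v: "v:V1" "0 < lookup e v" using wt_pos[of V1 e] by force
 have "single v 1:E" "e - single v 1:E"
 using v V1 e EV_minus[of e W v] unfolding EW' by (auto simp: EV_iff lookup_single when_def)
 then have "e - single v 1:?A (int l)" "single v 1:?A 1" using e v fV1 by (auto simp: wt_single)
 then have "Xp (e - single v 1) \<otimes> Xp (single v 1):?K"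
 unfolding I Xp_def by (intro ideal_prod.prod imageI single_cs)
 then have "Xp e:?K" using Xp_mult[OF \<open>e - single v 1:E\<close> \<open>single v 1:E\<close>] by simp
 then show "single e 1:{c. c:cs E&Ph c:?K}" using e by (simp add: Xp_def)
 qed
 then show ?thesis by blast
 qed
 then have "?K = Ph ` cs (?A (int (Suc l)))" using 1 by blast
 then show ?case using Suc by (simp add: nat_pow_def ideals_set_def)
qed

lemma tc_ER: "w:cs (ER W V1)==>tc l w:cs E"
 by (erule tc_cs) (use W0 in \<open>auto simp: EW' EV_iff ER_iff lookup_minus lookup_single when_def\<close>)

theorem mpres_rees: "mpres (rees_algebra R I) W H (ER W V1) PhR"
proof
 let ?R = "rees_algebra R I"
 have V10: "0 ~: V1" using V1 W0 by blast
 have wt0: "wt V1 (tt x) = 0" "wt W (tt x) = 0" for x using V10 W0 V1 fV1 by (simp_all add: tt_def wt_single)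
 \<comment> \<open>A monomial of \<open>R\<close> is one of \<open>A\<close> times a power of t, and
   t counts 0 in both weights; so the condition for the coefficient to lie in a power of
   \<open>I\<close> becomes the bound in \<open>ER\<close>.\<close>
 have shE: "0 <= lookup e 0&e - tt (lookup e 0):E&int (nat (lookup e 0)) <= wt V1 (e - tt (lookup e 0))
 <-> e:ER W V1" for e
 using W0 by (auto simp: ER_iff EW' EV_iff wt0 lookup_minus split: if_splits) (metis gr0I)
 show "carrier ?R = PhR ` cs (ER W V1)"
 proof -
 have "carrier ?R = {f:up R. ALL l. f l:Ph ` cs {e:E. int l <= wt V1 e}}"
 by (simp add: rees_algebra_def Let_def UP_def I_power)
 also have "... = PhR ` cs {e. 0 <= lookup e 0&e - tt (lookup e 0):{f:E. int (nat (lookup e 0)) <= wt V1 f}}"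
 by (rule up_tc) blast
 also have "... = PhR ` cs (ER W V1)" by (simp only: mem_Collect_eq shE Collect_mem_eq)
 finally show ?thesis .
 qed
 then have carR: "PhR c:carrier ?R" if "c:cs (ER W V1)" for c using that by blast
 then have upR: "PhR c:up R" if "c:cs (ER W V1)" for c
 using that by (auto simp: rees_algebra_def Let_def UP_def)
 show "gcomp ?R d = PhR ` cs {e:ER W V1. wt W e = d}" for d
 proof -
 \<comment> \<open>An element that is homogeneous of degree \<open>d\<close> is represented by the
   degree \<open>d\<close> part of any representative, so one representative satisfies both
   conditions.\<close>
 have int: "Ph ` cs {e:E. int l <= wt V1 e} Int gcomp R d = Ph ` cs {e:E. int l <= wt V1 e&wt W e = d}" for l
 proof (intro equalityI subsetI)
 fix x assume x: "x:Ph ` cs {e:E. int l <= wt V1 e} Int gcomp R d"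
 then obtain c where c: "c:cs {e:E. int l <= wt V1 e}" "x = Ph c" by blast
 then have cE: "c:cs E" using cs_mono[of "{e:E. int l <= wt V1 e}" E] by blast
 have "x = Ph (rst {e. wt W e = d} c)" using x pr_same[of x d] pr_eq[OF cE, of d] c by simp
 moreover have "rst {e. wt W e = d} c:cs {e:E. int l <= wt V1 e&wt W e = d}"
 by (rule cs_mono[OF _ rst_cs_Int[OF c(1)]]) auto
 ultimately show "x:Ph ` cs {e:E. int l <= wt V1 e&wt W e = d}" by blast
 next
 fix x assume "x:Ph ` cs {e:E. int l <= wt V1 e&wt W e = d}"
 then obtain c where c: "c:cs {e:E. int l <= wt V1 e&wt W e = d}" "x = Ph c" by blast
 have "c:cs {e:E. int l <= wt V1 e}" "c:cs {e:E. wt W e = d}" by (rule cs_mono[OF _ c(1)], blast)+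
 then show "x:Ph ` cs {e:E. int l <= wt V1 e} Int gcomp R d" unfolding gc c(2) by blast
 qed
 have "gcomp ?R d = {f:up R. ALL l. f l:Ph ` cs {e:E. int l <= wt V1 e&wt W e = d}}"
 unfolding int[symmetric] by (auto simp: rees_algebra_def Let_def UP_def I_power)
 also have "... = PhR ` cs {e:ER W V1. wt W e = d}"
 proof -
 have "{e. 0 <= lookup e 0&e - tt (lookup e 0):{f:E. int (nat (lookup e 0)) <= wt V1 f&wt W f = d}} = {e:ER W V1. wt W e = d}"
 unfolding shE[symmetric] by (auto simp: wt0)
 moreover have "{f:up R. ALL l. f l:Ph ` cs {e:E. int l <= wt V1 e&wt W e = d}}
 = PhR ` cs {e. 0 <= lookup e 0&e - tt (lookup e 0):{f:E. int (nat (lookup e 0)) <= wt V1 f&wt W f = d}}"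
 by (rule up_tc) blast
 ultimately show ?thesis by simp
 qed
 finally show ?thesis .
 qed
 show "0 ~: W" by (rule W0)
 show "0:ER W V1" by (simp add: ER_iff)
 show EE': "e + f:ER W V1" if "e:ER W V1" "f:ER W V1" for e f
 using that by (auto simp: ER_iff lookup_add add_mono)
 show "ER W V1 <= LL W {}" by (auto simp: ER_def LL_def)
 show "EX d. h:cs {e. wt W e = d}" if "h:H" for h by (rule Hd[OF that])
 show "PhR (c + c') = PhR c \<oplus>\<^bsub>?R\<^esub> PhR c'" if "c:cs (ER W V1)" "c':cs (ER W V1)" for c c'
 using upR[OF that(1)] upR[OF that(2)] tc_ER[OF that(1)] tc_ER[OF that(2)]
 by (simp add: rees_algebra_def Let_def UP_def) (simp add: PhR_def lin_add hadd)
 show "PhR (c * c') = PhR c \<otimes>\<^bsub>?R\<^esub> PhR c'" if c: "c:cs (ER W V1)" "c':cs (ER W V1)" for c c'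
 proof -
 have "PhR c \<otimes>\<^bsub>?R\<^esub> PhR c' = (%n. \<Oplus>i\<in>{..n}. Ph (tc i c) \<otimes> Ph (tc (n - i) c'))"
 using upR[OF c(1)] upR[OF c(2)] by (simp add: rees_algebra_def Let_def UP_def) (simp add: PhR_def)
 also have "... = (%n. \<Oplus>i\<in>{..n}. Ph (tc i c * tc (n - i) c'))"
 using tc_ER[OF c(1)] tc_ER[OF c(2)] by (simp add: hmult)
 also have "... = (%n. Ph (tc n (c * c')))"
 using tc_ER[OF c(1)] tc_ER[OF c(2)] tc_mult[OF c] by (intro ext) (simp add: Phi_sum ER_iff)
 finally show ?thesis by (simp add: PhR_def)
 qed
 show "PhR (sc a c) = a \<odot>\<^bsub>?R\<^esub> PhR c" if "c:cs (ER W V1)" for a c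
 using tc_ER[OF that] by (simp add: rees_algebra_def Let_def PhR_def lin_sc hsc)
 show "PhR 0 = \<zero>\<^bsub>?R\<^esub>" by (simp add: rees_algebra_def Let_def UP_def PhR_def lin_0 hzero)
 have "tc l 1 = (if l = 0 then 1 else (0 :: ex \<Rightarrow>\<^sub>0 'k))" for l using tc_single[where 'k = 'k and l = l and e = 0] by (simp add: tt_def)
 then show "PhR 1 = \<one>\<^bsub>?R\<^esub>" by (auto simp: rees_algebra_def Let_def UP_def PhR_def hzero hone)
 show "PhR c = PhR c' <-> c - c':NL W H {}" if c: "c:cs (ER W V1)" "c':cs (ER W V1)" for c c'
 proof -
 have LLt: "tt x:LL W {}" "- tt x:LL W {}" for x using W0 by (auto simp: LL_def in_keys_iff split: if_splits)
 \<comment> \<open>\<open>H\<close> has t-exponent 0, so being a relation is decided separately for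
   the coefficient of each power of t.\<close>
 have "PhR c = PhR c' <-> (ALL l. tc l (c - c'):NL W H {})"
 unfolding PhR_def fun_eq_iff using ker[OF tc_ER[OF c(1)] tc_ER[OF c(2)]] by (simp add: lin_diff)
 also have "... <-> c - c':NL W H {}"
 proof
 assume "c - c':NL W H {}"
 then have "rst {e. lookup e 0:{int l}} (c - c'):NL W H {}" for l
 by (rule NL_hom) (use H0 in \<open>auto simp: lookup_add\<close>)
 then show "ALL l. tc l (c - c'):NL W H {}" unfolding tc_def using NL_shift[OF _ LLt(2)] by auto
 next
 assume l: "ALL l. tc l (c - c'):NL W H {}"
 show "c - c':NL W H {}"
 proof (rule lsub_by_parts[OF lsub_NL])
 fix g
 show "rst {e. lookup e 0 = g} (c - c'):NL W H {}"
 proof (cases "0 <= g")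
 case True
 then have "single (tt g) 1 * tc (nat g) (c - c') = rst {e. lookup e 0 = g} (c - c')" by (simp add: tc_def)
 then show ?thesis using NL_shift[OF spec[OF l, of "nat g"] LLt(1)[of g]] by simp
 next
 case False
 have "c - c':cs (ER W V1)" using c by (rule lsub_diff[OF lsub_cs])
 then have "rst {e. lookup e 0 = g} (c - c') = 0" by (rule rst_disjoint) (use False in \<open>auto simp: ER_iff\<close>)
 then show ?thesis by (simp add: lsub_0)
 qed
 qed
 qed
 finally show ?thesis .
 qed
qed

end

end

section \<open>The Laurent complexes\<close>

lemma coh_empty:
 assumes "0:ZZ P N gr d g" "ZZ P N gr d g <= BB P N gr dl d g"
 shows "coh P N gr dl d g {}"
proof -
 have "cs {} = {0}" by (auto simp: cs_def)
 then show ?thesis unfolding coh_def qb_def using assms by (intro exI[of _ "%_. 0"]) (auto simp: lin_const0)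
qed

text \<open>Cohomology in one degree sees only the keys in that degree and its two neighbours.
  Complexes that share these agree there, even if graded by different groups.\<close>

lemma coh_strand:
 fixes D :: "('x, 'k::field) pm=>('x, 'k) pm" and gr :: "'x=>'g::ab_group_add" and gr' :: "'x=>'h::ab_group_add"
 assumes D: "lin D" "!!x. x:P==>D (single x 1):cs {y. gr y = gr x + dl}"
 "!!x. x:P'==>D (single x 1):cs {y. gr' y = gr' x + dl'}"
 and P: "{x:P. gr x = g - dl} = {x:P'. gr' x = g' - dl'}" "{x:P. gr x = g} = {x:P'. gr' x = g'}"
 "{x:P. gr x = g + dl} = {x:P'. gr' x = g' + dl'}"
 and N: "N = {c:cs P. Q c}" "N' = {c:cs P'. Q c}"
 shows "coh P N gr dl (%c. rst P (D c)) g B <-> coh P' N' gr' dl' (%c. rst P' (D c)) g' B"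
proof -
 have eq: "rst P (D c) = rst P' (D c)"
 if h: "{x:P. gr x = h} = {x:P'. gr' x = h'}" "{x:P. gr x = h + dl} = {x:P'. gr' x = h' + dl'}"
 and c: "c:cs {x:P. gr x = h}" for h h' c
 proof (rule lin_cs_eqI[OF c lin_comp[OF lin_rst D(1)] lin_comp[OF lin_rst D(1)]])
 fix x assume x: "x:{x:P. gr x = h}"
 then have x': "x:{x:P'. gr' x = h'}" unfolding h(1) .
 have "rst P (D (single x 1)) = rst (P Int {y. gr y = h + dl}) (D (single x 1))"
 using D(2)[of x] x rst_id[of "D (single x 1)" _ "{y. gr y = h + dl}"] by (simp flip: rst_rst)
 moreover have "rst P' (D (single x 1)) = rst (P' Int {y. gr' y = h' + dl'}) (D (single x 1))"
 using D(3)[of x] x' rst_id[of "D (single x 1)" _ "{y. gr' y = h' + dl'}"] by (simp flip: rst_rst)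
 ultimately show "rst P (D (single x 1)) = rst P' (D (single x 1))" using h(2) by (simp add: Collect_conj_eq)
 qed
 have C: "Ch P gr g = (Ch P' gr' g' :: ('x, 'k) pm set)" "Ch P gr (g - dl) = (Ch P' gr' (g' - dl') :: ('x, 'k) pm set)"
 by (simp_all only: Ch_def P)
 have d: "rst P (D c) = rst P' (D c)" if "c:Ch P gr g" for c using eq[OF P(2,3)] that by (simp add: Ch_def)
 have d': "rst P (D c) = rst P' (D c)" if "c:Ch P gr (g - dl)" for c
 using eq[of "g - dl" "g' - dl'"] P(1,2) that by (simp add: Ch_def)
 have rc: "rst A c:cs A" for A and c :: "('x, 'k) pm" by (rule rst_cs)
 have Z: "ZZ P N gr (%c. rst P (D c)) g = ZZ P' N' gr' (%c. rst P' (D c)) g'"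
 unfolding ZZ_def N C(1)[symmetric] using d rc by auto
 have "N Int Ch P gr g = N' Int Ch P' gr' g'" unfolding N C(1)[symmetric] using Ch_cs[of _ P gr g] Ch_cs[of _ P' gr' g'] C(1) by blast
 then have "BB P N gr dl (%c. rst P (D c)) g = BB P' N' gr' dl' (%c. rst P' (D c)) g'"
 unfolding BB_def C(2)[symmetric] using d' by (intro Collect_cong) metis
 then show ?thesis unfolding coh_def Z by simp
qed

text \<open>It also serves for two families in one cube that differ only at faces without keys in
  the given strand.\<close>

lemma cohF_strand:
 fixes gr :: "nat set \<times> 'e=>'g::ab_group_add" and gr' :: "nat set \<times> 'e=>'h::ab_group_add" and NS :: "nat set=>('e, 'k::field) pm set"
 assumes c: "cube X E NS gr dl" and c': "cube X E' NS gr' dl'"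
 and P: "!!S e h h'. S <= X==>(h, h'):{(g - dl, g' - dl'), (g, g'), (g + dl, g' + dl')}==>
 e:E S&S:F&gr (S, e) = h <-> e:E' S&S:F'&gr' (S, e) = h'"
 shows "cube.cohF X E NS gr dl F g B <-> cube.cohF X E' NS gr' dl' F' g' B"
proof -
 interpret c: cube X E NS gr dl by (rule c)
 interpret c': cube X E' NS gr' dl' by (rule c')
 have N: "c.NN Int cs (c.QQ F) = {c:cs (c.QQ F). \<forall>S\<subseteq>X. slice S c:NS S}"
 unfolding c.NN_def using cs_mono[OF c.QQ_PP] by blast
 have N': "c'.NN Int cs (c'.QQ F') = {c:cs (c'.QQ F'). \<forall>S\<subseteq>X. slice S c:NS S}"
 unfolding c'.NN_def using cs_mono[OF c'.QQ_PP] by blast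
 have Q: "{x:c.QQ F. gr x = h} = {x:c'.QQ F'. gr' x = h'}"
 if "(h, h'):{(g - dl, g' - dl'), (g, g'), (g + dl, g' + dl')}" for h h'
 proof (rule Collect_cong)
 fix x show "x:c.QQ F&gr x = h <-> x:c'.QQ F'&gr' x = h'"
 using P[OF _ that, of "fst x" "snd x"] unfolding c.QQ_def c'.QQ_def by (cases x) auto
 qed
 show ?thesis
 unfolding c.cohF_def c'.cohF_def c.dQ_def[abs_def] c'.dQ_def[abs_def]
 proof (rule coh_strand[OF lin_dX _ _ _ _ _ N N'])
 fix x assume x: "x:c.QQ F"
 show "dX X (single x (1 :: 'k)):cs {y. gr y = gr x + dl}"
 proof -
 have "x:c.PP" using x c.QQ_PP by blast
 then have "dX X (single x (1 :: 'k)):cs {y:c.PP. gr y = gr x + dl&fst x <= fst y}"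
 using c.dX_single_mem[of "fst x" "snd x"] by simp
 then show ?thesis by (rule cs_mono[rotated]) blast
 qed
 next
 fix x assume x: "x:c'.QQ F'"
 show "dX X (single x (1 :: 'k)):cs {y. gr' y = gr' x + dl'}"
 proof -
 have "x:c'.PP" using x c'.QQ_PP by blast
 then have "dX X (single x (1 :: 'k)):cs {y:c'.PP. gr' y = gr' x + dl'&fst x <= fst y}"
 using c'.dX_single_mem[of "fst x" "snd x"] by simp
 then show ?thesis by (rule cs_mono[rotated]) blast
 qed
 qed (use Q in auto)
qed

lemma (in cube) cohF_acyclic:
 assumes "conv F" "acF F"
 shows "cohF F g {}"
 unfolding cohF_def using assms lsub_0[OF lsub_ZZ[OF cpx_conv[OF assms(1)]]] unfolding acF_def acyc_def by (intro coh_empty) auto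

text \<open>Induction on \<open>Y\<close>: modulo the faces that meet \<open>Y\<close>, what a new
  \<open>y\<close> adds are the faces through \<open>y\<close> that avoid \<open>Y\<close>. There
  the partner \<open>t y\<close> can be toggled, since it changes neither spaces nor relations when
  \<open>y\<close> is present.\<close>

lemma (in cube) acF_meets:
 assumes "finite Y" "Y <= X" and t: "!!y. y:Y==>t y:X - Y"
 and E: "!!S y. S <= X==>y:S Int Y==>E (insert (t y) S) <= E (S - {t y})"
 and NS: "!!S y. S <= X==>y:S Int Y==>NS (insert (t y) S) <= NS (S - {t y})"
 shows "acF {S. S Int Y ~= {}}"
 using assms
proof (induction Y)
 case empty
 have "conv {}" by (simp add: conv_def)
 then have "cpx (QQ {}) (NN Int cs (QQ {})) gr dl (dQ {})" by (rule cpx_conv)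
 moreover have "cs (QQ {}) = ({0} :: (nat set \<times> 'e \<Rightarrow>\<^sub>0 'k) set)" by (auto simp: QQ_def cs_def)
 ultimately show ?case
 unfolding acF_def acyc_def using lsub_0[OF lsub_BB] Ch_cs by (fastforce simp: ZZ_def)
next
 case (insert y Y)
 let ?F = "{S. S Int insert y Y ~= {}}" and ?D = "{S. S Int Y ~= {}}"
 have ac: "acF ?D"
 proof (rule insert.IH)
 show "t z:X - Y" if "z:Y" for z using insert.prems(2)[of z] that by auto
 qed (use insert.prems in auto)
 have cF: "conv ?F" and up: "up_in ?F ?D" by (auto simp: conv_def up_in_def)
 have FD: "?F - ?D = {S. y:S&S Int Y = {}}" by auto
 have ty: "t y:X" "t y ~= y" "t y ~: Y" using insert.prems(2)[of y] by auto
 have "acF (?F - ?D)" unfolding FD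
 proof (rule acF_toggle[OF ty(1)])
 show "conv {S. y:S&S Int Y = {}}" by (auto simp: conv_def)
 show "insert (t y) S:{S. y:S&S Int Y = {}} <-> S - {t y}:{S. y:S&S Int Y = {}}" for S using ty by auto
 fix S assume S: "S <= X" "S:{S. y:S&S Int Y = {}}"
 show "E (insert (t y) S) <= E (S - {t y})" by (rule insert.prems(3)) (use S in auto)
 have "NS (insert (t y) S) <= NS (S - {t y})" by (rule insert.prems(4)) (use S in auto)
 then show "NS (insert (t y) S) Int cs (E (insert (t y) S)) <= NS (S - {t y})" by blast
 qed
 then show ?case using acF_quotient[OF cF up ac] by blast
qed

lemma LL_wt: "e:LL W {}==>0 <= wt W e"
 by (auto simp: LL_def wt_def intro: sum_nonneg)

text \<open>The differential keeps the degree and the t-exponent, so recording both splits the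
  complex into strands.\<close>

definition gr3 :: "nat set=>nat set \<times> ex=>int \<times> int \<times> int" where
 "gr3 W = (%(S, e). (int (card S), wt W e, lookup e 0))"

definition homog :: "nat set=>(ex \<Rightarrow>\<^sub>0 'k::field) set=>bool" where
 "homog W H <-> (ALL h:H. EX d. h:cs {e. wt W e = d&lookup e 0 = 0})"

lemma cube_NL:
 assumes X: "finite X" and E: "!!S T. S <= T==>T <= X==>E S <= E T" and H: "homog W H"
 shows "cube X E (%S. NL W H (vr ` S)) (gr3 W) (1, 0, 0)"
 and "cube X E (%S. NL W H (vr ` S)) (%(S, e). int (card S)) 1"
proof -
 note fin = finite_subset[OF _ X]
 have m: "NL W H (vr ` S) <= NL W H (vr ` T)" if "S <= T" for S T
 using that by (intro NL_mono LL_mono image_mono) auto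
 have h: "rst {e. P&wt W e = a&lookup e 0 = b} n:NL W H U" if "n:NL W H U" for a b U P n
 proof -
 have "rst {e. (wt W e, lookup e 0):{x. P&x = (a, b)}} n:NL W H U"
 proof (rule NL_hom[OF that])
 fix h assume "h:H"
 then obtain d where "h:cs {e. wt W e = d&lookup e 0 = 0}" using H unfolding homog_def by blast
 then show "EX d. h:cs {e. (wt W e, lookup e 0) = d}" by (intro exI[of _ "(d, 0)"]) simp
 qed (simp add: lookup_add)
 moreover have "{e. (wt W e, lookup e 0):{x. P&x = (a, b)}} = {e. P&wt W e = a&lookup e 0 = b}" by blast
 ultimately show ?thesis by simp
 qed
 show "cube X E (%S. NL W H (vr ` S)) (gr3 W) (1, 0, 0)"
 proof
 show "rst {e. gr3 W (S, e) = g} n:NL W H (vr ` S)" if "n:NL W H (vr ` S)" for S g n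
 proof -
 obtain a b c where g: "g = (a, b, c)" by (cases g)
 have "{e. gr3 W (S, e) = g} = {e. int (card S) = a&wt W e = b&lookup e 0 = c}" by (simp add: gr3_def g)
 then show ?thesis using h[OF that] by presburger
 qed
 qed (use X E m fin in \<open>auto simp: gr3_def card_insert_disjoint\<close>)
 show "cube X E (%S. NL W H (vr ` S)) (%(S, e). int (card S)) 1"
 proof
 show "rst {e. (case (S, e) of (S, e)=>int (card S)) = g} n:NL W H (vr ` S)" if "n:NL W H (vr ` S)" for S g n
 using that rst_id[of n "keys n" UNIV] rst_disjoint[of n "keys n" "{}"]
 by (cases "int (card S) = g") (auto simp: lsub_0 cs_def)
 qed (use X E m fin in \<open>auto simp: card_insert_disjoint\<close>)
qed

text \<open>Position \<open>j < m\<close> stands for the j-th variable and position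
  \<open>m + j\<close> for its product with t. Both invert the same variable, because t is already a
  unit in \<open>LL\<close>.\<close>

locale doubled =
 fixes V :: "nat set" and m :: nat and x :: "nat=>nat" and H :: "(ex \<Rightarrow>\<^sub>0 'k::field) set"
 assumes H: "homog V H"
begin

definition vr :: "nat=>nat" where "vr j = (if j < m then x j else x (j - m))"

abbreviation "X == {..<2 * m}"
abbreviation "L S == LL V (vr ` S)"
abbreviation "NS S == NL V H (vr ` S)"

text \<open>The monomials in the localization of A_1[It] at \<open>S\<close>: inverting some x_i t
  admits negative t-exponents, and inverting some x_i lifts the bound of the t-exponent by the
  degree.\<close>

definition EC :: "nat set=>ex set" where
 "EC S = {e:L S. (0 <= lookup e 0 \<or> S Int {m..<2 * m} ~= {})&(lookup e 0 <= wt V e \<or> S Int {..<m} ~= {})}"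

sublocale full: cube X L NS "gr3 V" "(1, 0, 0)"
 by (rule cube_NL(1)[OF _ _ H]) (auto intro!: LL_mono)

sublocale rees: cube X EC NS "gr3 V" "(1, 0, 0)"
proof (rule cube_NL(1)[OF _ _ H])
 fix S T assume "S <= T" "T <= X"
 then show "EC S <= EC T" using LL_mono[of "vr ` S" "vr ` T" V] by (auto simp: EC_def)
qed simp

text \<open>A face through one of x_j and x_j t may gain or lose the other without a change of the
  inverted variables.\<close>

lemma acyclic: "full.acF {S. S Int {m..<2 * m} ~= {}}" "full.acF {S. S Int {..<m} ~= {}}"
proof -
 have im: "vr ` insert a S = vr ` (S - {a})" if "vr b = vr a" "b ~= a" "b:S" for a b S
 proof -
 have "vr a:vr ` (S - {a})" using that by (metis Diff_iff imageI singletonD)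
 moreover have "vr ` insert a S = insert (vr a) (vr ` (S - {a}))" by auto
 ultimately show ?thesis by (simp add: insert_absorb)
 qed
 show "full.acF {S. S Int {m..<2 * m} ~= {}}"
 proof (rule full.acF_meets[where t = "%y. y - m"])
 have p: "vr ` insert (y - m) S = vr ` (S - {y - m})" if "y:S Int {m..<2 * m}" for y S
 by (rule im[of y]) (use that in \<open>auto simp: vr_def\<close>)
 show "L (insert (y - m) S) <= L (S - {y - m})" "NS (insert (y - m) S) <= NS (S - {y - m})" if "y:S Int {m..<2 * m}" for S y
 unfolding p[OF that] by (rule order_refl)+
 qed auto
 show "full.acF {S. S Int {..<m} ~= {}}"
 proof (rule full.acF_meets[where t = "%y. y + m"])
 have p: "vr ` insert (y + m) S = vr ` (S - {y + m})" if "y:S Int {..<m}" for y S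
 by (rule im[of y]) (use that in \<open>auto simp: vr_def\<close>)
 show "L (insert (y + m) S) <= L (S - {y + m})" "NS (insert (y + m) S) <= NS (S - {y + m})" if "y:S Int {..<m}" for S y
 unfolding p[OF that] by (rule order_refl)+
 qed auto
qed

text \<open>With \<alpha> and c fixed, the two disjunctions in \<open>EC\<close> are conditions on
  the face alone, so the strand is that of a family of faces in the \<open>full\<close>
  cube.\<close>

theorem rees_coh:
 assumes Bx: "!!g. full.cohF {S. S <= {..<m}} g (Bx g :: 'b set)" and Bt: "!!g. full.cohF {S. S <= {m..<2 * m}} g (Bt g)"
 shows "rees.cohF UNIV (p, al, c) (if 0 <= c&c <= al then Bx (p, al, c) else if al < c&c < 0 then Bt (p - 1, al, c) else {})"
proof -
 let ?F = "{S. (0 <= c \<or> S Int {m..<2 * m} ~= {})&(c <= al \<or> S Int {..<m} ~= {})}"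
 have 0: "rees.cohF UNIV (p, al, c) B <-> full.cohF ?F (p, al, c) B" for B :: "'b set"
 by (rule cohF_strand[OF rees.cube_axioms full.cube_axioms]) (auto simp: EC_def gr3_def)
 have same: "full.cohF F (q, al, c) B <-> full.cohF F' (q, al, c) B"
 if "!!S e. S <= X==>e:L S==>wt V e = al==>S:F <-> S:F'" for F F' q and B :: "'b set"
 by (rule cohF_strand[OF full.cube_axioms full.cube_axioms]) (use that in \<open>auto simp: gr3_def\<close>)
 consider "0 <= c" "c <= al" | "0 <= c" "al < c" | "c < 0" "c <= al" | "c < 0" "al < c" by linarith
 then show ?thesis
 proof cases
 case 1
 have cv: "full.conv UNIV" and up: "full.up_in UNIV {S. S Int {m..<2 * m} ~= {}}"
 by (auto simp: full.conv_def full.up_in_def)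
 have "full.cohF UNIV (p, al, c) (Bx (p, al, c)) <-> full.cohF (UNIV - {S. S Int {m..<2 * m} ~= {}}) (p, al, c) (Bx (p, al, c))"
 by (rule full.cohF_quotient[OF cv up acyclic(1)])
 also have "... <-> full.cohF {S. S <= {..<m}} (p, al, c) (Bx (p, al, c))"
 by (rule same) (auto simp: disjoint_iff subset_iff, meson not_le)
 finally show ?thesis using Bx 1 unfolding 0 by simp
 next
 case 2
 have "full.conv {S. S Int {..<m} ~= {}}" by (auto simp: full.conv_def)
 then show ?thesis using full.cohF_acyclic[OF _ acyclic(2)] 2 unfolding 0 by simp
 next
 case 3
 have "full.conv {S. S Int {m..<2 * m} ~= {}}" by (auto simp: full.conv_def)
 then show ?thesis using full.cohF_acyclic[OF _ acyclic(1)] 3 unfolding 0 by simp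
 next
 case 4
 \<comment> \<open>\<open>?D\<close> is the family at hand, an upward closed part of the acyclic
   \<open>?G\<close>; the complement consists of nonempty faces with positions x_j t only.\<close>
 let ?G = "{S. S Int {m..<2 * m} ~= {}}" and ?D = "{S. S Int {m..<2 * m} ~= {}&S Int {..<m} ~= {}}"
 have cv: "full.conv ?G" and up: "full.up_in ?G ?D" by (auto simp: full.conv_def full.up_in_def)
 have "full.cohF (?G - ?D) (p - 1, al, c) (Bt (p - 1, al, c)) <-> full.cohF ?D ((p - 1, al, c) + (1, 0, 0)) (Bt (p - 1, al, c))"
 by (rule full.cohF_connecting[OF cv up acyclic(1)])
 moreover have "full.cohF (?G - ?D) (p - 1, al, c) (Bt (p - 1, al, c)) <-> full.cohF {S. S <= {m..<2 * m}} (p - 1, al, c) (Bt (p - 1, al, c))"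
 proof (rule same)
 fix S e assume S: "S <= X" and e: "e:L S" "wt V e = al"
 \<comment> \<open>With \<alpha> < 0 the empty face carries no monomial, so it can be included; this
   completes the nonempty faces of the x_j t to a full Cech complex.\<close>
 have "S ~= {}" using LL_wt[of e V] e 4 by auto
 then show "S:?G - ?D <-> S:{S. S <= {m..<2 * m}}" using S by (fastforce simp: disjoint_iff subset_iff not_le)
 qed
 ultimately show ?thesis using Bt 4 unfolding 0 by simp
 qed
qed

end

section \<open>Exponents in products of generators of the form x_i or x_i t\<close>

context mpres
begin

interpretation galg R pr by (rule galg)

context
 fixes gs :: "ex list" and vr :: "nat=>nat" and T :: "nat=>bool" and c :: int
 assumes gs: "set gs <= E" and vr: "ALL i<length gs. vr i:W"
 and nth: "ALL i<length gs. gs ! i = single (vr i) 1 + tt (of_bool (T i))"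
begin

lemma mxd: "mx gs S ep = (\<Sum>i\<in>S. npw (ep i) (gs ! i))" and VSd: "VS gs S = (\<Union>i\<in>S. keys (gs ! i))"
 by (rule mx_def[OF gs, where tau = 0], simp) (rule VS_def[OF gs, where tau = 0], simp)

lemma lookup_gs: "i < length gs==>lookup (gs ! i) v = of_bool (vr i = v) + of_bool (v = 0&T i)"
 by (auto simp: nth lookup_add lookup_single when_def)

lemma VS_LL: "S <= {..<length gs}==>LL W (VS gs S) = LL W (vr ` S)"
proof -
 assume S: "S <= {..<length gs}"
 have "v:VS gs S <-> v:vr ` S" if v: "v:W" for v
 proof -
 have v0: "v ~= 0" using v W0 by metis
 have "v:keys (gs ! i) <-> vr i = v" if "i:S" for i
 proof -
 have "i < length gs" using S that by auto
 then show ?thesis using lookup_gs[of i v] v0 by (simp add: in_keys_iff)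
 qed
 then show ?thesis by (auto simp: VSd)
 qed
 then show ?thesis by (auto simp: LL_def)
qed

lemma lookup_mx:
 assumes "S <= {..<length gs}"
 shows "lookup (mx gs S ep) v = (\<Sum>i\<in>S. int (ep i) * (of_bool (vr i = v) + of_bool (v = 0&T i)))"
 unfolding mxd lookup_sum lookup_npw
 by (rule sum.cong[OF refl]) (use lookup_gs assms in \<open>simp add: subset_iff\<close>)

lemma wt_mx:
 assumes S: "S <= {..<length gs}" and V: "V <= W" "finite V"
 shows "wt V (mx gs S ep) = (\<Sum>i\<in>S. int (ep i) * of_bool (vr i:V))"
proof -
 have "wt V (mx gs S ep) = (\<Sum>v\<in>V. \<Sum>i\<in>S. int (ep i) * of_bool (vr i = v))"
 unfolding wt_def
 proof (rule sum.cong[OF refl])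
 fix v assume "v:V"
 then have "v ~= 0" using V W0 by (metis subsetD)
 then show "lookup (mx gs S ep) v = (\<Sum>i\<in>S. int (ep i) * of_bool (vr i = v))" by (simp add: lookup_mx[OF S])
 qed
 also have "... = (\<Sum>i\<in>S. \<Sum>v\<in>V. int (ep i) * of_bool (vr i = v))" by (rule sum.swap)
 also have "... = (\<Sum>i\<in>S. int (ep i) * of_bool (vr i:V))"
 by (rule sum.cong[OF refl]) (use V in \<open>simp add: of_bool_def flip: sum_distrib_left\<close>)
 finally show ?thesis .
qed

lemma mx_nonneg: "S <= {..<length gs}==>0 <= lookup (mx gs S ep) v"
 by (simp add: lookup_mx) (rule sum_nonneg, simp)

lemma mx_off: "S <= {..<length gs}==>v ~= 0==>v ~: vr ` S==>lookup (mx gs S ep) v = 0"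
 by (simp add: lookup_mx) (rule sum.neutral, auto)

lemma sum_ge: 
 assumes "S <= {..<length gs}" "j:S" "P j"
 shows "int N <= (\<Sum>i\<in>S. int N * of_bool (P i))"
 using member_le_sum[of j S "%i. int N * of_bool (P i)"] assms finite_subset[OF assms(1)] by simp

lemma mx_on: "S <= {..<length gs}==>v:vr ` S==>int N <= lookup (mx gs S (%_. N)) v"
proof -
 assume S: "S <= {..<length gs}" "v:vr ` S"
 then obtain j where j: "j:S" "vr j = v" by blast
 have "int N <= (\<Sum>i\<in>S. int N * of_bool (vr i = v))" by (rule sum_ge[of S j "%i. vr i = v", OF S(1) j])
 also have "... <= lookup (mx gs S (%_. N)) v" unfolding lookup_mx[OF S(1)] by (rule sum_mono) (simp add: of_bool_def)
 finally show ?thesis .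
qed

end

end

text \<open>A common bound for the exponents and the partial degrees of \<open>e\<close>, from which
  sufficiently large denominators are taken.\<close>

definition bnd :: "ex=>nat" where "bnd e = nat (\<Sum>v\<in>keys e. \<bar>lookup e v\<bar>)"

lemma bnd: "\<bar>lookup e v\<bar> <= int (bnd e)" "finite V==>\<bar>wt V e\<bar> <= int (bnd e)"
proof -
 have nn: "0 <= (\<Sum>v\<in>keys e. \<bar>lookup e v\<bar>)" by (rule sum_nonneg) simp
 show "\<bar>lookup e v\<bar> <= int (bnd e)"
 using member_le_sum[of v "keys e" "%v. \<bar>lookup e v\<bar>"] nn by (cases "v:keys e") (auto simp: bnd_def in_keys_iff)
 assume V: "finite V"
 have "\<bar>wt V e\<bar> <= (\<Sum>v\<in>V. \<bar>lookup e v\<bar>)" unfolding wt_def by (rule sum_abs)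
 also have "... = (\<Sum>v\<in>V Int keys e. \<bar>lookup e v\<bar>)" using V by (intro sum.mono_neutral_right) (auto simp: in_keys_iff)
 also have "... <= (\<Sum>v\<in>keys e. \<bar>lookup e v\<bar>)" by (rule sum_mono2) auto
 finally show "\<bar>wt V e\<bar> <= int (bnd e)" using nn by (simp add: bnd_def)
qed

lemma LL_iff: "e:LL W U <-> (ALL v. v ~= 0 --> v ~: W --> lookup e v = 0)&(ALL v:W - U. 0 <= lookup e v)"
 by (auto simp: LL_def in_keys_iff)

lemma map_nat_single: "Poly_Mapping.map nat (single v 1) = single v 1"
 by (rule pmI) (simp add: lookup_single when_def)

lemma intp_gcomp:
 assumes "finite V" "p:gcomp (poly_algebra V) d"
 shows "intp p:cs {e:EV V. wt V e = d}"
proof -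
 have "natp ` cs {e:EV V. wt V e = d} = cs {e. keys e <= V&int (mono_degree e) = d}"
 by (rule natp_cs) (simp add: mono_degree_nat[OF assms(1)])
 then obtain c where c: "p = natp c" "c:cs {e:EV V. wt V e = d}" using assms(2) unfolding poly_simps by blast
 then have "c:cs (EV V)" using cs_mono[of "{e:EV V. wt V e = d}" "EV V"] by blast
 then show ?thesis using c intp_natp[of c V] by simp
qed

lemma intp_homog:
 assumes "finite V" "0 ~: V" "!!p. p:H0==>EX d. p:gcomp (poly_algebra V) d"
 shows "homog V (intp ` H0)" "intp ` H0 <= cs (EV V)"
proof -
 have 1: "EX d. intp p:cs {e:EV V. wt V e = d}" if "p:H0" for p using intp_gcomp[OF assms(1)] assms(3)[OF that] by blast
 have "{e:EV V. wt V e = d} <= {e. wt V e = d&lookup e 0 = 0}" for d using EV_mem(2)[of _ V 0] assms(2) by blast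
 then show "homog V (intp ` H0)" unfolding homog_def using 1 cs_mono by blast
 show "intp ` H0 <= cs (EV V)" using 1 cs_mono[of "{e:EV V. wt V e = _}" "EV V"] by blast
qed

lemma mpres_A:
 fixes H0 :: "'k::field mpoly set"
 assumes V: "finite V" "0 ~: V" and H0: "!!p. p:H0==>EX d. p:gcomp (poly_algebra V) d"
 and J: "J = Idl\<^bsub>poly_algebra V\<^esub> H0"
 shows "mpres (quotient_algebra (poly_algebra V) J) V (intp ` H0) (EV V) (%w. J +>\<^bsub>poly_algebra V\<^esub> natp w)"
proof (rule mpres.mpres_quotient[OF mpres_poly[OF V] refl refl intp_homog(2)[OF V H0]])
 show "EX d. h:cs {e. wt V e = d}" if "h:intp ` H0" for h :: "ex \<Rightarrow>\<^sub>0 'k"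
 using that intp_gcomp[OF V(1)] H0 cs_mono[of "{e:EV V. wt V e = _}" "{e. wt V e = _}"] by blast
 show "J = Idl\<^bsub>poly_algebra V\<^esub> (natp ` intp ` H0)" by (simp add: J image_image natp_intp)
qed

lemma natp_Var: "natp (single (single v 1) 1) = Var v"
 by (simp add: natp_def Var_def map_nat_single)

text \<open>The algebra contains no t, and the strand of t-exponent c is a copy of its Cech complex
  labelled by t^c. The twist \<open>tt c\<close> removes the label, so every c yields the same local
  cohomology.\<close>

lemma A_lc:
 fixes H0 :: "'k::field mpoly set" and B :: "'b set" and k :: nat and xl :: "nat list"
 defines "P == poly_algebra (set xl)"
 assumes x0: "0 ~: set xl" and H0: "!!p. p:H0==>EX d. p:gcomp P d" and J: "J = Idl\<^bsub>P\<^esub> H0"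
 and X: "finite X" "{k..<k + length xl} <= X" and vr: "!!j. j < length xl==>vr (k + j) = xl ! j"
 and cube: "cube X E (%S. NL (set xl) (intp ` H0) (vr ` S)) (gr3 (set xl)) (1, 0, 0)"
 and E: "!!S e. S <= {k..<k + length xl}==>lookup e 0 = c==>e:E S <-> e:LL (set xl) (vr ` S)"
 and coh: "cube.cohF X E (%S. NL (set xl) (intp ` H0) (vr ` S)) (gr3 (set xl)) (1, 0, 0) {S. S <= {k..<k + length xl}} (p, al, c) B"
 shows "is_free (local_cohomology (quotient_algebra P J) (Idl\<^bsub>quotient_algebra P J\<^esub> ((%v. J +>\<^bsub>P\<^esub> Var v) ` set xl)) p al) B"
proof -
 let ?V = "set xl" and ?F = "{S. S <= {k..<k + length xl}}" and ?Ph = "%w. J +>\<^bsub>P\<^esub> natp w"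
 have V: "finite ?V" by simp
 note H0' = H0[unfolded P_def]
 interpret M: mpres "quotient_algebra P J" ?V "intp ` H0" "EV ?V" ?Ph
 unfolding P_def by (rule mpres_A[OF V x0 H0' J[unfolded P_def]])
 define gs :: "ex list" where "gs = map (%v. single v 1) xl"
 define E' where "E' S = {e:LL ?V (vr ` S). wt ?V e = al&lookup e 0 = c}" for S
 have len: "length gs = length xl" by (simp add: gs_def)
 have gsE: "set gs <= EV ?V" by (auto simp: gs_def EV_iff lookup_single when_def)
 have tau: "keys (tt c) <= {0}" by (auto simp: tt_def)
 have nv: "ALL i<length gs. xl ! i:?V" by (simp add: len)
 have nth: "ALL i<length gs. gs ! i = single (xl ! i) 1 + tt (of_bool False)" by (simp add: gs_def tt_def)
 note mx = M.mx_nonneg[OF gsE nv nth] M.mx_off[OF gsE nv nth] M.mx_on[OF gsE nv nth]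
 have ES: "e:M.ES gs (tt c) S <-> e:LL ?V ((!) xl ` S)&lookup e 0 = c" if S: "S <= {..<length gs}" for S e
 proof
 have im: "(!) xl ` S <= ?V" using S len by auto
 have z: "lookup (M.mx gs S ep) 0 = 0" for ep
 unfolding M.lookup_mx[OF gsE nv nth S] by (rule sum.neutral) (use im x0 in force)
 {
 assume "e:M.ES gs (tt c) S"
 then obtain ep where ep: "e + M.mx gs S ep - tt c:EV ?V" unfolding M.ES_def[OF gsE tau] by blast
 then have l: "0 <= lookup e v + lookup (M.mx gs S ep) v - lookup (tt c) v"
 "v ~: ?V==>lookup e v + lookup (M.mx gs S ep) v - lookup (tt c) v = 0" for v
 by (auto simp: EV_iff lookup_add lookup_minus)
 have "lookup e 0 = c" using l(2)[OF x0] z by simp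
 moreover have "lookup e v = 0" if "v ~= 0" "v ~: ?V" for v
 proof -
 have "v ~: (!) xl ` S" using im that by blast
 then show ?thesis using l(2)[OF that(2)] mx(2)[OF S that(1)] that by simp
 qed
 moreover have "0 <= lookup e v" if "v:?V - (!) xl ` S" for v
 proof -
 have "v ~= 0" using that x0 by auto
 then show ?thesis using l(1)[of v] mx(2)[OF S] that by simp
 qed
 ultimately show "e:LL ?V ((!) xl ` S)&lookup e 0 = c" by (simp add: LL_iff)
 }
 assume e: "e:LL ?V ((!) xl ` S)&lookup e 0 = c"
 \<comment> \<open>Each generator is used \<open>bnd e\<close> times, which outweighs every negative
   exponent of an inverted variable.\<close>
 let ?m = "M.mx gs S (%_. bnd e)"
 have "0 <= lookup e v + lookup ?m v" if v: "v ~= 0" for v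
 proof (cases "v:(!) xl ` S")
 case True
 then show ?thesis using mx(3)[OF S True, of "bnd e"] bnd(1)[of e v] by linarith
 next
 case False
 then show ?thesis using mx(1)[OF S, of "%_. bnd e" v] e v by (cases "v:?V") (auto simp: LL_iff)
 qed
 moreover have "lookup e v + lookup ?m v = 0" if "v ~= 0" "v ~: ?V" for v
 proof -
 have "v ~: (!) xl ` S" using im that by blast
 then show ?thesis using mx(2)[OF S that(1)] e that by (simp add: LL_iff)
 qed
 ultimately have "e + ?m - tt c:EV ?V" using e z x0 by (auto simp: EV_iff lookup_add lookup_minus)
 then show "e:M.ES gs (tt c) S" unfolding M.ES_def[OF gsE tau] by blast
 qed
 have shim: "(!) xl ` (%i. i - k) ` S = vr ` S" and shX: "(%i. i - k) ` S <= {..<length gs}" if "S:?F" for S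
 proof -
 have 1: "xl ! (i - k) = vr i&i - k < length gs" if "i:S" for i
 proof -
 have "k <= i" "i < k + length xl" using \<open>S:?F\<close> that by auto
 then show ?thesis using vr[of "i - k"] by (simp add: len)
 qed
 show "(!) xl ` (%i. i - k) ` S = vr ` S" "(%i. i - k) ` S <= {..<length gs}"
 using 1 by (auto simp: image_image intro!: image_cong)
 qed
 have hom: "homog ?V (intp ` H0)" by (rule intp_homog(1)[OF V x0 H0'])
 have cube': "cube X E' (%S. NL ?V (intp ` H0) (vr ` S)) (%(S, e). int (card S)) 1"
 proof (rule cube_NL(2)[OF X(1) _ hom])
 fix S T assume "S <= (T :: nat set)"
 then have "LL ?V (vr ` S) <= LL ?V (vr ` T)" by (intro LL_mono image_mono)
 then show "E' S <= E' T" unfolding E'_def by blast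
 qed
 have "cube.cohF X E' (%S. NL ?V (intp ` H0) (vr ` S)) (%(S, e). int (card S)) 1 ?F p B"
 using coh by (subst cohF_strand[OF cube' cube, where g' = "(p, al, c)" and F' = ?F]) (auto simp: gr3_def E'_def E)
 then have "is_free (cech_cohomology (quotient_algebra P J) (map M.Xp gs) p al) B"
 proof (intro M.cech_cube_pres[OF gsE tau cube', where k = k])
 show "E' S = {e:M.ES gs (tt c) ((%i. i - k) ` S). wt ?V e = al}" if "S:{S. S <= {k..<k + length gs}}" for S
 using ES[OF shX] shim[of S] that by (auto simp: E'_def len)
 show "w:NL ?V (intp ` H0) (vr ` S) <-> w:NL ?V (intp ` H0) (M.VS gs ((%i. i - k) ` S))"
 if "S:{S. S <= {k..<k + length gs}}" for S w
 unfolding NL_def using M.VS_LL[OF gsE nv nth shX[of S]] shim[of S] that by (simp add: len)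
 qed (use X in \<open>simp_all add: len\<close>)
 moreover have "Idl\<^bsub>quotient_algebra P J\<^esub> ((%v. J +>\<^bsub>P\<^esub> Var v) ` ?V) = Idl\<^bsub>quotient_algebra P J\<^esub> (M.Xp ` set gs)"
 by (rule arg_cong[where f = "%A. Idl\<^bsub>quotient_algebra P J\<^esub> A"]) (simp add: gs_def image_image M.Xp_def natp_Var)
 ultimately show ?thesis using M.lc_free[OF gsE] by blast
qed

section \<open>The Cech complex of the Rees algebra as a tensor product\<close>

lemma NL_mult: "w:NL W H U==>c:cs (LL W U)==>c * w:NL W H U"
 by (erule lin_cs_mem[OF _ lin_mult2 lsub_NL]) (rule NL_shift)

definition ez :: "nat set=>ex=>ex" where "ez A e = (\<Sum>v\<in>A. single v (lookup e v))"

lemma lookup_ez [simp]: "finite A==>lookup (ez A e) v = (if v:A then lookup e v else 0)"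
 by (simp add: ez_def lookup_sum lookup_single when_def)

lemma LL_sub:
 assumes "0 ~: Z" "V <= Z" "U <= U'"
 shows "LL V U <= LL Z U'"
proof
 fix e assume e: "e:LL V U"
 have "0 <= lookup e v" if v: "v:Z - U'" for v
 proof (cases "v:V")
 case False
 moreover have "v ~= 0" using v assms(1) by (metis DiffD1)
 ultimately show ?thesis using e by (simp add: LL_iff)
 qed (use e v assms(3) in \<open>auto simp: LL_iff\<close>)
 then show "e:LL Z U'" using e assms(2) by (auto simp: LL_iff)
qed

locale split =
 fixes xl yl :: "nat list" and H1 H2 :: "(ex \<Rightarrow>\<^sub>0 'k::field) set"
 assumes x0: "0 ~: set xl" "0 ~: set yl" "set xl Int set yl = {}"
 and H1: "homog (set xl) H1" "H1 <= cs (EV (set xl))" and H2: "homog (set yl) H2" "H2 <= cs (EV (set yl))"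
begin

abbreviation "m == length xl"
abbreviation "X1 == {..<2 * m}"
abbreviation "X2 == {2 * m..<2 * m + length yl}"
abbreviation "Xs == {..<2 * m + length yl}"
abbreviation "V1 == set xl"
abbreviation "V2 == set yl"
abbreviation "Z == V1 Un V2"

sublocale D: doubled V1 m "(!) xl" H1 by unfold_locales (rule H1)

definition vr :: "nat=>nat" where "vr i = (if i < 2 * m then D.vr i else yl ! (i - 2 * m))"
text \<open>The exponent of t is given to the first factor alone; this makes the splitting of a
  monomial unique.\<close>

definition E2 :: "nat set=>ex set" where "E2 S = {e:LL V2 (vr ` S). lookup e 0 = 0}"

sublocale c2: cube X2 E2 "%S. NL V2 H2 (vr ` S)" "gr3 V2" "(1, 0, 0)"
proof (rule cube_NL(1)[OF _ _ H2(1)])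
 show "E2 S <= E2 T" if "S <= T" for S T using LL_mono[OF image_mono[OF that], of V2 vr] by (auto simp: E2_def)
qed simp

abbreviation "P1 == D.rees.PP"
abbreviation "N1 == D.rees.NN"
abbreviation "P2 == c2.PP"
abbreviation "N2 == c2.NN"

definition par :: "int \<times> int \<times> int=>'k" where "par g = (if even (fst g) then 1 else - 1)"

lemma par: "par (g + (1, 0, 0)) = - par g" "par g * par g = 1"
 by (cases g; simp add: par_def)+

lemmas T = D.rees.cpx_PP c2.cpx_PP par
lemmas tI = tN_into[where par = par, OF T]
lemmas tNs = tN1[where par = par, OF T] tN2[where par = par, OF T]
lemmas tl = lsub_tN[where par = par, OF T]

definition sp :: "(nat set \<times> ex) \<times> (nat set \<times> ex)=>nat set" where "sp = (%((S1, e1), (S2, e2)). S1 Un S2)"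
definition xx :: "(nat set \<times> ex) \<times> (nat set \<times> ex)=>ex" where "xx = (%((S1, e1), (S2, e2)). e1 + e2)"
text \<open>Recombines the split keys over the face \<open>S\<close> into ordinary Laurent
  monomials.\<close>

definition mu :: "nat set=>((nat set \<times> ex) \<times> (nat set \<times> ex) \<Rightarrow>\<^sub>0 'k)=>(ex \<Rightarrow>\<^sub>0 'k)" where
 "mu S c = lext (%x. single (xx x) 1) (rst {x. sp x = S} c)"

lemma lin_mu: "lin (mu S)"
 unfolding mu_def by (rule lin_comp[OF lin_lext lin_rst])

lemma vr1: "S <= X1==>D.vr ` S = vr ` S"
 by (rule image_cong) (auto simp: vr_def)

lemma vr_V1: "i:X1==>vr i:V1" and vr_V2: "i:X2==>vr i:V2"
 by (auto simp: vr_def D.vr_def)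

lemma LLd:
 assumes S: "S <= Xs"
 shows "LL V1 (vr ` (S Int X1)) <= LL Z (vr ` S)" "LL V2 (vr ` (S Int X2)) <= LL Z (vr ` S)"
 "e:LL Z (vr ` S)==>ez (insert 0 V1) e:LL V1 (vr ` (S Int X1))"
 "e:LL Z (vr ` S)==>ez V2 e:E2 (S Int X2)"
proof -
 have i: "vr ` S Int V1 = vr ` (S Int X1)" "vr ` S Int V2 = vr ` (S Int X2)"
 proof -
 have j: "j:X1&vr j:V1&vr j ~: V2 \<or> j:X2&vr j:V2&vr j ~: V1" if "j:S" for j
 proof (cases "j:X1")
 case False
 then have "j:X2" using that S by auto
 then show ?thesis using vr_V2[of j] x0(3) by blast
 qed (use vr_V1[of j] x0(3) in blast)
 have "vr j:V2" if "j:X2" for j using vr_V2[OF that] .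
 then show "vr ` S Int V1 = vr ` (S Int X1)" "vr ` S Int V2 = vr ` (S Int X2)" using j vr_V1 by blast+
 qed
 show "LL V1 (vr ` (S Int X1)) <= LL Z (vr ` S)" "LL V2 (vr ` (S Int X2)) <= LL Z (vr ` S)"
 by (rule LL_sub; use x0 in auto)+
 assume e: "e:LL Z (vr ` S)"
 have "v ~: vr ` S" if "v:V1 - vr ` (S Int X1) \<or> v:V2 - vr ` (S Int X2)" for v using i that by blast
 then show "ez (insert 0 V1) e:LL V1 (vr ` (S Int X1))" "ez V2 e:E2 (S Int X2)"
 using e x0 by (auto simp: LL_iff E2_def)
qed

lemma P_iff: "((S1, e1), (S2, e2)):P1 \<times> P2 <-> S1 <= X1&e1:D.EC S1&S2 <= X2&e2:E2 S2"
 by (auto simp: D.rees.PP_def c2.PP_def)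

lemma V12: "v:insert 0 V1==>v ~: V2"
 using x0 by blast

lemma EC_0: "e:D.EC S==>v ~: insert 0 V1==>lookup e v = 0"
 by (simp add: D.EC_def LL_iff)

lemma E2_0: "e:E2 S==>v ~: V2==>lookup e v = 0"
 by (cases "v = 0") (simp_all add: E2_def LL_iff)

lemma ez_split:
 assumes e: "e1:D.EC S1" "e2:E2 S2"
 shows "ez (insert 0 V1) (e1 + e2) = e1" "ez V2 (e1 + e2) = e2"
proof -
 have "lookup (ez (insert 0 V1) (e1 + e2)) v = lookup e1 v&lookup (ez V2 (e1 + e2)) v = lookup e2 v" for v
 proof (cases "v:insert 0 V1")
 case True
 then show ?thesis using V12[OF True] E2_0[OF e(2) V12[OF True]] by (simp add: lookup_add)
 next
 case False
 then show ?thesis using EC_0[OF e(1) False] E2_0[OF e(2), of v] by (cases "v:V2") (simp_all add: lookup_add)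
 qed
 then show "ez (insert 0 V1) (e1 + e2) = e1" "ez V2 (e1 + e2) = e2" by (blast intro: pmI)+
qed

lemma sp_Int: "S1 <= X1==>S2 <= X2==>S1 Un S2 = S <-> S <= Xs&S1 = S Int X1&S2 = S Int X2"
 by fastforce

lemma mu_tens:
 assumes u: "u:cs P1" and v: "v:cs P2" and S: "S <= Xs"
 shows "mu S (tens u v) = slice (S Int X1) u * slice (S Int X2) v"
proof (rule lin_cs_eqI[OF u lin_comp[OF lin_mu lin_tens1] lin_comp[OF lin_mult2 lin_slice]])
 fix x assume x: "x:P1"
 show "mu S (tens (single x 1) v) = slice (S Int X1) (single x 1) * slice (S Int X2) v"
 proof (rule lin_cs_eqI[OF v lin_comp[OF lin_mu lin_tens2] lin_comp[OF lin_mult lin_slice]])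
 fix y assume y: "y:P2"
 obtain S1 e1 S2 e2 where xy: "x = (S1, e1)" "y = (S2, e2)" by (cases x, cases y) auto
 have "((S1, e1), (S2, e2)):P1 \<times> P2" using x y xy by simp
 then have S12: "S1 <= X1" "S2 <= X2" unfolding P_iff by simp_all
 then have "S1 Un S2 = S <-> S1 = S Int X1&S2 = S Int X2" using sp_Int[OF S12, of S] S by simp
 then show "mu S (tens (single x 1) (single y 1)) = slice (S Int X1) (single x 1) * slice (S Int X2) (single y 1)"
 by (auto simp: mu_def xy rst_single sp_def xx_def slice_single single_mult lin_0)
 qed
qed

lemma E_add: "f:EV V1==>ez (insert 0 V1) (e + f) = ez (insert 0 V1) e + f&ez V2 (e + f) = ez V2 e"
 "f:EV V2==>ez (insert 0 V1) (e + f) = ez (insert 0 V1) e&ez V2 (e + f) = ez V2 e + f"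
proof -
 {
 assume f: "f:EV V1"
 have "lookup f v = 0" if "v:V2" for v using EV_mem(2)[OF f, of v] x0(3) that by blast
 moreover have "lookup f v = 0" if "v ~: insert 0 V1" for v using EV_mem(2)[OF f, of v] that by blast
 ultimately show "ez (insert 0 V1) (e + f) = ez (insert 0 V1) e + f&ez V2 (e + f) = ez V2 e"
 by (intro conjI pmI; simp add: lookup_add)
 }
 assume f: "f:EV V2"
 have "lookup f v = 0" if "v:insert 0 V1" for v using EV_mem(2)[OF f, of v] x0 that by blast
 moreover have "lookup f v = 0" if "v ~: V2" for v using EV_mem(2)[OF f, of v] that by blast
 ultimately show "ez (insert 0 V1) (e + f) = ez (insert 0 V1) e&ez V2 (e + f) = ez V2 e + f"
 by (intro conjI pmI; simp add: lookup_add)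
qed

lemma EV_LL: "e:LL V U==>f:EV V==>e + f:LL V U"
 by (auto simp: LL_iff EV_iff lookup_add)

text \<open>A tensor relation gives relations at every face by multiplying slices. Conversely, a
  monomial multiple of \<open>h\<close> splits into a relation in the factor to which
  \<open>h\<close> belongs and a monomial in the other factor.\<close>

theorem kernel: "tN P1 N1 P2 N2 = {c:cs (P1 \<times> P2). \<forall>S\<subseteq>Xs. mu S c:NL Z (H1 Un H2) (vr ` S)}" (is "_ = ?K")
proof (intro equalityI subsetI)
 fix c assume c: "c:tN P1 N1 P2 N2"
 show "c:?K"
 proof (rule tI[OF lin_id _ _ _ c])
 show "lsub ?K"
 by (rule lsubI) (auto simp: lin_0[OF lin_mu] lin_add[OF lin_mu] lin_sc[OF lin_mu] lsub_0 lsub_add lsub_sc)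
 fix u :: "nat set \<times> ex \<Rightarrow>\<^sub>0 'k" and v :: "nat set \<times> ex \<Rightarrow>\<^sub>0 'k"
 {
 assume u: "u:N1" and v: "v:cs P2"
 have u': "u:cs P1" using u by (simp add: D.rees.NN_def)
 have "mu S (tens u v):NL Z (H1 Un H2) (vr ` S)" if S: "S <= Xs" for S
 proof -
 have "slice (S Int X1) u:NL V1 H1 (D.vr ` (S Int X1))" using u by (auto simp: D.rees.NN_def)
 then have "slice (S Int X1) u:NL V1 H1 (vr ` (S Int X1))" unfolding vr1[OF Int_lower2] .
 then have "slice (S Int X1) u:NL Z (H1 Un H2) (vr ` S)" using NL_mono[OF LLd(1)[OF S]] by blast
 moreover have "slice (S Int X2) v:cs (LL Z (vr ` S))"
 using c2.slice_cs_PP[OF v, of "S Int X2"] LLd(2)[OF S] by (auto simp: E2_def elim!: cs_mono[rotated])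
 ultimately show ?thesis unfolding mu_tens[OF u' v S] mult.commute[of "slice (S Int X1) u"] by (rule NL_mult)
 qed
 then show "tens u v:?K" using tens_cs[OF u' v] by blast
 }
 assume u: "u:cs P1" and v: "v:N2"
 have v': "v:cs P2" using v by (simp add: c2.NN_def)
 have "mu S (tens u v):NL Z (H1 Un H2) (vr ` S)" if S: "S <= Xs" for S
 proof -
 have "slice (S Int X2) v:NL V2 H2 (vr ` (S Int X2))" using v by (simp add: c2.NN_def)
 then have "slice (S Int X2) v:NL Z (H1 Un H2) (vr ` S)" using NL_mono[OF LLd(2)[OF S]] by blast
 moreover have "slice (S Int X1) u:cs (LL Z (vr ` S))"
 using D.rees.slice_cs_PP[OF u, of "S Int X1"] LLd(1)[OF S] vr1[of "S Int X1"] by (auto simp: D.EC_def elim!: cs_mono[rotated])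
 ultimately show ?thesis unfolding mu_tens[OF u v' S] by (rule NL_mult)
 qed
 then show "tens u v:?K" using tens_cs[OF u v'] by blast
 qed
next
 fix c assume "c:?K"
 then have c: "c:cs (P1 \<times> P2)" "!!S. S <= Xs==>mu S c:NL Z (H1 Un H2) (vr ` S)" by auto
 let ?h = "%((S1, e1 :: ex), (S2, e2 :: ex)). (S1 :: nat set, S2 :: nat set)"
 show "c:tN P1 N1 P2 N2"
 proof (rule lsub_by_parts[OF tl, where h = ?h])
 fix g :: "nat set \<times> nat set"
 obtain S1 S2 where g: "g = (S1, S2)" by (cases g)
 have bc: "rst {x. ?h x = g} c:cs {x:P1 \<times> P2. ?h x = g}"
 by (rule cs_mono[OF _ rst_cs_Int[OF c(1)]]) auto
 show "rst {x. ?h x = g} c:tN P1 N1 P2 N2"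
 proof (cases "S1 <= X1&S2 <= X2")
 case False
 then have 0: "{x:P1 \<times> P2. ?h x = g} = {}" using g by (auto simp: D.rees.PP_def c2.PP_def)
 have "rst {x. ?h x = g} c = 0" using bc unfolding 0 by (simp only: cs_def subset_empty mem_Collect_eq keys_eq_empty)
 then show ?thesis by (simp add: lsub_0[OF tl])
 next
 case True
 define S where "S = S1 Un S2"
 have S: "S <= Xs" "S1 = S Int X1" "S2 = S Int X2" using True sp_Int[of S1 S2 S] S_def by auto
 have "rst {x. sp x = S} c = rst {x. ?h x = g} c"
 proof (rule pmI)
 fix x :: "(nat set \<times> ex) \<times> (nat set \<times> ex)"
 obtain T1 e1 T2 e2 where x: "x = ((T1, e1), (T2, e2))" by (metis surj_pair)
 show "lookup (rst {x. sp x = S} c) x = lookup (rst {x. ?h x = g} c) x"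
 proof (cases "x:P1 \<times> P2")
 case True
 then have T12: "T1 <= X1" "T2 <= X2" unfolding x P_iff by simp_all
 then have "T1 Un T2 = S <-> T1 = S1&T2 = S2" using sp_Int[OF T12, of S] S by simp
 then show ?thesis by (simp add: lookup_rst x sp_def g)
 next
 case False
 then have "lookup c x = 0" using c(1) unfolding cs_iff_lookup by blast
 then show ?thesis by (simp add: lookup_rst)
 qed
 qed
 then have w: "lext (%x. single (xx x) 1) (rst {x. ?h x = g} c):NL Z (H1 Un H2) (vr ` S)" (is "?w:_")
 using c(2)[OF S(1)] by (simp add: mu_def)
 \<comment> \<open>\<open>G\<close> splits a monomial into its two parts. \<open>NL\<close> may
   contain monomials whose first part is outside \<open>D.EC\<close>; they are sent to 0, and none
   of them occurs in \<open>c\<close> itself.\<close>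
 define G where "G = lext (%e. if ez (insert 0 V1) e:D.EC S1 then single ((S1, ez (insert 0 V1) e), (S2, ez V2 e)) (1 :: 'k) else 0)"
 have G: "lin G" by (simp add: G_def)
 have "G ?w = rst {x. ?h x = g} c"
 proof (rule lin_cs_eqI[OF bc lin_comp[OF G lin_lext] lin_id])
 fix x assume x': "x:{x:P1 \<times> P2. ?h x = g}"
 obtain T1 e1 T2 e2 where x: "x = ((T1, e1), (T2, e2))" by (metis surj_pair)
 with x' have "x = ((S1, e1), (S2, e2))" "((S1, e1), (S2, e2)):P1 \<times> P2" by (auto simp: g)
 then have x: "x = ((S1, e1), (S2, e2))" "e1:D.EC S1" "e2:E2 S2" unfolding P_iff by simp_all
 show "G (lext (%x. single (xx x) 1) (single x 1)) = single x 1" using ez_split[OF x(2,3)] x(2) by (simp add: x(1) xx_def G_def)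
 qed
 moreover have "?w:{w. G w:tN P1 N1 P2 N2}"
 proof (rule NL_into[OF w lsub_vimage[OF G tl]])
 fix e h assume e: "e:LL Z (vr ` S)" and h: "h:H1 Un H2"
 let ?e1 = "ez (insert 0 V1) e" and ?e2 = "ez V2 e"
 have e1: "?e1:LL V1 (D.vr ` S1)" and e2: "?e2:E2 S2"
 using LLd(3,4)[OF S(1) e] S(2,3) vr1[of S1] by auto
 show "single e 1 * h:{w. G w:tN P1 N1 P2 N2}"
 proof (cases "h:H1")
 case True
 then have hE: "h:cs (EV V1)" using H1 by blast
 let ?z = "single ?e1 1 * h"
 have "G (single e 1 * h) = tens (tag S1 (rst (D.EC S1) ?z)) (single (S2, ?e2) 1)"
 proof (rule lin_cs_eqI[OF hE lin_comp[OF G lin_mult] lin_comp[OF lin_tens1 lin_comp[OF lin_tag lin_comp[OF lin_rst lin_mult]]]])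
 fix f assume f: "f:EV V1"
 show "G (single e 1 * single f 1) = tens (tag S1 (rst (D.EC S1) (single ?e1 1 * single f 1))) (single (S2, ?e2) 1)"
 using E_add(1)[OF f, of e] by (auto simp: G_def single_mult rst_single tag_def lin_0[OF lin_tens1] lin_0[OF lin_lext])
 qed
 moreover have "tag S1 (rst (D.EC S1) ?z):N1"
 proof -
 have zc: "?z:cs (LL V1 (D.vr ` S1))" by (rule cs_shift[OF hE EV_LL[OF e1]])
 have "rst (D.EC S1) ?z = rst (D.EC S1) (rst (LL V1 (D.vr ` S1)) ?z)" using rst_id[OF zc order_refl] by simp
 \<comment> \<open>Within \<open>LL\<close>, membership in \<open>D.EC\<close> depends only on the
   t-exponent and the degree. \<open>H1\<close> is homogeneous in both, so the restriction of a
   relation is again one.\<close>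
 also have "... = rst {e. (lookup e 0, wt V1 e):{(a, b). (0 <= a \<or> S1 Int {m..<2 * m} ~= {})&(a <= b \<or> S1 Int {..<m} ~= {})}} (rst (LL V1 (D.vr ` S1)) ?z)"
 unfolding rst_rst by (rule arg_cong[where f = "%A. rst A ?z"]) (auto simp: D.EC_def)
 also have "...:NL V1 H1 (D.vr ` S1)"
 unfolding rst_id[OF zc order_refl]
 proof (rule NL_hom[OF NL_gen[OF e1 True]])
 fix h assume "h:H1"
 then obtain d where "h:cs {e. wt V1 e = d&lookup e 0 = 0}" using H1(1) unfolding homog_def by blast
 then show "EX d. h:cs {e. (lookup e 0, wt V1 e) = d}" by (intro exI[of _ "(0, d)"]) (auto elim!: cs_mono[rotated])
 qed (simp add: lookup_add)
 finally have "rst (D.EC S1) ?z:NL V1 H1 (D.vr ` S1)" .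
 moreover have "tag S1 (rst (D.EC S1) ?z):cs P1"
 proof -
 have "P1 = Sigma {S. S <= X1} D.EC" by (auto simp: D.rees.PP_def)
 then show ?thesis using tag_cs[of S1 "{S. S <= X1}" _ D.EC, OF _ rst_cs] \<open>S1 <= X1&S2 <= X2\<close> by simp
 qed
 ultimately show ?thesis by (simp add: D.rees.NN_def slice_tag lsub_0)
 qed
 moreover have v: "single (S2, ?e2) (1 :: 'k):cs P2" using e2 \<open>S1 <= X1&S2 <= X2\<close> by (intro single_cs) (simp add: c2.PP_def)
 ultimately have "G (single e 1 * h):tN P1 N1 P2 N2" using tNs(1)[OF _ v] by presburger
 then show ?thesis by blast
 next
 case False
 then have h2: "h:H2" and hE: "h:cs (EV V2)" using h H2 by auto
 let ?z = "single ?e2 1 * h"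
 have 1: "G (single e 1 * h) = (if ?e1:D.EC S1 then tens (single (S1, ?e1) 1) (tag S2 ?z) else 0)"
 proof (rule lin_cs_eqI[OF hE lin_comp[OF G lin_mult]])
 show "lin (%h. if ?e1:D.EC S1 then tens (single (S1, ?e1) 1) (tag S2 (single ?e2 1 * h)) else (0 :: _ \<Rightarrow>\<^sub>0 'k))"
 using lin_comp[OF lin_tens2 lin_comp[OF lin_tag lin_mult]] by (cases "?e1:D.EC S1") (simp_all add: lin_const0)
 fix f assume f: "f:EV V2"
 show "G (single e 1 * single f 1) = (if ?e1:D.EC S1 then tens (single (S1, ?e1) 1) (tag S2 (single ?e2 1 * single f 1)) else 0)"
 using E_add(2)[OF f, of e] by (auto simp: G_def single_mult tag_def)
 qed
 have zN: "?z:NL V2 H2 (vr ` S2)" using e2 by (intro NL_gen[OF _ h2]) (simp add: E2_def)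
 have "?z:cs (E2 S2)"
 by (rule cs_shift[OF hE]) (use e2 x0 in \<open>auto simp: E2_def EV_LL lookup_add EV_iff\<close>)
 moreover have "P2 = Sigma {S. S <= X2} E2" by (auto simp: c2.PP_def)
 ultimately have "tag S2 ?z:cs P2" using tag_cs[of S2 "{S. S <= X2}" ?z E2] \<open>S1 <= X1&S2 <= X2\<close> by simp
 then have "tag S2 ?z:N2" using zN by (simp add: c2.NN_def slice_tag lsub_0)
 moreover have "single (S1, ?e1) (1 :: 'k):cs P1" if "?e1:D.EC S1"
 using that \<open>S1 <= X1&S2 <= X2\<close> by (intro single_cs) (simp add: D.rees.PP_def)
 ultimately have "G (single e 1 * h):tN P1 N1 P2 N2" unfolding 1 using tNs(2) lsub_0[OF tl] by presburger
 then show ?thesis by blast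
 qed
 qed
 ultimately show ?thesis by simp
 qed
 qed
qed

section \<open>The total differential and its signs\<close>

abbreviation "dT == td par (gr3 V1) (dX X1) (dX X2)"

definition ins :: "nat=>(nat set \<times> ex) \<times> (nat set \<times> ex)=>(nat set \<times> ex) \<times> (nat set \<times> ex)" where
 "ins j = (%((S1, e1), (S2, e2)). if j:X1 then ((insert j S1, e1), (S2, e2)) else ((S1, e1), (insert j S2, e2)))"

text \<open>All positions of \<open>X1\<close> precede those of \<open>X2\<close>, so for
  \<open>j\<close> in \<open>X2\<close> the elements of \<open>S1\<close> contribute exactly the
  Koszul sign.\<close>

lemma dT_single:
 assumes x: "x:P1 \<times> P2"
 shows "dT (single x 1) = (\<Sum>j\<in>Xs - sp x. single (ins j x) (sgnS (sp x) j))"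
proof -
 obtain S1 e1 S2 e2 where x': "x = ((S1, e1), (S2, e2))" by (metis surj_pair)
 have S: "S1 <= X1" "S2 <= X2" using x unfolding x' P_iff by simp_all
 have fin: "finite S1" "finite S2" using S finite_subset by blast+
 have s1: "sgnS (S1 Un S2) j = (sgnS S1 j :: 'k)" if "j:X1" for j
 proof -
 have "{k:S1 Un S2. k < j} = {k:S1. k < j}" using S that by fastforce
 then show ?thesis by (simp add: sgnS_def)
 qed
 have s2: "sgnS (S1 Un S2) j = par (gr3 V1 (S1, e1)) * (sgnS S2 j :: 'k)" if "j:X2" for j
 proof -
 have "{k:S1 Un S2. k < j} = S1 Un {k:S2. k < j}" using S that by fastforce
 moreover have "card (S1 Un {k:S2. k < j}) = card S1 + card {k:S2. k < j}"
 using S fin by (intro card_Un_disjoint) (auto, fastforce)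
 ultimately show ?thesis by (simp add: sgnS_def par_def gr3_def power_add minus_one_power_iff)
 qed
 have "dT (tens (single (S1, e1) 1) (single (S2, e2) 1))
 = tens (dX X1 (single (S1, e1) 1)) (single (S2, e2) 1) + tens (sgn_op par (gr3 V1) (single (S1, e1) 1)) (dX X2 (single (S2, e2) 1))"
 by (rule td_tens[where par = par, OF T])
 also have "... = (\<Sum>j\<in>X1 - S1. single ((insert j S1, e1), (S2, e2)) (sgnS S1 j))
 + (\<Sum>j\<in>X2 - S2. single ((S1, e1), (insert j S2, e2)) (par (gr3 V1 (S1, e1)) * sgnS S2 j))"
 by (simp add: dX_def sgn_op_def lin_sum[OF lin_tens1] lin_sum[OF lin_tens2])
 also have "... = (\<Sum>j\<in>X1 - S1. single (ins j x) (sgnS (sp x) j)) + (\<Sum>j\<in>X2 - S2. single (ins j x) (sgnS (sp x) j))"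
 by (intro arg_cong2[where f = "(+)"] sum.cong refl) (auto simp: x' ins_def sp_def s1 s2)
 also have "... = (\<Sum>j\<in>(X1 - S1) Un (X2 - S2). single (ins j x) (sgnS (sp x) j))"
 by (rule sum.union_disjoint[symmetric]) auto
 also have "(X1 - S1) Un (X2 - S2) = Xs - sp x" using S by (fastforce simp: x' sp_def)
 finally show ?thesis by (simp add: x')
qed

lemma dT_dT: "x:P1 \<times> P2==>dT (dT (single x 1)) = 0"
proof -
 assume x: "x:P1 \<times> P2"
 note l = cpx_lin[OF D.rees.cpx_PP] cpx_lin[OF c2.cpx_PP]
 note sg = sgn_d[where par = par, OF T]
 let ?u = "single (fst x) 1 :: _ \<Rightarrow>\<^sub>0 'k" and ?v = "single (snd x) 1 :: _ \<Rightarrow>\<^sub>0 'k" and ?e = "sgn_op par (gr3 V1)"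
 have uv: "?u:cs P1" "?v:cs P2" using x by (auto intro: single_cs)
 have 1: "single x 1 = tens ?u ?v" by simp
 have "dT (dT (tens ?u ?v)) = 0"
 using cpx_dd[OF D.rees.cpx_PP uv(1)] cpx_dd[OF c2.cpx_PP uv(2)] sg[OF uv(1)]
 by (simp add: td_tens[where par = par, OF T] lin_add[OF lin_td] tens_minus1 lin_0[OF lin_tens1] lin_0[OF lin_tens2] del: tens_single)
 then show ?thesis unfolding 1 .
qed

end

lemma (in cube) cohF_UNIV: "cohF UNIV g B <-> coh PP NN gr dl (dX X) g B"
proof -
 have 1: "NN Int cs PP = NN" by (auto simp: NN_def)
 have 2: "dQ UNIV c = dX X c" if "c:cs PP" for c
 unfolding dQ_def QQ_UNIV by (rule rst_id[OF cpx_d_cs[OF cpx_PP that] order_refl])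
 show ?thesis unfolding cohF_def QQ_UNIV 1 by (rule coh_cong) (rule 2)
qed

text \<open>In the grading of the Rees algebra t has degree 0, so the t-exponent is forgotten and
  cohomology is collected over all its values.\<close>

definition coarse :: "int \<times> int \<times> int=>int \<times> int" where "coarse = (%(p, al, c). (p, al))"

section \<open>Local cohomology of the Rees algebra from its two factors\<close>

context split
begin

definition gl :: "ex list" where
 "gl = map (%v. single v 1) xl @ map (%v. single v 1 + tt 1) xl @ map (%v. single v 1) yl"

lemma Z0: "0 ~: Z" using x0 by simp

lemma len_gl: "length gl = 2 * m + length yl" by (simp add: gl_def)

lemma gl_ER: "set gl <= ER Z V1"
proof -
 have "wt V1 (tt 1) = 0" unfolding wt_def by (rule sum.neutral) (use x0 in auto)
 then show ?thesis using x0 by (auto simp: gl_def ER_iff lookup_add lookup_single when_def wt_single)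
qed

lemma gl_vr: "ALL i<length gl. vr i:Z"
 unfolding len_gl using vr_V1 vr_V2 by (metis UnCI atLeastLessThan_iff lessThan_iff not_le)

lemma gl_nth: "ALL i<length gl. gl ! i = single (vr i) 1 + tt (of_bool (m <= i&i < 2 * m))"
 unfolding len_gl by (auto simp: gl_def nth_append vr_def D.vr_def tt_def not_less mult_2)

definition grT :: "(nat set \<times> ex) \<times> (nat set \<times> ex)=>int \<times> int \<times> int" where
 "grT = (%(x, y). gr3 V1 x + gr3 V2 y)"

lemma grT: "x:P1 \<times> P2==>coarse (grT x) = (int (card (sp x)), wt Z (xx x))"
proof -
 assume x: "x:P1 \<times> P2"
 obtain S1 e1 S2 e2 where x': "x = ((S1, e1), (S2, e2))" by (metis surj_pair)
 have S: "S1 <= X1" "S2 <= X2" and e: "e1:D.EC S1" "e2:E2 S2" using x unfolding x' P_iff by simp_all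
 have "finite S1" "finite S2" "S1 Int S2 = {}" using S finite_subset by (blast, blast, fastforce)
 then have c: "card (S1 Un S2) = card S1 + card S2" by (rule card_Un_disjoint)
 have z: "lookup e1 v = 0" if "v:V2" for v
 proof -
 have "v ~: V1" "v ~= 0" using that x0 by (blast, metis)
 then show ?thesis using e(1) by (simp add: D.EC_def LL_iff)
 qed
 have z': "lookup e2 v = 0" if "v:V1" for v
 proof -
 have "v ~: V2" "v ~= 0" using that x0 by (blast, metis)
 then show ?thesis using e(2) by (simp add: E2_def LL_iff)
 qed
 have "wt Z e = wt V1 e + wt V2 e" for e unfolding wt_def by (rule sum.union_disjoint) (use x0 in auto)
 moreover have "wt V2 e1 = 0" "wt V1 e2 = 0" using z z' by (simp_all add: wt_def)
 ultimately show ?thesis using c by (simp add: x' grT_def gr3_def coarse_def sp_def xx_def)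
qed

context
 fixes R :: "('k, 'r) graded_algebra" and Ph
 assumes M: "mpres R Z (H1 Un H2) (ER Z V1) Ph"
begin

interpretation M: mpres R Z "H1 Un H2" "ER Z V1" Ph by (rule M)

text \<open>A product of generators in \<open>S\<close> raises the t-exponent only through some x_i
  t, and raises the gap between the degree in \<open>V1\<close> and the t-exponent only through some
  x_i. Elsewhere the original bound must already hold.\<close>

lemma ES_gl:
 assumes S: "S <= {..<length gl}"
 shows "e:M.ES gl 0 S <-> e:LL Z (vr ` S)&(0 <= lookup e 0 \<or> S Int {m..<2 * m} ~= {})&(lookup e 0 <= wt V1 e \<or> S Int {..<m} ~= {})"
proof
 note G = gl_ER gl_vr gl_nth
 have k0: "keys (0 :: ex) <= {0}" by simp
 have im: "vr ` S <= Z" using S gl_vr by auto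
 note mx = M.mx_nonneg[OF G S] M.mx_off[OF G S] M.mx_on[OF G S]
 have m0: "lookup (M.mx gl S ep) 0 = (\<Sum>i\<in>S. int (ep i) * of_bool (m <= i&i < 2 * m))" for ep
 unfolding M.lookup_mx[OF G S]
 proof (rule sum.cong[OF refl])
 fix i assume "i:S"
 then have "vr i ~= 0" using im Z0 by (metis image_subset_iff)
 then show "int (ep i) * (of_bool (vr i = 0) + of_bool (0 = (0 :: nat)&m <= i&i < 2 * m)) = int (ep i) * of_bool (m <= i&i < 2 * m)" by simp
 qed
 have m1: "wt V1 (M.mx gl S ep) = (\<Sum>i\<in>S. int (ep i) * of_bool (i < m)) + lookup (M.mx gl S ep) 0" for ep
 proof -
 have "wt V1 (M.mx gl S ep) = (\<Sum>i\<in>S. int (ep i) * of_bool (vr i:V1))" by (rule M.wt_mx[OF G S]) auto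
 also have "... = (\<Sum>i\<in>S. int (ep i) * of_bool (i < m) + int (ep i) * of_bool (m <= i&i < 2 * m))"
 proof (rule sum.cong[OF refl])
 fix i assume "i:S"
 then have i: "i < 2 * m + length yl" using S len_gl by auto
 have "vr i:V1 <-> i < 2 * m"
 proof (cases "i < 2 * m")
 case False
 then have "vr i:V2" using vr_V2[of i] i by simp
 then show ?thesis using False x0(3) by blast
 qed (use vr_V1 in simp)
 then show "int (ep i) * of_bool (vr i:V1) = int (ep i) * of_bool (i < m) + int (ep i) * of_bool (m <= i&i < 2 * m)"
 by (auto simp: of_bool_def)
 qed
 finally show ?thesis by (simp only: sum.distrib m0)
 qed
 {
 assume "e:M.ES gl 0 S"
 then obtain ep where "e + M.mx gl S ep:ER Z V1" unfolding M.ES_def[OF gl_ER k0] by auto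
 then have l: "0 <= lookup e v + lookup (M.mx gl S ep) v"
 "v ~= 0==>v ~: Z==>lookup e v + lookup (M.mx gl S ep) v = 0"
 "lookup e 0 + lookup (M.mx gl S ep) 0 <= wt V1 e + wt V1 (M.mx gl S ep)" for v
 by (auto simp: ER_iff lookup_add)
 have "lookup e v = 0" if "v ~= 0" "v ~: Z" for v
 proof -
 have "v ~: vr ` S" using im that by blast
 then show ?thesis using l(2)[OF that] mx(2)[OF that(1)] by simp
 qed
 moreover have "0 <= lookup e v" if "v:Z - vr ` S" for v
 proof -
 have "v ~= 0" using that Z0 by (metis DiffD1)
 then show ?thesis using l(1)[of v] mx(2)[of v] that by simp
 qed
 moreover have "0 <= lookup e 0" if "S Int {m..<2 * m} = {}"
 proof -
 have "lookup (M.mx gl S ep) 0 = 0" unfolding m0 by (rule sum.neutral) (use that in auto)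
 then show ?thesis using l(1)[of 0] by simp
 qed
 moreover have "lookup e 0 <= wt V1 e" if "S Int {..<m} = {}"
 proof -
 have "(\<Sum>i\<in>S. int (ep i) * of_bool (i < m)) = 0" by (rule sum.neutral) (use that in auto)
 then show ?thesis using l(3) m1 by simp
 qed
 ultimately show "e:LL Z (vr ` S)&(0 <= lookup e 0 \<or> S Int {m..<2 * m} ~= {})&(lookup e 0 <= wt V1 e \<or> S Int {..<m} ~= {})"
 by (auto simp: LL_iff)
 }
 assume e: "e:LL Z (vr ` S)&(0 <= lookup e 0 \<or> S Int {m..<2 * m} ~= {})&(lookup e 0 <= wt V1 e \<or> S Int {..<m} ~= {})"
 \<comment> \<open>The factor 2 covers the gap \<open>lookup e 0 - wt V1 e\<close>, both terms of
   which are bounded by \<open>bnd e\<close>.\<close>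
 let ?N = "2 * bnd e" and ?m = "M.mx gl S (%_. 2 * bnd e)"
 have bw: "\<bar>wt V1 e\<bar> <= int (bnd e)" by (rule bnd(2)) simp
 have nn: "0 <= (\<Sum>i\<in>S. int ?N * of_bool (i < m))" by (rule sum_nonneg) simp
 have 0: "0 <= lookup e 0 + lookup ?m 0"
 proof (cases "S Int {m..<2 * m} = {}")
 case True
 then show ?thesis using e mx(1)[of _ 0] by simp
 next
 case False
 then have "EX j:S. m <= j&j < 2 * m" by fastforce
 then obtain j where "j:S" "m <= j&j < 2 * m" by blast
 then have "int ?N <= lookup ?m 0" unfolding m0 by (rule M.sum_ge[OF G S, of j "%j. m <= j&j < 2 * m"])
 then show ?thesis using bnd(1)[of e 0] by linarith
 qed
 have "0 <= lookup e v + lookup ?m v" for v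
 proof (cases "v = 0")
 case v: False
 show ?thesis
 proof (cases "v:vr ` S")
 case True
 then show ?thesis using mx(3)[OF True, of ?N] bnd(1)[of e v] by linarith
 next
 case False
 then show ?thesis using mx(1)[of "%_. ?N" v] e v by (cases "v:Z") (auto simp: LL_iff)
 qed
 qed (use 0 in simp)
 moreover have "lookup e v + lookup ?m v = 0" if "v ~= 0" "v ~: Z" for v
 proof -
 have "v ~: vr ` S" using im that by blast
 then show ?thesis using mx(2)[OF that(1)] e that by (simp add: LL_iff)
 qed
 moreover have "lookup e 0 + lookup ?m 0 <= wt V1 e + wt V1 ?m"
 proof (cases "S Int {..<m} = {}")
 case True
 then show ?thesis using e nn unfolding m1 by simp
 next
 case False
 then have "EX j:S. j < m" by fastforce
 then obtain j where "j:S" "j < m" by blast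
 then have "int ?N <= (\<Sum>i\<in>S. int ?N * of_bool (i < m))" by (rule M.sum_ge[OF G S, of j "%j. j < m"])
 then show ?thesis using bw bnd(1)[of e 0] unfolding m1 by linarith
 qed
 ultimately have "e + ?m - 0:ER Z V1" by (auto simp: ER_iff lookup_add)
 then show "e:M.ES gl 0 S" unfolding M.ES_def[OF gl_ER k0] by blast
qed

text \<open>Both factors are retracted to their cohomology, the retractions are tensored, and
  \<open>coarse\<close> collects the t-exponents. The result passes by \<open>coh_strand\<close> to
  the keys of internal degree \<open>a\<close>, which present the Cech complex in that
  degree.\<close>

theorem rees_lc:
 fixes B1 :: "int \<times> int \<times> int=>'b set" and B2 :: "int \<times> int \<times> int=>'c set"
 assumes B1: "!!g. D.rees.cohF UNIV g (B1 g)" and B2: "!!g. c2.cohF UNIV g (B2 g)"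
 shows "is_free (local_cohomology R (Idl\<^bsub>R\<^esub> (M.Xp ` set gl)) l a)
 {z:Sigma UNIV B1 \<times> Sigma UNIV B2. coarse (fst (fst z) + fst (snd z)) = (l, a)}" (is "is_free _ ?B")
proof (rule M.lc_free[OF gl_ER refl])
 have k0: "keys (0 :: ex) <= {0}" by simp
 let ?P = "P1 \<times> P2" and ?N = "tN P1 N1 P2 N2"
 define Pa where "Pa = {x:?P. wt Z (xx x) = a}"
 let ?Q = "%c. \<forall>S\<subseteq>Xs. mu S c:NL Z (H1 Un H2) (vr ` S)"
 have lT: "lin dT" by (rule lin_td)
 have dC: "dT (single x 1):cs {y:?P. grT y = grT x + (1, 0, 0)}" if "x:?P" for x
 using td_Ch[where par = par, OF T that] by (simp add: grT_def)
 obtain f1 G1 s1 where s1: "sdr P1 N1 (gr3 V1) (1, 0, 0) (dX X1) (Sigma UNIV B1) fst f1 G1 s1"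
 using sdr_of_coh[OF D.rees.cpx_PP] B1 unfolding D.rees.cohF_UNIV by blast
 obtain f2 G2 s2 where s2: "sdr P2 N2 (gr3 V2) (1, 0, 0) (dX X2) (Sigma UNIV B2) fst f2 G2 s2"
 using sdr_of_coh[OF c2.cpx_PP] B2 unfolding c2.cohF_UNIV by blast
 have "coh ?P ?N (%x. coarse (grT x)) (coarse (1, 0, 0)) dT (l, a)
 {b:Sigma UNIV B1 \<times> Sigma UNIV B2. coarse ((%(a, b). fst a + fst b) b) = (l, a)}"
 by (rule coh_of_sdr[OF lT tl dC sdr_tensor[where par = par, OF T s1 s2, folded grT_def]]) (auto simp: coarse_def)
 then have "coh ?P ?N (%x. coarse (grT x)) (1, 0) dT (l, a) ?B"
 by (simp add: case_prod_unfold coarse_def)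
 moreover have "dT c = rst ?P (dT c)" if c: "c:cs ?P" for c
 proof -
 have "dT c:cs ?P" by (rule lin_cs_mem[OF c lT lsub_cs]) (use dC in \<open>blast intro: cs_mono[rotated]\<close>)
 then show ?thesis by (simp add: rst_id)
 qed
 ultimately have "coh ?P ?N (%x. coarse (grT x)) (1, 0) (%c. rst ?P (dT c)) (l, a) ?B" by (subst coh_cong[symmetric])
 moreover have Pe: "{x:?P. coarse (grT x) = (q, a)} = {x:Pa. int (card (sp x)) = q}" for q
 using grT by (auto simp: Pa_def)
 have dcard: "dT (single x 1):cs {y. coarse (grT y) = coarse (grT x) + (1, 0)}"
 "dT (single x 1):cs {y:?P. int (card (sp y)) = int (card (sp x)) + 1&wt Z (xx y) = wt Z (xx x)}" if "x:?P" for x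
 proof -
 have "grT y = grT x + (1, 0, 0)==>coarse (grT y) = coarse (grT x) + (1, 0)" for y
 by (cases "grT x") (simp add: coarse_def)
 then have s: "{y:?P. grT y = grT x + (1, 0, 0)} <= {y:?P. coarse (grT y) = coarse (grT x) + (1, 0)}" by blast
 show "dT (single x 1):cs {y. coarse (grT y) = coarse (grT x) + (1, 0)}" by (rule cs_mono[OF _ dC[OF that]]) (use s in blast)
 show "dT (single x 1):cs {y:?P. int (card (sp y)) = int (card (sp x)) + 1&wt Z (xx y) = wt Z (xx x)}"
 by (rule cs_mono[OF _ dC[OF that]], rule subset_trans[OF s]) (use grT that in auto)
 qed
 have "coh ?P ?N (%x. coarse (grT x)) (1, 0) (%c. rst ?P (dT c)) (l, a) ?B
 <-> coh Pa {c:cs Pa. ?Q c} (%x. int (card (sp x))) 1 (%c. rst Pa (dT c)) l ?B"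
 proof (rule coh_strand[OF lT dcard(1) _ _ _ _ kernel refl])
 show "dT (single x 1):cs {y. int (card (sp y)) = int (card (sp x)) + 1}" if "x:Pa" for x
 using dcard(2)[of x] that by (auto simp: Pa_def elim!: cs_mono[rotated])
 qed (use Pe[of "l - 1"] Pe[of l] Pe[of "l + 1"] in simp_all)
 ultimately have coh: "coh Pa {c:cs Pa. ?Q c} (%x. int (card (sp x))) 1 (%c. rst Pa (dT c)) l ?B" by blast
 have rP: "rst Pa (dT (single x 1)) = dT (single x 1)" if "x:Pa" for x
 by (rule rst_id[OF dcard(2)]) (use that in \<open>auto simp: Pa_def\<close>)
 show "is_free (cech_cohomology R (map M.Xp gl) l a) ?B"
 proof (rule M.cech_keys_pres[OF gl_ER k0, where sp = sp and xx = xx and ins = ins and P = Pa, OF _ _ _ _ _ _ _ coh])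
 fix x assume x: "x:Pa"
 obtain S1 e1 S2 e2 where x': "x = ((S1, e1), (S2, e2))" by (metis surj_pair)
 have xP: "x:?P" using x by (simp add: Pa_def)
 have S: "S1 <= X1" "S2 <= X2" and e: "e1:D.EC S1" "e2:E2 S2" using xP unfolding x' P_iff by simp_all
 define S where "S = S1 Un S2"
 have SX: "S <= Xs" "S1 = S Int X1" "S2 = S Int X2" using sp_Int[OF S, of S] S_def by simp_all
 have l: "e1:LL Z (vr ` S)" "e2:LL Z (vr ` S)"
 using e LLd(1,2)[OF SX(1)] vr1[OF S(1)] SX by (auto simp: D.EC_def E2_def)
 have int: "S Int {m..<2 * m} = S1 Int {m..<2 * m}" "S Int {..<m} = S1 Int {..<m}" unfolding SX(2) by auto
 have "wt V1 e2 = 0"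
 proof -
 have "lookup e2 v = 0" if v: "v:V1" for v
 proof -
 have "v ~: V2" "v ~= 0" using v x0 by (blast, metis)
 then show ?thesis using e(2) by (simp add: E2_def LL_iff)
 qed
 then show ?thesis by (simp add: wt_def)
 qed
 then have "e1 + e2:M.ES gl 0 S"
 using SX(1) LL_add[OF l] e by (subst ES_gl) (auto simp: len_gl int D.EC_def E2_def lookup_add)
 then show "sp x <= {..<length gl}&xx x:M.ES gl 0 (sp x)&wt Z (xx x) = a"
 using x SX(1) by (simp add: x' sp_def xx_def Pa_def len_gl S_def)
 show "rst Pa (dT (single x 1)) = (\<Sum>j\<in>{..<length gl} - sp x. single (ins j x) (sgnS (sp x) j))"
 using rP[OF x] dT_single[OF xP] by (simp only: len_gl)
 show "rst Pa (dT (rst Pa (dT (single x 1)))) = 0" unfolding rP[OF x] dT_dT[OF xP] by (rule lin_rst_0)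
 show "ins j x:Pa&sp (ins j x) = insert j (sp x)&xx (ins j x) = xx x" if j: "j:{..<length gl} - sp x" for j
 proof (cases "j:X1")
 case True
 then have "e1:D.EC (insert j S1)" using D.rees.E_mono[of S1 "insert j S1"] e(1) S(1) by auto
 then show ?thesis using x e S True by (auto simp: Pa_def x' ins_def sp_def xx_def D.rees.PP_def c2.PP_def)
 next
 case False
 then have j2: "j:X2" using j len_gl by auto
 then have "e2:E2 (insert j S2)" using c2.E_mono[of S2 "insert j S2"] e(2) S(2) by auto
 then show ?thesis using x e S False j2 by (auto simp: Pa_def x' ins_def sp_def xx_def D.rees.PP_def c2.PP_def)
 qed
 next
 fix S e assume S: "S <= {..<length gl}" and e: "e:M.ES gl 0 S" "wt Z e = a"
 have SX: "S <= Xs" using S len_gl by simp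
 have e': "e:LL Z (vr ` S)" "0 <= lookup e 0 \<or> S Int {m..<2 * m} ~= {}" "lookup e 0 <= wt V1 e \<or> S Int {..<m} ~= {}"
 using e(1) ES_gl[OF S] by blast+
 let ?x = "((S Int X1, ez (insert 0 V1) e), (S Int X2, ez V2 e))"
 have "wt V1 (ez (insert 0 V1) e) = wt V1 e" by (simp add: wt_def)
 moreover have "(S Int X1) Int {m..<2 * m} = S Int {m..<2 * m}" "(S Int X1) Int {..<m} = S Int {..<m}" by auto
 ultimately have "ez (insert 0 V1) e:D.EC (S Int X1)"
 using LLd(3)[OF SX e'(1)] e'(2,3) vr1[of "S Int X1"] by (simp add: D.EC_def)
 then have xP: "?x:?P" unfolding P_iff using LLd(4)[OF SX e'(1)] by simp
 have "ez (insert 0 V1) e + ez V2 e = e"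
 proof (rule pmI)
 fix v
 show "lookup (ez (insert 0 V1) e + ez V2 e) v = lookup e v"
 proof (cases "v:insert 0 V1")
 case True
 then have "v ~: V2" using x0 by blast
 then show ?thesis using True by (simp add: lookup_add)
 qed (use e'(1) in \<open>auto simp: lookup_add LL_iff\<close>)
 qed
 then have xe: "xx ?x = e" by (simp add: xx_def)
 have "S Int X1 Un S Int X2 = S" using sp_Int[of "S Int X1" "S Int X2" S] SX by simp
 then have "sp ?x = S" by (simp add: sp_def)
 then show "EX x:Pa. sp x = S&xx x = e" using xP xe e(2) unfolding Pa_def by (intro bexI[of _ ?x]) auto
 next
 show "lin (%c. rst Pa (dT c))" by (rule lin_comp[OF lin_rst lT])
 have "NL Z (H1 Un H2) (M.VS gl S) = NL Z (H1 Un H2) (vr ` S)" if "S <= {..<length gl}" for S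
 unfolding NL_def M.VS_LL[OF gl_ER gl_vr gl_nth that] ..
 then show "{c:cs Pa. ?Q c} = {c:cs Pa. \<forall>S\<subseteq>{..<length gl}. lext (%x. single (xx x) 1) (rst {x. sp x = S} c):NL Z (H1 Un H2) (M.VS gl S)}"
 by (auto simp: mu_def len_gl)
 qed
qed

end

end

text \<open>For given \<alpha> the t-exponents are c = j with 0 <= j <= \<alpha>, or c = -1 - j with
  0 <= j < -\<alpha> - 1; there is none for \<alpha> = -1. The second factor contributes only
  t-exponent 0.\<close>

lemma basis_bij:
 fixes Bx Bt :: "int \<times> int \<times> int=>'b set" and B2 :: "int \<times> int=>'c set"
 defines "B1 == %(p, al, c). if 0 <= c&c <= al then Bx (p, al, c) else if al < c&c < 0 then Bt (p - 1, al, c) else {}"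
 and "B2' == %(q, be, d :: int). if d = 0 then B2 (q, be) else {}"
 shows "bij_betw (%(((p, al, c), b), ((q, be, d), b')).
 if 0 <= c then Inl ((al, be), (p, q), (nat c, b), b') else Inr ((al, be), (p, q), (nat (- 1 - c), b), b'))
 {z:Sigma UNIV B1 \<times> Sigma UNIV B2'. coarse (fst (fst z) + fst (snd z)) = (l, a)}
 ((SIGMA (al, be) : {(al, be). al + be = a&al \<ge> 0}. SIGMA (p, q) : {(p, q). p + q = l}.
 (SIGMA j : {..<nat (al + 1)}. Bx (p, al, int j)) \<times> B2 (q, be))
 <+> (SIGMA (al, be) : {(al, be). al + be = a&al <= -2}. SIGMA (p, q) : {(p, q). p + q = l}.
 (SIGMA j : {..<nat (- al - 1)}. Bt (p - 1, al, - 1 - int j)) \<times> B2 (q, be)))"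
 (is "bij_betw ?f ?A (?C <+> ?D)")
proof (rule bij_betw_byWitness[where f' = "%x. case x of Inl ((al, be), (p, q), (j, b), b')=>(((p, al, int j), b), ((q, be, 0), b'))
 | Inr ((al, be), (p, q), (j, b), b')=>(((p, al, - 1 - int j), b), ((q, be, 0), b'))"], goal_cases)
 case 1
 show ?case by (auto simp: B1_def B2'_def split: if_splits)
next
 case 2
 show ?case by auto
next
 case 3
 show ?case by (auto simp: B1_def B2'_def coarse_def split: if_splits)
next
 case 4
 show ?case by (auto simp: B1_def B2'_def coarse_def)
qed

lemma gcomp_mono: "V <= V'==>p:gcomp (poly_algebra V) d==>p:gcomp (poly_algebra V') d"
 unfolding poly_simps by (erule cs_mono[rotated]) auto

lemma (in mpres) Idl_vars:
 assumes E: "E = EV W" and V: "V <= W" "finite W"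
 shows "Idl (Xp ` (%v. single v 1) ` V) = Ph ` cs {e:E. 1 <= wt V e}"
proof (rule Idl_Xp)
 have fV: "finite V" using V finite_subset by blast
 show "e + f:{e:E. 1 <= wt V e}" if "e:E" "f:{e:E. 1 <= wt V e}" for e f
 proof -
 have "0 <= wt V e" unfolding wt_def by (rule sum_nonneg) (use that(1) EV_mem(1) E in blast)
 then show ?thesis using that by simp
 qed
 show "(%v. single v 1) ` V <= {e:E. 1 <= wt V e}"
 using V fV by (auto simp: E EV_iff wt_single lookup_single when_def)
 show "EX g:(%v. single v 1) ` V. e - g:E" if "e:{e:E. 1 <= wt V e}" for e
 proof -
 have "0 < wt V e" using that by simp
 then obtain v where "v:V" "0 < lookup e v" by (rule wt_pos)
 then show ?thesis using EV_minus[of e W v] that by (auto simp: E)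
 qed
qed blast

theorem proposition6:
  fixes n m r s :: nat
    and i :: "nat \<Rightarrow> nat"
    and h :: "nat \<Rightarrow> 'k::field mpoly"
    and l a :: int
  defines "V1 \<equiv> i ` {1..m}"
    and "V2 \<equiv> i ` {m+1..n}"
  defines "J \<equiv> Idl\<^bsub>poly_algebra {1..n}\<^esub> (h ` {1..s})"
    and "J1 \<equiv> Idl\<^bsub>poly_algebra V1\<^esub> (h ` {1..r})"
    and "J2 \<equiv> Idl\<^bsub>poly_algebra V2\<^esub> (h ` {r+1..s})"
  defines "A \<equiv> quotient_algebra (poly_algebra {1..n}) J"
    and "A1 \<equiv> quotient_algebra (poly_algebra V1) J1"
    and "A2 \<equiv> quotient_algebra (poly_algebra V2) J2"
  defines "\<mm> \<equiv> Idl\<^bsub>A\<^esub> ((\<lambda>v. J +>\<^bsub>poly_algebra {1..n}\<^esub> Var v) ` {1..n})"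
    and "\<mm>1 \<equiv> Idl\<^bsub>A1\<^esub> ((\<lambda>v. J1 +>\<^bsub>poly_algebra V1\<^esub> Var v) ` V1)"
    and "\<mm>2 \<equiv> Idl\<^bsub>A2\<^esub> ((\<lambda>v. J2 +>\<^bsub>poly_algebra V2\<^esub> Var v) ` V2)"
    and "I \<equiv> Idl\<^bsub>A\<^esub> ((\<lambda>v. J +>\<^bsub>poly_algebra {1..n}\<^esub> Var v) ` V1)"
  defines "R \<equiv> rees_algebra A I"
  defines "M \<equiv> {f \<in> carrier R. f 0 \<in> \<mm>}"
  assumes "bij_betw i {1..n} {1..n}" and "m \<le> n" and "r \<le> s"
    and "\<And>j. j \<in> {1..r} \<Longrightarrow> \<exists>d\<ge>2. h j \<in> gcomp (poly_algebra V1) d"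
    and "\<And>j. j \<in> {r+1..s} \<Longrightarrow> \<exists>d\<ge>2. h j \<in> gcomp (poly_algebra V2) d"
  shows "local_cohomology R M l a \<cong>\<^sub>k
      direct_sum {(\<alpha>, \<beta>). \<alpha> + \<beta> = a \<and> \<alpha> \<ge> 0} (\<lambda>(\<alpha>, \<beta>).
        direct_sum {(p, q). p + q = l} (\<lambda>(p, q).
          copies (nat (\<alpha> + 1)) (local_cohomology A1 \<mm>1 p \<alpha>) \<otimes>\<^sub>k local_cohomology A2 \<mm>2 q \<beta>))
      \<oplus>\<^sub>k
      direct_sum {(\<alpha>, \<beta>). \<alpha> + \<beta> = a \<and> \<alpha> \<le> -2} (\<lambda>(\<alpha>, \<beta>).
        direct_sum {(p, q). p + q = l} (\<lambda>(p, q).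
          copies (nat (- \<alpha> - 1)) (local_cohomology A1 \<mm>1 (p - 1) \<alpha>) \<otimes>\<^sub>k local_cohomology A2 \<mm>2 q \<beta>))"
proof -
 define xl where "xl = map i [1..<m+1]"
 define yl where "yl = map i [m+1..<n+1]"
 define H1 where "H1 = intp ` h ` {1..r}"
 define H2 where "H2 = intp ` h ` {r+1..s}"
 have i: "inj_on i {1..n}" "i ` {1..n} = {1..n}" using assms(15) by (auto simp: bij_betw_def)
 have mn: "{1..m} Un {m+1..n} = {1..n}" "{1..r} Un {r+1..s} = {1..s}" using \<open>m <= n\<close> \<open>r <= s\<close> by auto
 have xl: "set xl = V1" and yl: "set yl = V2" by (auto simp: xl_def yl_def V1_def V2_def)
 have len: "length xl = m" by (simp add: xl_def)
 have V: "V1 Un V2 = {1..n}" unfolding V1_def V2_def using mn(1) i(2) by (metis image_Un)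
 have dis: "V1 Int V2 = {}"
 proof -
 have "i ` ({1..m} Int {m+1..n}) = V1 Int V2" unfolding V1_def V2_def
 by (rule inj_on_image_Int[OF i(1)]) (use \<open>m <= n\<close> in auto)
 then show ?thesis by auto
 qed
 have "V1 <= {1..n}" "V2 <= {1..n}" using V by blast+
 then have z: "0 ~: V1" "0 ~: V2" "0 ~: {1..n}" by auto
 have fin: "finite V1" "finite V2" "finite {1..n}" by (auto simp: V1_def V2_def)
 have hg: "EX d. p:gcomp (poly_algebra V1) d" if "p:h ` {1..r}" for p using assms(18) that by blast
 have hg2: "EX d. p:gcomp (poly_algebra V2) d" if "p:h ` {r+1..s}" for p using assms(19) that by blast
 have hgA: "EX d. p:gcomp (poly_algebra {1..n}) d" if "p:h ` {1..s}" for p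
 proof -
 have "p:h ` {1..r} \<or> p:h ` {r+1..s}" using that mn(2) by blast
 then show ?thesis using hg[of p] hg2[of p] gcomp_mono[of V1 "{1..n}" p] gcomp_mono[of V2 "{1..n}" p] V by blast
 qed
 have HH: "intp ` h ` {1..s} = H1 Un H2" unfolding H1_def H2_def using mn(2) by (metis image_Un)
 interpret sp: split xl yl H1 H2
 by unfold_locales (use z dis intp_homog[OF fin(1) z(1) hg] intp_homog[OF fin(2) z(2) hg2] in \<open>simp_all add: xl yl H1_def H2_def\<close>)
 define Ph where "Ph = (%w :: ex \<Rightarrow>\<^sub>0 'k. J +>\<^bsub>poly_algebra {1..n}\<^esub> natp w)"
 interpret A: mpres A "{1..n}" "H1 Un H2" "EV {1..n}" Ph
 unfolding A_def Ph_def HH[symmetric] by (rule mpres_A[OF fin(3) z(3) _ J_def[THEN meta_eq_to_obj_eq]]) (rule hgA)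
 have Xp: "A.Xp (single v 1) = J +>\<^bsub>poly_algebra {1..n}\<^esub> Var v" for v unfolding A.Xp_def by (simp add: Ph_def natp_Var)
 have I: "I = Ph ` cs {e:EV {1..n}. 1 <= wt V1 e}" and mm: "\<mm> = Ph ` cs {e:EV {1..n}. 1 <= wt {1..n} e}"
 using A.Idl_vars[OF refl _ fin(3), of V1] A.Idl_vars[OF refl _ fin(3), of "{1..n}"] V
 by (auto simp: I_def \<mm>_def image_image Xp)
 have H0: "H1 Un H2 <= cs {e. lookup e 0 = 0}"
 proof
 fix x assume x: "x:H1 Un H2"
 have "intp ` h ` {1..s} <= cs (EV {1..n})" by (rule intp_homog(2)[OF fin(3) z(3)]) (rule hgA)
 then have "x:cs (EV {1..n})" using x unfolding HH by blast
 moreover have "EV {1..n} <= {e. lookup e 0 = 0}" using EV_mem(2)[of _ "{1..n}" 0] z(3) by blast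
 ultimately show "x:cs {e. lookup e 0 = 0}" by (rule cs_mono[rotated])
 qed
 have V1n: "V1 <= {1..n}" using V by blast
 define \<Psi> where "\<Psi> = A.PhR"
 have MR: "mpres R {1..n} (H1 Un H2) (ER {1..n} V1) \<Psi>"
 unfolding R_def \<Psi>_def by (rule A.mpres_rees[OF refl H0 V1n fin(3) I])
 interpret R: mpres R "{1..n}" "H1 Un H2" "ER {1..n} V1" \<Psi> by (rule MR)
 have \<Psi>: "\<Psi> w = (%l. Ph (tc l w))" for w unfolding \<Psi>_def by (rule A.PhR_def[OF refl H0 V1n fin(3) I])
 have EVER: "EV {1..n} <= ER {1..n} V1"
 proof
 fix e assume e: "e:EV {1..n}"
 then have "0 <= wt V1 e" unfolding wt_def by (intro sum_nonneg) (rule EV_mem(1))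
 then show "e:ER {1..n} V1" using e EV_mem(2)[OF e z(3)] by (auto simp: EV_iff ER_iff)
 qed
 \<comment> \<open>All monomials of \<open>R\<close> other than 1. Both \<open>M\<close> and the
   ideal of the generators \<open>sp.gl\<close> turn out to be the image of their span.\<close>
 let ?Q = "{e:ER {1..n} V1. e ~= 0}"
 have wt1: "1 <= wt {1..n} e" if e: "e:EV {1..n}" "e ~= 0" for e
 proof -
 obtain v where v: "lookup e v ~= 0" using e(2) by (metis pmI lookup_zero)
 then have "v:{1..n}" using EV_mem(2)[OF e(1)] by blast
 then have "0 < wt {1..n} e" unfolding wt_def using v EV_mem(1)[OF e(1)] by (intro sum_pos2[of _ v]) (auto simp: order_less_le)
 then show ?thesis by simp
 qed
 have ER0: "e:EV {1..n}" if "e:ER {1..n} V1" "lookup e 0 = 0" for e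
 unfolding EV_iff
 proof (intro conjI allI impI)
 fix v
 show "0 <= lookup e v" using that(1) by (simp add: ER_iff)
 show "lookup e v = 0" if "v ~: {1..n}"
 using \<open>e:ER {1..n} V1\<close> \<open>lookup e 0 = 0\<close> that by (cases "v = 0") (simp_all add: ER_iff)
 qed
 have t0: "tc 0 w = rst {e. lookup e 0 = 0} w" for w :: "ex \<Rightarrow>\<^sub>0 'k" by (simp add: tc_def tt_def)
 have MQ: "M = \<Psi> ` cs ?Q"
 proof (intro equalityI subsetI)
 fix f assume "f:\<Psi> ` cs ?Q"
 then obtain w where w: "f = \<Psi> w" "w:cs ?Q" by blast
 have "tc 0 w:cs {e:EV {1..n}. 1 <= wt {1..n} e}"
 proof (rule tc_cs[OF w(2)])
 fix e assume e: "e:?Q" "lookup e 0 = int 0"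
 then have "e:EV {1..n}" using ER0 by simp
 then show "e - tt (int 0):{e:EV {1..n}. 1 <= wt {1..n} e}" using e wt1[of e] by (simp add: tt_def)
 qed
 moreover have "w:cs (ER {1..n} V1)" by (rule cs_mono[OF _ w(2)]) blast
 ultimately show "f:M" unfolding M_def mm w(1) using R.Phi_closed by (auto simp: \<Psi>)
 next
 fix f assume "f:M"
 then obtain w c where w: "f = \<Psi> w" "w:cs (ER {1..n} V1)" and c: "Ph (tc 0 w) = Ph c" "c:cs {e:EV {1..n}. 1 <= wt {1..n} e}"
 unfolding M_def mm R.car by (auto simp: \<Psi>)
 have cE: "c:cs (EV {1..n})" by (rule cs_mono[OF _ c(2)]) blast
 have tE: "tc 0 w:cs (EV {1..n})" by (rule tc_cs[OF w(2)]) (use ER0 in \<open>simp add: tt_def\<close>)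
 have N: "tc 0 w - c:NL {1..n} (H1 Un H2) {}" using A.ker[OF tE cE] c(1) by blast
 \<comment> \<open>Membership in \<open>M\<close> constrains only the coefficient of t^0. It is
   replaced by a representative without constant term, which changes \<open>w\<close> by a
   relation.\<close>
 let ?w = "w - tc 0 w + c"
 have 1: "w - tc 0 w = rst {e. lookup e 0 ~= 0} w" unfolding t0 by (rule pmI) (simp add: lookup_minus lookup_rst)
 have 2: "rst {e. lookup e 0 ~= 0} w:cs ?Q" by (rule cs_mono[OF _ rst_cs_Int[OF w(2)]]) auto
 have 3: "c:cs ?Q" by (rule cs_mono[OF _ c(2)]) (use EVER in auto)
 have w': "?w:cs ?Q" unfolding 1 by (rule lsub_add[OF lsub_cs 2 3])
 have "?w:cs (ER {1..n} V1)" by (rule cs_mono[OF _ w']) blast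
 moreover have "w - ?w = tc 0 w - c" by simp
 ultimately have "\<Psi> w = \<Psi> ?w" using R.ker[OF w(2)] N by metis
 then show "f:\<Psi> ` cs ?Q" using w' w(1) by blast
 qed
 have VZ: "set xl Un set yl = {1..n}" unfolding xl yl by (rule V)
 \<comment> \<open>Every monomial of \<open>R\<close> other than 1 is divisible within
   \<open>R\<close> by a generator: by some x_v t if t occurs, since then a variable of
   \<open>I\<close> occurs too, and by a variable otherwise.\<close>
 have MI: "M = Idl\<^bsub>R\<^esub> (R.Xp ` set sp.gl)"
 proof -
 have gER: "set sp.gl <= ER {1..n} V1" using sp.gl_ER unfolding VZ unfolding xl .
 have "Idl\<^bsub>R\<^esub> (R.Xp ` set sp.gl) = \<Psi> ` cs ?Q"
 proof (rule R.Idl_Xp)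
 have gn: "g ~= 0" if "g:set sp.gl" for g
 proof -
 from that obtain v where v: "v:set xl Un set yl" "g = single v 1 \<or> g = single v 1 + tt 1" unfolding sp.gl_def by auto
 then have "v ~= 0" using z(3) VZ by metis
 then have "lookup g v = 1" using v(2) by (auto simp: lookup_add)
 then show ?thesis by auto
 qed
 show "e + f:?Q" if e: "e:ER {1..n} V1" "f:?Q" for e f
 proof -
 have "f = 0" if "e + f = 0"
 proof (rule pmI)
 fix v
 have "lookup e v + lookup f v = 0" using that by (metis lookup_add lookup_zero)
 moreover have "0 <= lookup e v" "0 <= lookup f v" using e by (auto simp: ER_iff)
 ultimately show "lookup f v = lookup 0 v" by simp
 qed
 then show ?thesis using e R.EE by blast
 qed
 show "set sp.gl <= ?Q" using gER gn by blast
 show "EX g:set sp.gl. e - g:ER {1..n} V1" if e: "e:?Q" for e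
 proof (cases "lookup e 0 = 0")
 case False
 have "0 <= lookup e 0" "lookup e 0 <= wt V1 e" using e by (auto simp: ER_iff)
 then have "0 < wt V1 e" "0 < lookup e 0" using False by linarith+
 from this(1) obtain v where v: "v:V1" "0 < lookup e v" by (rule wt_pos)
 have v0: "v ~= 0" using v z by metis
 have "single v 1 + tt 1:set sp.gl" using v by (simp add: sp.gl_def xl)
 moreover have "wt V1 (tt 1) = 0" unfolding wt_def
 proof (rule sum.neutral, rule ballI)
 fix u assume "u:V1"
 then have "u ~= 0" using z(1) by metis
 then show "lookup (tt 1) u = 0" by simp
 qed
 then have "e - (single v 1 + tt 1):ER {1..n} V1"
 using e v V \<open>0 < lookup e 0\<close> v0 fin by (auto simp: ER_iff lookup_minus lookup_add lookup_single when_def wt_single)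
 ultimately show ?thesis by blast
 next
 case True
 then have eE: "e:EV {1..n}" "e ~= 0" using e ER0 by auto
 have "0 < wt {1..n} e" using wt1[OF eE] by simp
 then obtain v where v: "v:{1..n}" "0 < lookup e v" by (rule wt_pos)
 have "single v 1:set sp.gl" using v V by (auto simp: sp.gl_def xl yl)
 moreover have "e - single v 1:ER {1..n} V1" using EV_minus[OF eE(1) v(2)] EVER by blast
 ultimately show ?thesis by blast
 qed
 qed blast
 then show ?thesis using MQ by simp
 qed
 have ex: "\<exists>B :: (nat set \<times> ex \<Rightarrow>\<^sub>0 'k) set. sp.D.full.cohF {S. S <= Y} g B" for Y g
 proof -
 have "sp.D.full.conv {S. S <= Y}" by (auto simp: sp.D.full.conv_def)
 then show ?thesis unfolding sp.D.full.cohF_def by (rule coh_exists[OF sp.D.full.cpx_conv])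
 qed
 obtain Bx :: "int \<times> int \<times> int=>(nat set \<times> ex \<Rightarrow>\<^sub>0 'k) set" where Bx: "!!g. sp.D.full.cohF {S. S <= {..<length xl}} g (Bx g)"
 using ex[of "{..<length xl}"] by metis
 obtain Bt :: "int \<times> int \<times> int=>(nat set \<times> ex \<Rightarrow>\<^sub>0 'k) set" where Bt: "!!g. sp.D.full.cohF {S. S <= {length xl..<2 * length xl}} g (Bt g)"
 using ex[of "{length xl..<2 * length xl}"] by metis
 have "\<exists>B :: (nat set \<times> ex \<Rightarrow>\<^sub>0 'k) set. sp.c2.cohF UNIV g B" for g
 unfolding sp.c2.cohF_UNIV by (rule coh_exists[OF sp.c2.cpx_PP])
 then obtain Bq :: "int \<times> int \<times> int=>(nat set \<times> ex \<Rightarrow>\<^sub>0 'k) set" where Bq: "!!g. sp.c2.cohF UNIV g (Bq g)" by metis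
 \<comment> \<open>The second factor lives in t-exponent 0; \<open>?B2\<close> extends its bases by
   empty sets to all triples.\<close>
 define B2 where "B2 = (%(q, be). Bq (q, be, 0))"
 let ?B1 = "%(p, al, c). if 0 <= c&c <= al then Bx (p, al, c) else if al < c&c < 0 then Bt (p - 1, al, c) else {}"
 let ?B2 = "%(q, be, d :: int). if d = 0 then B2 (q, be) else {}"
 have B1: "sp.D.rees.cohF UNIV g (?B1 g)" for g
 using sp.D.rees_coh[OF Bx Bt] by (cases g) simp
 have B2: "sp.c2.cohF UNIV g (?B2 g)" for g
 proof -
 obtain q be d where g: "g = (q, be, d)" by (cases g)
 show ?thesis
 proof (cases "d = 0")
 case True
 then show ?thesis using Bq by (simp add: g B2_def)
 next
 case False
 have "Ch sp.c2.PP (gr3 (set yl)) g = cs {}" unfolding Ch_def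
 by (rule arg_cong[where f = cs]) (use False in \<open>auto simp: g sp.c2.PP_def gr3_def sp.E2_def\<close>)
 also have "cs {} = ({0} :: (nat set \<times> ex \<Rightarrow>\<^sub>0 'k) set)" by (auto simp: cs_def)
 finally have C: "Ch sp.c2.PP (gr3 (set yl)) g = ({0} :: (nat set \<times> ex \<Rightarrow>\<^sub>0 'k) set)" .
 have "sp.c2.cohF UNIV g {}" unfolding sp.c2.cohF_UNIV
 proof (rule coh_empty)
 show "0:ZZ sp.c2.PP sp.c2.NN (gr3 (set yl)) (dX {2 * length xl..<2 * length xl + length yl}) g"
 by (rule lsub_0[OF lsub_ZZ[OF sp.c2.cpx_PP]])
 have "ZZ sp.c2.PP sp.c2.NN (gr3 (set yl)) (dX {2 * length xl..<2 * length xl + length yl}) g <= {0}"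
 unfolding ZZ_def C by blast
 moreover have "0:BB sp.c2.PP sp.c2.NN (gr3 (set yl)) (1, 0, 0) (dX {2 * length xl..<2 * length xl + length yl}) g"
 by (rule lsub_0[OF lsub_BB[OF sp.c2.cpx_PP]])
 ultimately show "ZZ sp.c2.PP sp.c2.NN (gr3 (set yl)) (dX {2 * length xl..<2 * length xl + length yl}) g
 <= BB sp.c2.PP sp.c2.NN (gr3 (set yl)) (1, 0, 0) (dX {2 * length xl..<2 * length xl + length yl}) g"
 by blast
 qed
 then show ?thesis using False by (simp add: g)
 qed
 qed
 have lcR: "is_free (local_cohomology R M l a) {z:Sigma UNIV ?B1 \<times> Sigma UNIV ?B2. coarse (fst (fst z) + fst (snd z)) = (l, a)}"
 unfolding MI by (rule sp.rees_lc[OF _ B1 B2, unfolded VZ, unfolded xl, OF MR])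
 have hgx: "EX d. p:gcomp (poly_algebra (set xl)) d" if "p:h ` {1..r}" for p using hg[OF that] by (simp add: xl)
 have x0: "0 ~: set xl" "0 ~: set yl" using z by (simp_all add: xl yl)
 have J1: "J1 = Idl\<^bsub>poly_algebra (set xl)\<^esub> (h ` {1..r})" by (simp add: J1_def xl)
 have lcx: "is_free (local_cohomology A1 \<mm>1 p al) (Bx (p, al, c))" for p al c
 unfolding \<mm>1_def A1_def xl[symmetric]
 proof (rule A_lc[OF x0(1) _ J1, where k = "0" and c = c and vr = sp.D.vr and X = "{..<2 * length xl}" and E = "%S. LL (set xl) (sp.D.vr ` S)"])
 show "EX d. q:gcomp (poly_algebra (set xl)) d" if "q:h ` {1..r}" for q by (rule hgx[OF that])
 show "finite {..<2 * length xl}" by simp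
 show "{0..<0 + length xl} <= {..<2 * length xl}" by auto
 show "sp.D.vr (0 + j) = xl ! j" if "j < length xl" for j using that by (simp add: sp.D.vr_def)
 show "cube {..<2 * length xl} (%S. LL (set xl) (sp.D.vr ` S)) (%S. NL (set xl) (intp ` h ` {1..r}) (sp.D.vr ` S)) (gr3 (set xl)) (1, 0, 0)"
 using sp.D.full.cube_axioms unfolding H1_def .
 have *: "{0..<0 + length xl} = {..<length xl}" by auto
 show "cube.cohF {..<2 * length xl} (%S. LL (set xl) (sp.D.vr ` S)) (%S. NL (set xl) (intp ` h ` {1..r}) (sp.D.vr ` S)) (gr3 (set xl)) (1, 0, 0)
 {S. S <= {0..<0 + length xl}} (p, al, c) (Bx (p, al, c))"
 using Bx[of "(p, al, c)"] unfolding H1_def * .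
 qed (rule refl)
 \<comment> \<open>The generators x_i t invert the same variables as the x_i, so their block of the
   cube also computes the local cohomology of \<open>A1\<close>.\<close>
 have lct: "is_free (local_cohomology A1 \<mm>1 p al) (Bt (p, al, c))" for p al c
 unfolding \<mm>1_def A1_def xl[symmetric]
 proof (rule A_lc[OF x0(1) _ J1, where k = "length xl" and c = c and vr = sp.D.vr and X = "{..<2 * length xl}" and E = "%S. LL (set xl) (sp.D.vr ` S)"])
 show "EX d. q:gcomp (poly_algebra (set xl)) d" if "q:h ` {1..r}" for q by (rule hgx[OF that])
 show "finite {..<2 * length xl}" by simp
 show "{length xl..<length xl + length xl} <= {..<2 * length xl}" by auto
 show "sp.D.vr (length xl + j) = xl ! j" if "j < length xl" for j using that by (simp add: sp.D.vr_def)
 show "cube {..<2 * length xl} (%S. LL (set xl) (sp.D.vr ` S)) (%S. NL (set xl) (intp ` h ` {1..r}) (sp.D.vr ` S)) (gr3 (set xl)) (1, 0, 0)"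
 using sp.D.full.cube_axioms unfolding H1_def .
 have *: "{length xl..<length xl + length xl} = {length xl..<2 * length xl}" by auto
 show "cube.cohF {..<2 * length xl} (%S. LL (set xl) (sp.D.vr ` S)) (%S. NL (set xl) (intp ` h ` {1..r}) (sp.D.vr ` S)) (gr3 (set xl)) (1, 0, 0)
 {S. S <= {length xl..<length xl + length xl}} (p, al, c) (Bt (p, al, c))"
 using Bt[of "(p, al, c)"] unfolding H1_def * .
 qed (rule refl)
 have hgy: "EX d. p:gcomp (poly_algebra (set yl)) d" if "p:h ` {r+1..s}" for p using hg2[OF that] by (simp add: yl)
 have J2: "J2 = Idl\<^bsub>poly_algebra (set yl)\<^esub> (h ` {r+1..s})" by (simp add: J2_def yl)
 have lc2: "is_free (local_cohomology A2 \<mm>2 q be) (B2 (q, be))" for q be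
 proof -
 \<comment> \<open>This cube has no other positions, so all its faces lie in the block of the
   y-variables.\<close>
 have "sp.c2.cohF UNIV (q, be, 0) (B2 (q, be)) <-> sp.c2.cohF {S. S <= {2 * length xl..<2 * length xl + length yl}} (q, be, 0) (B2 (q, be))"
 by (rule cohF_strand[OF sp.c2.cube_axioms sp.c2.cube_axioms]) auto
 then have "sp.c2.cohF {S. S <= {2 * length xl..<2 * length xl + length yl}} (q, be, 0) (B2 (q, be))" using Bq by (simp add: B2_def)
 then show ?thesis
 unfolding \<mm>2_def A2_def yl[symmetric]
 proof (intro A_lc[OF x0(2) _ J2, where k = "2 * length xl" and c = 0 and vr = sp.vr and X = "{2 * length xl..<2 * length xl + length yl}" and E = sp.E2])
 show "EX d. q:gcomp (poly_algebra (set yl)) d" if "q:h ` {r+1..s}" for q by (rule hgy[OF that])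
 show "sp.vr (2 * length xl + j) = yl ! j" for j by (simp add: sp.vr_def)
 show "cube {2 * length xl..<2 * length xl + length yl} sp.E2 (%S. NL (set yl) (intp ` h ` {r+1..s}) (sp.vr ` S)) (gr3 (set yl)) (1, 0, 0)"
 using sp.c2.cube_axioms unfolding H2_def .
 show "e:sp.E2 S <-> e:LL (set yl) (sp.vr ` S)" if "lookup e 0 = 0" for e S using that by (simp add: sp.E2_def)
 qed (simp_all add: H2_def)
 qed
 have r1: "is_free (direct_sum {(al, be). al + be = a&al \<ge> 0} (%(al, be).
 direct_sum {(p, q). p + q = l} (%(p, q).
 copies (nat (al + 1)) (local_cohomology A1 \<mm>1 p al) \<otimes>\<^sub>k local_cohomology A2 \<mm>2 q be)))
 (SIGMA (al, be) : {(al, be). al + be = a&al \<ge> 0}. SIGMA (p, q) : {(p, q). p + q = l}.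
 (SIGMA j : {..<nat (al + 1)}. Bx (p, al, int j)) \<times> B2 (q, be))"
 by (rule is_free_direct_sum, clarify, rule is_free_direct_sum, clarify, rule is_free_tensor[OF _ lc2], unfold copies_def, rule is_free_direct_sum, rule lcx)
 have r2: "is_free (direct_sum {(al, be). al + be = a&al <= -2} (%(al, be).
 direct_sum {(p, q). p + q = l} (%(p, q).
 copies (nat (- al - 1)) (local_cohomology A1 \<mm>1 (p - 1) al) \<otimes>\<^sub>k local_cohomology A2 \<mm>2 q be)))
 (SIGMA (al, be) : {(al, be). al + be = a&al <= -2}. SIGMA (p, q) : {(p, q). p + q = l}.
 (SIGMA j : {..<nat (- al - 1)}. Bt (p - 1, al, - 1 - int j)) \<times> B2 (q, be))"
 by (rule is_free_direct_sum, clarify, rule is_free_direct_sum, clarify, rule is_free_tensor[OF _ lc2], unfold copies_def, rule is_free_direct_sum, rule lct)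
 show ?thesis
 by (rule is_free_iso[OF is_free_reindex[OF lcR basis_bij] is_free_direct_sum2[OF r1 r2]])
qed

end
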